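(* Let $f:T\to S$ be a morphism of schemes and let $T\xrightarrow{h}E\xrightarrow{g}S$ be a separator of $f$. Then: (i) For every retrocompact open $U$ of $T$ (i.e. such that $U\to T$ is quasi-compact), $h(U)$ is an open subset of $E$ and the morphism $U\to h(U)$ induced by $h$ is a separator of $U$ (over $S$). (ii) Let $U$ be an open of $T$ which is separated over $S$ (for example a separated open). Then $h$ restricts to an isomorphism of $U$ onto the open $h(U)$. In particular, if $T$ is separated over $S$, then $h$ is an isomorphism. (iii) (Universal property) For every $S$-morphism $h':T\to E'$ to a scheme $E'$ separated over $S$, there exists a unique $S$-morphism $u:E\to E'$ such that $h'=uh$.
   Context: A morphism of schemes $h:X\to Y$ is a local isomorphism if every point of $X$ lies in an open $U\subset X$ such that $h$ induces an open immersion $U\to Y$. A morphism $t:Y\to X$ is schematically dominant if $\mathcal O_X\to t_*(\mathcal O_Y)$ is injective. A separator for a morphism $f:T\to S$ is a morphism of $S$-schemes $h:T\to E$, where $E$ is separated over $S$ (with structure morphism $g:E\to S$), such that (i) $h$ is a surjective, quasi-compact and quasi-separated local isomorphism; (ii) the diagonal morphism $\Delta_h:T\to T\times_E T$ is schematically dominant. *)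

theory Defs
  imports "HOL-Library.FuncSet" "HOL-Analysis.Abstract_Topology" "HOL-Algebra.IntRing"
begin

section \<open>Ringed spaces\<close>

text \<open>
  Only the values of \<open>sections\<close> and \<open>restrn\<close> on open sets carry meaning:
  \<open>sections X U\<close> is the ring \<open>O\<^sub>X(U)\<close>, and \<open>restrn X U V\<close> is the restriction map
  from \<open>O\<^sub>X(U)\<close> to \<open>O\<^sub>X(V)\<close> for \<open>V \<subseteq> U\<close>.
\<close>

record ('a, 'b) ringed_data =
  topol :: "'a topology"
  sections :: "'a set \<Rightarrow> 'b ring"
  restrn :: "'a set \<Rightarrow> 'a set \<Rightarrow> 'b \<Rightarrow> 'b"

definition points :: "('a, 'b) ringed_data \<Rightarrow> 'a set" where
  "points X = topspace (topol X)"

definition is_presheaf :: "('a, 'b) ringed_data \<Rightarrow> bool" where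
  "is_presheaf X \<longleftrightarrow>
     (\<forall>U. openin (topol X) U \<longrightarrow> cring (sections X U)) \<and>
     (\<forall>U V. openin (topol X) U \<and> openin (topol X) V \<and> V \<subseteq> U \<longrightarrow>
        restrn X U V \<in> ring_hom (sections X U) (sections X V)) \<and>
     (\<forall>U. openin (topol X) U \<longrightarrow> (\<forall>s\<in>carrier (sections X U). restrn X U U s = s)) \<and>
     (\<forall>U V W. openin (topol X) U \<and> openin (topol X) V \<and> openin (topol X) W \<and> V \<subseteq> U \<and> W \<subseteq> V \<longrightarrow>
        (\<forall>s\<in>carrier (sections X U). restrn X V W (restrn X U V s) = restrn X U W s))"

definition is_sheaf :: "('a, 'b) ringed_data \<Rightarrow> bool" where
  "is_sheaf X \<longleftrightarrow> is_presheaf X \<and>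
     (\<forall>C. (\<forall>V\<in>C. openin (topol X) V) \<longrightarrow>
        (\<forall>s\<in>carrier (sections X (\<Union>C)). \<forall>t\<in>carrier (sections X (\<Union>C)).
           (\<forall>V\<in>C. restrn X (\<Union>C) V s = restrn X (\<Union>C) V t) \<longrightarrow> s = t) \<and>
        (\<forall>\<sigma>. (\<forall>V\<in>C. \<sigma> V \<in> carrier (sections X V)) \<and>
             (\<forall>V\<in>C. \<forall>W\<in>C. restrn X V (V \<inter> W) (\<sigma> V) = restrn X W (V \<inter> W) (\<sigma> W)) \<longrightarrow>
             (\<exists>s\<in>carrier (sections X (\<Union>C)). \<forall>V\<in>C. restrn X (\<Union>C) V s = \<sigma> V)))"

definition germ :: "('a, 'b) ringed_data \<Rightarrow> 'a \<Rightarrow> 'a set \<Rightarrow> 'b \<Rightarrow> ('a set \<times> 'b) set" where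
  "germ X x U s =
     {(V, t). openin (topol X) V \<and> x \<in> V \<and> t \<in> carrier (sections X V) \<and>
        (\<exists>W. openin (topol X) W \<and> x \<in> W \<and> W \<subseteq> U \<inter> V \<and> restrn X U W s = restrn X V W t)}"

text \<open>
  The ring operations on germs are computed on representatives; all members of the unions
  below coincide, so each union is the germ of the sum or product of any two representatives.
\<close>

definition stalk :: "('a, 'b) ringed_data \<Rightarrow> 'a \<Rightarrow> ('a set \<times> 'b) set ring" where
  "stalk X x =
     \<lparr>carrier = {germ X x U s | U s.
         openin (topol X) U \<and> x \<in> U \<and> s \<in> carrier (sections X U)},
      mult = (\<lambda>c d. \<Union>(U, s)\<in>c. \<Union>(V, t)\<in>d.
         germ X x (U \<inter> V)
           (restrn X U (U \<inter> V) s \<otimes>\<^bsub>sections X (U \<inter> V)\<^esub> restrn X V (U \<inter> V) t)),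
      one = germ X x (points X) \<one>\<^bsub>sections X (points X)\<^esub>,
      zero = germ X x (points X) \<zero>\<^bsub>sections X (points X)\<^esub>,
      add = (\<lambda>c d. \<Union>(U, s)\<in>c. \<Union>(V, t)\<in>d.
         germ X x (U \<inter> V)
           (restrn X U (U \<inter> V) s \<oplus>\<^bsub>sections X (U \<inter> V)\<^esub> restrn X V (U \<inter> V) t))\<rparr>"

definition is_local_ring :: "'r ring \<Rightarrow> bool" where
  "is_local_ring R \<longleftrightarrow> cring R \<and> (\<exists>!I. maximalideal I R)"

definition is_local_hom :: "'r ring \<Rightarrow> 's ring \<Rightarrow> ('r \<Rightarrow> 's) \<Rightarrow> bool" where
  "is_local_hom R S \<phi> \<longleftrightarrow>
     \<phi> \<in> ring_hom R S \<and> (\<forall>a\<in>carrier R. \<phi> a \<in> Units S \<longrightarrow> a \<in> Units R)"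

definition locally_ringed :: "('a, 'b) ringed_data \<Rightarrow> bool" where
  "locally_ringed X \<longleftrightarrow> is_sheaf X \<and> (\<forall>x\<in>points X. is_local_ring (stalk X x))"

definition open_sub :: "('a, 'b) ringed_data \<Rightarrow> 'a set \<Rightarrow> ('a, 'b) ringed_data" where
  "open_sub X U = X\<lparr>topol := subtopology (topol X) U\<rparr>"


section \<open>Morphisms\<close>

text \<open>
  A morphism from \<open>X\<close> to \<open>Y\<close> consists of a map on points and, for every open \<open>V\<close> of \<open>Y\<close>, a map
  from \<open>O\<^sub>Y(V)\<close> to \<open>O\<^sub>X\<close> of the inverse image of \<open>V\<close>. All these functions are required to be
  extensional, so that HOL equality of morphisms from \<open>X\<close> to \<open>Y\<close> is equality of morphisms.
\<close>

record ('a, 'b, 'c, 'd) mor_data =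
  on_pts :: "'a \<Rightarrow> 'c"
  on_sec :: "'c set \<Rightarrow> 'd \<Rightarrow> 'b"

definition inv_img :: "('a, 'b) ringed_data \<Rightarrow> ('a, 'b, 'c, 'd) mor_data \<Rightarrow> 'c set \<Rightarrow> 'a set" where
  "inv_img X f V = {x \<in> points X. on_pts f x \<in> V}"

definition stalk_map ::
  "('a, 'b) ringed_data \<Rightarrow> ('c, 'd) ringed_data \<Rightarrow> ('a, 'b, 'c, 'd) mor_data \<Rightarrow> 'a \<Rightarrow>
   ('c set \<times> 'd) set \<Rightarrow> ('a set \<times> 'b) set" where
  "stalk_map X Y f x c = (\<Union>(V, t)\<in>c. germ X x (inv_img X f V) (on_sec f V t))"

definition morphism ::
  "('a, 'b) ringed_data \<Rightarrow> ('c, 'd) ringed_data \<Rightarrow> ('a, 'b, 'c, 'd) mor_data \<Rightarrow> bool" where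
  "morphism X Y f \<longleftrightarrow>
     continuous_map (topol X) (topol Y) (on_pts f) \<and>
     on_pts f \<in> extensional (points X) \<and>
     on_sec f \<in> extensional {V. openin (topol Y) V} \<and>
     (\<forall>V. openin (topol Y) V \<longrightarrow>
        on_sec f V \<in> ring_hom (sections Y V) (sections X (inv_img X f V)) \<and>
        on_sec f V \<in> extensional (carrier (sections Y V))) \<and>
     (\<forall>V W. openin (topol Y) V \<and> openin (topol Y) W \<and> W \<subseteq> V \<longrightarrow>
        (\<forall>t\<in>carrier (sections Y V).
           on_sec f W (restrn Y V W t) =
           restrn X (inv_img X f V) (inv_img X f W) (on_sec f V t))) \<and>
     (\<forall>x\<in>points X. is_local_hom (stalk Y (on_pts f x)) (stalk X x) (stalk_map X Y f x))"

definition mor_id :: "('a, 'b) ringed_data \<Rightarrow> ('a, 'b, 'a, 'b) mor_data" where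
  "mor_id X =
     \<lparr>on_pts = (\<lambda>x\<in>points X. x),
      on_sec = (\<lambda>V\<in>{V. openin (topol X) V}. \<lambda>s\<in>carrier (sections X V). s)\<rparr>"

text \<open>\<open>mor_comp X Y Z g f\<close> is the composite of \<open>f\<close> from \<open>X\<close> to \<open>Y\<close> followed by \<open>g\<close> from \<open>Y\<close> to \<open>Z\<close>.\<close>

definition mor_comp ::
  "('a, 'b) ringed_data \<Rightarrow> ('c, 'd) ringed_data \<Rightarrow> ('e, 'f) ringed_data \<Rightarrow>
   ('c, 'd, 'e, 'f) mor_data \<Rightarrow> ('a, 'b, 'c, 'd) mor_data \<Rightarrow> ('a, 'b, 'e, 'f) mor_data" where
  "mor_comp X Y Z g f =
     \<lparr>on_pts = (\<lambda>x\<in>points X. on_pts g (on_pts f x)),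
      on_sec = (\<lambda>W\<in>{W. openin (topol Z) W}. \<lambda>s\<in>carrier (sections Z W).
                  on_sec f (inv_img Y g W) (on_sec g W s))\<rparr>"

text \<open>
  For \<open>f\<close> from \<open>X\<close> to \<open>Y\<close> and opens \<open>U\<close> of \<open>X\<close>, \<open>V\<close> of \<open>Y\<close> with \<open>f(U) \<subseteq> V\<close>, the induced
  morphism from \<open>U\<close> to \<open>V\<close>.
\<close>

definition mor_restrict ::
  "('a, 'b) ringed_data \<Rightarrow> ('c, 'd) ringed_data \<Rightarrow> ('a, 'b, 'c, 'd) mor_data \<Rightarrow>
   'a set \<Rightarrow> 'c set \<Rightarrow> ('a, 'b, 'c, 'd) mor_data" where
  "mor_restrict X Y f U V =
     \<lparr>on_pts = (\<lambda>x\<in>points (open_sub X U). on_pts f x),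
      on_sec = (\<lambda>W\<in>{W. openin (topol (open_sub Y V)) W}. \<lambda>t\<in>carrier (sections Y W).
                  restrn X (inv_img X f W) (U \<inter> inv_img X f W) (on_sec f W t))\<rparr>"

definition open_incl :: "('a, 'b) ringed_data \<Rightarrow> 'a set \<Rightarrow> ('a, 'b, 'a, 'b) mor_data" where
  "open_incl X U = mor_restrict X X (mor_id X) U (points X)"

definition isomorphism ::
  "('a, 'b) ringed_data \<Rightarrow> ('c, 'd) ringed_data \<Rightarrow> ('a, 'b, 'c, 'd) mor_data \<Rightarrow> bool" where
  "isomorphism X Y f \<longleftrightarrow> morphism X Y f \<and>
     (\<exists>g. morphism Y X g \<and> mor_comp X Y X g f = mor_id X \<and> mor_comp Y X Y f g = mor_id Y)"


section \<open>Spectra and schemes\<close>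

definition loc_frac :: "'r ring \<Rightarrow> 'r set \<Rightarrow> 'r \<Rightarrow> 'r \<Rightarrow> ('r \<times> 'r) set" where
  "loc_frac A \<pp> a f =
     {(b, g). b \<in> carrier A \<and> g \<in> carrier A - \<pp> \<and>
        (\<exists>k\<in>carrier A - \<pp>. k \<otimes>\<^bsub>A\<^esub> (g \<otimes>\<^bsub>A\<^esub> a) = k \<otimes>\<^bsub>A\<^esub> (f \<otimes>\<^bsub>A\<^esub> b))}"

text \<open>The localization of \<open>A\<close> at the prime ideal \<open>\<pp>\<close>, with operations as for \<open>stalk\<close>.\<close>

definition localization :: "'r ring \<Rightarrow> 'r set \<Rightarrow> ('r \<times> 'r) set ring" where
  "localization A \<pp> =
     \<lparr>carrier = {loc_frac A \<pp> a f | a f. a \<in> carrier A \<and> f \<in> carrier A - \<pp>},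
      mult = (\<lambda>c d. \<Union>(a, f)\<in>c. \<Union>(b, g)\<in>d. loc_frac A \<pp> (a \<otimes>\<^bsub>A\<^esub> b) (f \<otimes>\<^bsub>A\<^esub> g)),
      one = loc_frac A \<pp> \<one>\<^bsub>A\<^esub> \<one>\<^bsub>A\<^esub>,
      zero = loc_frac A \<pp> \<zero>\<^bsub>A\<^esub> \<one>\<^bsub>A\<^esub>,
      add = (\<lambda>c d. \<Union>(a, f)\<in>c. \<Union>(b, g)\<in>d.
               loc_frac A \<pp> (a \<otimes>\<^bsub>A\<^esub> g \<oplus>\<^bsub>A\<^esub> b \<otimes>\<^bsub>A\<^esub> f) (f \<otimes>\<^bsub>A\<^esub> g))\<rparr>"

definition zariski :: "'r ring \<Rightarrow> 'r set topology" where
  "zariski A = topology_generated_by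
     {{\<pp>. primeideal \<pp> A \<and> f \<notin> \<pp>} | f. f \<in> carrier A}"

definition spec_sections ::
  "'r ring \<Rightarrow> 'r set set \<Rightarrow> ('r set \<Rightarrow> ('r \<times> 'r) set) ring" where
  "spec_sections A U =
     \<lparr>carrier = {s \<in> (\<Pi>\<^sub>E \<pp>\<in>U. carrier (localization A \<pp>)).
         \<forall>\<pp>\<in>U. \<exists>V. openin (zariski A) V \<and> \<pp> \<in> V \<and> V \<subseteq> U \<and>
           (\<exists>a\<in>carrier A. \<exists>f\<in>carrier A. \<forall>\<qq>\<in>V. f \<notin> \<qq> \<and> s \<qq> = loc_frac A \<qq> a f)},
      mult = (\<lambda>s t. \<lambda>\<pp>\<in>U. s \<pp> \<otimes>\<^bsub>localization A \<pp>\<^esub> t \<pp>),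
      one = (\<lambda>\<pp>\<in>U. \<one>\<^bsub>localization A \<pp>\<^esub>),
      zero = (\<lambda>\<pp>\<in>U. \<zero>\<^bsub>localization A \<pp>\<^esub>),
      add = (\<lambda>s t. \<lambda>\<pp>\<in>U. s \<pp> \<oplus>\<^bsub>localization A \<pp>\<^esub> t \<pp>)\<rparr>"

definition Spec :: "'r ring \<Rightarrow> ('r set, 'r set \<Rightarrow> ('r \<times> 'r) set) ringed_data" where
  "Spec A =
     \<lparr>topol = zariski A, sections = spec_sections A, restrn = (\<lambda>U V s. restrict s V)\<rparr>"

text \<open>
  The ring in the definition of an affine scheme may be taken in the type of sections,
  since it is isomorphic to the ring of global sections.
\<close>

definition affine :: "('a, 'b) ringed_data \<Rightarrow> bool" where
  "affine X \<longleftrightarrow> (\<exists>(A :: 'b ring) \<phi>. cring A \<and> isomorphism X (Spec A) \<phi>)"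

definition scheme :: "('a, 'b) ringed_data \<Rightarrow> bool" where
  "scheme X \<longleftrightarrow> locally_ringed X \<and>
     (\<forall>x\<in>points X. \<exists>U. openin (topol X) U \<and> x \<in> U \<and> affine (open_sub X U))"


section \<open>Fibre products\<close>

text \<open>
  Fibre products are defined by their universal property. A formula cannot quantify over
  types, so the fibre product and the test schemes range over the schemes with points and
  sections in the types below, which are large enough to contain a copy \<open>P\<^sub>0\<close> of the fibre product
  of any \<open>X\<close> and \<open>Y\<close> over any \<open>S\<close>: a point of \<open>P\<^sub>0\<close> is determined by its images \<open>x\<close>, \<open>y\<close> and a prime
  ideal of \<open>A \<otimes>\<^sub>R B\<close> for affine neighbourhoods \<open>Spec A\<close> of \<open>x\<close> and \<open>Spec B\<close> of \<open>y\<close> chosen for \<open>x\<close>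
  and \<open>y\<close> (elements of \<open>A \<otimes>\<^sub>R B\<close> are represented by lists of pairs, so prime ideals by sets of
  such lists), and a section of \<open>P\<^sub>0\<close> is determined by its germs, each a fraction of elements of
  \<open>A \<otimes>\<^sub>R B\<close>. If \<open>P\<close> has the universal property below, then testing it with \<open>P\<^sub>0\<close> and with \<open>P\<close> shows
  that \<open>P\<close> is isomorphic to \<open>P\<^sub>0\<close>, and hence that \<open>P\<close> is a fibre product in the category of
  all schemes. Conversely, a fibre product with points and sections in these types has the
  property trivially.
\<close>

type_synonym ('a, 'b, 'c, 'd) fp_pt = "'a \<times> 'c \<times> ('b \<times> 'd) list set"

type_synonym ('a, 'b, 'c, 'd) fp_sec =
  "('a, 'b, 'c, 'd) fp_pt \<Rightarrow> ('b \<times> 'd) list \<times> ('b \<times> 'd) list"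

type_synonym ('a, 'b, 'c, 'd) fp =
  "(('a, 'b, 'c, 'd) fp_pt, ('a, 'b, 'c, 'd) fp_sec) ringed_data"

definition is_fibre_product ::
  "('a, 'b) ringed_data \<Rightarrow> ('c, 'd) ringed_data \<Rightarrow> ('e, 'f) ringed_data \<Rightarrow>
   ('a, 'b, 'e, 'f) mor_data \<Rightarrow> ('c, 'd, 'e, 'f) mor_data \<Rightarrow> ('a, 'b, 'c, 'd) fp \<Rightarrow>
   (('a, 'b, 'c, 'd) fp_pt, ('a, 'b, 'c, 'd) fp_sec, 'a, 'b) mor_data \<Rightarrow>
   (('a, 'b, 'c, 'd) fp_pt, ('a, 'b, 'c, 'd) fp_sec, 'c, 'd) mor_data \<Rightarrow> bool" where
  "is_fibre_product X Y S f g P p q \<longleftrightarrow>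
     scheme P \<and> morphism P X p \<and> morphism P Y q \<and>
     mor_comp P X S f p = mor_comp P Y S g q \<and>
     (\<forall>(Z :: ('a, 'b, 'c, 'd) fp) a b.
        scheme Z \<and> morphism Z X a \<and> morphism Z Y b \<and>
        mor_comp Z X S f a = mor_comp Z Y S g b \<longrightarrow>
        (\<exists>!u. morphism Z P u \<and> mor_comp Z P X p u = a \<and> mor_comp Z P Y q u = b))"

text \<open>\<open>is_diagonal X S f P d\<close>: \<open>P\<close> is a fibre product of \<open>X\<close> with itself over \<open>S\<close>, with diagonal \<open>d\<close>.\<close>

definition is_diagonal ::
  "('a, 'b) ringed_data \<Rightarrow> ('e, 'f) ringed_data \<Rightarrow> ('a, 'b, 'e, 'f) mor_data \<Rightarrow>
   ('a, 'b, 'a, 'b) fp \<Rightarrow>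
   ('a, 'b, ('a, 'b, 'a, 'b) fp_pt, ('a, 'b, 'a, 'b) fp_sec) mor_data \<Rightarrow> bool" where
  "is_diagonal X S f P d \<longleftrightarrow>
     (\<exists>p q. is_fibre_product X X S f f P p q \<and> morphism X P d \<and>
        mor_comp X P X p d = mor_id X \<and> mor_comp X P X q d = mor_id X)"


section \<open>Properties of morphisms\<close>

definition open_immersion ::
  "('a, 'b) ringed_data \<Rightarrow> ('c, 'd) ringed_data \<Rightarrow> ('a, 'b, 'c, 'd) mor_data \<Rightarrow> bool" where
  "open_immersion X Y f \<longleftrightarrow> morphism X Y f \<and>
     openin (topol Y) (on_pts f ` points X) \<and>
     isomorphism X (open_sub Y (on_pts f ` points X))
       (mor_restrict X Y f (points X) (on_pts f ` points X))"

text \<open>The last conjunct says that \<open>O\<^sub>Y \<rightarrow> f\<^sub>* O\<^sub>X\<close> is an epimorphism of sheaves.\<close>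

definition closed_immersion ::
  "('a, 'b) ringed_data \<Rightarrow> ('c, 'd) ringed_data \<Rightarrow> ('a, 'b, 'c, 'd) mor_data \<Rightarrow> bool" where
  "closed_immersion X Y f \<longleftrightarrow> morphism X Y f \<and>
     closedin (topol Y) (on_pts f ` points X) \<and>
     homeomorphic_map (topol X) (subtopology (topol Y) (on_pts f ` points X)) (on_pts f) \<and>
     (\<forall>V. openin (topol Y) V \<longrightarrow>
        (\<forall>s\<in>carrier (sections X (inv_img X f V)). \<forall>y\<in>V.
           \<exists>W. openin (topol Y) W \<and> y \<in> W \<and> W \<subseteq> V \<and>
             (\<exists>t\<in>carrier (sections Y W).
                on_sec f W t = restrn X (inv_img X f V) (inv_img X f W) s)))"

definition quasi_compact ::
  "('a, 'b) ringed_data \<Rightarrow> ('c, 'd) ringed_data \<Rightarrow> ('a, 'b, 'c, 'd) mor_data \<Rightarrow> bool" where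
  "quasi_compact X Y f \<longleftrightarrow> morphism X Y f \<and>
     (\<forall>V. openin (topol Y) V \<and> compactin (topol Y) V \<longrightarrow> compactin (topol X) (inv_img X f V))"

definition quasi_separated ::
  "('a, 'b) ringed_data \<Rightarrow> ('c, 'd) ringed_data \<Rightarrow> ('a, 'b, 'c, 'd) mor_data \<Rightarrow> bool" where
  "quasi_separated X S f \<longleftrightarrow> morphism X S f \<and>
     (\<exists>P d. is_diagonal X S f P d \<and> quasi_compact X P d)"

definition separated ::
  "('a, 'b) ringed_data \<Rightarrow> ('c, 'd) ringed_data \<Rightarrow> ('a, 'b, 'c, 'd) mor_data \<Rightarrow> bool" where
  "separated X S f \<longleftrightarrow> morphism X S f \<and>
     (\<exists>P d. is_diagonal X S f P d \<and> closed_immersion X P d)"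

definition separated_scheme :: "('a, 'b) ringed_data \<Rightarrow> bool" where
  "separated_scheme X \<longleftrightarrow> scheme X \<and> (\<exists>f. separated X (Spec \<Z>) f)"

definition local_isomorphism ::
  "('a, 'b) ringed_data \<Rightarrow> ('c, 'd) ringed_data \<Rightarrow> ('a, 'b, 'c, 'd) mor_data \<Rightarrow> bool" where
  "local_isomorphism X Y h \<longleftrightarrow> morphism X Y h \<and>
     (\<forall>x\<in>points X. \<exists>U. openin (topol X) U \<and> x \<in> U \<and>
        open_immersion (open_sub X U) Y (mor_restrict X Y h U (points Y)))"

definition schematically_dominant ::
  "('a, 'b) ringed_data \<Rightarrow> ('c, 'd) ringed_data \<Rightarrow> ('a, 'b, 'c, 'd) mor_data \<Rightarrow> bool" where
  "schematically_dominant Y X t \<longleftrightarrow> morphism Y X t \<and>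
     (\<forall>V. openin (topol X) V \<longrightarrow> inj_on (on_sec t V) (carrier (sections X V)))"

definition retrocompact :: "('a, 'b) ringed_data \<Rightarrow> 'a set \<Rightarrow> bool" where
  "retrocompact X U \<longleftrightarrow> openin (topol X) U \<and> quasi_compact (open_sub X U) X (open_incl X U)"


section \<open>Separators\<close>

definition is_separator ::
  "('a, 'b) ringed_data \<Rightarrow> ('c, 'd) ringed_data \<Rightarrow> ('a, 'b, 'c, 'd) mor_data \<Rightarrow>
   ('e, 'f) ringed_data \<Rightarrow> ('a, 'b, 'e, 'f) mor_data \<Rightarrow> ('e, 'f, 'c, 'd) mor_data \<Rightarrow> bool" where
  "is_separator T S f E h g \<longleftrightarrow>
     scheme T \<and> scheme S \<and> scheme E \<and> morphism T S f \<and> morphism T E h \<and>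
     separated E S g \<and> mor_comp T E S g h = f \<and>
     on_pts h ` points T = points E \<and> quasi_compact T E h \<and> quasi_separated T E h \<and>
     local_isomorphism T E h \<and>
     (\<exists>P d. is_diagonal T E h P d \<and> schematically_dominant T P d)"

end

theory Submission
  imports Defs "HOL-Algebra.Ring_Divisibility" "HOL-Algebra.Weak_Morphisms" "HOL-Algebra.Subrings"
begin

text \<open>
  Proof idea. Let $a, b : X \to E'$ be $S$-morphisms into a separated $S$-scheme that agree on a
  schematically dominant $Y \to X$; then $a = b$, because the preimage of the diagonal is closed and
  contains the image of $Y$. Let $W, W'$ be opens of $T$ that $h$ maps isomorphically onto the same
  open of $E$, and let $\sigma : W \to W'$ be the resulting transition isomorphism. The graph of
  $\sigma$ embeds $W$ into $T \times_E T$ and meets the diagonal in $W \cap W'$; since the diagonal is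
  schematically dominant, so is $W \cap W' \to W$, and $\sigma$ is the identity on $W \cap W'$. Hence
  every $S$-morphism from $T$ to a separated $S$-scheme takes the same values on $W$ and, through
  $\sigma$, on $W'$. Applied to morphisms $h' : T \to E'$ this says that $h'$ descends along the
  surjective local isomorphism $h$, which is (iii). Applied to the identity of a separated open $U$ it
  says that $h$ is injective on $U$, which gives (ii). For (i), the fibre products that occur
  are open subschemes of $T \times_E T$ and $E \times_S E$.
\<close>

section \<open>Commutative rings\<close>

text \<open>The obstacle is that a fibre product is universal only for test schemes whose points and
  sections have fixed types, and that no fibre product is ever constructed: each one that occurs is
  contained in a hypothesis or is an open part of such a one. A morphism that is to be tested must
  therefore start from a scheme of the right types. For the graph of a transition the open image of
  a chart under the diagonal serves. For two morphisms a, b from X to a separated E, they are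
  extended locally to Spec C, where C is the subring of the functions on X generated by the
  functions pulled back from two affine opens of E; its elements are named by lists of pairs, as in
  a tensor product, so Spec C has a copy in the required types. That X -> Spec C is schematically
  dominant rests on the fact that a function vanishing where f is invertible is killed by a power of
  f; this is where compactness of spectra enters, and why affine schemes are developed from the
  beginning. Conditions on stalks are restated by sections that are invertible near a point.\<close>

lemma ideal_carrier_subset: "ideal I R \<Longrightarrow> I \<subseteq> carrier R"
  by (meson ideal.Icarr subsetI)

text \<open>Zorn's lemma. It is used twice: with \<open>S\<close> the powers of an element, where
  the maximal ideal turns out to be prime, and with \<open>S\<close> consisting of the unit element,
  where it is a maximal ideal in the usual sense.\<close>

lemma (in cring) maximal_avoiding_ideal:
  assumes I: "ideal I R" and S: "I \<inter> S = {}"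
  obtains M where "ideal M R" "I \<subseteq> M" "M \<inter> S = {}" "\<forall>J. ideal J R \<and> M \<subseteq> J \<and> J \<inter> S = {} \<longrightarrow> J = M"
proof -
  define \<A> where "\<A> = {J. ideal J R \<and> I \<subseteq> J \<and> J \<inter> S = {}}"
  have "\<exists>M\<in>\<A>. \<forall>X\<in>\<A>. M \<subseteq> X \<longrightarrow> X = M"
  proof (rule subset_Zorn_nonempty)
    show "\<A> \<noteq> {}" using I S unfolding \<A>_def by blast
    fix C assume C: "C \<noteq> {}" "subset.chain \<A> C"
    have "subset.chain {I. ideal I R} C" using C(2)
      unfolding pred_on.chain_def \<A>_def by blast
    from chain_Union_is_ideal[OF this] C(1) have "ideal (\<Union>C) R" by simp
    moreover have "C \<subseteq> \<A>" using C(2) unfolding pred_on.chain_def by blast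
    ultimately show "\<Union>C \<in> \<A>" using C(1) unfolding \<A>_def by blast
  qed
  then obtain M where M: "M \<in> \<A>" "\<And>J. J \<in> \<A> \<Longrightarrow> M \<subseteq> J \<Longrightarrow> J = M" by blast
  show ?thesis
  proof (rule that[of M])
    show "\<forall>J. ideal J R \<and> M \<subseteq> J \<and> J \<inter> S = {} \<longrightarrow> J = M"
      using M unfolding \<A>_def by blast
  qed (use M(1) in \<open>auto simp: \<A>_def\<close>)
qed

text \<open>An ideal that is maximal among those avoiding the powers of \<open>f\<close> is prime:
  if \<open>a\<close> and \<open>b\<close> lay outside, adjoining either would bring in a power of
  \<open>f\<close>, and the product of these two powers would lie in the ideal as soon as the
  product of \<open>a\<close> and \<open>b\<close> does.\<close>

lemma (in cring) prime_avoiding_powers: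
  assumes I: "ideal I R" and f: "f \<in> carrier R" and nI: "\<And>n::nat. f [^] n \<notin> I"
  obtains P where "primeideal P R" "I \<subseteq> P" "f \<notin> P"
proof -
  define S where "S = range (\<lambda>n::nat. f [^] n)"
  have IS: "I \<inter> S = {}" using nI unfolding S_def by blast
  obtain M where Mi: "ideal M R" and IM: "I \<subseteq> M" and MS: "M \<inter> S = {}"
    and max: "\<forall>J. ideal J R \<and> M \<subseteq> J \<and> J \<inter> S = {} \<longrightarrow> J = M"
    using maximal_avoiding_ideal[OF I IS] .
  have fM: "f [^] n \<notin> M" for n :: nat using MS unfolding S_def by blast
  interpret M: ideal M R by (rule Mi)
  \<comment> \<open>Maximality of \<open>M\<close>: the ideal generated by \<open>M\<close> and
    \<open>a\<close> is strictly larger, so it contains a power of \<open>f\<close>.\<close>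
  have step: "\<exists>(n::nat) m x. m \<in> M \<and> x \<in> carrier R \<and> f [^] n = m \<oplus> x \<otimes> a"
    if a: "a \<in> carrier R" "a \<notin> M" for a
  proof (rule ccontr)
    assume no: "\<not> ?thesis"
    let ?J = "M <+>\<^bsub>R\<^esub> PIdl a"
    have J: "ideal ?J R" by (rule add_ideals[OF Mi cgenideal_ideal[OF a(1)]])
    have mem: "y \<in> ?J \<longleftrightarrow> (\<exists>m x. m \<in> M \<and> x \<in> carrier R \<and> y = m \<oplus> x \<otimes> a)" for y
      unfolding set_add_def' cgenideal_def by auto
    have sub: "M \<subseteq> ?J"
    proof
      fix m assume m: "m \<in> M"
      have "m = m \<oplus> \<zero> \<otimes> a" using m a M.Icarr by simp
      then show "m \<in> ?J" unfolding mem using m by blast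
    qed
    have "?J \<inter> S = {}" using no mem unfolding S_def by blast
    then have "?J = M" using max J sub by blast
    moreover have "a = \<zero> \<oplus> \<one> \<otimes> a" using a by simp
    then have "a \<in> ?J" unfolding mem using M.zero_closed by blast
    ultimately show False using a by simp
  qed
  have "primeideal M R"
  proof (intro primeidealI)
    show "ideal M R" by (rule Mi)
    show "cring R" by (rule cring_axioms)
    have "f [^] (0::nat) \<notin> M" by (rule fM)
    then have "\<one> \<notin> M" by simp
    then show "carrier R \<noteq> M" using one_closed by blast
    fix a b assume a: "a \<in> carrier R" and b: "b \<in> carrier R" and ab: "a \<otimes> b \<in> M"
    show "a \<in> M \<or> b \<in> M"
    proof (rule ccontr)
      assume "\<not> ?thesis"
      then obtain n m x and k::nat and l y where
        1: "m \<in> M" "x \<in> carrier R" "f [^] (n::nat) = m \<oplus> x \<otimes> a" and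
        2: "l \<in> M" "y \<in> carrier R" "f [^] k = l \<oplus> y \<otimes> b"
        using step[OF a] step[OF b] by blast
      have c: "m \<in> carrier R" "l \<in> carrier R" using 1 2 M.Icarr by auto
      have "f [^] (n + k) = f [^] n \<otimes> f [^] k" using f by (simp add: nat_pow_mult)
      also have "\<dots> = m \<otimes> (l \<oplus> y \<otimes> b) \<oplus> l \<otimes> (x \<otimes> a) \<oplus> (x \<otimes> y) \<otimes> (a \<otimes> b)"
        unfolding 1(3) 2(3) using c a b 1(2) 2(2) by algebra
      also have "\<dots> \<in> M"
        using M.I_r_closed[OF 1(1), of "l \<oplus> y \<otimes> b"] M.I_r_closed[OF 2(1), of "x \<otimes> a"]
          M.I_l_closed[OF ab, of "x \<otimes> y"] 1(2) 2(2) a b c by (intro M.a_closed) auto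
      finally show False using fM by blast
    qed
  qed
  then show ?thesis using that IM fM[of 1] f by simp
qed

lemma (in cring) proper_ideal_in_maximalideal:
  assumes I: "ideal I R" and 1: "\<one> \<notin> I"
  obtains M where "maximalideal M R" "I \<subseteq> M"
proof -
  have "I \<inter> {\<one>} = {}" using 1 by simp
  then obtain M where Mi: "ideal M R" and IM: "I \<subseteq> M" and oM: "\<one> \<notin> M"
    and max: "\<forall>J. ideal J R \<and> M \<subseteq> J \<and> J \<inter> {\<one>} = {} \<longrightarrow> J = M"
    using maximal_avoiding_ideal[OF I, of "{\<one>}"] by auto
  have "maximalideal M R"
  proof (rule maximalidealI[OF Mi])
    show "carrier R \<noteq> M" using oM one_closed by blast
    fix J assume J: "ideal J R" "M \<subseteq> J" "J \<subseteq> carrier R"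
    show "J = M \<or> J = carrier R"
    proof (cases "\<one> \<in> J")
      case True then show ?thesis using ideal.one_imp_carrier[OF J(1)] by simp
    next
      case False
      then show ?thesis using max J by simp
    qed
  qed
  then show ?thesis using that IM by blast
qed

lemma (in cring) ideal_with_unit:
  assumes "ideal I R" "u \<in> Units R" "u \<in> I" shows "I = carrier R"
proof -
  have "inv u \<otimes> u \<in> I" by (rule ideal.I_l_closed[OF assms(1,3)]) (use assms in simp)
  then show ?thesis using ideal.one_imp_carrier[OF assms(1)] assms by simp
qed

lemma (in cring) nonunit_cgenideal:
  assumes "a \<in> carrier R" "a \<notin> Units R" shows "\<one> \<notin> PIdl a"
proof
  assume "\<one> \<in> PIdl a"
  then obtain x where "x \<in> carrier R" "\<one> = x \<otimes> a" unfolding cgenideal_def by blast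
  then show False using assms unfolding Units_def by (auto simp: m_comm)
qed

text \<open>Closure under sums is the contrapositive of \<open>add\<close>; closure under multiples
  holds because a factor of a unit is a unit.\<close>

lemma (in cring) nonunits_ideal:
  assumes 1: "\<one> \<noteq> \<zero>" and add: "\<forall>a\<in>carrier R. \<forall>b\<in>carrier R. a \<oplus> b \<in> Units R \<longrightarrow> a \<in> Units R \<or> b \<in> Units R"
  shows "ideal (carrier R - Units R) R"
proof -
  define I where "I = carrier R - Units R"
  have mult: "x \<otimes> a \<in> I" if "a \<in> I" "x \<in> carrier R" for a x
  proof -
    have "a \<in> Units R" if "x \<otimes> a \<in> Units R" "a \<in> carrier R"
      using that \<open>x \<in> carrier R\<close> unit_factor[of a x] m_comm[of a x] by simp
    then show ?thesis using that unfolding I_def by auto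
  qed
  have I: "ideal I R"
  proof (rule idealI)
    show "ring R" by (rule ring_axioms)
    show "subgroup I (add_monoid R)"
    proof
      show "I \<subseteq> carrier (add_monoid R)" unfolding I_def by auto
      fix x y assume "x \<in> I" "y \<in> I"
      then show "x \<otimes>\<^bsub>add_monoid R\<^esub> y \<in> I" unfolding I_def using add by auto
    next
      have "\<zero> \<notin> Units R" using 1 unfolding Units_def by auto
      then show "\<one>\<^bsub>add_monoid R\<^esub> \<in> I" unfolding I_def by auto
    next
      fix x assume x: "x \<in> I"
      have "\<ominus> x = (\<ominus> \<one>) \<otimes> x" using x unfolding I_def by (simp add: l_minus)
      then have "\<ominus> x \<in> I" using mult[OF x, of "\<ominus> \<one>"] by simp
      then show "inv\<^bsub>add_monoid R\<^esub> x \<in> I" by (simp add: a_inv_def)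
    qed
    fix a x assume "a \<in> I" "x \<in> carrier R"
    then show "x \<otimes> a \<in> I" "a \<otimes> x \<in> I"
      using mult[of a x] m_comm[of a x] unfolding I_def by auto
  qed
  then show ?thesis unfolding I_def .
qed

text \<open>The definition speaks of ideals. The right-hand side speaks of single elements, and only
  this form can be translated from germs into sections.\<close>

lemma is_local_ring_iff:
  fixes R (structure)
  shows "is_local_ring R \<longleftrightarrow> cring R \<and> \<one>\<^bsub>R\<^esub> \<noteq> \<zero>\<^bsub>R\<^esub> \<and>
     (\<forall>a\<in>carrier R. \<forall>b\<in>carrier R. a \<oplus>\<^bsub>R\<^esub> b \<in> Units R \<longrightarrow> a \<in> Units R \<or> b \<in> Units R)"
proof (cases "cring R")
  case False then show ?thesis by (simp add: is_local_ring_def)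
next
  case True
  interpret cring R by (rule True)
  show ?thesis
  proof
    assume "is_local_ring R"
    then obtain I where I: "maximalideal I R" "\<And>J. maximalideal J R \<Longrightarrow> J = I"
      unfolding is_local_ring_def by blast
    interpret I: maximalideal I R by (rule I(1))
    have 1: "\<one> \<notin> I" using I.one_imp_carrier I.I_notcarr by blast
    have nu: "a \<in> I" if a: "a \<in> carrier R" "a \<notin> Units R" for a
    proof -
      obtain M where "maximalideal M R" "PIdl a \<subseteq> M"
        using proper_ideal_in_maximalideal[OF cgenideal_ideal[OF a(1)] nonunit_cgenideal[OF a]] .
      then have "PIdl a \<subseteq> I" using I(2) by simp
      then show ?thesis using cgenideal_self[OF a(1)] by blast
    qed
    have "\<one> \<noteq> \<zero>" using 1 I.zero_closed by metis
    moreover have "a \<in> Units R \<or> b \<in> Units R"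
      if "a \<in> carrier R" "b \<in> carrier R" "a \<oplus> b \<in> Units R" for a b
    proof (rule ccontr)
      assume "\<not> ?thesis"
      then have "a \<oplus> b \<in> I" using nu that by auto
      then show False using ideal_with_unit[OF I.is_ideal that(3)] I.I_notcarr by blast
    qed
    ultimately show "cring R \<and> \<one> \<noteq> \<zero> \<and>
       (\<forall>a\<in>carrier R. \<forall>b\<in>carrier R. a \<oplus> b \<in> Units R \<longrightarrow> a \<in> Units R \<or> b \<in> Units R)"
      using True by blast
  next
    assume *: "cring R \<and> \<one> \<noteq> \<zero> \<and>
       (\<forall>a\<in>carrier R. \<forall>b\<in>carrier R. a \<oplus> b \<in> Units R \<longrightarrow> a \<in> Units R \<or> b \<in> Units R)"
    define I where "I = carrier R - Units R"
    have I: "ideal I R" unfolding I_def using nonunits_ideal * by blast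
    have uniq: "J = I" if J: "maximalideal J R" for J
    proof -
      interpret J: maximalideal J R by (rule J)
      have "J \<subseteq> I" unfolding I_def using ideal_with_unit[OF J.is_ideal] J.I_notcarr J.Icarr by blast
      then show ?thesis using J.I_maximal[OF I] unfolding I_def using one_closed Units_one_closed by blast
    qed
    obtain M where "maximalideal M R" "I \<subseteq> M"
      using proper_ideal_in_maximalideal[OF I] unfolding I_def by auto
    then have "maximalideal I R" using uniq by blast
    then show "is_local_ring R" unfolding is_local_ring_def using True uniq by blast
  qed
qed

lemma local_ring_nonunits_prime:
  assumes "is_local_ring R" shows "primeideal (carrier R - Units R) R"
proof -
  interpret cring R using assms by (simp add: is_local_ring_def)
  have I: "ideal (carrier R - Units R) R" using assms nonunits_ideal unfolding is_local_ring_iff by blast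
  show ?thesis
  proof (rule primeidealI[OF I cring_axioms])
    show "carrier R \<noteq> carrier R - Units R" using one_closed Units_one_closed by blast
  qed (use Units_m_closed in blast)
qed

text \<open>The operations of \<open>stalk\<close> and \<open>localization\<close> are unions over
  all representatives. This reduces their evaluation to the independence of the
  representatives.\<close>

lemma UN_pair_const:
  assumes "\<And>a f b g. (a, f) \<in> C \<Longrightarrow> (b, g) \<in> D \<Longrightarrow> F a f b g = K" "C \<noteq> {}" "D \<noteq> {}"
  shows "(\<Union>(a, f)\<in>C. \<Union>(b, g)\<in>D. F a f b g) = K"
  using assms by fastforce

section \<open>Localization of a commutative ring at a prime ideal\<close>

locale prime_spot = primeideal I R for I and R :: "'a ring" (structure)
begin

lemma compl_mult: "f \<in> carrier R - I \<Longrightarrow> g \<in> carrier R - I \<Longrightarrow> f \<otimes> g \<in> carrier R - I"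
  using I_prime by blast

lemma one_compl: "\<one> \<in> carrier R - I"
  using one_imp_carrier I_notcarr by blast

lemma loc_frac_eq_iff:
  assumes "a \<in> carrier R" "f \<in> carrier R - I" "b \<in> carrier R" "g \<in> carrier R - I"
  shows "loc_frac R I a f = loc_frac R I b g \<longleftrightarrow>
    (\<exists>k\<in>carrier R - I. k \<otimes> (g \<otimes> a) = k \<otimes> (f \<otimes> b))"
proof
  assume "loc_frac R I a f = loc_frac R I b g"
  moreover have "(b, g) \<in> loc_frac R I b g"
    unfolding loc_frac_def using assms one_compl by blast
  ultimately have "(b, g) \<in> loc_frac R I a f" by simp
  then show "\<exists>k\<in>carrier R - I. k \<otimes> (g \<otimes> a) = k \<otimes> (f \<otimes> b)" unfolding loc_frac_def by blast
next
  have tr: "\<exists>l\<in>carrier R - I. l \<otimes> (h \<otimes> b) = l \<otimes> (g \<otimes> c)"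
    if abf: "a \<in> carrier R" "f \<in> carrier R - I" "b \<in> carrier R" "g \<in> carrier R - I"
      "c \<in> carrier R" "h \<in> carrier R - I" and k: "k \<in> carrier R - I" "k \<otimes> (g \<otimes> a) = k \<otimes> (f \<otimes> b)"
      and l: "l \<in> carrier R - I" "l \<otimes> (h \<otimes> a) = l \<otimes> (f \<otimes> c)" for a f b g c h k l
  \<comment> \<open>Transitivity through the fraction with denominator \<open>f\<close>: it appears
    in both given equations and cannot be cancelled, so it is absorbed into the witness.\<close>
  proof (rule bexI[of _ "(k \<otimes> l) \<otimes> f"])
    show "(k \<otimes> l) \<otimes> f \<in> carrier R - I" using compl_mult k l abf by simp
    have C: "k \<in> carrier R" "l \<in> carrier R" "f \<in> carrier R" "g \<in> carrier R" "h \<in> carrier R"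
      using abf k l by auto
    have "(k \<otimes> l) \<otimes> f \<otimes> (h \<otimes> b) = l \<otimes> h \<otimes> (k \<otimes> (f \<otimes> b))" using C abf by algebra
    also have "\<dots> = k \<otimes> g \<otimes> (l \<otimes> (h \<otimes> a))" unfolding k(2)[symmetric] using C abf by algebra
    also have "\<dots> = (k \<otimes> l) \<otimes> f \<otimes> (g \<otimes> c)" unfolding l(2) using C abf by algebra
    finally show "(k \<otimes> l) \<otimes> f \<otimes> (h \<otimes> b) = (k \<otimes> l) \<otimes> f \<otimes> (g \<otimes> c)" .
  qed
  assume "\<exists>k\<in>carrier R - I. k \<otimes> (g \<otimes> a) = k \<otimes> (f \<otimes> b)"
  then obtain k where k: "k\<in>carrier R - I" "k \<otimes> (g \<otimes> a) = k \<otimes> (f \<otimes> b)" by blast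
  show "loc_frac R I a f = loc_frac R I b g"
    unfolding loc_frac_def
    using tr[OF assms(1-4) _ _ k] tr[OF assms(3,4,1,2) _ _ k(1) k(2)[symmetric]] by blast
qed

lemma loc_carrier: "carrier (localization R I) =
    {loc_frac R I a f | a f. a \<in> carrier R \<and> f \<in> carrier R - I}"
  by (simp add: localization_def)

lemma loc_frac_carrier: "a \<in> carrier R \<Longrightarrow> f \<in> carrier R - I \<Longrightarrow>
    loc_frac R I a f \<in> carrier (localization R I)"
  unfolding loc_carrier by blast

lemma loc_one: "\<one>\<^bsub>localization R I\<^esub> = loc_frac R I \<one> \<one>"
  and loc_zero: "\<zero>\<^bsub>localization R I\<^esub> = loc_frac R I \<zero> \<one>"
  by (simp_all add: localization_def)

lemma loc_frac_self: "a \<in> carrier R \<Longrightarrow> f \<in> carrier R - I \<Longrightarrow> (a, f) \<in> loc_frac R I a f"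
  unfolding loc_frac_def using one_compl by blast

lemma loc_mult:
  assumes a: "a \<in> carrier R" "f \<in> carrier R - I" and b: "b \<in> carrier R" "g \<in> carrier R - I"
  shows "loc_frac R I a f \<otimes>\<^bsub>localization R I\<^esub> loc_frac R I b g = loc_frac R I (a \<otimes> b) (f \<otimes> g)"
    and "loc_frac R I a f \<oplus>\<^bsub>localization R I\<^esub> loc_frac R I b g = loc_frac R I (a \<otimes> g \<oplus> b \<otimes> f) (f \<otimes> g)"
proof -
  have *: "loc_frac R I (a' \<otimes> b') (f' \<otimes> g') = loc_frac R I (a \<otimes> b) (f \<otimes> g) \<and>
      loc_frac R I (a' \<otimes> g' \<oplus> b' \<otimes> f') (f' \<otimes> g') = loc_frac R I (a \<otimes> g \<oplus> b \<otimes> f) (f \<otimes> g)"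
    if "(a', f') \<in> loc_frac R I a f" "(b', g') \<in> loc_frac R I b g" for a' f' b' g'
  proof -
    obtain k l where kl: "a' \<in> carrier R" "f' \<in> carrier R - I" "k \<in> carrier R - I" "b' \<in> carrier R" "g' \<in> carrier R - I" "l \<in> carrier R - I"
      and k: "k \<otimes> (f' \<otimes> a) = k \<otimes> (f \<otimes> a')" and l: "l \<otimes> (g' \<otimes> b) = l \<otimes> (g \<otimes> b')"
      using \<open>(a', f') \<in> loc_frac R I a f\<close> \<open>(b', g') \<in> loc_frac R I b g\<close> unfolding loc_frac_def by auto
    have c: "a \<in> carrier R" "b \<in> carrier R" "f \<in> carrier R" "g \<in> carrier R" "a' \<in> carrier R" "b' \<in> carrier R"
      "f' \<in> carrier R" "g' \<in> carrier R" "k \<in> carrier R" "l \<in> carrier R" using a b kl by auto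
    have n: "k \<otimes> l \<in> carrier R - I" "f \<otimes> g \<in> carrier R - I" "f' \<otimes> g' \<in> carrier R - I"
      using compl_mult kl a b by auto
    have "(k \<otimes> l) \<otimes> ((f \<otimes> g) \<otimes> (a' \<otimes> b')) = (k \<otimes> (f \<otimes> a')) \<otimes> (l \<otimes> (g \<otimes> b'))" using c by algebra
    also have "\<dots> = (k \<otimes> l) \<otimes> ((f' \<otimes> g') \<otimes> (a \<otimes> b))" unfolding k[symmetric] l[symmetric] using c by algebra
    finally have 1: "(k \<otimes> l) \<otimes> ((f \<otimes> g) \<otimes> (a' \<otimes> b')) = (k \<otimes> l) \<otimes> ((f' \<otimes> g') \<otimes> (a \<otimes> b))" .
    have "(k \<otimes> l) \<otimes> ((f \<otimes> g) \<otimes> (a' \<otimes> g' \<oplus> b' \<otimes> f')) =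
        (l \<otimes> g \<otimes> g') \<otimes> (k \<otimes> (f \<otimes> a')) \<oplus> (k \<otimes> f \<otimes> f') \<otimes> (l \<otimes> (g \<otimes> b'))" using c by algebra
    also have "\<dots> = (k \<otimes> l) \<otimes> ((f' \<otimes> g') \<otimes> (a \<otimes> g \<oplus> b \<otimes> f))" unfolding k[symmetric] l[symmetric] using c by algebra
    finally have "(k \<otimes> l) \<otimes> ((f \<otimes> g) \<otimes> (a' \<otimes> g' \<oplus> b' \<otimes> f')) = (k \<otimes> l) \<otimes> ((f' \<otimes> g') \<otimes> (a \<otimes> g \<oplus> b \<otimes> f))" .
    then show ?thesis using 1 n c by (auto simp: loc_frac_eq_iff)
  qed
  have ne: "loc_frac R I a f \<noteq> {}" "loc_frac R I b g \<noteq> {}" using loc_frac_self a b by blast+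
  show "loc_frac R I a f \<otimes>\<^bsub>localization R I\<^esub> loc_frac R I b g = loc_frac R I (a \<otimes> b) (f \<otimes> g)"
    unfolding localization_def by simp (rule UN_pair_const[OF _ ne], use * in blast)
  show "loc_frac R I a f \<oplus>\<^bsub>localization R I\<^esub> loc_frac R I b g = loc_frac R I (a \<otimes> g \<oplus> b \<otimes> f) (f \<otimes> g)"
    unfolding localization_def by simp (rule UN_pair_const[OF _ ne], use * in blast)
qed

lemmas loc_add = loc_mult(2)

lemma loc_frac_eqI:
  assumes "a \<in> carrier R" "f \<in> carrier R - I" "b \<in> carrier R" "g \<in> carrier R - I" "g \<otimes> a = f \<otimes> b"
  shows "loc_frac R I a f = loc_frac R I b g"
  unfolding loc_frac_eq_iff[OF assms(1-4)] assms(5) using one_compl by blast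

lemma loc_cring: "cring (localization R I)"
proof (rule cringI)
  let ?L = "localization R I"
  have closed: "x \<oplus>\<^bsub>?L\<^esub> y \<in> carrier ?L" "x \<otimes>\<^bsub>?L\<^esub> y \<in> carrier ?L" if "x \<in> carrier ?L" "y \<in> carrier ?L" for x y
    using that unfolding loc_carrier by (auto simp: loc_mult) (use compl_mult in blast)+
  have 01: "\<zero>\<^bsub>?L\<^esub> \<in> carrier ?L" "\<one>\<^bsub>?L\<^esub> \<in> carrier ?L" unfolding loc_one loc_zero using loc_frac_carrier one_compl by auto
  have c: "f \<in> carrier R" if "f \<in> carrier R - I" for f using that by blast
  show "abelian_group ?L"
  proof (rule abelian_groupI)
    fix x y z assume "x \<in> carrier ?L" "y \<in> carrier ?L" "z \<in> carrier ?L"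
    then obtain a f b g d h where *: "x = loc_frac R I a f" "y = loc_frac R I b g" "z = loc_frac R I d h"
      "a \<in> carrier R" "b \<in> carrier R" "d \<in> carrier R" and n: "f \<in> carrier R - I" "g \<in> carrier R - I" "h \<in> carrier R - I"
      unfolding loc_carrier by blast
    note fgh = n[THEN c]
    have m: "f \<otimes> g \<in> carrier R - I" "g \<otimes> h \<in> carrier R - I" using compl_mult n by auto
    show "x \<oplus>\<^bsub>?L\<^esub> y \<oplus>\<^bsub>?L\<^esub> z = x \<oplus>\<^bsub>?L\<^esub> (y \<oplus>\<^bsub>?L\<^esub> z)"
      unfolding *(1-3) using *(4-6) n m fgh compl_mult
      by (simp add: loc_mult) (intro loc_frac_eqI, simp_all, algebra)
    show "x \<oplus>\<^bsub>?L\<^esub> y = y \<oplus>\<^bsub>?L\<^esub> x" unfolding *(1-3) using *(4-6) n fgh by (simp add: loc_mult m_comm a_comm)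
    show "\<zero>\<^bsub>?L\<^esub> \<oplus>\<^bsub>?L\<^esub> x = x" unfolding *(1) loc_zero using *(4) n fgh one_compl by (simp add: loc_mult)
    show "\<exists>y\<in>carrier ?L. y \<oplus>\<^bsub>?L\<^esub> x = \<zero>\<^bsub>?L\<^esub>"
    proof
      have "\<ominus> a \<otimes> f \<oplus> a \<otimes> f = \<zero>" using *(4) fgh by algebra
      then show "loc_frac R I (\<ominus> a) f \<oplus>\<^bsub>?L\<^esub> x = \<zero>\<^bsub>?L\<^esub>"
        unfolding *(1) loc_zero using *(4) n fgh compl_mult one_compl by (simp add: loc_mult) (intro loc_frac_eqI, simp_all)
      show "loc_frac R I (\<ominus> a) f \<in> carrier ?L" using loc_frac_carrier *(4) n by simp
    qed
  qed (use closed 01 in auto)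
  show "Group.comm_monoid ?L"
  proof (rule comm_monoidI)
    fix x y z assume "x \<in> carrier ?L" "y \<in> carrier ?L" "z \<in> carrier ?L"
    then obtain a f b g d h where *: "x = loc_frac R I a f" "y = loc_frac R I b g" "z = loc_frac R I d h"
      "a \<in> carrier R" "b \<in> carrier R" "d \<in> carrier R" and n: "f \<in> carrier R - I" "g \<in> carrier R - I" "h \<in> carrier R - I"
      unfolding loc_carrier by blast
    have m: "f \<otimes> g \<in> carrier R - I" "g \<otimes> h \<in> carrier R - I" using compl_mult n by auto
    note fgh = n[THEN c]
    show "x \<otimes>\<^bsub>?L\<^esub> y \<otimes>\<^bsub>?L\<^esub> z = x \<otimes>\<^bsub>?L\<^esub> (y \<otimes>\<^bsub>?L\<^esub> z)" unfolding *(1-3) using *(4-6) n m fgh by (simp add: loc_mult m_assoc)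
    show "x \<otimes>\<^bsub>?L\<^esub> y = y \<otimes>\<^bsub>?L\<^esub> x" unfolding *(1-3) using *(4-6) n fgh by (simp add: loc_mult m_comm)
    show "\<one>\<^bsub>?L\<^esub> \<otimes>\<^bsub>?L\<^esub> x = x" unfolding *(1) loc_one using *(4) n fgh one_compl by (simp add: loc_mult)
  qed (use closed 01 in auto)
  fix x y z assume "x \<in> carrier ?L" "y \<in> carrier ?L" "z \<in> carrier ?L"
  then obtain a f b g d h where *: "x = loc_frac R I a f" "y = loc_frac R I b g" "z = loc_frac R I d h"
    "a \<in> carrier R" "b \<in> carrier R" "d \<in> carrier R" and n: "f \<in> carrier R - I" "g \<in> carrier R - I" "h \<in> carrier R - I"
    unfolding loc_carrier by blast
  have m: "f \<otimes> g \<in> carrier R - I" "f \<otimes> h \<in> carrier R - I" "g \<otimes> h \<in> carrier R - I" using compl_mult n by auto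
  note fgh = n[THEN c]
  show "(x \<oplus>\<^bsub>?L\<^esub> y) \<otimes>\<^bsub>?L\<^esub> z = x \<otimes>\<^bsub>?L\<^esub> z \<oplus>\<^bsub>?L\<^esub> y \<otimes>\<^bsub>?L\<^esub> z"
    unfolding *(1-3) using *(4-6) n m fgh compl_mult by (simp add: loc_mult) (intro loc_frac_eqI, simp_all, algebra)
qed

lemma loc_frac_zero_iff:
  assumes "a \<in> carrier R" "f \<in> carrier R - I"
  shows "loc_frac R I a f = \<zero>\<^bsub>localization R I\<^esub> \<longleftrightarrow> (\<exists>k\<in>carrier R - I. k \<otimes> a = \<zero>)"
proof -
  have "k \<otimes> (\<one> \<otimes> a) = k \<otimes> (f \<otimes> \<zero>) \<longleftrightarrow> k \<otimes> a = \<zero>" if "k \<in> carrier R - I" for k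
    using that assms by simp
  then show ?thesis using assms one_compl unfolding loc_zero
    by (subst loc_frac_eq_iff) auto
qed

text \<open>Invertibility of a fraction is decided by its numerator. This is how values of sections
  of a spectrum are compared with the points of the spectrum.\<close>

lemma loc_frac_unit_iff:
  assumes a: "a \<in> carrier R" and f: "f \<in> carrier R - I"
  shows "loc_frac R I a f \<in> Units (localization R I) \<longleftrightarrow> a \<notin> I"
proof
  interpret L: cring "localization R I" by (rule loc_cring)
  assume "loc_frac R I a f \<in> Units (localization R I)"
  then obtain b g where b: "b \<in> carrier R" "g \<in> carrier R - I"
    "loc_frac R I a f \<otimes>\<^bsub>localization R I\<^esub> loc_frac R I b g = \<one>\<^bsub>localization R I\<^esub>"
    unfolding Units_def loc_carrier by auto
  then have "loc_frac R I (a \<otimes> b) (f \<otimes> g) = loc_frac R I \<one> \<one>"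
    using a f by (simp add: loc_mult loc_one)
  then obtain k where k: "k \<in> carrier R - I" "k \<otimes> (\<one> \<otimes> (a \<otimes> b)) = k \<otimes> (f \<otimes> g \<otimes> \<one>)"
    using loc_frac_eq_iff[of "a \<otimes> b" "f \<otimes> g" \<one> \<one>] a f b compl_mult[OF f b(2)] one_compl by auto
  have fg: "k \<otimes> (f \<otimes> g \<otimes> \<one>) \<notin> I"
    using compl_mult[OF k(1) compl_mult[OF compl_mult[OF f b(2)] one_compl]] by blast
  show "a \<notin> I"
  proof
    assume "a \<in> I"
    then have "k \<otimes> (\<one> \<otimes> (a \<otimes> b)) \<in> I" using k(1) b by (intro I_l_closed I_r_closed) auto
    then show False using fg k(2) by simp
  qed
next
  interpret L: cring "localization R I" by (rule loc_cring)
  assume "a \<notin> I"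
  then have a': "a \<in> carrier R - I" using a by blast
  have "loc_frac R I a f \<otimes>\<^bsub>localization R I\<^esub> loc_frac R I f a = loc_frac R I (a \<otimes> f) (f \<otimes> a)"
    using a' f by (simp add: loc_mult)
  also have "\<dots> = \<one>\<^bsub>localization R I\<^esub>"
    unfolding loc_one using a' f compl_mult[OF f a'] one_compl
    by (subst loc_frac_eq_iff) (auto simp: m_comm)
  finally show "loc_frac R I a f \<in> Units (localization R I)"
    using loc_frac_carrier[OF a f] loc_frac_carrier[of f a] a' f L.m_comm
    unfolding Units_def by fastforce
qed

end

section \<open>Stalks\<close>

text \<open>Equivalent to invertibility of the germ of \<open>s\<close> at \<open>x\<close>, but
  without mention of the stalk. All conditions on local rings and local homomorphisms are restated
  with it.\<close>

definition unit_near :: "('a, 'b) ringed_data \<Rightarrow> 'a \<Rightarrow> 'a set \<Rightarrow> 'b \<Rightarrow> bool" where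
  "unit_near X x U s \<longleftrightarrow> (\<exists>W. openin (topol X) W \<and> x \<in> W \<and> W \<subseteq> U \<and>
     restrn X U W s \<in> Units (sections X W))"

lemma openin_points: "openin (topol X) U \<Longrightarrow> U \<subseteq> points X"
  by (simp add: openin_subset points_def)

lemma openin_points_self [simp]: "openin (topol X) (points X)"
  by (simp add: points_def)

lemma ring_hom_Units:
  assumes "h \<in> ring_hom R S" "cring R" "cring S" "u \<in> Units R"
  shows "h u \<in> Units S"
proof -
  interpret R: cring R by fact
  interpret S: cring S by fact
  interpret h: ring_hom_cring R S h using assms by (simp add: ring_hom_cring_def ring_hom_cring_axioms_def)
  show ?thesis using assms(4) unfolding Units_def
    by (smt (verit, del_insts) h.hom_closed h.hom_mult h.hom_one mem_Collect_eq)
qed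

text \<open>
  A stalk is a union of homomorphic images of commutative rings, any three of its elements lying in
  one of them.
\<close>

lemma cring_of_images:
  fixes Q :: "'q ring"
  assumes ex: "\<And>c d e. c \<in> carrier Q \<Longrightarrow> d \<in> carrier Q \<Longrightarrow> e \<in> carrier Q \<Longrightarrow>
      \<exists>(R :: 'r ring) h. cring R \<and> h \<in> ring_hom R Q \<and> h \<zero>\<^bsub>R\<^esub> = \<zero>\<^bsub>Q\<^esub> \<and> {c, d, e} \<subseteq> h ` carrier R"
    and 1: "\<one>\<^bsub>Q\<^esub> \<in> carrier Q" and 0: "\<zero>\<^bsub>Q\<^esub> \<in> carrier Q"
  shows "cring Q"
proof -
  have *: "c \<oplus>\<^bsub>Q\<^esub> d \<in> carrier Q \<and> c \<otimes>\<^bsub>Q\<^esub> d \<in> carrier Q \<and> c \<oplus>\<^bsub>Q\<^esub> d \<oplus>\<^bsub>Q\<^esub> e = c \<oplus>\<^bsub>Q\<^esub> (d \<oplus>\<^bsub>Q\<^esub> e) \<and>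
      c \<otimes>\<^bsub>Q\<^esub> d \<otimes>\<^bsub>Q\<^esub> e = c \<otimes>\<^bsub>Q\<^esub> (d \<otimes>\<^bsub>Q\<^esub> e) \<and> c \<oplus>\<^bsub>Q\<^esub> d = d \<oplus>\<^bsub>Q\<^esub> c \<and> c \<otimes>\<^bsub>Q\<^esub> d = d \<otimes>\<^bsub>Q\<^esub> c \<and>
      (c \<oplus>\<^bsub>Q\<^esub> d) \<otimes>\<^bsub>Q\<^esub> e = c \<otimes>\<^bsub>Q\<^esub> e \<oplus>\<^bsub>Q\<^esub> d \<otimes>\<^bsub>Q\<^esub> e \<and> \<zero>\<^bsub>Q\<^esub> \<oplus>\<^bsub>Q\<^esub> c = c \<and> \<one>\<^bsub>Q\<^esub> \<otimes>\<^bsub>Q\<^esub> c = c \<and>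
      (\<exists>y\<in>carrier Q. y \<oplus>\<^bsub>Q\<^esub> c = \<zero>\<^bsub>Q\<^esub>)"
    if cde: "c \<in> carrier Q" "d \<in> carrier Q" "e \<in> carrier Q" for c d e
  proof -
    obtain R :: "'r ring" and h where R: "cring R" and h: "h \<in> ring_hom R Q" and z: "h \<zero>\<^bsub>R\<^esub> = \<zero>\<^bsub>Q\<^esub>"
      and im: "{c, d, e} \<subseteq> h ` carrier R" using ex[OF cde] by (elim exE conjE)
    obtain r s t where r: "r \<in> carrier R" "s \<in> carrier R" "t \<in> carrier R" "c = h r" "d = h s" "e = h t"
      using im by (auto simp: image_iff)
    interpret R: cring R by (rule R)
    note hs = ring_hom_add[OF h, symmetric] ring_hom_mult[OF h, symmetric] ring_hom_one[OF h, symmetric] z[symmetric] ring_hom_closed[OF h]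
    have "h (\<ominus>\<^bsub>R\<^esub> r) \<oplus>\<^bsub>Q\<^esub> c = \<zero>\<^bsub>Q\<^esub>" using r by (simp add: hs R.l_neg)
    then have "\<exists>y\<in>carrier Q. y \<oplus>\<^bsub>Q\<^esub> c = \<zero>\<^bsub>Q\<^esub>" using hs(5)[of "\<ominus>\<^bsub>R\<^esub> r"] r(1) by auto
    then show ?thesis using r by (simp add: hs R.a_ac R.m_ac R.r_distr)
  qed
  show ?thesis
    by (intro cringI abelian_groupI comm_monoidI 0 1) (use * 0 in blast)+
qed

locale presheaf =
  fixes X :: "('a, 'b) ringed_data"
  assumes presheaf: "is_presheaf X"
begin

lemma cring_sec: "openin (topol X) U \<Longrightarrow> cring (sections X U)"
  using presheaf[unfolded is_presheaf_def, THEN conjunct1] by simp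

lemma res_hom: "openin (topol X) U \<Longrightarrow> openin (topol X) V \<Longrightarrow> V \<subseteq> U \<Longrightarrow>
    restrn X U V \<in> ring_hom (sections X U) (sections X V)"
  using presheaf[unfolded is_presheaf_def, THEN conjunct2, THEN conjunct1] by simp

lemma res_id [simp]: "openin (topol X) U \<Longrightarrow> s \<in> carrier (sections X U) \<Longrightarrow> restrn X U U s = s"
  using presheaf[unfolded is_presheaf_def, THEN conjunct2, THEN conjunct2, THEN conjunct1] by simp

lemma res_res [simp]: "openin (topol X) U \<Longrightarrow> openin (topol X) V \<Longrightarrow> openin (topol X) W \<Longrightarrow>
    V \<subseteq> U \<Longrightarrow> W \<subseteq> V \<Longrightarrow> s \<in> carrier (sections X U) \<Longrightarrow>
    restrn X V W (restrn X U V s) = restrn X U W s"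
  using presheaf[unfolded is_presheaf_def, THEN conjunct2, THEN conjunct2, THEN conjunct2] by simp

lemma res_closed [simp]: "openin (topol X) U \<Longrightarrow> openin (topol X) V \<Longrightarrow> V \<subseteq> U \<Longrightarrow>
    s \<in> carrier (sections X U) \<Longrightarrow> restrn X U V s \<in> carrier (sections X V)"
  by (rule ring_hom_closed[OF res_hom])

lemma res_mult [simp]: "openin (topol X) U \<Longrightarrow> openin (topol X) V \<Longrightarrow> V \<subseteq> U \<Longrightarrow>
    s \<in> carrier (sections X U) \<Longrightarrow> t \<in> carrier (sections X U) \<Longrightarrow>
    restrn X U V (s \<otimes>\<^bsub>sections X U\<^esub> t) = restrn X U V s \<otimes>\<^bsub>sections X V\<^esub> restrn X U V t"
  by (rule ring_hom_mult[OF res_hom])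

lemma res_add [simp]: "openin (topol X) U \<Longrightarrow> openin (topol X) V \<Longrightarrow> V \<subseteq> U \<Longrightarrow>
    s \<in> carrier (sections X U) \<Longrightarrow> t \<in> carrier (sections X U) \<Longrightarrow>
    restrn X U V (s \<oplus>\<^bsub>sections X U\<^esub> t) = restrn X U V s \<oplus>\<^bsub>sections X V\<^esub> restrn X U V t"
  by (rule ring_hom_add[OF res_hom])

lemma res_one [simp]: "openin (topol X) U \<Longrightarrow> openin (topol X) V \<Longrightarrow> V \<subseteq> U \<Longrightarrow>
    restrn X U V \<one>\<^bsub>sections X U\<^esub> = \<one>\<^bsub>sections X V\<^esub>"
  by (rule ring_hom_one[OF res_hom])

lemma res_zero [simp]: "openin (topol X) U \<Longrightarrow> openin (topol X) V \<Longrightarrow> V \<subseteq> U \<Longrightarrow>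
    restrn X U V \<zero>\<^bsub>sections X U\<^esub> = \<zero>\<^bsub>sections X V\<^esub>"
  using ring_hom_zero[OF res_hom] cring_sec[THEN cring.axioms(1)] by simp

lemma res_Units: "openin (topol X) U \<Longrightarrow> openin (topol X) V \<Longrightarrow> V \<subseteq> U \<Longrightarrow>
    s \<in> Units (sections X U) \<Longrightarrow> restrn X U V s \<in> Units (sections X V)"
  by (rule ring_hom_Units[OF res_hom cring_sec cring_sec])

lemma unit_near_res:
  assumes "openin (topol X) U" "openin (topol X) V" "V \<subseteq> U" "s \<in> carrier (sections X U)" "x \<in> V"
  shows "unit_near X x V (restrn X U V s) \<longleftrightarrow> unit_near X x U s"
proof
  assume "unit_near X x V (restrn X U V s)"
  then show "unit_near X x U s" unfolding unit_near_def using assms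
    by (metis res_res subset_trans)
next
  assume "unit_near X x U s"
  then obtain W where W: "openin (topol X) W" "x \<in> W" "W \<subseteq> U"
    "restrn X U W s \<in> Units (sections X W)" unfolding unit_near_def by blast
  have "openin (topol X) (W \<inter> V)" using W assms by blast
  then have "restrn X U (W \<inter> V) s \<in> Units (sections X (W \<inter> V))"
    using res_Units[OF W(1), of "W \<inter> V"] W assms by (metis inf_le1 res_res)
  then show "unit_near X x V (restrn X U V s)" unfolding unit_near_def
    using assms W \<open>openin (topol X) (W \<inter> V)\<close> by (metis IntI inf_le2 res_res)
qed

definition reps :: "'a \<Rightarrow> ('a set \<times> 'b) set" where
  "reps x = {(U, s). openin (topol X) U \<and> x \<in> U \<and> s \<in> carrier (sections X U)}"

text \<open>A germ is the set of all pairs that agree with the given one near \<open>x\<close>.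
  Equality of two such sets is transitivity of local agreement, which is obtained on the
  intersection of the two neighbourhoods.\<close>

lemma germ_eqI:
  assumes "(U, s) \<in> reps x" "(V, t) \<in> reps x"
    and "openin (topol X) W" "x \<in> W" "W \<subseteq> U \<inter> V" "restrn X U W s = restrn X V W t"
  shows "germ X x U s = germ X x V t"
proof -
  have tr: "\<exists>W. openin (topol X) W \<and> x \<in> W \<and> W \<subseteq> V \<inter> V' \<and> restrn X V W t = restrn X V' W t'"
    if "(U, s) \<in> reps x" "(V, t) \<in> reps x" "openin (topol X) W" "x \<in> W" "W \<subseteq> U \<inter> V"
      "restrn X U W s = restrn X V W t" and W': "openin (topol X) W'" "x \<in> W'" "W' \<subseteq> U \<inter> V'"
      "restrn X U W' s = restrn X V' W' t'"
      "openin (topol X) V'" "t' \<in> carrier (sections X V')" for U s V t W V' t' W'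
  proof (intro exI conjI)
    show O: "openin (topol X) (W \<inter> W')" using that by blast
    show "x \<in> W \<inter> W'" "W \<inter> W' \<subseteq> V \<inter> V'" using that by auto
    have "restrn X V (W \<inter> W') t = restrn X W (W \<inter> W') (restrn X U W s)"
      using that O by (simp add: reps_def)
    also have "\<dots> = restrn X W' (W \<inter> W') (restrn X U W' s)"
      using that(1-5,7-9) O by (simp add: reps_def)
    also have "\<dots> = restrn X V' (W \<inter> W') t'" using that O by simp
    finally show "restrn X V (W \<inter> W') t = restrn X V' (W \<inter> W') t'" .
  qed
  have sym: "restrn X V W t = restrn X U W s" "W \<subseteq> V \<inter> U" using assms by auto
  have half: "(V', t') \<in> germ X x V t" if m: "(V', t') \<in> germ X x U s" and that': "(U, s) \<in> reps x" "(V, t) \<in> reps x"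
      "W \<subseteq> U \<inter> V" "restrn X U W s = restrn X V W t" for U s V t V' t'
  proof -
    obtain W' where W': "openin (topol X) V'" "x \<in> V'" "t' \<in> carrier (sections X V')"
      "openin (topol X) W'" "x \<in> W'" "W' \<subseteq> U \<inter> V'" "restrn X U W' s = restrn X V' W' t'"
      using m unfolding germ_def by auto
    show ?thesis
      using tr[OF that'(1,2) assms(3,4) that'(3,4) W'(4-7,1,3)] W'(1-3) unfolding germ_def by simp
  qed
  show ?thesis
    using half[OF _ assms(1,2,5,6)] half[OF _ assms(2,1) sym(2,1)] by (meson subrelI subset_antisym)
qed

lemma germ_eq_iff:
  assumes "(U, s) \<in> reps x" "(V, t) \<in> reps x"
  shows "germ X x U s = germ X x V t \<longleftrightarrow> (\<exists>W. openin (topol X) W \<and> x \<in> W \<and> W \<subseteq> U \<inter> V \<and>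
    restrn X U W s = restrn X V W t)"
proof
  assume "germ X x U s = germ X x V t"
  moreover have "(V, t) \<in> germ X x V t" using assms(2) unfolding germ_def reps_def by auto
  ultimately have "(V, t) \<in> germ X x U s" by simp
  then show "\<exists>W. openin (topol X) W \<and> x \<in> W \<and> W \<subseteq> U \<inter> V \<and>
    restrn X U W s = restrn X V W t" unfolding germ_def by auto
next
  assume "\<exists>W. openin (topol X) W \<and> x \<in> W \<and> W \<subseteq> U \<inter> V \<and> restrn X U W s = restrn X V W t"
  then show "germ X x U s = germ X x V t" using germ_eqI[OF assms] by blast
qed

context
  fixes x assumes x: "x \<in> points X"
begin

lemma stalk_carrier: "carrier (stalk X x) = (\<lambda>(U, s). germ X x U s) ` reps x"
  unfolding stalk_def reps_def by (auto simp: image_iff)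

lemma stalk_one: "\<one>\<^bsub>stalk X x\<^esub> = germ X x (points X) \<one>\<^bsub>sections X (points X)\<^esub>"
  and stalk_zero: "\<zero>\<^bsub>stalk X x\<^esub> = germ X x (points X) \<zero>\<^bsub>sections X (points X)\<^esub>"
  by (simp_all add: stalk_def)

lemma germ_res:
  assumes "openin (topol X) U" "openin (topol X) W" "x \<in> W" "W \<subseteq> U" "s \<in> carrier (sections X U)"
  shows "germ X x W (restrn X U W s) = germ X x U s"
  by (rule germ_eqI[of _ _ _ _ _ W]) (use assms in \<open>auto simp: reps_def\<close>)

text \<open>Only germs represented on one common open set are considered; \<open>stalk_pair\<close>
  supplies such representatives for any two germs.\<close>

lemma stalk_mult:
  assumes s: "(U, s) \<in> reps x" and t: "(U, t) \<in> reps x"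
  shows "germ X x U s \<otimes>\<^bsub>stalk X x\<^esub> germ X x U t = germ X x U (s \<otimes>\<^bsub>sections X U\<^esub> t)"
    and "germ X x U s \<oplus>\<^bsub>stalk X x\<^esub> germ X x U t = germ X x U (s \<oplus>\<^bsub>sections X U\<^esub> t)"
proof -
  have U: "openin (topol X) U" "x \<in> U" "s \<in> carrier (sections X U)" "t \<in> carrier (sections X U)"
    using s t by (auto simp: reps_def)
  interpret U: cring "sections X U" by (rule cring_sec[OF U(1)])
  have *: "germ X x (V \<inter> V') (restrn X V (V \<inter> V') s' \<otimes>\<^bsub>sections X (V \<inter> V')\<^esub> restrn X V' (V \<inter> V') t') =
        germ X x U (s \<otimes>\<^bsub>sections X U\<^esub> t) \<and>
      germ X x (V \<inter> V') (restrn X V (V \<inter> V') s' \<oplus>\<^bsub>sections X (V \<inter> V')\<^esub> restrn X V' (V \<inter> V') t') =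
        germ X x U (s \<oplus>\<^bsub>sections X U\<^esub> t)"
    if V: "(V, s') \<in> germ X x U s" and V': "(V', t') \<in> germ X x U t" for V s' V' t'
  proof -
    obtain W W' where V: "openin (topol X) V" "x \<in> V" "s' \<in> carrier (sections X V)" and
      V': "openin (topol X) V'" "x \<in> V'" "t' \<in> carrier (sections X V')" and
      W: "openin (topol X) W" "x \<in> W" "W \<subseteq> U \<inter> V" and e: "restrn X U W s = restrn X V W s'" and
      W': "openin (topol X) W'" "x \<in> W'" "W' \<subseteq> U \<inter> V'" and e': "restrn X U W' t = restrn X V' W' t'"
      using V V' unfolding germ_def by blast
    \<comment> \<open>Here both chosen representatives agree with \<open>s\<close> and
      \<open>t\<close>, so sums and products agree as well.\<close>
    let ?N = "W \<inter> W'"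
    have O: "openin (topol X) ?N" "openin (topol X) (V \<inter> V')" using W W' V V' by blast+
    have N: "?N \<subseteq> W" "?N \<subseteq> W'" "?N \<subseteq> U" "?N \<subseteq> V" "?N \<subseteq> V'" "?N \<subseteq> V \<inter> V'" using W W' by auto
    have "restrn X W ?N (restrn X U W s) = restrn X W ?N (restrn X V W s')" by (simp add: e)
    then have 1: "restrn X U ?N s = restrn X V ?N s'" using W V U O N by simp
    have "restrn X W' ?N (restrn X U W' t) = restrn X W' ?N (restrn X V' W' t')" by (simp add: e')
    then have 2: "restrn X U ?N t = restrn X V' ?N t'" using W' V' U O N by simp
    interpret VV: cring "sections X (V \<inter> V')" by (rule cring_sec[OF O(2)])
    have x: "x \<in> ?N" "?N \<subseteq> (V \<inter> V') \<inter> U" using W W' by auto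
    show ?thesis
      by (intro conjI germ_eqI[OF _ _ O(1) x]) (use U V V' O N 1 2 in \<open>simp_all add: reps_def\<close>)
  qed
  have ne: "germ X x U s \<noteq> {}" "germ X x U t \<noteq> {}" using U by (auto simp: germ_def)
  show "germ X x U s \<otimes>\<^bsub>stalk X x\<^esub> germ X x U t = germ X x U (s \<otimes>\<^bsub>sections X U\<^esub> t)"
    unfolding stalk_def by simp (rule UN_pair_const[OF _ ne], use * in blast)
  show "germ X x U s \<oplus>\<^bsub>stalk X x\<^esub> germ X x U t = germ X x U (s \<oplus>\<^bsub>sections X U\<^esub> t)"
    unfolding stalk_def by simp (rule UN_pair_const[OF _ ne], use * in blast)
qed

lemmas stalk_add = stalk_mult(2)

lemma stalk_one_U: "openin (topol X) U \<Longrightarrow> x \<in> U \<Longrightarrow> \<one>\<^bsub>stalk X x\<^esub> = germ X x U \<one>\<^bsub>sections X U\<^esub>"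
  and stalk_zero_U: "openin (topol X) U \<Longrightarrow> x \<in> U \<Longrightarrow> \<zero>\<^bsub>stalk X x\<^esub> = germ X x U \<zero>\<^bsub>sections X U\<^esub>"
  using germ_res[of "points X" U "\<one>\<^bsub>sections X (points X)\<^esub>"]
    germ_res[of "points X" U "\<zero>\<^bsub>sections X (points X)\<^esub>"] openin_points[of X U]
    cring_sec[OF openin_points_self, THEN cring.axioms(1), THEN ring.ring_simprules(2)]
    cring_sec[OF openin_points_self, THEN cring.axioms(1), THEN ring.ring_simprules(6)]
  by (simp_all add: stalk_one stalk_zero)

lemma stalk_pair:
  assumes "c \<in> carrier (stalk X x)" "d \<in> carrier (stalk X x)" "openin (topol X) N" "x \<in> N"
  obtains U s t where "(U, s) \<in> reps x" "(U, t) \<in> reps x" "U \<subseteq> N" "c = germ X x U s" "d = germ X x U t"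
proof -
  obtain U s V t where *: "(U, s) \<in> reps x" "(V, t) \<in> reps x" "c = germ X x U s" "d = germ X x V t"
    using assms unfolding stalk_carrier by auto
  have O: "openin (topol X) (U \<inter> V \<inter> N)" using * assms unfolding reps_def by blast
  have "U \<inter> V \<inter> N \<subseteq> U" "U \<inter> V \<inter> N \<subseteq> V" by auto
  then show ?thesis
    using * O assms(4) germ_res[of U "U \<inter> V \<inter> N" s] germ_res[of V "U \<inter> V \<inter> N" t]
    by (intro that[of "U \<inter> V \<inter> N" "restrn X U (U \<inter> V \<inter> N) s" "restrn X V (U \<inter> V \<inter> N) t"])
      (auto simp: reps_def)
qed

lemma stalk_hom:
  assumes U: "openin (topol X) U" "x \<in> U"
  shows "germ X x U \<in> ring_hom (sections X U) (stalk X x)"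
proof -
  have r: "(U, s) \<in> reps x" if "s \<in> carrier (sections X U)" for s using U that by (simp add: reps_def)
  show ?thesis
    by (rule ring_hom_memI) (use r stalk_mult stalk_add stalk_one_U[OF U] in \<open>force simp: stalk_carrier\<close>)+
qed

lemma stalk_cring: "cring (stalk X x)"
proof (rule cring_of_images)
  show "\<one>\<^bsub>stalk X x\<^esub> \<in> carrier (stalk X x)" "\<zero>\<^bsub>stalk X x\<^esub> \<in> carrier (stalk X x)"
    using ring_hom_closed[OF stalk_hom[OF openin_points_self x]] cring_sec[OF openin_points_self, THEN cring.axioms(1)]
    unfolding stalk_one stalk_zero by (simp_all add: ring.ring_simprules(2,6))
  fix c d e assume c: "c \<in> carrier (stalk X x)" "d \<in> carrier (stalk X x)" "e \<in> carrier (stalk X x)"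
  obtain V r where V: "openin (topol X) V" "x \<in> V" "r \<in> carrier (sections X V)" "e = germ X x V r"
    using c(3) unfolding stalk_carrier reps_def by auto
  obtain U s t where U: "(U, s) \<in> reps x" "(U, t) \<in> reps x" "U \<subseteq> V" "c = germ X x U s" "d = germ X x U t"
    using stalk_pair[OF c(1,2) V(1,2)] .
  have U': "openin (topol X) U" "x \<in> U" "s \<in> carrier (sections X U)" "t \<in> carrier (sections X U)"
    using U by (auto simp: reps_def)
  have "e = germ X x U (restrn X V U r)" using germ_res[OF V(1) U'(1,2) U(3) V(3)] V(4) by simp
  then have "{c, d, e} \<subseteq> germ X x U ` carrier (sections X U)"
    using U(4,5) U'(3,4) res_closed[OF V(1) U'(1) U(3) V(3)] by blast
  then show "\<exists>(R :: 'b ring) h. cring R \<and> h \<in> ring_hom R (stalk X x) \<and> h \<zero>\<^bsub>R\<^esub> = \<zero>\<^bsub>stalk X x\<^esub> \<and> {c, d, e} \<subseteq> h ` carrier R"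
    using cring_sec[OF U'(1)] stalk_hom[OF U'(1,2)] stalk_zero_U[OF U'(1,2)] by metis
qed

text \<open>An inverse in the stalk is the germ of a section over a smaller open set, and the
  product becomes one after a further restriction. Conversely a section that is invertible on a
  neighbourhood has an inverse whose germ inverts that of \<open>s\<close>.\<close>

lemma germ_Units_iff:
  assumes s: "(U, s) \<in> reps x"
  shows "germ X x U s \<in> Units (stalk X x) \<longleftrightarrow> unit_near X x U s"
proof
  interpret S: cring "stalk X x" by (rule stalk_cring)
  have U: "openin (topol X) U" "x \<in> U" "s \<in> carrier (sections X U)" using s by (auto simp: reps_def)
  show "unit_near X x U s" if "germ X x U s \<in> Units (stalk X x)"
  proof -
    obtain c where c: "c \<in> carrier (stalk X x)" "germ X x U s \<otimes>\<^bsub>stalk X x\<^esub> c = \<one>\<^bsub>stalk X x\<^esub>"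
      using S.Units_r_inv_ex \<open>germ X x U s \<in> Units (stalk X x)\<close> by blast
    have "germ X x U s \<in> carrier (stalk X x)" unfolding stalk_carrier using s by auto
    from stalk_pair[OF this c(1) U(1,2)] obtain V r t where
      V: "(V, r) \<in> reps x" "(V, t) \<in> reps x" "V \<subseteq> U" "germ X x U s = germ X x V r" "c = germ X x V t" .
    have V': "openin (topol X) V" "x \<in> V" "r \<in> carrier (sections X V)" "t \<in> carrier (sections X V)"
      using V by (auto simp: reps_def)
    interpret V: cring "sections X V" by (rule cring_sec[OF V'(1)])
    have "germ X x V (r \<otimes>\<^bsub>sections X V\<^esub> t) = germ X x V \<one>\<^bsub>sections X V\<^esub>"
      using c(2) V V' by (simp add: stalk_mult stalk_one_U[of V])
    then obtain W where W: "openin (topol X) W" "x \<in> W" "W \<subseteq> V"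
      "restrn X V W (r \<otimes>\<^bsub>sections X V\<^esub> t) = restrn X V W \<one>\<^bsub>sections X V\<^esub>"
      using germ_eq_iff[of V "r \<otimes>\<^bsub>sections X V\<^esub> t" x V "\<one>\<^bsub>sections X V\<^esub>"] V' by (auto simp: reps_def)
    interpret W: cring "sections X W" by (rule cring_sec[OF W(1)])
    have u: "restrn X V W r \<in> Units (sections X W)"
    proof -
      have "restrn X V W r \<otimes>\<^bsub>sections X W\<^esub> restrn X V W t = \<one>\<^bsub>sections X W\<^esub>"
        using W V' by simp
      moreover from this have "restrn X V W t \<otimes>\<^bsub>sections X W\<^esub> restrn X V W r = \<one>\<^bsub>sections X W\<^esub>"
        using W V' by (simp add: W.m_comm)
      ultimately show ?thesis unfolding Units_def using W V' by auto
    qed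
    obtain W' where W': "openin (topol X) W'" "x \<in> W'" "W' \<subseteq> U \<inter> V"
      "restrn X U W' s = restrn X V W' r" using V(4) germ_eq_iff[OF s V(1)] by blast
    have O: "openin (topol X) (W \<inter> W')" using W W' by blast
    have "restrn X W (W \<inter> W') (restrn X V W r) = restrn X W' (W \<inter> W') (restrn X U W' s)"
      unfolding W'(4) using W W' O V' U by simp
    also have "\<dots> = restrn X U (W \<inter> W') s" using W'(1-3) O U by simp
    finally have "restrn X U (W \<inter> W') s = restrn X W (W \<inter> W') (restrn X V W r)" by simp
    then have "restrn X U (W \<inter> W') s \<in> Units (sections X (W \<inter> W'))"
      using res_Units[OF W(1) O _ u] by simp
    then show ?thesis unfolding unit_near_def using O W W' by blast
  qed
  assume "unit_near X x U s"
  then obtain W where W: "openin (topol X) W" "x \<in> W" "W \<subseteq> U" "restrn X U W s \<in> Units (sections X W)"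
    unfolding unit_near_def by blast
  interpret W: cring "sections X W" by (rule cring_sec[OF W(1)])
  let ?t = "inv\<^bsub>sections X W\<^esub> (restrn X U W s)"
  have g: "germ X x U s = germ X x W (restrn X U W s)" using germ_res[of U W s] W U by simp
  have r: "(W, restrn X U W s) \<in> reps x" "(W, ?t) \<in> reps x" using W U by (auto simp: reps_def)
  have "germ X x U s \<otimes>\<^bsub>stalk X x\<^esub> germ X x W ?t = \<one>\<^bsub>stalk X x\<^esub>"
    "germ X x W ?t \<otimes>\<^bsub>stalk X x\<^esub> germ X x U s = \<one>\<^bsub>stalk X x\<^esub>"
    unfolding g using W by (simp_all add: stalk_mult[OF r] stalk_mult[OF r(2,1)] stalk_one_U[of W])
  moreover have "germ X x U s \<in> carrier (stalk X x)" "germ X x W ?t \<in> carrier (stalk X x)"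
    unfolding stalk_carrier using s r by auto
  ultimately show "germ X x U s \<in> Units (stalk X x)" unfolding Units_def by auto
qed

text \<open>This is \<open>is_local_ring_iff\<close> for the stalk, written with sections. That one
  and zero differ is demanded over every neighbourhood, because two germs are equal as soon as their
  representatives agree on some neighbourhood.\<close>

lemma local_stalk_iff:
  "is_local_ring (stalk X x) \<longleftrightarrow> (\<forall>U. openin (topol X) U \<and> x \<in> U \<longrightarrow>
     \<one>\<^bsub>sections X U\<^esub> \<noteq> \<zero>\<^bsub>sections X U\<^esub> \<and>
     (\<forall>s\<in>carrier (sections X U). \<forall>t\<in>carrier (sections X U).
        unit_near X x U (s \<oplus>\<^bsub>sections X U\<^esub> t) \<longrightarrow> unit_near X x U s \<or> unit_near X x U t))"
  (is "_ \<longleftrightarrow> ?R")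
proof
  assume L: "is_local_ring (stalk X x)"
  show ?R
  proof (intro allI impI conjI ballI)
    fix U assume U: "openin (topol X) U \<and> x \<in> U"
    show "\<one>\<^bsub>sections X U\<^esub> \<noteq> \<zero>\<^bsub>sections X U\<^esub>"
      using L U stalk_one_U[of U] stalk_zero_U[of U] unfolding is_local_ring_iff by auto
    fix s t assume s: "s \<in> carrier (sections X U)" and t: "t \<in> carrier (sections X U)"
      and u: "unit_near X x U (s \<oplus>\<^bsub>sections X U\<^esub> t)"
    interpret U: cring "sections X U" using U cring_sec by blast
    have r: "(U, s) \<in> reps x" "(U, t) \<in> reps x" "(U, s \<oplus>\<^bsub>sections X U\<^esub> t) \<in> reps x"
      using U s t by (auto simp: reps_def)
    have "germ X x U s \<oplus>\<^bsub>stalk X x\<^esub> germ X x U t \<in> Units (stalk X x)"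
      using u germ_Units_iff[OF r(3)] stalk_add[OF r(1,2)] by simp
    moreover have "germ X x U s \<in> carrier (stalk X x)" "germ X x U t \<in> carrier (stalk X x)"
      unfolding stalk_carrier using r by auto
    ultimately show "unit_near X x U s \<or> unit_near X x U t"
      using L germ_Units_iff[OF r(1)] germ_Units_iff[OF r(2)] unfolding is_local_ring_iff by blast
  qed
next
  assume R: ?R
  show "is_local_ring (stalk X x)" unfolding is_local_ring_iff
  proof (intro conjI ballI impI)
    show "cring (stalk X x)" by (rule stalk_cring)
    show "\<one>\<^bsub>stalk X x\<^esub> \<noteq> \<zero>\<^bsub>stalk X x\<^esub>"
    proof
      assume "\<one>\<^bsub>stalk X x\<^esub> = \<zero>\<^bsub>stalk X x\<^esub>"
      then obtain W where W: "openin (topol X) W" "x \<in> W" "W \<subseteq> points X"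
        "restrn X (points X) W \<one>\<^bsub>sections X (points X)\<^esub> = restrn X (points X) W \<zero>\<^bsub>sections X (points X)\<^esub>"
        using germ_eq_iff[of "points X" "\<one>\<^bsub>sections X (points X)\<^esub>" x "points X" "\<zero>\<^bsub>sections X (points X)\<^esub>"] x
          cring_sec[OF openin_points_self, THEN cring.axioms(1)] unfolding stalk_one stalk_zero reps_def by (auto simp: ring.ring_simprules(2,6))
      then show False using R by auto
    qed
    fix c d assume cd: "c \<in> carrier (stalk X x)" "d \<in> carrier (stalk X x)"
      and u: "c \<oplus>\<^bsub>stalk X x\<^esub> d \<in> Units (stalk X x)"
    obtain U s t where U: "(U, s) \<in> reps x" "(U, t) \<in> reps x" "c = germ X x U s" "d = germ X x U t"
      using stalk_pair[OF cd openin_points_self x] by metis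
    have U': "openin (topol X) U" "x \<in> U" "s \<in> carrier (sections X U)" "t \<in> carrier (sections X U)"
      using U by (auto simp: reps_def)
    interpret U: cring "sections X U" by (rule cring_sec[OF U'(1)])
    have r: "(U, s \<oplus>\<^bsub>sections X U\<^esub> t) \<in> reps x" using U' by (auto simp: reps_def)
    then have "unit_near X x U (s \<oplus>\<^bsub>sections X U\<^esub> t)"
      using u germ_Units_iff[OF r] stalk_add[OF U(1,2)] U(3,4) by simp
    then show "c \<in> Units (stalk X x) \<or> d \<in> Units (stalk X x)"
      using R U' germ_Units_iff[OF U(1)] germ_Units_iff[OF U(2)] U(3,4) by blast
  qed
qed

end

end

text \<open>All conditions of \<open>morphism\<close> except the one on stalks. They already make
  the maps of stalks well-defined ring homomorphisms, so that under them the remaining condition can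
  be rewritten.\<close>

definition premorphism ::
  "('a, 'b) ringed_data \<Rightarrow> ('c, 'd) ringed_data \<Rightarrow> ('a, 'b, 'c, 'd) mor_data \<Rightarrow> bool" where
  "premorphism X Y f \<longleftrightarrow>
     continuous_map (topol X) (topol Y) (on_pts f) \<and>
     on_pts f \<in> extensional (points X) \<and>
     on_sec f \<in> extensional {V. openin (topol Y) V} \<and>
     (\<forall>V. openin (topol Y) V \<longrightarrow>
        on_sec f V \<in> ring_hom (sections Y V) (sections X (inv_img X f V)) \<and>
        on_sec f V \<in> extensional (carrier (sections Y V))) \<and>
     (\<forall>V W. openin (topol Y) V \<and> openin (topol Y) W \<and> W \<subseteq> V \<longrightarrow>
        (\<forall>t\<in>carrier (sections Y V).
           on_sec f W (restrn Y V W t) =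
           restrn X (inv_img X f V) (inv_img X f W) (on_sec f V t)))"

lemma inv_img_mono: "W \<subseteq> V \<Longrightarrow> inv_img X f W \<subseteq> inv_img X f V"
  by (auto simp: inv_img_def)

lemma premorphism_open: "premorphism X Y f \<Longrightarrow> openin (topol Y) V \<Longrightarrow> openin (topol X) (inv_img X f V)"
  unfolding premorphism_def inv_img_def points_def by (blast intro: openin_continuous_map_preimage)

lemma premorphism_pts: "premorphism X Y f \<Longrightarrow> x \<in> points X \<Longrightarrow> on_pts f x \<in> points Y"
  unfolding premorphism_def points_def continuous_map_def by blast

text \<open>The map of stalks sends the germ of \<open>t\<close> to the germ of its pullback. With
  \<open>germ_Units_iff\<close> on both sides, reflecting units means that a section whose pullback
  is invertible near \<open>x\<close> is itself invertible near the image of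
  \<open>x\<close>.\<close>

lemma local_stalk_map_iff:
  assumes X: "is_presheaf X" and Y: "is_presheaf Y" and f: "premorphism X Y f" and x: "x \<in> points X"
  shows "is_local_hom (stalk Y (on_pts f x)) (stalk X x) (stalk_map X Y f x) \<longleftrightarrow>
    (\<forall>V t. openin (topol Y) V \<and> on_pts f x \<in> V \<and> t \<in> carrier (sections Y V) \<and>
       unit_near X x (inv_img X f V) (on_sec f V t) \<longrightarrow> unit_near Y (on_pts f x) V t)"
proof -
  interpret X: presheaf X by unfold_locales (rule X)
  interpret Y: presheaf Y by unfold_locales (rule Y)
  let ?y = "on_pts f x" let ?g = "stalk_map X Y f x"
  have y: "?y \<in> points Y" using premorphism_pts[OF f x] .
  have hom: "on_sec f V \<in> ring_hom (sections Y V) (sections X (inv_img X f V))" if "openin (topol Y) V" for V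
    using f that unfolding premorphism_def by blast
  have nat: "on_sec f W (restrn Y V W t) = restrn X (inv_img X f V) (inv_img X f W) (on_sec f V t)"
    if "openin (topol Y) V" "openin (topol Y) W" "W \<subseteq> V" "t \<in> carrier (sections Y V)" for V W t
    using f that unfolding premorphism_def by blast
  have rX: "(inv_img X f V, on_sec f V t) \<in> X.reps x" if "(V, t) \<in> Y.reps ?y" for V t
    using that premorphism_open[OF f] ring_hom_closed[OF hom] x
    unfolding X.reps_def Y.reps_def by (auto simp: inv_img_def)
  \<comment> \<open>Compatibility with restriction makes the union in \<open>stalk_map\<close>
    independent of the representative.\<close>
  have g: "?g (germ Y ?y V t) = germ X x (inv_img X f V) (on_sec f V t)" if r: "(V, t) \<in> Y.reps ?y" for V t
  proof -
    have "germ X x (inv_img X f V') (on_sec f V' t') = germ X x (inv_img X f V) (on_sec f V t)"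
      if m: "(V', t') \<in> germ Y ?y V t" for V' t'
    proof -
      obtain W where W: "openin (topol Y) W" "?y \<in> W" "W \<subseteq> V \<inter> V'" "restrn Y V W t = restrn Y V' W t'"
        using m unfolding germ_def by auto
      have r': "(V', t') \<in> Y.reps ?y" using m unfolding germ_def Y.reps_def by auto
      show ?thesis
      proof (rule X.germ_eqI[OF rX[OF r'] rX[OF r], of "inv_img X f W"])
        show "openin (topol X) (inv_img X f W)" using premorphism_open[OF f W(1)] .
        show "x \<in> inv_img X f W" using W x by (simp add: inv_img_def)
        show "inv_img X f W \<subseteq> inv_img X f V' \<inter> inv_img X f V" using W by (auto simp: inv_img_def)
        show "restrn X (inv_img X f V') (inv_img X f W) (on_sec f V' t') =
              restrn X (inv_img X f V) (inv_img X f W) (on_sec f V t)"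
          using nat[of V' W t'] nat[of V W t] W r r' unfolding Y.reps_def by simp
      qed
    qed
    moreover have "(V, t) \<in> germ Y ?y V t" using r unfolding germ_def Y.reps_def by auto
    ultimately show ?thesis unfolding stalk_map_def by blast
  qed
  have gh: "?g \<in> ring_hom (stalk Y ?y) (stalk X x)"
  proof (rule ring_hom_memI)
    fix c assume "c \<in> carrier (stalk Y ?y)"
    then obtain V t where "(V, t) \<in> Y.reps ?y" "c = germ Y ?y V t"
      unfolding Y.stalk_carrier[OF y] by auto
    then show "?g c \<in> carrier (stalk X x)" using g rX unfolding X.stalk_carrier[OF x] by auto
  next
    fix c d assume "c \<in> carrier (stalk Y ?y)" "d \<in> carrier (stalk Y ?y)"
    from Y.stalk_pair[OF y this openin_points_self y] obtain V s t
      where V: "(V, s) \<in> Y.reps ?y" "(V, t) \<in> Y.reps ?y" "c = germ Y ?y V s" "d = germ Y ?y V t" .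
    have V': "openin (topol Y) V" "?y \<in> V" "s \<in> carrier (sections Y V)" "t \<in> carrier (sections Y V)"
      using V unfolding Y.reps_def by auto
    interpret V: cring "sections Y V" by (rule Y.cring_sec[OF V'(1)])
    have r: "(V, s \<otimes>\<^bsub>sections Y V\<^esub> t) \<in> Y.reps ?y" "(V, s \<oplus>\<^bsub>sections Y V\<^esub> t) \<in> Y.reps ?y"
      using V' unfolding Y.reps_def by auto
    show "?g (c \<otimes>\<^bsub>stalk Y ?y\<^esub> d) = ?g c \<otimes>\<^bsub>stalk X x\<^esub> ?g d"
      unfolding V(3,4) Y.stalk_mult[OF y V(1,2)] g[OF r(1)] g[OF V(1)] g[OF V(2)]
        X.stalk_mult[OF x rX[OF V(1)] rX[OF V(2)]]
      using ring_hom_mult[OF hom[OF V'(1)]] V' by simp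
    show "?g (c \<oplus>\<^bsub>stalk Y ?y\<^esub> d) = ?g c \<oplus>\<^bsub>stalk X x\<^esub> ?g d"
      unfolding V(3,4) Y.stalk_add[OF y V(1,2)] g[OF r(2)] g[OF V(1)] g[OF V(2)]
        X.stalk_add[OF x rX[OF V(1)] rX[OF V(2)]]
      using ring_hom_add[OF hom[OF V'(1)]] V' by simp
  next
    interpret P: cring "sections Y (points Y)" by (rule Y.cring_sec) simp
    have r: "(points Y, \<one>\<^bsub>sections Y (points Y)\<^esub>) \<in> Y.reps ?y" using y unfolding Y.reps_def by auto
    have "inv_img X f (points Y) = points X" using premorphism_pts[OF f] by (auto simp: inv_img_def)
    then show "?g \<one>\<^bsub>stalk Y ?y\<^esub> = \<one>\<^bsub>stalk X x\<^esub>"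
      unfolding Y.stalk_one[OF y] g[OF r] X.stalk_one[OF x]
      using ring_hom_one[OF hom[of "points Y"]] by simp
  qed
  show ?thesis
  proof
    assume L: "is_local_hom (stalk Y ?y) (stalk X x) ?g"
    show "\<forall>V t. openin (topol Y) V \<and> ?y \<in> V \<and> t \<in> carrier (sections Y V) \<and>
       unit_near X x (inv_img X f V) (on_sec f V t) \<longrightarrow> unit_near Y ?y V t"
    proof (intro allI impI, elim conjE)
      fix V t assume V: "openin (topol Y) V" "?y \<in> V" "t \<in> carrier (sections Y V)"
        and u: "unit_near X x (inv_img X f V) (on_sec f V t)"
      then have r: "(V, t) \<in> Y.reps ?y" unfolding Y.reps_def by auto
      then have "?g (germ Y ?y V t) \<in> Units (stalk X x)"
        using u g[OF r] X.germ_Units_iff[OF x rX[OF r]] by simp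
      moreover have "germ Y ?y V t \<in> carrier (stalk Y ?y)" unfolding Y.stalk_carrier[OF y] using r by auto
      ultimately have "germ Y ?y V t \<in> Units (stalk Y ?y)" using L unfolding is_local_hom_def by blast
      then show "unit_near Y ?y V t" using Y.germ_Units_iff[OF y r] by simp
    qed
  next
    assume R: "\<forall>V t. openin (topol Y) V \<and> ?y \<in> V \<and> t \<in> carrier (sections Y V) \<and>
       unit_near X x (inv_img X f V) (on_sec f V t) \<longrightarrow> unit_near Y ?y V t"
    show "is_local_hom (stalk Y ?y) (stalk X x) ?g" unfolding is_local_hom_def
    proof (intro conjI ballI impI)
      show "?g \<in> ring_hom (stalk Y ?y) (stalk X x)" by (rule gh)
      fix c assume "c \<in> carrier (stalk Y ?y)" and u: "?g c \<in> Units (stalk X x)"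
      then obtain V t where r: "(V, t) \<in> Y.reps ?y" "c = germ Y ?y V t"
        unfolding Y.stalk_carrier[OF y] by auto
      then have "unit_near X x (inv_img X f V) (on_sec f V t)"
        using u g[OF r(1)] X.germ_Units_iff[OF x rX[OF r(1)]] by simp
      then have "unit_near Y ?y V t" using R r(1) unfolding Y.reps_def by auto
      then show "c \<in> Units (stalk Y ?y)" using Y.germ_Units_iff[OF y r(1)] r(2) by simp
    qed
  qed
qed

lemma morphism_iff:
  assumes "is_presheaf X" "is_presheaf Y"
  shows "morphism X Y f \<longleftrightarrow> premorphism X Y f \<and>
    (\<forall>x\<in>points X. \<forall>V t. openin (topol Y) V \<and> on_pts f x \<in> V \<and> t \<in> carrier (sections Y V) \<and>
       unit_near X x (inv_img X f V) (on_sec f V t) \<longrightarrow> unit_near Y (on_pts f x) V t)"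
proof -
  have "morphism X Y f \<longleftrightarrow> premorphism X Y f \<and>
    (\<forall>x\<in>points X. is_local_hom (stalk Y (on_pts f x)) (stalk X x) (stalk_map X Y f x))"
    unfolding morphism_def premorphism_def by blast
  then show ?thesis by (auto simp only: local_stalk_map_iff[OF assms])
qed

lemma locally_ringed_iff:
  "locally_ringed X \<longleftrightarrow> is_sheaf X \<and> (\<forall>x\<in>points X. \<forall>U. openin (topol X) U \<and> x \<in> U \<longrightarrow>
     \<one>\<^bsub>sections X U\<^esub> \<noteq> \<zero>\<^bsub>sections X U\<^esub> \<and>
     (\<forall>s\<in>carrier (sections X U). \<forall>t\<in>carrier (sections X U).
        unit_near X x U (s \<oplus>\<^bsub>sections X U\<^esub> t) \<longrightarrow> unit_near X x U s \<or> unit_near X x U t))"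
proof (cases "is_sheaf X")
  case True
  then interpret presheaf X by unfold_locales (simp add: is_sheaf_def)
  show ?thesis unfolding locally_ringed_def by (simp add: True local_stalk_iff)
qed (simp add: locally_ringed_def)

section \<open>Sheaves and open subspaces\<close>

lemma locally_ringed_sheaf: "locally_ringed X \<Longrightarrow> is_sheaf X"
  by (simp add: locally_ringed_def)

lemma sheaf_presheaf: "is_sheaf X \<Longrightarrow> presheaf X"
  by unfold_locales (simp add: is_sheaf_def)

lemma locally_ringed_presheaf: "locally_ringed X \<Longrightarrow> presheaf X"
  by (simp add: locally_ringed_sheaf sheaf_presheaf)

lemma sheaf_eqI:
  assumes X: "is_sheaf X" and U: "openin (topol X) U"
    and s: "s \<in> carrier (sections X U)" and t: "t \<in> carrier (sections X U)"
    and loc: "\<And>x. x \<in> U \<Longrightarrow> \<exists>W. openin (topol X) W \<and> x \<in> W \<and> W \<subseteq> U \<and> restrn X U W s = restrn X U W t"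
  shows "s = t"
proof -
  define C where "C = {W. openin (topol X) W \<and> W \<subseteq> U \<and> restrn X U W s = restrn X U W t}"
  have UC: "\<Union>C = U" unfolding C_def using loc by blast
  have "(\<forall>V\<in>C. openin (topol X) V) \<longrightarrow> (\<forall>s\<in>carrier (sections X (\<Union>C)). \<forall>t\<in>carrier (sections X (\<Union>C)).
           (\<forall>V\<in>C. restrn X (\<Union>C) V s = restrn X (\<Union>C) V t) \<longrightarrow> s = t)"
    using X unfolding is_sheaf_def by simp
  then show ?thesis unfolding UC using s t unfolding C_def by simp
qed

text \<open>The family to be glued is a relation between open sets and sections instead of a chosen
  function. Since the relation is stable under restriction and single-valued, the pieces agree on
  overlaps automatically; applications only have to supply pieces locally.\<close>

lemma sheaf_glue:
  assumes X: "is_sheaf X" and U: "openin (topol X) U"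
    and R: "\<And>W s. R W s \<Longrightarrow> openin (topol X) W \<and> W \<subseteq> U \<and> s \<in> carrier (sections X W)"
    and res: "\<And>W s W'. R W s \<Longrightarrow> openin (topol X) W' \<Longrightarrow> W' \<subseteq> W \<Longrightarrow> R W' (restrn X W W' s)"
    and uniq: "\<And>W s s'. R W s \<Longrightarrow> R W s' \<Longrightarrow> s = s'"
    and ex: "\<And>x. x \<in> U \<Longrightarrow> \<exists>W s. x \<in> W \<and> R W s"
  obtains s where "s \<in> carrier (sections X U)" "\<And>W s'. R W s' \<Longrightarrow> restrn X U W s = s'"
proof -
  define C where "C = {W. \<exists>s. R W s}"
  define \<sigma> where "\<sigma> W = (SOME s. R W s)" for W
  have \<sigma>: "R W (\<sigma> W)" if "W \<in> C" for W
    using that someI_ex[of "R W"] unfolding C_def \<sigma>_def by blast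
  have UC: "\<Union>C = U" unfolding C_def using ex R by blast
  have o: "\<forall>V\<in>C. openin (topol X) V" using \<sigma> R by blast
  have "(\<forall>V\<in>C. \<sigma> V \<in> carrier (sections X V)) \<and>
             (\<forall>V\<in>C. \<forall>W\<in>C. restrn X V (V \<inter> W) (\<sigma> V) = restrn X W (V \<inter> W) (\<sigma> W)) \<longrightarrow>
             (\<exists>s\<in>carrier (sections X (\<Union>C)). \<forall>V\<in>C. restrn X (\<Union>C) V s = \<sigma> V)"
    by (rule X[unfolded is_sheaf_def, THEN conjunct2, THEN spec, THEN mp, OF o, THEN conjunct2, THEN spec])
  moreover have "\<forall>V\<in>C. \<sigma> V \<in> carrier (sections X V)" using \<sigma> R by blast
  moreover have "\<forall>V\<in>C. \<forall>W\<in>C. restrn X V (V \<inter> W) (\<sigma> V) = restrn X W (V \<inter> W) (\<sigma> W)"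
  proof (intro ballI)
    fix V W assume VW: "V \<in> C" "W \<in> C"
    have "openin (topol X) (V \<inter> W)" using o VW by blast
    then show "restrn X V (V \<inter> W) (\<sigma> V) = restrn X W (V \<inter> W) (\<sigma> W)"
      using uniq[OF res[OF \<sigma>[OF VW(1)], of "V \<inter> W"] res[OF \<sigma>[OF VW(2)], of "V \<inter> W"]] by simp
  qed
  ultimately obtain s where s: "s \<in> carrier (sections X U)" "\<forall>V\<in>C. restrn X U V s = \<sigma> V"
    unfolding UC by blast
  show ?thesis
  proof (rule that[OF s(1)])
    fix W s' assume W: "R W s'"
    then have "W \<in> C" unfolding C_def by blast
    then show "restrn X U W s = s'" using s(2) uniq[OF W \<sigma>] by simp
  qed
qed

text \<open>The sheaf condition for the empty cover. It turns an empty inverse image under a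
  schematically dominant morphism into the equation of one and zero.\<close>

lemma sheaf_zero_of_empty:
  assumes X: "is_sheaf X" and st: "s \<in> carrier (sections X {})" "t \<in> carrier (sections X {})"
  shows "s = t"
  by (rule sheaf_eqI[OF X _ st]) auto

lemma open_sub_simps [simp]:
  "sections (open_sub X U) = sections X" "restrn (open_sub X U) = restrn X"
  by (simp_all add: open_sub_def)

lemma openin_open_sub: "openin (topol X) U \<Longrightarrow> openin (topol (open_sub X U)) V \<longleftrightarrow> openin (topol X) V \<and> V \<subseteq> U"
  by (simp add: open_sub_def openin_open_subtopology)

lemma points_open_sub [simp]: "openin (topol X) U \<Longrightarrow> points (open_sub X U) = U"
  by (simp add: open_sub_def points_def inf_absorb2 openin_subset)

lemma open_sub_points [simp]: "open_sub X (points X) = X"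
  by (simp add: open_sub_def points_def subtopology_topspace)

lemma open_sub_open_sub: "U \<subseteq> V \<Longrightarrow> open_sub (open_sub X V) U = open_sub X U"
  by (simp add: open_sub_def subtopology_subtopology inf_absorb2)

lemma unit_near_open_sub: "openin (topol X) U \<Longrightarrow> V \<subseteq> U \<Longrightarrow>
    unit_near (open_sub X U) x V s \<longleftrightarrow> unit_near X x V s"
  unfolding unit_near_def by (auto simp: openin_open_sub)

lemma sheaf_open_sub:
  assumes X: "is_sheaf X" and U: "openin (topol X) U"
  shows "is_sheaf (open_sub X U)"
proof -
  have "is_presheaf (open_sub X U)"
    using X unfolding is_sheaf_def is_presheaf_def by (simp add: openin_open_sub[OF U])
  then show ?thesis
    unfolding is_sheaf_def[of "open_sub X U"] open_sub_simps
  proof (intro conjI[of "is_presheaf _"] allI[where P = "\<lambda>C. (\<forall>V\<in>C. _ V) \<longrightarrow> _ C"] impI)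
    fix C assume "\<forall>V\<in>C. openin (topol (open_sub X U)) V"
    then have "\<forall>V\<in>C. openin (topol X) V" using openin_open_sub[OF U] by blast
    from X[unfolded is_sheaf_def, THEN conjunct2, THEN spec, THEN mp, OF this]
    show "(\<forall>s\<in>carrier (sections X (\<Union>C)). \<forall>t\<in>carrier (sections X (\<Union>C)).
           (\<forall>V\<in>C. restrn X (\<Union>C) V s = restrn X (\<Union>C) V t) \<longrightarrow> s = t) \<and>
        (\<forall>\<sigma>. (\<forall>V\<in>C. \<sigma> V \<in> carrier (sections X V)) \<and>
             (\<forall>V\<in>C. \<forall>W\<in>C. restrn X V (V \<inter> W) (\<sigma> V) = restrn X W (V \<inter> W) (\<sigma> W)) \<longrightarrow>
             (\<exists>s\<in>carrier (sections X (\<Union>C)). \<forall>V\<in>C. restrn X (\<Union>C) V s = \<sigma> V))" .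
  qed
qed

lemma locally_ringed_open_sub:
  assumes X: "locally_ringed X" and U: "openin (topol X) U"
  shows "locally_ringed (open_sub X U)"
proof -
  have "\<one>\<^bsub>sections X V\<^esub> \<noteq> \<zero>\<^bsub>sections X V\<^esub> \<and>
     (\<forall>s\<in>carrier (sections X V). \<forall>t\<in>carrier (sections X V).
        unit_near (open_sub X U) x V (s \<oplus>\<^bsub>sections X V\<^esub> t) \<longrightarrow>
        unit_near (open_sub X U) x V s \<or> unit_near (open_sub X U) x V t)"
    if "x \<in> U" "openin (topol X) V" "V \<subseteq> U" "x \<in> V" for x V
    using X[unfolded locally_ringed_iff, THEN conjunct2, THEN bspec, THEN spec, of x V] that openin_points[OF U]
    by (simp add: unit_near_open_sub[OF U] subset_iff)
  then show ?thesis
    using sheaf_open_sub[OF locally_ringed_sheaf[OF X] U] unfolding locally_ringed_iff[of "open_sub X U"]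
    by (simp add: openin_open_sub[OF U] points_open_sub[OF U])
qed

section \<open>The category of locally ringed spaces\<close>

lemma morphism_premorphism: "morphism X Y f \<Longrightarrow> premorphism X Y f"
  unfolding morphism_def premorphism_def by blast

lemma mor_pts: "morphism X Y f \<Longrightarrow> x \<in> points X \<Longrightarrow> on_pts f x \<in> points Y"
  by (rule premorphism_pts[OF morphism_premorphism])

lemma mor_open: "morphism X Y f \<Longrightarrow> openin (topol Y) V \<Longrightarrow> openin (topol X) (inv_img X f V)"
  by (rule premorphism_open[OF morphism_premorphism])

lemma mor_hom: "morphism X Y f \<Longrightarrow> openin (topol Y) V \<Longrightarrow>
    on_sec f V \<in> ring_hom (sections Y V) (sections X (inv_img X f V))"
  unfolding morphism_def by (elim conjE) simp

lemma mor_sec: "morphism X Y f \<Longrightarrow> openin (topol Y) V \<Longrightarrow> t \<in> carrier (sections Y V) \<Longrightarrow>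
    on_sec f V t \<in> carrier (sections X (inv_img X f V))"
  by (rule ring_hom_closed[OF mor_hom])

lemma mor_nat: "morphism X Y f \<Longrightarrow> openin (topol Y) V \<Longrightarrow> openin (topol Y) W \<Longrightarrow> W \<subseteq> V \<Longrightarrow>
    t \<in> carrier (sections Y V) \<Longrightarrow>
    on_sec f W (restrn Y V W t) = restrn X (inv_img X f V) (inv_img X f W) (on_sec f V t)"
  unfolding morphism_def by (elim conjE) simp

text \<open>One direction is locality, the other holds because a ring homomorphism preserves units.
  Together they move invertibility near a point in both directions along a morphism.\<close>

lemma mor_unit_near:
  assumes X: "locally_ringed X" and Y: "locally_ringed Y" and f: "morphism X Y f"
    and x: "x \<in> points X" and V: "openin (topol Y) V" "on_pts f x \<in> V" "t \<in> carrier (sections Y V)"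
  shows "unit_near X x (inv_img X f V) (on_sec f V t) \<longleftrightarrow> unit_near Y (on_pts f x) V t"
proof
  interpret X: presheaf X by (rule locally_ringed_presheaf[OF X])
  interpret Y: presheaf Y by (rule locally_ringed_presheaf[OF Y])
  show "unit_near X x (inv_img X f V) (on_sec f V t) \<Longrightarrow> unit_near Y (on_pts f x) V t"
    using f[unfolded morphism_iff[OF X.presheaf Y.presheaf]] x V by blast
  assume "unit_near Y (on_pts f x) V t"
  then obtain W where W: "openin (topol Y) W" "on_pts f x \<in> W" "W \<subseteq> V"
    "restrn Y V W t \<in> Units (sections Y W)" unfolding unit_near_def by blast
  have "on_sec f W (restrn Y V W t) \<in> Units (sections X (inv_img X f W))"
    using ring_hom_Units[OF mor_hom[OF f W(1)] Y.cring_sec[OF W(1)] X.cring_sec[OF mor_open[OF f W(1)]] W(4)] .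
  then show "unit_near X x (inv_img X f V) (on_sec f V t)" unfolding unit_near_def
    using mor_nat[OF f V(1) W(1,3) V(3)] mor_open[OF f W(1)] W x
    by (intro exI[of _ "inv_img X f W"]) (auto simp: inv_img_def)
qed

lemma morphismI:
  assumes X: "locally_ringed X" and Y: "locally_ringed Y"
    and "on_pts f \<in> extensional (points X)" "on_sec f \<in> extensional {V. openin (topol Y) V}"
    and "\<And>V. openin (topol Y) V \<Longrightarrow> on_sec f V \<in> extensional (carrier (sections Y V))"
    and "\<And>x. x \<in> points X \<Longrightarrow> on_pts f x \<in> points Y"
    and "\<And>V. openin (topol Y) V \<Longrightarrow> openin (topol X) (inv_img X f V)"
    and "\<And>V. openin (topol Y) V \<Longrightarrow> on_sec f V \<in> ring_hom (sections Y V) (sections X (inv_img X f V))"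
    and "\<And>V W t. openin (topol Y) V \<Longrightarrow> openin (topol Y) W \<Longrightarrow> W \<subseteq> V \<Longrightarrow> t \<in> carrier (sections Y V) \<Longrightarrow>
      on_sec f W (restrn Y V W t) = restrn X (inv_img X f V) (inv_img X f W) (on_sec f V t)"
    and "\<And>x V t. x \<in> points X \<Longrightarrow> openin (topol Y) V \<Longrightarrow> on_pts f x \<in> V \<Longrightarrow> t \<in> carrier (sections Y V) \<Longrightarrow>
      unit_near X x (inv_img X f V) (on_sec f V t) \<Longrightarrow> unit_near Y (on_pts f x) V t"
  shows "morphism X Y f"
proof -
  interpret X: presheaf X by (rule locally_ringed_presheaf[OF X])
  interpret Y: presheaf Y by (rule locally_ringed_presheaf[OF Y])
  have "continuous_map (topol X) (topol Y) (on_pts f)"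
    unfolding continuous_map_def using assms(6,7) by (auto simp: points_def inv_img_def)
  then show ?thesis unfolding morphism_iff[OF X.presheaf Y.presheaf] premorphism_def
    using assms(3-) by simp
qed

lemma mor_eqI:
  assumes f: "morphism X Y f" and g: "morphism X Y g"
    and pts: "\<And>x. x \<in> points X \<Longrightarrow> on_pts f x = on_pts g x"
    and sec: "\<And>V t. openin (topol Y) V \<Longrightarrow> t \<in> carrier (sections Y V) \<Longrightarrow> on_sec f V t = on_sec g V t"
  shows "f = g"
proof (rule mor_data.equality)
  note f' = morphism_premorphism[OF f, unfolded premorphism_def]
  note g' = morphism_premorphism[OF g, unfolded premorphism_def]
  show "on_pts f = on_pts g"
    by (rule extensionalityI[of _ "points X"]) (use f' g' pts in auto)
  show "on_sec f = on_sec g"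
  proof (rule extensionalityI[of _ "{V. openin (topol Y) V}"])
    fix V assume V: "V \<in> {V. openin (topol Y) V}"
    show "on_sec f V = on_sec g V"
      by (rule extensionalityI[of _ "carrier (sections Y V)"]) (use f' g' V sec in auto)
  qed (use f' g' in auto)
qed simp

lemma pts_comp [simp]: "x \<in> points X \<Longrightarrow> on_pts (mor_comp X Y Z g f) x = on_pts g (on_pts f x)"
  by (simp add: mor_comp_def)

lemma sec_comp [simp]: "openin (topol Z) W \<Longrightarrow> s \<in> carrier (sections Z W) \<Longrightarrow>
    on_sec (mor_comp X Y Z g f) W s = on_sec f (inv_img Y g W) (on_sec g W s)"
  by (simp add: mor_comp_def)

lemma inv_comp: "morphism X Y f \<Longrightarrow> inv_img X (mor_comp X Y Z g f) W = inv_img X f (inv_img Y g W)"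
  by (auto simp: inv_img_def mor_pts)

lemma mor_comp_morphism:
  assumes X: "locally_ringed X" and Y: "locally_ringed Y" and Z: "locally_ringed Z"
    and f: "morphism X Y f" and g: "morphism Y Z g"
  shows "morphism X Z (mor_comp X Y Z g f)"
proof (rule morphismI[OF X Z])
  show "on_pts (mor_comp X Y Z g f) \<in> extensional (points X)"
    "on_sec (mor_comp X Y Z g f) \<in> extensional {V. openin (topol Z) V}"
    "\<And>V. openin (topol Z) V \<Longrightarrow> on_sec (mor_comp X Y Z g f) V \<in> extensional (carrier (sections Z V))"
    by (simp_all add: mor_comp_def)
  show "on_pts (mor_comp X Y Z g f) x \<in> points Z" if "x \<in> points X" for x
    using that mor_pts[OF g mor_pts[OF f that]] by simp
  fix V assume V: "openin (topol Z) V"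
  note gV = mor_open[OF g V]
  show "openin (topol X) (inv_img X (mor_comp X Y Z g f) V)"
    unfolding inv_comp[OF f] by (rule mor_open[OF f gV])
  show "on_sec (mor_comp X Y Z g f) V \<in> ring_hom (sections Z V) (sections X (inv_img X (mor_comp X Y Z g f) V))"
    unfolding inv_comp[OF f]
    using ring_hom_closed[OF mor_hom[OF g V]] ring_hom_closed[OF mor_hom[OF f gV]]
      ring_hom_mult[OF mor_hom[OF g V]] ring_hom_mult[OF mor_hom[OF f gV]]
      ring_hom_add[OF mor_hom[OF g V]] ring_hom_add[OF mor_hom[OF f gV]]
      ring_hom_one[OF mor_hom[OF g V]] ring_hom_one[OF mor_hom[OF f gV]]
      presheaf.cring_sec[OF locally_ringed_presheaf[OF Z] V, THEN cring.axioms(1)] V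
    by (intro ring_hom_memI) (simp_all add: ring.ring_simprules)
  show "on_sec (mor_comp X Y Z g f) W (restrn Z V W t) =
      restrn X (inv_img X (mor_comp X Y Z g f) V) (inv_img X (mor_comp X Y Z g f) W) (on_sec (mor_comp X Y Z g f) V t)"
    if W: "openin (topol Z) W" "W \<subseteq> V" and t: "t \<in> carrier (sections Z V)" for W t
  proof -
    have "restrn Z V W t \<in> carrier (sections Z W)"
      by (rule presheaf.res_closed[OF locally_ringed_presheaf[OF Z] V W t])
    then show ?thesis unfolding inv_comp[OF f] using V W t mor_nat[OF g V W t]
        mor_nat[OF f gV mor_open[OF g W(1)] inv_img_mono[OF W(2)] mor_sec[OF g V t]] by simp
  qed
  fix x t assume x: "x \<in> points X" and fx: "on_pts (mor_comp X Y Z g f) x \<in> V" and t: "t \<in> carrier (sections Z V)"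
    and u: "unit_near X x (inv_img X (mor_comp X Y Z g f) V) (on_sec (mor_comp X Y Z g f) V t)"
  have fx': "on_pts f x \<in> inv_img Y g V" using fx x mor_pts[OF f x] by (simp add: inv_img_def)
  have "unit_near Y (on_pts f x) (inv_img Y g V) (on_sec g V t)"
    using u mor_unit_near[OF X Y f x gV fx' mor_sec[OF g V t]] V t unfolding inv_comp[OF f] by simp
  then show "unit_near Z (on_pts (mor_comp X Y Z g f) x) V t"
    using mor_unit_near[OF Y Z g mor_pts[OF f x] V _ t] fx x by simp
qed

lemma mor_comp_assoc:
  assumes "locally_ringed X" "locally_ringed Y" "locally_ringed Z" "locally_ringed W"
    and f: "morphism X Y f" and g: "morphism Y Z g" and h: "morphism Z W h"
  shows "mor_comp X Y W (mor_comp Y Z W h g) f = mor_comp X Z W h (mor_comp X Y Z g f)"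
proof (rule mor_eqI[of X W])
  show "morphism X W (mor_comp X Y W (mor_comp Y Z W h g) f)"
    using assms by (intro mor_comp_morphism)
  show "morphism X W (mor_comp X Z W h (mor_comp X Y Z g f))"
    using assms by (intro mor_comp_morphism)
  show "on_pts (mor_comp X Y W (mor_comp Y Z W h g) f) x = on_pts (mor_comp X Z W h (mor_comp X Y Z g f)) x"
    if "x \<in> points X" for x using that mor_pts[OF f that] by simp
  show "on_sec (mor_comp X Y W (mor_comp Y Z W h g) f) V t = on_sec (mor_comp X Z W h (mor_comp X Y Z g f)) V t"
    if "openin (topol W) V" "t \<in> carrier (sections W V)" for V t
    using that mor_open[OF h that(1)] mor_sec[OF h that] by (simp add: inv_comp[OF g])
qed

lemma pts_id [simp]: "x \<in> points X \<Longrightarrow> on_pts (mor_id X) x = x"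
  by (simp add: mor_id_def)

lemma sec_id [simp]: "openin (topol X) V \<Longrightarrow> t \<in> carrier (sections X V) \<Longrightarrow> on_sec (mor_id X) V t = t"
  by (simp add: mor_id_def)

lemma inv_id: "openin (topol X) V \<Longrightarrow> inv_img X (mor_id X) V = V"
  using openin_points[of X V] by (auto simp: inv_img_def)

lemma mor_id_morphism:
  assumes X: "locally_ringed X" shows "morphism X X (mor_id X)"
proof (rule morphismI[OF X X])
  interpret X: presheaf X by (rule locally_ringed_presheaf[OF X])
  fix V assume V: "openin (topol X) V"
  interpret ring "sections X V" using X.cring_sec[OF V] by (rule cring.axioms(1))
  show "on_sec (mor_id X) V \<in> ring_hom (sections X V) (sections X (inv_img X (mor_id X) V))"
    unfolding inv_id[OF V] using V by (intro ring_hom_memI) simp_all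
qed (auto simp: mor_id_def inv_id[unfolded mor_id_def] presheaf.res_closed[OF locally_ringed_presheaf[OF X]])

lemma mor_comp_id_right:
  assumes X: "locally_ringed X" and Y: "locally_ringed Y" and f: "morphism X Y f"
  shows "mor_comp X X Y f (mor_id X) = f"
  by (rule mor_eqI[OF mor_comp_morphism[OF X X Y mor_id_morphism[OF X] f] f])
    (simp_all add: mor_sec[OF f] mor_open[OF f])

lemma mor_comp_id_left:
  assumes X: "locally_ringed X" and Y: "locally_ringed Y" and f: "morphism X Y f"
  shows "mor_comp X Y Y (mor_id Y) f = f"
  by (rule mor_eqI[OF mor_comp_morphism[OF X Y Y f mor_id_morphism[OF Y]] f])
    (simp_all add: inv_id mor_pts[OF f])

section \<open>Restrictions of morphisms and inclusions of open subspaces\<close>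

lemma pts_restrict [simp]: "openin (topol X) U \<Longrightarrow> x \<in> U \<Longrightarrow> on_pts (mor_restrict X Y f U V) x = on_pts f x"
  by (simp add: mor_restrict_def)

lemma sec_restrict: "openin (topol Y) V \<Longrightarrow> openin (topol Y) W \<Longrightarrow> W \<subseteq> V \<Longrightarrow> t \<in> carrier (sections Y W) \<Longrightarrow>
    on_sec (mor_restrict X Y f U V) W t = restrn X (inv_img X f W) (U \<inter> inv_img X f W) (on_sec f W t)"
  by (simp add: mor_restrict_def openin_open_sub)

lemma inv_restrict: "openin (topol X) U \<Longrightarrow> inv_img (open_sub X U) (mor_restrict X Y f U V) W = U \<inter> inv_img X f W"
  using openin_points[of X U] by (auto simp: inv_img_def)

lemma mor_restrict_morphism:
  assumes X: "locally_ringed X" and Y: "locally_ringed Y" and f: "morphism X Y f"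
    and U: "openin (topol X) U" and V: "openin (topol Y) V" and UV: "\<And>x. x \<in> U \<Longrightarrow> on_pts f x \<in> V"
  shows "morphism (open_sub X U) (open_sub Y V) (mor_restrict X Y f U V)"
proof (rule morphismI[OF locally_ringed_open_sub[OF X U] locally_ringed_open_sub[OF Y V]])
  interpret X: presheaf X by (rule locally_ringed_presheaf[OF X])
  interpret Y: presheaf Y by (rule locally_ringed_presheaf[OF Y])
  let ?f = "mor_restrict X Y f U V"
  show "on_pts ?f \<in> extensional (points (open_sub X U))" "on_sec ?f \<in> extensional {W. openin (topol (open_sub Y V)) W}"
    "\<And>W. openin (topol (open_sub Y V)) W \<Longrightarrow> on_sec ?f W \<in> extensional (carrier (sections (open_sub Y V) W))"
    by (simp_all add: mor_restrict_def)
  show "on_pts ?f x \<in> points (open_sub Y V)" if "x \<in> points (open_sub X U)" for x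
    using that UV U V by simp
  fix W assume W0: "openin (topol (open_sub Y V)) W"
  then have W: "openin (topol Y) W" "W \<subseteq> V" using openin_open_sub[OF V] by auto
  have O: "openin (topol X) (inv_img X f W)" by (rule mor_open[OF f W(1)])
  have OU: "openin (topol X) (U \<inter> inv_img X f W)" using U O by blast
  show "openin (topol (open_sub X U)) (inv_img (open_sub X U) ?f W)"
    unfolding inv_restrict[OF U] openin_open_sub[OF U] using OU by simp
  show "on_sec ?f W \<in> ring_hom (sections (open_sub Y V) W) (sections (open_sub X U) (inv_img (open_sub X U) ?f W))"
    unfolding inv_restrict[OF U] open_sub_simps
    using ring_hom_closed[OF mor_hom[OF f W(1)]] ring_hom_mult[OF mor_hom[OF f W(1)]]
      ring_hom_add[OF mor_hom[OF f W(1)]] ring_hom_one[OF mor_hom[OF f W(1)]] O OU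
      Y.cring_sec[OF W(1), THEN cring.axioms(1)]
    by (intro ring_hom_memI) (simp_all add: ring.ring_simprules sec_restrict[OF V W])
  show "on_sec ?f W' (restrn (open_sub Y V) W W' t) =
      restrn (open_sub X U) (inv_img (open_sub X U) ?f W) (inv_img (open_sub X U) ?f W') (on_sec ?f W t)"
    if W': "openin (topol (open_sub Y V)) W'" "W' \<subseteq> W" and t: "t \<in> carrier (sections (open_sub Y V) W)" for W' t
  proof -
    have W'': "openin (topol Y) W'" "W' \<subseteq> V" using W' openin_open_sub[OF V] by auto
    have O': "openin (topol X) (inv_img X f W')" by (rule mor_open[OF f W''(1)])
    have OU': "openin (topol X) (U \<inter> inv_img X f W')" using U O' by blast
    have S: "inv_img X f W' \<subseteq> inv_img X f W" by (rule inv_img_mono[OF W'(2)])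
    then have S': "U \<inter> inv_img X f W' \<subseteq> U \<inter> inv_img X f W" "U \<inter> inv_img X f W' \<subseteq> inv_img X f W" by auto
    show ?thesis unfolding inv_restrict[OF U] open_sub_simps
      using t W W'' W'(2) mor_nat[OF f W(1) W''(1) W'(2)] mor_sec[OF f W(1)] O O' OU OU' S S'
      by (simp add: sec_restrict[OF V])
  qed
  fix x t assume x: "x \<in> points (open_sub X U)" and fx: "on_pts ?f x \<in> W" and t: "t \<in> carrier (sections (open_sub Y V) W)"
    and u: "unit_near (open_sub X U) x (inv_img (open_sub X U) ?f W) (on_sec ?f W t)"
  have xU: "x \<in> U" "x \<in> points X" using x U openin_points by auto
  have fx': "on_pts f x \<in> W" using fx xU U by simp
  have "unit_near X x (U \<inter> inv_img X f W) (restrn X (inv_img X f W) (U \<inter> inv_img X f W) (on_sec f W t))"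
    using u t W V unfolding inv_restrict[OF U] by (simp add: unit_near_open_sub[OF U] sec_restrict)
  then have "unit_near X x (inv_img X f W) (on_sec f W t)"
    using X.unit_near_res[OF O OU _ _] mor_sec[OF f W(1)] t xU fx' by (simp add: inv_img_def)
  then have "unit_near Y (on_pts f x) W t" using mor_unit_near[OF X Y f xU(2) W(1) fx'] t by simp
  then show "unit_near (open_sub Y V) (on_pts ?f x) W t" using unit_near_open_sub[OF V W(2)] xU U by simp
qed

lemma pts_incl [simp]: "openin (topol X) U \<Longrightarrow> x \<in> U \<Longrightarrow> on_pts (open_incl X U) x = x"
  using openin_points[of X U] by (auto simp: open_incl_def)

lemma sec_incl: "openin (topol X) W \<Longrightarrow> t \<in> carrier (sections X W) \<Longrightarrow>
    on_sec (open_incl X U) W t = restrn X W (U \<inter> W) t"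
  using openin_points[of X W] by (simp add: open_incl_def sec_restrict inv_id)

lemma inv_incl: "openin (topol X) U \<Longrightarrow> inv_img (open_sub X U) (open_incl X U) W = U \<inter> W"
  by (auto simp: inv_img_def)

lemma open_incl_morphism:
  assumes X: "locally_ringed X" and U: "openin (topol X) U"
  shows "morphism (open_sub X U) X (open_incl X U)"
proof -
  have "on_pts (mor_id X) x \<in> points X" if "x \<in> U" for x using that openin_points[OF U] by auto
  from mor_restrict_morphism[OF X X mor_id_morphism[OF X] U openin_points_self this]
  show ?thesis by (simp add: open_incl_def)
qed

lemma open_incl_points: assumes X: "locally_ringed X" shows "open_incl X (points X) = mor_id X"
proof (rule mor_eqI[of X X])
  show "morphism X X (open_incl X (points X))" using open_incl_morphism[OF X openin_points_self] by simp
  show "morphism X X (mor_id X)" by (rule mor_id_morphism[OF X])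
  show "on_sec (open_incl X (points X)) V t = on_sec (mor_id X) V t"
    if "openin (topol X) V" "t \<in> carrier (sections X V)" for V t
    using that openin_points[OF that(1)] presheaf.res_id[OF locally_ringed_presheaf[OF X] that]
    by (simp add: sec_incl inf_absorb2)
qed simp

text \<open>This square characterizes the restriction, because the inclusion of an open subspace is
  a monomorphism (\<open>open_incl_mono\<close>). Most later identities between restricted morphisms
  are derived from these two facts together with associativity.\<close>

lemma incl_comp_restrict:
  assumes X: "locally_ringed X" and Y: "locally_ringed Y" and f: "morphism X Y f"
    and U: "openin (topol X) U" and V: "openin (topol Y) V" and UV: "\<And>x. x \<in> U \<Longrightarrow> on_pts f x \<in> V"
  shows "mor_comp (open_sub X U) (open_sub Y V) Y (open_incl Y V) (mor_restrict X Y f U V) =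
     mor_comp (open_sub X U) X Y f (open_incl X U)"
proof (rule mor_eqI[of "open_sub X U" Y])
  note XU = locally_ringed_open_sub[OF X U] note YV = locally_ringed_open_sub[OF Y V]
  interpret X: presheaf X by (rule locally_ringed_presheaf[OF X])
  interpret Y: presheaf Y by (rule locally_ringed_presheaf[OF Y])
  note r = mor_restrict_morphism[OF X Y f U V UV]
  show "morphism (open_sub X U) Y (mor_comp (open_sub X U) (open_sub Y V) Y (open_incl Y V) (mor_restrict X Y f U V))"
    by (rule mor_comp_morphism[OF XU YV Y r open_incl_morphism[OF Y V]])
  show "morphism (open_sub X U) Y (mor_comp (open_sub X U) X Y f (open_incl X U))"
    by (rule mor_comp_morphism[OF XU X Y open_incl_morphism[OF X U] f])
  show "on_pts (mor_comp (open_sub X U) (open_sub Y V) Y (open_incl Y V) (mor_restrict X Y f U V)) x =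
     on_pts (mor_comp (open_sub X U) X Y f (open_incl X U)) x" if "x \<in> points (open_sub X U)" for x
    using that U V UV by simp
  fix W t assume W: "openin (topol Y) W" and t: "t \<in> carrier (sections Y W)"
  have O: "openin (topol Y) (V \<inter> W)" "openin (topol X) (inv_img X f W)" "openin (topol X) (inv_img X f (V \<inter> W))"
    "openin (topol X) (U \<inter> inv_img X f W)"
    using U V W mor_open[OF f] by blast+
  have e: "U \<inter> inv_img X f (V \<inter> W) = U \<inter> inv_img X f W" using UV by (auto simp: inv_img_def)
  have S: "inv_img X f (V \<inter> W) \<subseteq> inv_img X f W" "U \<inter> inv_img X f W \<subseteq> inv_img X f (V \<inter> W)"
    using e by (auto simp: inv_img_def)
  have "restrn X (inv_img X f (V \<inter> W)) (U \<inter> inv_img X f (V \<inter> W)) (on_sec f (V \<inter> W) (restrn Y W (V \<inter> W) t))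
      = restrn X (inv_img X f W) (U \<inter> inv_img X f W) (on_sec f W t)"
    using W O S t mor_nat[OF f W O(1) _ t] mor_sec[OF f W t] unfolding e by simp
  then show "on_sec (mor_comp (open_sub X U) (open_sub Y V) Y (open_incl Y V) (mor_restrict X Y f U V)) W t =
     on_sec (mor_comp (open_sub X U) X Y f (open_incl X U)) W t"
    using W t U V O mor_sec[OF f W t] by (simp add: inv_incl sec_incl sec_restrict)
qed

lemma open_incl_mono:
  assumes X: "locally_ringed X" and U: "openin (topol X) U"
    and a: "morphism Z (open_sub X U) a" and b: "morphism Z (open_sub X U) b"
    and eq: "mor_comp Z (open_sub X U) X (open_incl X U) a = mor_comp Z (open_sub X U) X (open_incl X U) b"
  shows "a = b"
proof (rule mor_eqI[OF a b])
  interpret X: presheaf X by (rule locally_ringed_presheaf[OF X])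
  fix x assume x: "x \<in> points Z"
  have "on_pts a x \<in> U" "on_pts b x \<in> U" using mor_pts[OF a x] mor_pts[OF b x] U by auto
  then show "on_pts a x = on_pts b x"
    using arg_cong[OF eq, of "\<lambda>m. on_pts m x"] x U by simp
next
  interpret X: presheaf X by (rule locally_ringed_presheaf[OF X])
  fix V t assume "openin (topol (open_sub X U)) V" and t: "t \<in> carrier (sections (open_sub X U) V)"
  then have V: "openin (topol X) V" "V \<subseteq> U" using openin_open_sub[OF U] by auto
  then have e: "U \<inter> V = V" by auto
  show "on_sec a V t = on_sec b V t"
    using arg_cong[OF eq, of "\<lambda>m. on_sec m V t"] V t U by (simp add: inv_incl sec_incl e)
qed

lemma corestrict:
  assumes X: "locally_ringed X" and Y: "locally_ringed Y" and f: "morphism X Y f"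
    and V: "openin (topol Y) V" and fV: "\<forall>x\<in>points X. on_pts f x \<in> V"
  shows "morphism X (open_sub Y V) (mor_restrict X Y f (points X) V)"
    and "mor_comp X (open_sub Y V) Y (open_incl Y V) (mor_restrict X Y f (points X) V) = f"
  using mor_restrict_morphism[OF X Y f openin_points_self V]
    incl_comp_restrict[OF X Y f openin_points_self V] fV
  by (simp_all add: open_incl_points[OF X] mor_comp_id_right[OF X Y f])

lemma restrict_eq_comp_incl:
  assumes X: "locally_ringed X" and Y: "locally_ringed Y" and f: "morphism X Y f" and U: "openin (topol X) U"
  shows "mor_restrict X Y f U (points Y) = mor_comp (open_sub X U) X Y f (open_incl X U)"
proof -
  have m: "morphism (open_sub X U) Y (mor_restrict X Y f U (points Y))"
    using mor_restrict_morphism[OF X Y f U openin_points_self] mor_pts[OF f] openin_points[OF U]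
    by auto
  show ?thesis
    using incl_comp_restrict[OF X Y f U openin_points_self] mor_pts[OF f] openin_points[OF U]
      mor_comp_id_left[OF locally_ringed_open_sub[OF X U] Y m]
    by (auto simp: open_incl_points[OF Y])
qed

lemma restrict_whole:
  assumes X: "locally_ringed X" and Y: "locally_ringed Y" and f: "morphism X Y f"
  shows "mor_restrict X Y f (points X) (points Y) = f"
  using restrict_eq_comp_incl[OF X Y f openin_points_self]
  by (simp add: open_incl_points[OF X] mor_comp_id_right[OF X Y f])

lemma restrict_restrict:
  assumes X: "locally_ringed X" and Y: "locally_ringed Y" and f: "morphism X Y f"
    and U: "openin (topol X) U" and V: "openin (topol Y) V" and UV: "\<And>x. x \<in> U \<Longrightarrow> on_pts f x \<in> V"
    and U': "openin (topol X) U'" "U' \<subseteq> U" and V': "openin (topol Y) V'" "V' \<subseteq> V" and UV': "\<And>x. x \<in> U' \<Longrightarrow> on_pts f x \<in> V'"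
  shows "mor_restrict (open_sub X U) (open_sub Y V) (mor_restrict X Y f U V) U' V' = mor_restrict X Y f U' V'"
proof (rule mor_eqI[of "open_sub X U'" "open_sub Y V'"])
  interpret X: presheaf X by (rule locally_ringed_presheaf[OF X])
  note oU = openin_open_sub[OF U] openin_open_sub[OF V]
  show "morphism (open_sub X U') (open_sub Y V') (mor_restrict X Y f U' V')"
    by (rule mor_restrict_morphism[OF X Y f U'(1) V'(1) UV'])
  have "on_pts (mor_restrict X Y f U V) x \<in> V'" if "x \<in> U'" for x
    using that UV' U U' by (metis pts_restrict subsetD)
  then show "morphism (open_sub X U') (open_sub Y V') (mor_restrict (open_sub X U) (open_sub Y V) (mor_restrict X Y f U V) U' V')"
    using mor_restrict_morphism[OF locally_ringed_open_sub[OF X U] locally_ringed_open_sub[OF Y V]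
      mor_restrict_morphism[OF X Y f U V UV], of U' V'] U' V' oU by (simp add: open_sub_open_sub)
  show "on_pts (mor_restrict (open_sub X U) (open_sub Y V) (mor_restrict X Y f U V) U' V') x = on_pts (mor_restrict X Y f U' V') x"
    if "x \<in> points (open_sub X U')" for x using that U U' oU by auto
  fix W t assume W0: "openin (topol (open_sub Y V')) W" and t: "t \<in> carrier (sections (open_sub Y V') W)"
  then have W: "openin (topol Y) W" "W \<subseteq> V'" "W \<subseteq> V" using V' openin_open_sub[OF V'(1)] by auto
  have O: "openin (topol X) (inv_img X f W)" "openin (topol X) (U \<inter> inv_img X f W)" "openin (topol X) (U' \<inter> inv_img X f W)"
    using mor_open[OF f W(1)] U U' by blast+
  have e: "U' \<inter> (U \<inter> inv_img X f W) = U' \<inter> inv_img X f W" using U' by auto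
  have S: "U' \<inter> inv_img X f W \<subseteq> U \<inter> inv_img X f W" using U' by auto
  show "on_sec (mor_restrict (open_sub X U) (open_sub Y V) (mor_restrict X Y f U V) U' V') W t = on_sec (mor_restrict X Y f U' V') W t"
    using t W V V' U U' O S mor_sec[OF f W(1)] e
    by (simp add: sec_restrict oU inv_restrict)
qed

lemma mor_eq_locally:
  assumes X: "locally_ringed X" and Y: "locally_ringed Y" and f: "morphism X Y f" and g: "morphism X Y g"
    and loc: "\<And>x. x \<in> points X \<Longrightarrow> \<exists>N. openin (topol X) N \<and> x \<in> N \<and>
      mor_comp (open_sub X N) X Y f (open_incl X N) = mor_comp (open_sub X N) X Y g (open_incl X N)"
  shows "f = g"
proof (rule mor_eqI[OF f g])
  interpret X: presheaf X by (rule locally_ringed_presheaf[OF X])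
  have P: "on_pts f x = on_pts g x" if x: "x \<in> points X" for x
  proof -
    obtain N where N: "openin (topol X) N" "x \<in> N"
      "mor_comp (open_sub X N) X Y f (open_incl X N) = mor_comp (open_sub X N) X Y g (open_incl X N)"
      using loc[OF x] by blast
    show ?thesis using arg_cong[OF N(3), of "\<lambda>m. on_pts m x"] N(1,2) by simp
  qed
  then show "on_pts f x = on_pts g x" if x: "x \<in> points X" for x using that by blast
  fix V t assume V: "openin (topol Y) V" and t: "t \<in> carrier (sections Y V)"
  have e: "inv_img X f V = inv_img X g V" using P by (auto simp: inv_img_def)
  note O = mor_open[OF f V]
  show "on_sec f V t = on_sec g V t"
  proof (rule sheaf_eqI[OF locally_ringed_sheaf[OF X] O mor_sec[OF f V t]])
    show "on_sec g V t \<in> carrier (sections X (inv_img X f V))" using mor_sec[OF g V t] e by simp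
    fix x assume x: "x \<in> inv_img X f V"
    then obtain N where N: "openin (topol X) N" "x \<in> N"
      "mor_comp (open_sub X N) X Y f (open_incl X N) = mor_comp (open_sub X N) X Y g (open_incl X N)"
      using loc[of x] by (auto simp: inv_img_def)
    have "restrn X (inv_img X f V) (N \<inter> inv_img X f V) (on_sec f V t) = restrn X (inv_img X f V) (N \<inter> inv_img X f V) (on_sec g V t)"
      using arg_cong[OF N(3), of "\<lambda>m. on_sec m V t"] V t mor_sec[OF f V t] mor_sec[OF g V t] mor_open[OF f V] mor_open[OF g V]
      by (simp add: sec_incl e)
    then show "\<exists>W. openin (topol X) W \<and> x \<in> W \<and> W \<subseteq> inv_img X f V \<and>
       restrn X (inv_img X f V) W (on_sec f V t) = restrn X (inv_img X f V) W (on_sec g V t)"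
      using N x O by (intro exI[of _ "N \<inter> inv_img X f V"]) auto
  qed
qed

subsection \<open>Isomorphisms\<close>

lemma isomorphism_morphism: "isomorphism X Y f \<Longrightarrow> morphism X Y f"
  by (simp add: isomorphism_def)

lemma isomorphism_inverse:
  assumes "isomorphism X Y f"
  obtains g where "isomorphism Y X g" "mor_comp X Y X g f = mor_id X" "mor_comp Y X Y f g = mor_id Y"
  using assms unfolding isomorphism_def by blast

lemma isomorphism_pts:
  assumes "isomorphism X Y f" shows "bij_betw (on_pts f) (points X) (points Y)"
proof -
  obtain g where g: "morphism X Y f" "morphism Y X g" "mor_comp X Y X g f = mor_id X" "mor_comp Y X Y f g = mor_id Y"
    using assms unfolding isomorphism_def by blast
  have "on_pts g (on_pts f x) = x" if "x \<in> points X" for x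
    using arg_cong[OF g(3), of "\<lambda>m. on_pts m x"] that by simp
  moreover have "on_pts f (on_pts g x) = x" if "x \<in> points Y" for x
    using arg_cong[OF g(4), of "\<lambda>m. on_pts m x"] that by simp
  ultimately show ?thesis
    using mor_pts[OF g(1)] mor_pts[OF g(2)] by (intro bij_betw_byWitness[of _ "on_pts g"]) auto
qed

lemma isomorphism_open:
  assumes "isomorphism X Y f" "openin (topol X) U" shows "openin (topol Y) (on_pts f ` U)"
proof -
  obtain g where g: "morphism X Y f" "morphism Y X g" "mor_comp X Y X g f = mor_id X" "mor_comp Y X Y f g = mor_id Y"
    using assms unfolding isomorphism_def by blast
  have 1: "on_pts g (on_pts f x) = x" if "x \<in> points X" for x
    using arg_cong[OF g(3), of "\<lambda>m. on_pts m x"] that by simp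
  have 2: "on_pts f (on_pts g x) = x" if "x \<in> points Y" for x
    using arg_cong[OF g(4), of "\<lambda>m. on_pts m x"] that by simp
  have "on_pts f ` U = inv_img Y g U"
    using 1 2 openin_points[OF assms(2)] mor_pts[OF g(1)] unfolding inv_img_def
    by (force simp: image_iff subset_iff)
  then show ?thesis using mor_open[OF g(2) assms(2)] by simp
qed

lemma inv_img_image:
  "inj_on (on_pts f) (points X) \<Longrightarrow> U \<subseteq> points X \<Longrightarrow> inv_img X f (on_pts f ` U) = U"
  by (auto simp: inv_img_def dest: inj_onD)

lemma isomorphism_sec:
  assumes "isomorphism X Y f" "openin (topol Y) V"
  shows "bij_betw (on_sec f V) (carrier (sections Y V)) (carrier (sections X (inv_img X f V)))"
proof -
  obtain g where g: "morphism X Y f" "morphism Y X g" "mor_comp X Y X g f = mor_id X" "mor_comp Y X Y f g = mor_id Y"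
    using assms unfolding isomorphism_def by blast
  have 2: "on_pts f (on_pts g x) = x" if "x \<in> points Y" for x
    using arg_cong[OF g(4), of "\<lambda>m. on_pts m x"] that by simp
  note V = assms(2) note O = mor_open[OF g(1) V]
  have e: "inv_img Y g (inv_img X f V) = V"
    using 2 mor_pts[OF g(2)] openin_points[OF V] by (auto simp: inv_img_def)
  show ?thesis
  proof (rule bij_betw_byWitness[of _ "on_sec g (inv_img X f V)"])
    show "\<forall>t\<in>carrier (sections Y V). on_sec g (inv_img X f V) (on_sec f V t) = t"
    proof
      fix t assume "t \<in> carrier (sections Y V)"
      then show "on_sec g (inv_img X f V) (on_sec f V t) = t"
        using arg_cong[OF g(4), of "\<lambda>m. on_sec m V t"] V by simp
    qed
    show "\<forall>s\<in>carrier (sections X (inv_img X f V)). on_sec f V (on_sec g (inv_img X f V) s) = s"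
    proof
      fix s assume "s \<in> carrier (sections X (inv_img X f V))"
      then show "on_sec f V (on_sec g (inv_img X f V) s) = s"
        using arg_cong[OF g(3), of "\<lambda>m. on_sec m (inv_img X f V) s"] O by (simp add: e)
    qed
    show "on_sec f V ` carrier (sections Y V) \<subseteq> carrier (sections X (inv_img X f V))"
      using mor_sec[OF g(1) V] by auto
    show "on_sec g (inv_img X f V) ` carrier (sections X (inv_img X f V)) \<subseteq> carrier (sections Y V)"
      using mor_sec[OF g(2) O] e by auto
  qed
qed

text \<open>Sections are glued on the target, so surjectivity of the pullback is only needed locally.\<close>

lemma isomorphismI:
  assumes X: "locally_ringed X" and Y: "locally_ringed Y" and f: "morphism X Y f"
    and bij: "bij_betw (on_pts f) (points X) (points Y)"
    and op: "\<And>U. openin (topol X) U \<Longrightarrow> openin (topol Y) (on_pts f ` U)"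
    and inj: "\<And>V. openin (topol Y) V \<Longrightarrow> inj_on (on_sec f V) (carrier (sections Y V))"
    and surj: "\<And>V s y. openin (topol Y) V \<Longrightarrow> s \<in> carrier (sections X (inv_img X f V)) \<Longrightarrow> y \<in> V \<Longrightarrow>
      \<exists>W t. openin (topol Y) W \<and> y \<in> W \<and> W \<subseteq> V \<and> t \<in> carrier (sections Y W) \<and>
        on_sec f W t = restrn X (inv_img X f V) (inv_img X f W) s"
  shows "isomorphism X Y f"
proof -
  interpret X: presheaf X by (rule locally_ringed_presheaf[OF X])
  interpret Y: presheaf Y by (rule locally_ringed_presheaf[OF Y])
  have glob: "\<exists>t\<in>carrier (sections Y V). on_sec f V t = s"
    if V: "openin (topol Y) V" and s: "s \<in> carrier (sections X (inv_img X f V))" for V s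
  proof -
    note O = mor_open[OF f V]
    \<comment> \<open>\<open>R W t\<close> says that \<open>t\<close> is a preimage of
      \<open>s\<close> over \<open>W\<close>. Injectivity makes such preimages unique, so the local
      ones glue.\<close>
    define R where "R W t \<longleftrightarrow> openin (topol Y) W \<and> W \<subseteq> V \<and> t \<in> carrier (sections Y W) \<and>
        on_sec f W t = restrn X (inv_img X f V) (inv_img X f W) s" for W t
    obtain t where t: "t \<in> carrier (sections Y V)" "\<And>W t'. R W t' \<Longrightarrow> restrn Y V W t = t'"
    proof (rule sheaf_glue[OF locally_ringed_sheaf[OF Y] V, of R])
      show "openin (topol Y) W \<and> W \<subseteq> V \<and> t \<in> carrier (sections Y W)" if "R W t" for W t
        using that unfolding R_def by blast
      show "R W' (restrn Y W W' t)" if R: "R W t" and W': "openin (topol Y) W'" "W' \<subseteq> W" for W t W'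
      proof -
        have W: "openin (topol Y) W" "W \<subseteq> V" "t \<in> carrier (sections Y W)"
          "on_sec f W t = restrn X (inv_img X f V) (inv_img X f W) s" using R unfolding R_def by auto
        show ?thesis
          using W W' mor_nat[OF f W(1) W' W(3)] Y.res_closed[OF W(1) W' W(3)]
            X.res_res[OF O mor_open[OF f W(1)] mor_open[OF f W'(1)] inv_img_mono[OF W(2)] inv_img_mono[OF W'(2)] s]
          unfolding R_def by auto
      qed
      show "t = t'" if "R W t" "R W t'" for W t t'
        using that inj[of W] unfolding R_def by (simp add: inj_on_def)
      show "\<exists>W t. y \<in> W \<and> R W t" if "y \<in> V" for y
        using surj[OF V s that] unfolding R_def by blast
    qed (rule that)
    have "on_sec f V t = s"
    proof (rule sheaf_eqI[OF locally_ringed_sheaf[OF X] O mor_sec[OF f V t(1)] s])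
      fix x assume "x \<in> inv_img X f V"
      then have x: "x \<in> points X" "on_pts f x \<in> V" by (auto simp: inv_img_def)
      obtain W r where W: "openin (topol Y) W" "on_pts f x \<in> W" "W \<subseteq> V" "r \<in> carrier (sections Y W)"
        "on_sec f W r = restrn X (inv_img X f V) (inv_img X f W) s"
        using surj[OF V s x(2)] by blast
      have "restrn Y V W t = r" using t(2)[of W r] W unfolding R_def by blast
      then show "\<exists>W. openin (topol X) W \<and> x \<in> W \<and> W \<subseteq> inv_img X f V \<and>
         restrn X (inv_img X f V) W (on_sec f V t) = restrn X (inv_img X f V) W s"
        using W x mor_nat[OF f V W(1,3) t(1)] mor_open[OF f W(1)]
        by (intro exI[of _ "inv_img X f W"]) (auto simp: inv_img_def)
    qed
    then show ?thesis using t(1) by blast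
  qed
  have inj_pts: "inj_on (on_pts f) (points X)" using bij by (simp add: bij_betw_def)
  have im: "inv_img X f (on_pts f ` U) = U" if "openin (topol X) U" for U
    using inv_img_image[OF inj_pts openin_points[OF that]] .
  \<comment> \<open>The inverse morphism has to send a section over \<open>U\<close> to its unique
    preimage over the image of \<open>U\<close>, which is open by \<open>op\<close>.\<close>
  define F where "F U = inv_into (carrier (sections Y (on_pts f ` U))) (on_sec f (on_pts f ` U))" for U
  have F: "F U s \<in> carrier (sections Y (on_pts f ` U))" "on_sec f (on_pts f ` U) (F U s) = s"
    if "openin (topol X) U" "s \<in> carrier (sections X U)" for U s
  proof -
    have "s \<in> on_sec f (on_pts f ` U) ` carrier (sections Y (on_pts f ` U))"
      using glob[OF op[OF that(1)], of s] im[OF that(1)] that(2) by force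
    then show "F U s \<in> carrier (sections Y (on_pts f ` U))" "on_sec f (on_pts f ` U) (F U s) = s"
      unfolding F_def by (auto intro: inv_into_into f_inv_into_f)
  qed
  have Fu: "F U s = t" if "openin (topol X) U" "t \<in> carrier (sections Y (on_pts f ` U))"
    "on_sec f (on_pts f ` U) t = s" for U s t
    using that inj[OF op[OF that(1)]] unfolding F_def by auto
  define g where "g = \<lparr>on_pts = (\<lambda>y\<in>points Y. inv_into (points X) (on_pts f) y),
     on_sec = (\<lambda>U\<in>{U. openin (topol X) U}. \<lambda>s\<in>carrier (sections X U). F U s)\<rparr>"
  have gf: "on_pts g (on_pts f x) = x" if "x \<in> points X" for x
    using that inj_pts mor_pts[OF f] unfolding g_def by simp
  have g_pts: "on_pts g y \<in> points X" "on_pts f (on_pts g y) = y" if "y \<in> points Y" for y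
    using that bij unfolding g_def bij_betw_def by (auto intro: inv_into_into f_inv_into_f)
  have g_inv: "inv_img Y g U = on_pts f ` U" if "openin (topol X) U" for U
    using gf g_pts openin_points[OF that] mor_pts[OF f] unfolding inv_img_def
    by (force simp: image_iff subset_iff)
  have g_sec: "on_sec g U s = F U s" if "openin (topol X) U" "s \<in> carrier (sections X U)" for U s
    using that unfolding g_def by simp
  have g: "morphism Y X g"
  proof (rule morphismI[OF Y X])
    show "on_pts g \<in> extensional (points Y)" "on_sec g \<in> extensional {V. openin (topol X) V}"
      "\<And>V. openin (topol X) V \<Longrightarrow> on_sec g V \<in> extensional (carrier (sections X V))"
      unfolding g_def by auto
    show "on_pts g y \<in> points X" if "y \<in> points Y" for y using g_pts that by blast
    fix U assume U: "openin (topol X) U"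
    interpret U: cring "sections X U" by (rule X.cring_sec[OF U])
    interpret fU: cring "sections Y (on_pts f ` U)" by (rule Y.cring_sec[OF op[OF U]])
    note hom = mor_hom[OF f op[OF U]]
    show "openin (topol Y) (inv_img Y g U)" unfolding g_inv[OF U] by (rule op[OF U])
    show "on_sec g U \<in> ring_hom (sections X U) (sections Y (inv_img Y g U))"
      unfolding g_inv[OF U]
    proof (rule ring_hom_memI)
      show "on_sec g U s \<in> carrier (sections Y (on_pts f ` U))" if "s \<in> carrier (sections X U)" for s
        using F(1)[OF U that] g_sec[OF U that] by simp
      show "on_sec g U (s \<otimes>\<^bsub>sections X U\<^esub> t) = on_sec g U s \<otimes>\<^bsub>sections Y (on_pts f ` U)\<^esub> on_sec g U t"
        if "s \<in> carrier (sections X U)" "t \<in> carrier (sections X U)" for s t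
        using that F[OF U] ring_hom_mult[OF hom F(1)[OF U that(1)] F(1)[OF U that(2)]] im[OF U]
        by (simp add: g_sec[OF U] Fu[OF U])
      show "on_sec g U (s \<oplus>\<^bsub>sections X U\<^esub> t) = on_sec g U s \<oplus>\<^bsub>sections Y (on_pts f ` U)\<^esub> on_sec g U t"
        if "s \<in> carrier (sections X U)" "t \<in> carrier (sections X U)" for s t
        using that F[OF U] ring_hom_add[OF hom F(1)[OF U that(1)] F(1)[OF U that(2)]] im[OF U]
        by (simp add: g_sec[OF U] Fu[OF U])
      show "on_sec g U \<one>\<^bsub>sections X U\<^esub> = \<one>\<^bsub>sections Y (on_pts f ` U)\<^esub>"
        using ring_hom_one[OF hom] im[OF U] by (simp add: g_sec[OF U] Fu[OF U])
    qed
    show "on_sec g W (restrn X U W s) = restrn Y (inv_img Y g U) (inv_img Y g W) (on_sec g U s)"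
      if W: "openin (topol X) W" "W \<subseteq> U" and s: "s \<in> carrier (sections X U)" for W s
    proof -
      have S: "on_pts f ` W \<subseteq> on_pts f ` U" using W by blast
      have "on_sec f (on_pts f ` W) (restrn Y (on_pts f ` U) (on_pts f ` W) (F U s)) = restrn X U W s"
        unfolding mor_nat[OF f op[OF U] op[OF W(1)] S F(1)[OF U s]] im[OF U] im[OF W(1)] F(2)[OF U s] ..
      from Fu[OF W(1) Y.res_closed[OF op[OF U] op[OF W(1)] S F(1)[OF U s]] this]
      show ?thesis by (simp add: g_sec U W s g_inv)
    qed
    fix y s assume y: "y \<in> points Y" and gy: "on_pts g y \<in> U" and s: "s \<in> carrier (sections X U)"
      and u: "unit_near Y y (inv_img Y g U) (on_sec g U s)"
    have "y \<in> on_pts f ` U" using gy g_pts[OF y] by force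
    then show "unit_near X (on_pts g y) U s"
      using mor_unit_near[OF X Y f g_pts(1)[OF y] op[OF U] _ F(1)[OF U s]] u g_pts(2)[OF y] F(2)[OF U s] im[OF U]
      by (simp add: g_inv[OF U] g_sec[OF U s])
  qed
  have "mor_comp X Y X g f = mor_id X"
  proof (rule mor_eqI[OF mor_comp_morphism[OF X Y X f g] mor_id_morphism[OF X]])
    show "on_sec (mor_comp X Y X g f) U s = on_sec (mor_id X) U s"
      if "openin (topol X) U" "s \<in> carrier (sections X U)" for U s
      using that F[OF that] by (simp add: g_inv g_sec)
  qed (simp add: gf)
  moreover have "mor_comp Y X Y f g = mor_id Y"
  proof (rule mor_eqI[OF mor_comp_morphism[OF Y X Y g f] mor_id_morphism[OF Y]])
    fix V t assume V: "openin (topol Y) V" "t \<in> carrier (sections Y V)"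
    have e: "on_pts f ` inv_img X f V = V"
    proof (rule equalityI)
      show "on_pts f ` inv_img X f V \<subseteq> V" by (auto simp: inv_img_def)
      have "V \<subseteq> on_pts f ` points X" using bij openin_points[OF V(1)] by (simp add: bij_betw_def)
      then show "V \<subseteq> on_pts f ` inv_img X f V" by (auto simp: inv_img_def)
    qed
    show "on_sec (mor_comp Y X Y f g) V t = on_sec (mor_id Y) V t"
      using V mor_open[OF f V(1)] mor_sec[OF f V] Fu[OF mor_open[OF f V(1)], unfolded e] e
      by (simp add: g_sec)
  qed (simp add: g_pts)
  ultimately show ?thesis unfolding isomorphism_def using f g by blast
qed

lemma isomorphism_restrict:
  assumes X: "locally_ringed X" and Y: "locally_ringed Y" and f: "isomorphism X Y f" and U: "openin (topol X) U"
  shows "isomorphism (open_sub X U) (open_sub Y (on_pts f ` U)) (mor_restrict X Y f U (on_pts f ` U))"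
proof -
  interpret X: presheaf X by (rule locally_ringed_presheaf[OF X])
  note m = isomorphism_morphism[OF f]
  let ?V = "on_pts f ` U" let ?r = "mor_restrict X Y f U ?V"
  note V = isomorphism_open[OF f U]
  have bij: "inj_on (on_pts f) (points X)" using isomorphism_pts[OF f] by (simp add: bij_betw_def)
  have sub: "inv_img X f W \<subseteq> U" if "W \<subseteq> ?V" for W
    using inv_img_mono[OF that, of X f] inv_img_image[OF bij openin_points[OF U]] by simp
  have inv: "inv_img (open_sub X U) ?r W = inv_img X f W" if "W \<subseteq> ?V" for W
    using sub[OF that] by (auto simp: inv_restrict[OF U])
  have sec: "on_sec ?r W t = on_sec f W t"
    if "openin (topol Y) W" "W \<subseteq> ?V" "t \<in> carrier (sections Y W)" for W t
    using that sub[OF that(2)] mor_sec[OF m that(1,3)] mor_open[OF m that(1)]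
    by (simp add: sec_restrict[OF V] inf_absorb2)
  show ?thesis
  proof (rule isomorphismI[OF locally_ringed_open_sub[OF X U] locally_ringed_open_sub[OF Y V]
        mor_restrict_morphism[OF X Y m U V]])
    have "inj_on (on_pts f) U" using bij openin_points[OF U] by (rule inj_on_subset)
    then show "bij_betw (on_pts ?r) (points (open_sub X U)) (points (open_sub Y ?V))"
      using U V by (auto simp: bij_betw_def inj_on_def)
    show "openin (topol (open_sub Y ?V)) (on_pts ?r ` U')" if "openin (topol (open_sub X U)) U'" for U'
    proof -
      have U': "openin (topol X) U'" "U' \<subseteq> U" using that openin_open_sub[OF U] by auto
      then have "on_pts ?r ` U' = on_pts f ` U'" using U by (auto simp: subset_iff)
      then show ?thesis using isomorphism_open[OF f U'(1)] U'(2) openin_open_sub[OF V] by auto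
    qed
    fix W assume "openin (topol (open_sub Y ?V)) W"
    then have W: "openin (topol Y) W" "W \<subseteq> ?V" using openin_open_sub[OF V] by auto
    note b = isomorphism_sec[OF f W(1)]
    have "inj_on (on_sec f W) (carrier (sections Y W))" using b by (simp add: bij_betw_def)
    then show "inj_on (on_sec ?r W) (carrier (sections (open_sub Y ?V) W))"
      using sec[OF W] by (simp add: inj_on_def)
    fix s y assume s: "s \<in> carrier (sections (open_sub X U) (inv_img (open_sub X U) ?r W))" and y: "y \<in> W"
    have s': "s \<in> carrier (sections X (inv_img X f W))" using s inv[OF W(2)] by simp
    then have "s \<in> on_sec f W ` carrier (sections Y W)" using b by (simp add: bij_betw_def)
    then obtain t where "t \<in> carrier (sections Y W)" "on_sec f W t = s" by blast
    then show "\<exists>W' t. openin (topol (open_sub Y ?V)) W' \<and> y \<in> W' \<and> W' \<subseteq> W \<and> t \<in> carrier (sections (open_sub Y ?V) W') \<and>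
        on_sec ?r W' t = restrn (open_sub X U) (inv_img (open_sub X U) ?r W) (inv_img (open_sub X U) ?r W') s"
      using y W sec[OF W] s' mor_open[OF m W(1)] inv[OF W(2)] openin_open_sub[OF V]
      by (intro exI[of _ W] exI[of _ t]) simp
  qed auto
qed

section \<open>Affine spectra\<close>

definition basic_open :: "'r ring \<Rightarrow> 'r \<Rightarrow> 'r set set" where
  "basic_open A f = {\<pp>. primeideal \<pp> A \<and> f \<notin> \<pp>}"

lemma primeideal_spot: "primeideal \<pp> (A :: 'r ring) \<Longrightarrow> prime_spot \<pp> A"
  by (simp add: prime_spot_def)

lemma basic_open_mult:
  assumes "cring A" "f \<in> carrier A" "g \<in> carrier A"
  shows "basic_open A (f \<otimes>\<^bsub>A\<^esub> g) = basic_open A f \<inter> basic_open A g"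
proof -
  interpret cring A by fact
  have "f \<otimes>\<^bsub>A\<^esub> g \<in> \<pp> \<longleftrightarrow> f \<in> \<pp> \<or> g \<in> \<pp>" if "primeideal \<pp> A" for \<pp>
  proof -
    interpret primeideal \<pp> A by fact
    show ?thesis using I_prime[of f g] I_l_closed[of g f] I_r_closed[of f g] assms by blast
  qed
  then show ?thesis unfolding basic_open_def by auto
qed

lemma basic_open_one: "cring A \<Longrightarrow> basic_open A \<one>\<^bsub>A\<^esub> = {\<pp>. primeideal \<pp> A}"
  unfolding basic_open_def using primeideal.I_notcarr ideal.one_imp_carrier primeideal.axioms(1) by blast

text \<open>The sets \<open>basic_open\<close> are introduced only as generators of the topology.
  They form a basis because the intersection of two of them is the one that belongs to the product
  of the elements.\<close>

lemma openin_zariski: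
  assumes A: "cring A"
  shows "openin (zariski A) U \<longleftrightarrow> (\<forall>\<pp>\<in>U. primeideal \<pp> A) \<and> (\<forall>\<pp>\<in>U. \<exists>f\<in>carrier A. \<pp> \<in> basic_open A f \<and> basic_open A f \<subseteq> U)"
    (is "?L \<longleftrightarrow> ?R U")
proof
  let ?B = "{{\<pp>. primeideal \<pp> A \<and> f \<notin> \<pp>} | f. f \<in> carrier A}"
  interpret cring A by fact
  assume ?L
  then have "generate_topology_on ?B U" unfolding zariski_def openin_topology_generated_by_iff .
  then show "?R U"
  proof (induction rule: generate_topology_on.induct)
    case Empty then show ?case by simp
  next
    case (Int a b)
    have "\<exists>h\<in>carrier A. \<pp> \<in> basic_open A h \<and> basic_open A h \<subseteq> a \<inter> b" if p: "\<pp> \<in> a" "\<pp> \<in> b" for \<pp>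
    proof -
      obtain f g where "f \<in> carrier A" "\<pp> \<in> basic_open A f" "basic_open A f \<subseteq> a"
        "g \<in> carrier A" "\<pp> \<in> basic_open A g" "basic_open A g \<subseteq> b" using Int p by meson
      then show ?thesis using basic_open_mult[OF A, of f g] by (intro bexI[of _ "f \<otimes>\<^bsub>A\<^esub> g"]) auto
    qed
    then show ?case using Int by simp
  next
    case (UN K) then show ?case by (meson Union_iff Union_upper order_trans)
  next
    case (Basis s)
    then obtain f where "f \<in> carrier A" "s = basic_open A f" unfolding basic_open_def by blast
    then show ?case by (auto simp: basic_open_def)
  qed
next
  assume R: "?R U"
  have "U = \<Union>{basic_open A f | f. f \<in> carrier A \<and> basic_open A f \<subseteq> U}" using R by blast
  moreover have "openin (zariski A) (basic_open A f)" if "f \<in> carrier A" for f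
    unfolding zariski_def openin_topology_generated_by_iff basic_open_def
    using that by (intro generate_topology_on.Basis) blast
  ultimately show ?L by (subst \<open>U = _\<close>) (rule openin_Union, blast)
qed

lemma openin_basic_open [simp]: "cring A \<Longrightarrow> f \<in> carrier A \<Longrightarrow> openin (zariski A) (basic_open A f)"
  by (subst openin_zariski) (auto simp: basic_open_def)

lemma Spec_simps [simp]: "topol (Spec A) = zariski A" "sections (Spec A) = spec_sections A"
  "restrn (Spec A) = (\<lambda>U V s. restrict s V)"
  by (simp_all add: Spec_def)

lemma points_Spec: assumes "cring A" shows "points (Spec A) = {\<pp>. primeideal \<pp> A}"
proof -
  interpret cring A by fact
  have "openin (zariski A) {\<pp>. primeideal \<pp> A}"
    using openin_basic_open[OF assms one_closed] basic_open_one[OF assms] by simp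
  then have "{\<pp>. primeideal \<pp> A} \<subseteq> points (Spec A)" by (simp add: points_def openin_subset)
  moreover have "points (Spec A) \<subseteq> {\<pp>. primeideal \<pp> A}"
    using openin_zariski[OF assms, of "points (Spec A)"] by (auto simp: points_def)
  ultimately show ?thesis by blast
qed

section \<open>The structure sheaf of a spectrum\<close>

definition const_sec :: "'r ring \<Rightarrow> 'r set set \<Rightarrow> 'r \<Rightarrow> 'r set \<Rightarrow> ('r \<times> 'r) set" where
  "const_sec A U a = (\<lambda>\<pp>\<in>U. loc_frac A \<pp> a \<one>\<^bsub>A\<^esub>)"

locale spectrum = cring A for A :: "'r ring" (structure)
begin

lemma A_cring: "cring A" by (rule cring_axioms)

lemma open_prime: "openin (zariski A) U \<Longrightarrow> \<pp> \<in> U \<Longrightarrow> prime_spot \<pp> A"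
  using openin_zariski[OF A_cring, of U] primeideal_spot[of \<pp> A] by simp

lemma spec_secI:
  assumes "openin (zariski A) U" "s \<in> extensional U"
    and "\<And>\<pp>. \<pp> \<in> U \<Longrightarrow> \<exists>V a f. openin (zariski A) V \<and> \<pp> \<in> V \<and> V \<subseteq> U \<and> a \<in> carrier A \<and> f \<in> carrier A \<and>
      (\<forall>\<qq>\<in>V. f \<notin> \<qq> \<and> s \<qq> = loc_frac A \<qq> a f)"
  shows "s \<in> carrier (spec_sections A U)"
proof -
  have "s \<pp> \<in> carrier (localization A \<pp>)" if p: "\<pp> \<in> U" for \<pp>
  proof -
    from assms(3)[OF p] obtain V a f where "\<pp> \<in> V" "a \<in> carrier A" "f \<in> carrier A"
      "\<forall>\<qq>\<in>V. f \<notin> \<qq> \<and> s \<qq> = loc_frac A \<qq> a f" by (elim exE conjE) (rule that)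
    then show ?thesis using prime_spot.loc_frac_carrier[OF open_prime[OF assms(1) p], of a f] by simp
  qed
  then have 1: "s \<in> (\<Pi>\<^sub>E \<pp>\<in>U. carrier (localization A \<pp>))" using assms(2) by (simp add: PiE_def)
  have "\<exists>V. openin (zariski A) V \<and> \<pp> \<in> V \<and> V \<subseteq> U \<and>
      (\<exists>a\<in>carrier A. \<exists>f\<in>carrier A. \<forall>\<qq>\<in>V. f \<notin> \<qq> \<and> s \<qq> = loc_frac A \<qq> a f)" if "\<pp> \<in> U" for \<pp>
    using assms(3)[OF that] by (elim exE conjE) (intro exI conjI bexI; assumption)
  then show ?thesis unfolding spec_sections_def using 1 by simp
qed

lemma spec_secE:
  assumes "s \<in> carrier (spec_sections A U)" "\<pp> \<in> U"
  obtains V a f where "openin (zariski A) V" "\<pp> \<in> V" "V \<subseteq> U" "a \<in> carrier A" "f \<in> carrier A"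
      "\<forall>\<qq>\<in>V. f \<notin> \<qq> \<and> s \<qq> = loc_frac A \<qq> a f"
proof -
  have "\<exists>V. openin (zariski A) V \<and> \<pp> \<in> V \<and> V \<subseteq> U \<and>
      (\<exists>a\<in>carrier A. \<exists>f\<in>carrier A. \<forall>\<qq>\<in>V. f \<notin> \<qq> \<and> s \<qq> = loc_frac A \<qq> a f)"
    using assms unfolding spec_sections_def by simp
  then obtain V a f where "openin (zariski A) V" "\<pp> \<in> V" "V \<subseteq> U" "a \<in> carrier A" "f \<in> carrier A"
    "\<forall>\<qq>\<in>V. f \<notin> \<qq> \<and> s \<qq> = loc_frac A \<qq> a f" by blast
  then show thesis by (intro that[of V a f]) auto
qed

lemma spec_sec_ext: "s \<in> carrier (spec_sections A U) \<Longrightarrow> s \<in> extensional U"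
  unfolding spec_sections_def by (auto simp: PiE_def)

lemma spec_sec_val: "s \<in> carrier (spec_sections A U) \<Longrightarrow> \<pp> \<in> U \<Longrightarrow> s \<pp> \<in> carrier (localization A \<pp>)"
  unfolding spec_sections_def by auto

lemma spec_sec_eqI: "s \<in> carrier (spec_sections A U) \<Longrightarrow> t \<in> carrier (spec_sections A U) \<Longrightarrow>
    (\<And>\<pp>. \<pp> \<in> U \<Longrightarrow> s \<pp> = t \<pp>) \<Longrightarrow> s = t"
  by (rule extensionalityI[OF spec_sec_ext spec_sec_ext])

lemma spec_ops:
  "s \<otimes>\<^bsub>spec_sections A U\<^esub> t = (\<lambda>\<pp>\<in>U. s \<pp> \<otimes>\<^bsub>localization A \<pp>\<^esub> t \<pp>)"
  "s \<oplus>\<^bsub>spec_sections A U\<^esub> t = (\<lambda>\<pp>\<in>U. s \<pp> \<oplus>\<^bsub>localization A \<pp>\<^esub> t \<pp>)"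
  "\<one>\<^bsub>spec_sections A U\<^esub> = (\<lambda>\<pp>\<in>U. \<one>\<^bsub>localization A \<pp>\<^esub>)"
  "\<zero>\<^bsub>spec_sections A U\<^esub> = (\<lambda>\<pp>\<in>U. \<zero>\<^bsub>localization A \<pp>\<^esub>)"
  by (simp_all add: spec_sections_def)

lemma frac_sec:
  assumes U: "openin (zariski A) U" and a: "a \<in> carrier A" and f: "f \<in> carrier A" and fU: "\<And>\<pp>. \<pp> \<in> U \<Longrightarrow> f \<notin> \<pp>"
  shows "(\<lambda>\<pp>\<in>U. loc_frac A \<pp> a f) \<in> carrier (spec_sections A U)"
  by (rule spec_secI[OF U]) (use assms in auto)

lemma const_eq_frac: "const_sec A U a = (\<lambda>\<pp>\<in>U. loc_frac A \<pp> a \<one>)"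
  by (simp add: const_sec_def)

lemma one_notin: "prime_spot \<pp> A \<Longrightarrow> \<one> \<notin> \<pp>"
  using prime_spot.one_compl by blast

lemma const_sec_closed: "openin (zariski A) U \<Longrightarrow> a \<in> carrier A \<Longrightarrow> const_sec A U a \<in> carrier (spec_sections A U)"
  unfolding const_eq_frac using one_notin open_prime by (intro frac_sec) auto

lemma spec_cring:
  assumes U: "openin (zariski A) U" shows "cring (spec_sections A U)"
proof -
  let ?S = "spec_sections A U"
  have L: "cring (localization A \<pp>)" if "\<pp> \<in> U" for \<pp>
    using prime_spot.loc_cring[OF open_prime[OF U that]] .
  note Lr = L[THEN cring.axioms(1)]
  note val = spec_sec_val
  have cl: "s \<otimes>\<^bsub>?S\<^esub> t \<in> carrier ?S" "s \<oplus>\<^bsub>?S\<^esub> t \<in> carrier ?S" if st: "s \<in> carrier ?S" "t \<in> carrier ?S" for s t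
  proof -
    have *: "\<exists>V a f b g. openin (zariski A) V \<and> \<pp> \<in> V \<and> V \<subseteq> U \<and> a \<in> carrier A \<and> f \<in> carrier A \<and> b \<in> carrier A \<and> g \<in> carrier A
      \<and> (\<forall>\<qq>\<in>V. f \<notin> \<qq> \<and> g \<notin> \<qq> \<and> s \<qq> = loc_frac A \<qq> a f \<and> t \<qq> = loc_frac A \<qq> b g)" if p: "\<pp> \<in> U" for \<pp>
    proof -
      obtain V a f where 1: "openin (zariski A) V" "\<pp> \<in> V" "V \<subseteq> U" "a \<in> carrier A" "f \<in> carrier A"
        "\<forall>\<qq>\<in>V. f \<notin> \<qq> \<and> s \<qq> = loc_frac A \<qq> a f" using spec_secE[OF st(1) p] .
      obtain W b g where 2: "openin (zariski A) W" "\<pp> \<in> W" "W \<subseteq> U" "b \<in> carrier A" "g \<in> carrier A"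
        "\<forall>\<qq>\<in>W. g \<notin> \<qq> \<and> t \<qq> = loc_frac A \<qq> b g" using spec_secE[OF st(2) p] .
      have "openin (zariski A) (V \<inter> W)" using 1(1) 2(1) by blast
      then show ?thesis using 1 2
        by (intro exI[of _ "V \<inter> W"] exI[of _ a] exI[of _ f] exI[of _ b] exI[of _ g]) (simp add: le_infI1)
    qed
    show "s \<otimes>\<^bsub>?S\<^esub> t \<in> carrier ?S"
    proof (rule spec_secI[OF U])
      fix \<pp> assume "\<pp> \<in> U"
      then obtain V a f b g where 1: "openin (zariski A) V" "\<pp> \<in> V" "V \<subseteq> U" "a \<in> carrier A" "f \<in> carrier A" "b \<in> carrier A" "g \<in> carrier A"
        "\<And>\<qq>. \<qq> \<in> V \<Longrightarrow> f \<notin> \<qq> \<and> g \<notin> \<qq> \<and> s \<qq> = loc_frac A \<qq> a f \<and> t \<qq> = loc_frac A \<qq> b g" using * by metis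
      have "f \<otimes> g \<notin> \<qq> \<and> (s \<otimes>\<^bsub>?S\<^esub> t) \<qq> = loc_frac A \<qq> (a \<otimes> b) (f \<otimes> g)" if q: "\<qq> \<in> V" for \<qq>
      proof -
        interpret prime_spot \<qq> A using open_prime[OF 1(1) q] .
        show ?thesis using 1 q compl_mult[of f g] by (auto simp: spec_ops loc_mult)
      qed
      then show "\<exists>V a f. openin (zariski A) V \<and> \<pp> \<in> V \<and> V \<subseteq> U \<and> a \<in> carrier A \<and> f \<in> carrier A \<and>
        (\<forall>\<qq>\<in>V. f \<notin> \<qq> \<and> (s \<otimes>\<^bsub>?S\<^esub> t) \<qq> = loc_frac A \<qq> a f)"
        using 1 by (intro exI[of _ V] exI[of _ "a \<otimes> b"] exI[of _ "f \<otimes> g"]) auto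
    qed (simp add: spec_ops)
    show "s \<oplus>\<^bsub>?S\<^esub> t \<in> carrier ?S"
    proof (rule spec_secI[OF U])
      fix \<pp> assume "\<pp> \<in> U"
      then obtain V a f b g where 1: "openin (zariski A) V" "\<pp> \<in> V" "V \<subseteq> U" "a \<in> carrier A" "f \<in> carrier A" "b \<in> carrier A" "g \<in> carrier A"
        "\<And>\<qq>. \<qq> \<in> V \<Longrightarrow> f \<notin> \<qq> \<and> g \<notin> \<qq> \<and> s \<qq> = loc_frac A \<qq> a f \<and> t \<qq> = loc_frac A \<qq> b g" using * by metis
      have "f \<otimes> g \<notin> \<qq> \<and> (s \<oplus>\<^bsub>?S\<^esub> t) \<qq> = loc_frac A \<qq> (a \<otimes> g \<oplus> b \<otimes> f) (f \<otimes> g)" if q: "\<qq> \<in> V" for \<qq>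
      proof -
        interpret prime_spot \<qq> A using open_prime[OF 1(1) q] .
        show ?thesis using 1 q compl_mult[of f g] by (auto simp: spec_ops loc_add)
      qed
      then show "\<exists>V a f. openin (zariski A) V \<and> \<pp> \<in> V \<and> V \<subseteq> U \<and> a \<in> carrier A \<and> f \<in> carrier A \<and>
        (\<forall>\<qq>\<in>V. f \<notin> \<qq> \<and> (s \<oplus>\<^bsub>?S\<^esub> t) \<qq> = loc_frac A \<qq> a f)"
        using 1 by (intro exI[of _ V] exI[of _ "a \<otimes> g \<oplus> b \<otimes> f"] exI[of _ "f \<otimes> g"]) auto
    qed (simp add: spec_ops)
  qed
  have one: "\<one>\<^bsub>?S\<^esub> \<in> carrier ?S" and zero: "\<zero>\<^bsub>?S\<^esub> \<in> carrier ?S"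
  proof -
    have "\<one>\<^bsub>?S\<^esub> = const_sec A U \<one>" "\<zero>\<^bsub>?S\<^esub> = const_sec A U \<zero>"
      unfolding spec_ops const_sec_def
      by (rule restrict_ext, simp add: prime_spot.loc_one[OF open_prime[OF U]] prime_spot.loc_zero[OF open_prime[OF U]])+
    then show "\<one>\<^bsub>?S\<^esub> \<in> carrier ?S" "\<zero>\<^bsub>?S\<^esub> \<in> carrier ?S" using const_sec_closed[OF U] by auto
  qed
  have neg: "\<exists>t\<in>carrier ?S. t \<oplus>\<^bsub>?S\<^esub> s = \<zero>\<^bsub>?S\<^esub>" if s: "s \<in> carrier ?S" for s
  \<comment> \<open>The negative is written as a product with the constant section of minus one, so
    that its being a section follows from closure under multiplication.\<close>
  proof (rule bexI[of _ "const_sec A U (\<ominus> \<one>) \<otimes>\<^bsub>?S\<^esub> s"])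
    show "const_sec A U (\<ominus> \<one>) \<otimes>\<^bsub>?S\<^esub> s \<in> carrier ?S" using cl const_sec_closed[OF U] s by simp
    have "(loc_frac A \<pp> (\<ominus> \<one>) \<one> \<otimes>\<^bsub>localization A \<pp>\<^esub> s \<pp>) \<oplus>\<^bsub>localization A \<pp>\<^esub> s \<pp> = \<zero>\<^bsub>localization A \<pp>\<^esub>"
      if p: "\<pp> \<in> U" for \<pp>
    proof -
      interpret prime_spot \<pp> A using open_prime[OF U p] .
      obtain a f where *: "a \<in> carrier A" "f \<in> carrier A - \<pp>" "s \<pp> = loc_frac A \<pp> a f"
        using val[OF s p] unfolding loc_carrier by blast
      have "(\<ominus> \<one> \<otimes> a) \<otimes> f \<oplus> a \<otimes> (\<one> \<otimes> f) = \<zero>" using *(1) *(2)[THEN DiffD1] by algebra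
      then show ?thesis using * one_compl compl_mult[OF *(2,2)] compl_mult[OF one_compl *(2)]
        by (auto simp: loc_mult loc_add loc_frac_zero_iff)
    qed
    then show "const_sec A U (\<ominus> \<one>) \<otimes>\<^bsub>?S\<^esub> s \<oplus>\<^bsub>?S\<^esub> s = \<zero>\<^bsub>?S\<^esub>"
      unfolding spec_ops const_sec_def by (auto intro!: restrict_ext)
  qed
  show ?thesis
  proof (rule cringI)
    show "abelian_group ?S"
    proof (rule abelian_groupI)
      fix s t r assume s: "s \<in> carrier ?S" and t: "t \<in> carrier ?S" and r: "r \<in> carrier ?S"
      note v = val[OF s] val[OF t] val[OF r]
      show "s \<oplus>\<^bsub>?S\<^esub> t \<in> carrier ?S" using cl s t by blast
      show "s \<oplus>\<^bsub>?S\<^esub> t = t \<oplus>\<^bsub>?S\<^esub> s" unfolding spec_ops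
        by (rule restrict_ext) (use v Lr in \<open>simp add: ring.ring_simprules(10)\<close>)
      show "s \<oplus>\<^bsub>?S\<^esub> t \<oplus>\<^bsub>?S\<^esub> r = s \<oplus>\<^bsub>?S\<^esub> (t \<oplus>\<^bsub>?S\<^esub> r)" unfolding spec_ops
        by (rule restrict_ext) (use v Lr in \<open>simp add: ring.ring_simprules(7)\<close>)
      show "\<zero>\<^bsub>?S\<^esub> \<oplus>\<^bsub>?S\<^esub> s = s" unfolding spec_ops
        by (rule extensionalityI[of _ U]) (use v Lr spec_sec_ext[OF s] in \<open>simp_all add: ring.ring_simprules(8)\<close>)
      show "\<exists>t\<in>carrier ?S. t \<oplus>\<^bsub>?S\<^esub> s = \<zero>\<^bsub>?S\<^esub>" by (rule neg[OF s])
    qed (rule zero)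
    show "Group.comm_monoid ?S"
    proof (rule comm_monoidI)
      fix s t r assume s: "s \<in> carrier ?S" and t: "t \<in> carrier ?S" and r: "r \<in> carrier ?S"
      note v = val[OF s] val[OF t] val[OF r]
      show "s \<otimes>\<^bsub>?S\<^esub> t \<in> carrier ?S" using cl s t by blast
      show "s \<otimes>\<^bsub>?S\<^esub> t = t \<otimes>\<^bsub>?S\<^esub> s" unfolding spec_ops
        by (rule restrict_ext) (use v L in \<open>simp add: cring.cring_simprules(14)\<close>)
      show "s \<otimes>\<^bsub>?S\<^esub> t \<otimes>\<^bsub>?S\<^esub> r = s \<otimes>\<^bsub>?S\<^esub> (t \<otimes>\<^bsub>?S\<^esub> r)" unfolding spec_ops
        by (rule restrict_ext) (use v L in \<open>simp add: cring.cring_simprules(11)\<close>)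
      show "\<one>\<^bsub>?S\<^esub> \<otimes>\<^bsub>?S\<^esub> s = s" unfolding spec_ops
        by (rule extensionalityI[of _ U]) (use v L spec_sec_ext[OF s] in \<open>simp_all add: cring.cring_simprules(12)\<close>)
    qed (rule one)
    fix s t r assume s: "s \<in> carrier ?S" and t: "t \<in> carrier ?S" and r: "r \<in> carrier ?S"
    note v = val[OF s] val[OF t] val[OF r]
    show "(s \<oplus>\<^bsub>?S\<^esub> t) \<otimes>\<^bsub>?S\<^esub> r = s \<otimes>\<^bsub>?S\<^esub> r \<oplus>\<^bsub>?S\<^esub> t \<otimes>\<^bsub>?S\<^esub> r" unfolding spec_ops
      by (rule restrict_ext) (use v L in \<open>simp add: cring.cring_simprules(13)\<close>)
  qed
qed

lemma restrict_sec:
  assumes "openin (zariski A) V" "V \<subseteq> U" "s \<in> carrier (spec_sections A U)"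
  shows "restrict s V \<in> carrier (spec_sections A V)"
proof (rule spec_secI[OF assms(1)])
  fix \<pp> assume p: "\<pp> \<in> V"
  then have pU: "\<pp> \<in> U" using assms(2) by blast
  obtain W a f where 1: "openin (zariski A) W" "\<pp> \<in> W" "W \<subseteq> U" "a \<in> carrier A" "f \<in> carrier A"
      "\<forall>\<qq>\<in>W. f \<notin> \<qq> \<and> s \<qq> = loc_frac A \<qq> a f" using spec_secE[OF assms(3) pU] .
  have "openin (zariski A) (V \<inter> W)" using 1(1) assms(1) by blast
  then show "\<exists>W a f. openin (zariski A) W \<and> \<pp> \<in> W \<and> W \<subseteq> V \<and> a \<in> carrier A \<and> f \<in> carrier A \<and>
      (\<forall>\<qq>\<in>W. f \<notin> \<qq> \<and> restrict s V \<qq> = loc_frac A \<qq> a f)"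
    using 1 p by (intro exI[of _ "V \<inter> W"] exI[of _ a] exI[of _ f]) simp
qed simp

lemma spec_presheaf: "is_presheaf (Spec A)"
  unfolding is_presheaf_def Spec_simps
proof (intro conjI allI impI ballI, goal_cases)
  case (1 U) then show ?case by (rule spec_cring)
next
  case (2 U V)
  then show ?case
    by (intro ring_hom_memI) (auto simp: restrict_sec spec_ops fun_eq_iff)
next
  case (3 U s) then show ?case by (simp add: extensional_restrict spec_sec_ext)
next
  case (4 U V W s) then show ?case by (auto simp: fun_eq_iff)
qed

text \<open>Sections are functions on primes, so compatible ones glue pointwise; to be a fraction
  locally is a condition near each point and is inherited from the pieces.\<close>

lemma spec_sheaf: "is_sheaf (Spec A)"
  unfolding is_sheaf_def Spec_simps
proof (rule conjI, rule spec_presheaf, rule allI, rule impI)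
  fix C assume C: "\<forall>V\<in>C. openin (zariski A) V"
  have UC: "openin (zariski A) (\<Union>C)" using C by blast
  show "(\<forall>s\<in>carrier (spec_sections A (\<Union>C)). \<forall>t\<in>carrier (spec_sections A (\<Union>C)).
           (\<forall>V\<in>C. restrict s V = restrict t V) \<longrightarrow> s = t) \<and>
        (\<forall>\<sigma>. (\<forall>V\<in>C. \<sigma> V \<in> carrier (spec_sections A V)) \<and>
             (\<forall>V\<in>C. \<forall>W\<in>C. restrict (\<sigma> V) (V \<inter> W) = restrict (\<sigma> W) (V \<inter> W)) \<longrightarrow>
             (\<exists>s\<in>carrier (spec_sections A (\<Union>C)). \<forall>V\<in>C. restrict s V = \<sigma> V))"
  proof (intro conjI ballI allI impI, goal_cases)
    case (1 s t)
    show ?case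
    proof (rule spec_sec_eqI[OF 1(1,2)])
      fix \<pp> assume "\<pp> \<in> \<Union>C"
      then obtain V where "V \<in> C" "\<pp> \<in> V" by blast
      then show "s \<pp> = t \<pp>" using 1(3) by (metis restrict_apply')
    qed
  next
    case (2 \<sigma>)
    then have \<sigma>: "\<And>V. V \<in> C \<Longrightarrow> \<sigma> V \<in> carrier (spec_sections A V)"
      and comp: "\<And>V W. V \<in> C \<Longrightarrow> W \<in> C \<Longrightarrow> restrict (\<sigma> V) (V \<inter> W) = restrict (\<sigma> W) (V \<inter> W)" by blast+
    define s where "s = (\<lambda>\<pp>\<in>\<Union>C. \<sigma> (SOME V. V \<in> C \<and> \<pp> \<in> V) \<pp>)"
    have s: "s \<pp> = \<sigma> V \<pp>" if "V \<in> C" "\<pp> \<in> V" for V \<pp>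
    proof -
      have W: "(SOME V. V \<in> C \<and> \<pp> \<in> V) \<in> C \<and> \<pp> \<in> (SOME V. V \<in> C \<and> \<pp> \<in> V)"
        using someI[of "\<lambda>V. V \<in> C \<and> \<pp> \<in> V" V] that by blast
      then have "\<sigma> V \<pp> = \<sigma> (SOME V. V \<in> C \<and> \<pp> \<in> V) \<pp>"
        using fun_cong[OF comp[OF that(1), of "SOME V. V \<in> C \<and> \<pp> \<in> V"], of \<pp>] that by simp
      then show ?thesis using that unfolding s_def by auto
    qed
    have "s \<in> carrier (spec_sections A (\<Union>C))"
    proof (rule spec_secI[OF UC])
      fix \<pp> assume "\<pp> \<in> \<Union>C"
      then obtain V where V: "V \<in> C" "\<pp> \<in> V" by blast
      obtain W a f where 1: "openin (zariski A) W" "\<pp> \<in> W" "W \<subseteq> V" "a \<in> carrier A" "f \<in> carrier A"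
        "\<forall>\<qq>\<in>W. f \<notin> \<qq> \<and> \<sigma> V \<qq> = loc_frac A \<qq> a f" using spec_secE[OF \<sigma>[OF V(1)] V(2)] .
      have "s \<qq> = \<sigma> V \<qq>" if "\<qq> \<in> W" for \<qq> using s[OF V(1)] 1(3) that by blast
      moreover have "W \<subseteq> \<Union>C" using 1(3) V(1) by blast
      ultimately show "\<exists>W a f. openin (zariski A) W \<and> \<pp> \<in> W \<and> W \<subseteq> \<Union>C \<and> a \<in> carrier A \<and> f \<in> carrier A \<and>
        (\<forall>\<qq>\<in>W. f \<notin> \<qq> \<and> s \<qq> = loc_frac A \<qq> a f)"
        using 1 by (intro exI[of _ W] exI[of _ a] exI[of _ f]) simp
    qed (simp add: s_def)
    moreover have "restrict s V = \<sigma> V" if "V \<in> C" for V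
      by (rule extensionalityI[of _ V]) (use that s spec_sec_ext[OF \<sigma>] in auto)
    ultimately show ?case by blast
  qed
qed

text \<open>A representation of the value at one prime by a prescribed fraction extends to a
  neighbourhood: the equality of two fractions at \<open>\<pp>\<close> is witnessed by a single
  element outside \<open>\<pp>\<close>, and the same witness works at every prime that avoids
  it.\<close>

lemma sec_frac_near:
  assumes U: "openin (zariski A) U" and s: "s \<in> carrier (spec_sections A U)" and p: "\<pp> \<in> U"
    and a: "a \<in> carrier A" and g: "g \<in> carrier A - \<pp>" and e: "s \<pp> = loc_frac A \<pp> a g"
  obtains V where "openin (zariski A) V" "\<pp> \<in> V" "V \<subseteq> U" "\<forall>\<qq>\<in>V. g \<notin> \<qq> \<and> s \<qq> = loc_frac A \<qq> a g"
proof -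
  interpret p: prime_spot \<pp> A using open_prime[OF U p] .
  obtain V b f where V: "openin (zariski A) V" "\<pp> \<in> V" "V \<subseteq> U" "b \<in> carrier A" "f \<in> carrier A"
      "\<forall>\<qq>\<in>V. f \<notin> \<qq> \<and> s \<qq> = loc_frac A \<qq> b f" using spec_secE[OF s p] .
  obtain k where k: "k \<in> carrier A - \<pp>" "k \<otimes> (g \<otimes> b) = k \<otimes> (f \<otimes> a)"
    using e V p.loc_frac_eq_iff[of b f a g] a g by auto
  let ?W = "V \<inter> basic_open A k \<inter> basic_open A g"
  have "openin (zariski A) ?W" using V(1) k(1) g openin_basic_open[OF A_cring] by blast
  moreover have "\<pp> \<in> ?W" using V k g p.primeideal_axioms by (auto simp: basic_open_def)
  moreover have "g \<notin> \<qq> \<and> s \<qq> = loc_frac A \<qq> a g" if q: "\<qq> \<in> ?W" for \<qq>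
  proof -
    interpret q: prime_spot \<qq> A using q open_prime[OF V(1)] by blast
    show ?thesis using V q k a g q.loc_frac_eq_iff[of b f a g] by (auto simp: basic_open_def)
  qed
  ultimately show ?thesis using that[of ?W] V(3) by blast
qed

text \<open>The fraction is described by the equation that multiplying it by its denominator gives
  its numerator. An equation between sections, with a unit as coefficient, survives pullback along
  any morphism, whereas a fraction at a prime does not.\<close>

lemma const_mult_frac:
  assumes V: "openin (zariski A) V" and a: "a \<in> carrier A" and g: "g \<in> carrier A"
    and s: "\<And>\<qq>. \<qq> \<in> V \<Longrightarrow> g \<notin> \<qq> \<and> s \<qq> = loc_frac A \<qq> a g"
  shows "const_sec A V g \<otimes>\<^bsub>spec_sections A V\<^esub> s = const_sec A V a"
    and "const_sec A V g \<in> Units (spec_sections A V)"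
proof -
  have "loc_frac A \<qq> g \<one> \<otimes>\<^bsub>localization A \<qq>\<^esub> loc_frac A \<qq> b g = loc_frac A \<qq> b \<one>"
    if q: "\<qq> \<in> V" and b: "b \<in> carrier A" for \<qq> b
  proof -
    interpret q: prime_spot \<qq> A using q open_prime[OF V] by blast
    have "\<one> \<otimes> (\<one> \<otimes> (g \<otimes> b)) = \<one> \<otimes> ((\<one> \<otimes> g) \<otimes> b)" using b g by simp
    then show ?thesis using s[OF q] g b q.one_compl q.compl_mult[OF q.one_compl, of g]
      by (simp add: q.loc_mult q.loc_frac_eq_iff) blast
  qed
  note * = this
  show "const_sec A V g \<otimes>\<^bsub>spec_sections A V\<^esub> s = const_sec A V a"
    unfolding const_sec_def spec_ops using * s a by (auto intro!: restrict_ext)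
  interpret V: cring "spec_sections A V" by (rule spec_cring[OF V])
  let ?t = "\<lambda>\<pp>\<in>V. loc_frac A \<pp> \<one> g"
  have t: "?t \<in> carrier (spec_sections A V)" using frac_sec[OF V one_closed g] s by blast
  have "const_sec A V g \<otimes>\<^bsub>spec_sections A V\<^esub> ?t = \<one>\<^bsub>spec_sections A V\<^esub>"
    unfolding const_sec_def spec_ops using *[OF _ one_closed] prime_spot.loc_one[OF open_prime[OF V]]
    by (auto intro!: restrict_ext)
  then show "const_sec A V g \<in> Units (spec_sections A V)"
    using t const_sec_closed[OF V g] V.m_comm[OF t const_sec_closed[OF V g]] unfolding Units_def by auto
qed

lemma eval_hom:
  assumes U: "openin (zariski A) U" and p: "\<pp> \<in> U"
  shows "(\<lambda>s. s \<pp>) \<in> ring_hom (spec_sections A U) (localization A \<pp>)"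
  using p by (intro ring_hom_memI) (auto simp: spec_sec_val spec_ops)

text \<open>If the value at \<open>\<pp>\<close> is a unit, its numerator avoids
  \<open>\<pp>\<close> and is invertible on its own basic open set. There the section is a factor of
  an invertible constant section, hence invertible.\<close>

lemma unit_near_Spec:
  assumes U: "openin (zariski A) U" and s: "s \<in> carrier (spec_sections A U)" and p: "\<pp> \<in> U"
  shows "unit_near (Spec A) \<pp> U s \<longleftrightarrow> s \<pp> \<in> Units (localization A \<pp>)"
proof
  interpret p: prime_spot \<pp> A using open_prime[OF U p] .
  assume "unit_near (Spec A) \<pp> U s"
  then obtain W where W: "openin (zariski A) W" "\<pp> \<in> W" "W \<subseteq> U" "restrict s W \<in> Units (spec_sections A W)"
    unfolding unit_near_def by auto
  then show "s \<pp> \<in> Units (localization A \<pp>)"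
    using ring_hom_Units[OF eval_hom[OF W(1,2)] spec_cring[OF W(1)] p.loc_cring W(4)] by simp
next
  interpret p: prime_spot \<pp> A using open_prime[OF U p] .
  assume u: "s \<pp> \<in> Units (localization A \<pp>)"
  obtain a f where *: "a \<in> carrier A" "f \<in> carrier A - \<pp>" "s \<pp> = loc_frac A \<pp> a f"
    using spec_sec_val[OF s p] unfolding p.loc_carrier by blast
  have a: "a \<notin> \<pp>" using u * p.loc_frac_unit_iff by simp
  obtain V where V: "openin (zariski A) V" "\<pp> \<in> V" "V \<subseteq> U" "\<forall>\<qq>\<in>V. f \<notin> \<qq> \<and> s \<qq> = loc_frac A \<qq> a f"
    using sec_frac_near[OF U s p *] .
  let ?W = "V \<inter> basic_open A a"
  have W: "openin (zariski A) ?W" using V(1) * openin_basic_open[OF A_cring] by blast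
  have W': "\<And>\<qq>. \<qq> \<in> ?W \<Longrightarrow> a \<notin> \<qq>" by (auto simp: basic_open_def)
  interpret W: cring "spec_sections A ?W" by (rule spec_cring[OF W])
  have ua: "const_sec A ?W a \<in> Units (spec_sections A ?W)"
    by (rule const_mult_frac(2)[OF W _ *(1), of "\<one>" "\<lambda>\<qq>. loc_frac A \<qq> \<one> a"]) (use W' in auto)
  have f: "f \<in> carrier A" using *(2) by blast
  have sW: "const_sec A ?W f \<otimes>\<^bsub>spec_sections A ?W\<^esub> restrict s ?W = const_sec A ?W a"
    using const_mult_frac(1)[OF W *(1) f, of "restrict s ?W"] V(4) by auto
  have rs: "restrict s ?W \<in> carrier (spec_sections A ?W)" using restrict_sec[OF W _ s] V(3) by blast
  have "restrict s ?W \<in> Units (spec_sections A ?W)"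
    using W.unit_factor[of "restrict s ?W" "const_sec A ?W f"] ua sW rs const_sec_closed[OF W f]
      W.m_comm[OF rs const_sec_closed[OF W f]] by simp
  moreover have "\<pp> \<in> ?W" using V a p.primeideal_axioms by (auto simp: basic_open_def)
  ultimately show "unit_near (Spec A) \<pp> U s" unfolding unit_near_def using W V(3)
    by (intro exI[of _ ?W]) auto
qed

lemma spec_locally_ringed: "locally_ringed (Spec A)"
  unfolding locally_ringed_iff
proof (intro conjI ballI allI impI, goal_cases)
  case 1 show ?case by (rule spec_sheaf)
next
  case (2 \<pp> U)
  then have U: "openin (zariski A) U" "\<pp> \<in> U" by auto
  interpret p: prime_spot \<pp> A using open_prime[OF U] .
  show ?case
  proof
    assume "\<one>\<^bsub>sections (Spec A) U\<^esub> = \<zero>\<^bsub>sections (Spec A) U\<^esub>"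
    then have "\<one>\<^bsub>localization A \<pp>\<^esub> = \<zero>\<^bsub>localization A \<pp>\<^esub>"
      using U by (simp add: spec_ops) (metis restrict_apply')
    then obtain k where "k \<in> carrier A - \<pp>" "k \<otimes> \<one> = \<zero>"
      using p.loc_frac_zero_iff[OF one_closed p.one_compl] p.loc_one by auto
    then show False using p.zero_closed by auto
  qed
next
  case (3 \<pp> U s t)
  then have U: "openin (zariski A) U" "\<pp> \<in> U" by auto
  interpret p: prime_spot \<pp> A using open_prime[OF U] .
  interpret U: cring "spec_sections A U" by (rule spec_cring[OF U(1)])
  have st: "s \<in> carrier (spec_sections A U)" "t \<in> carrier (spec_sections A U)" using 3 by auto
  obtain a f where 1: "a \<in> carrier A" "f \<in> carrier A - \<pp>" "s \<pp> = loc_frac A \<pp> a f"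
    using spec_sec_val[OF st(1) U(2)] unfolding p.loc_carrier by blast
  obtain b g where 2: "b \<in> carrier A" "g \<in> carrier A - \<pp>" "t \<pp> = loc_frac A \<pp> b g"
    using spec_sec_val[OF st(2) U(2)] unfolding p.loc_carrier by blast
  have "a \<otimes> g \<oplus> b \<otimes> f \<notin> \<pp>"
    using 3(5) unit_near_Spec[OF U(1) U.a_closed[OF st] U(2)] 1 2 U(2)
      p.loc_frac_unit_iff[of "a \<otimes> g \<oplus> b \<otimes> f" "f \<otimes> g"] p.compl_mult[OF 1(2) 2(2)]
    by (simp add: spec_ops p.loc_add)
  then have "a \<notin> \<pp> \<or> b \<notin> \<pp>" using 1 2 p.I_r_closed p.a_closed by auto
  then show ?case using 1 2 unit_near_Spec[OF U(1) st(1) U(2)] unit_near_Spec[OF U(1) st(2) U(2)]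
    by (simp add: p.loc_frac_unit_iff)
qed

lemma const_hom:
  assumes U: "openin (zariski A) U" shows "const_sec A U \<in> ring_hom A (spec_sections A U)"
proof (rule ring_hom_memI)
  show "const_sec A U \<one> = \<one>\<^bsub>spec_sections A U\<^esub>"
    unfolding const_sec_def spec_ops by (auto intro!: restrict_ext simp: prime_spot.loc_one[OF open_prime[OF U]])
  fix a b assume a: "a \<in> carrier A" and b: "b \<in> carrier A"
  show "const_sec A U a \<in> carrier (spec_sections A U)" by (rule const_sec_closed[OF U a])
  have "loc_frac A \<pp> (a \<otimes> b) \<one> = loc_frac A \<pp> a \<one> \<otimes>\<^bsub>localization A \<pp>\<^esub> loc_frac A \<pp> b \<one> \<and>
     loc_frac A \<pp> (a \<oplus> b) \<one> = loc_frac A \<pp> a \<one> \<oplus>\<^bsub>localization A \<pp>\<^esub> loc_frac A \<pp> b \<one>" if "\<pp> \<in> U" for \<pp>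
    using prime_spot.loc_mult[OF open_prime[OF U that] a _ b] prime_spot.loc_add[OF open_prime[OF U that] a _ b]
      prime_spot.one_compl[OF open_prime[OF U that]] a b by simp
  then show "const_sec A U (a \<otimes> b) = const_sec A U a \<otimes>\<^bsub>spec_sections A U\<^esub> const_sec A U b"
    "const_sec A U (a \<oplus> b) = const_sec A U a \<oplus>\<^bsub>spec_sections A U\<^esub> const_sec A U b"
    unfolding const_sec_def spec_ops by (auto intro!: restrict_ext)
qed

lemma restrict_const: "V \<subseteq> U \<Longrightarrow> restrict (const_sec A U a) V = const_sec A V a"
  unfolding const_sec_def by (auto simp: fun_eq_iff)

end

subsection \<open>Morphisms to affine spectra\<close>

lemma inv_img_points: "morphism X Y f \<Longrightarrow> inv_img X f (points Y) = points X"
  using mor_pts by (auto simp: inv_img_def)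

lemma (in cring) unit_cancel_eq:
  assumes "u \<in> Units R" "x \<in> carrier R" "y \<in> carrier R" "u \<otimes> x = u \<otimes> y" shows "x = y"
  using assms by (metis Units_l_cancel)

text \<open>The universal property of localization. The conclusion is an equation instead of a
  quotient in \<open>B\<close>; since the images of denominators are units, this equation has
  exactly one solution, and the solution does not depend on the fraction.\<close>

lemma (in prime_spot) loc_lift:
  assumes B: "cring B" and \<gamma>: "\<gamma> \<in> ring_hom R B" and u: "\<And>f. f \<in> carrier R - I \<Longrightarrow> \<gamma> f \<in> Units B"
  obtains \<eta> where "\<eta> \<in> ring_hom (localization R I) B"
    "\<And>a f. a \<in> carrier R \<Longrightarrow> f \<in> carrier R - I \<Longrightarrow> \<eta> (loc_frac R I a f) \<otimes>\<^bsub>B\<^esub> \<gamma> f = \<gamma> a"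
proof -
  interpret B: cring B by (rule B)
  note gc = ring_hom_closed[OF \<gamma>] and gm = ring_hom_mult[OF \<gamma>] and ga = ring_hom_add[OF \<gamma>] and g1 = ring_hom_one[OF \<gamma>]
  define \<eta> where "\<eta> \<xi> = (SOME y. \<exists>a f. a \<in> carrier R \<and> f \<in> carrier R - I \<and> \<xi> = loc_frac R I a f \<and> y \<in> carrier B \<and> y \<otimes>\<^bsub>B\<^esub> \<gamma> f = \<gamma> a)" for \<xi>
  have ex: "\<exists>y\<in>carrier B. y \<otimes>\<^bsub>B\<^esub> \<gamma> f = \<gamma> a" if "a \<in> carrier R" "f \<in> carrier R - I" for a f
    using that u[OF that(2)] gc by (intro bexI[of _ "\<gamma> a \<otimes>\<^bsub>B\<^esub> inv\<^bsub>B\<^esub> (\<gamma> f)"]) (auto simp: B.m_assoc)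
  have wd: "y \<otimes>\<^bsub>B\<^esub> \<gamma> g = \<gamma> b" if y: "y \<in> carrier B" "y \<otimes>\<^bsub>B\<^esub> \<gamma> f = \<gamma> a"
    and a: "a \<in> carrier R" "f \<in> carrier R - I" and b: "b \<in> carrier R" "g \<in> carrier R - I"
    and e: "loc_frac R I a f = loc_frac R I b g" for y a f b g
  proof -
    obtain k where k: "k \<in> carrier R - I" "k \<otimes> (g \<otimes> a) = k \<otimes> (f \<otimes> b)" using e loc_frac_eq_iff[OF a b] by blast
    have c: "\<gamma> k \<in> carrier B" "\<gamma> f \<in> carrier B" "\<gamma> g \<in> carrier B" "\<gamma> a \<in> carrier B" "\<gamma> b \<in> carrier B" using gc k a b by auto
    have "\<gamma> (k \<otimes> (g \<otimes> a)) = \<gamma> k \<otimes>\<^bsub>B\<^esub> (\<gamma> g \<otimes>\<^bsub>B\<^esub> \<gamma> a)"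
      "\<gamma> (k \<otimes> (f \<otimes> b)) = \<gamma> k \<otimes>\<^bsub>B\<^esub> (\<gamma> f \<otimes>\<^bsub>B\<^esub> \<gamma> b)" using k(1) a b gm by auto
    then have "\<gamma> k \<otimes>\<^bsub>B\<^esub> (\<gamma> g \<otimes>\<^bsub>B\<^esub> \<gamma> a) = \<gamma> k \<otimes>\<^bsub>B\<^esub> (\<gamma> f \<otimes>\<^bsub>B\<^esub> \<gamma> b)" using k(2) by simp
    then have "\<gamma> g \<otimes>\<^bsub>B\<^esub> \<gamma> a = \<gamma> f \<otimes>\<^bsub>B\<^esub> \<gamma> b" using B.unit_cancel_eq[OF u[OF k(1)]] c by auto
    then have "\<gamma> f \<otimes>\<^bsub>B\<^esub> (y \<otimes>\<^bsub>B\<^esub> \<gamma> g) = \<gamma> f \<otimes>\<^bsub>B\<^esub> \<gamma> b" using c y(1) y(2)[symmetric] by (simp add: B.m_ac)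
    then show ?thesis using B.unit_cancel_eq[OF u[OF a(2)]] c y by auto
  qed
  have \<eta>: "\<eta> (loc_frac R I a f) \<in> carrier B" "\<eta> (loc_frac R I a f) \<otimes>\<^bsub>B\<^esub> \<gamma> f = \<gamma> a"
    if af: "a \<in> carrier R" "f \<in> carrier R - I" for a f
  proof -
    have "\<exists>y b g. b \<in> carrier R \<and> g \<in> carrier R - I \<and> loc_frac R I a f = loc_frac R I b g \<and> y \<in> carrier B \<and> y \<otimes>\<^bsub>B\<^esub> \<gamma> g = \<gamma> b"
      using ex[OF af] af by blast
    from someI_ex[OF this] obtain b g where "b \<in> carrier R" "g \<in> carrier R - I" "loc_frac R I a f = loc_frac R I b g"
      "\<eta> (loc_frac R I a f) \<in> carrier B" "\<eta> (loc_frac R I a f) \<otimes>\<^bsub>B\<^esub> \<gamma> g = \<gamma> b" unfolding \<eta>_def[symmetric] by blast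
    then show "\<eta> (loc_frac R I a f) \<in> carrier B" "\<eta> (loc_frac R I a f) \<otimes>\<^bsub>B\<^esub> \<gamma> f = \<gamma> a" using wd af by metis+
  qed
  have \<eta>_eq: "\<eta> (loc_frac R I a f) = y" if "a \<in> carrier R" "f \<in> carrier R - I" "y \<in> carrier B" "y \<otimes>\<^bsub>B\<^esub> \<gamma> f = \<gamma> a" for a f y
    using \<eta>[OF that(1,2)] that B.unit_cancel_eq[OF u[OF that(2)]] gc by (metis B.Units_closed B.m_comm u)
  have "\<eta> \<in> ring_hom (localization R I) B"
  proof (rule ring_hom_memI)
    fix x assume "x \<in> carrier (localization R I)"
    then show "\<eta> x \<in> carrier B" unfolding loc_carrier using \<eta> by blast
  next
    fix x y assume "x \<in> carrier (localization R I)" "y \<in> carrier (localization R I)"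
    then obtain a f b g where x: "a \<in> carrier R" "f \<in> carrier R - I" "x = loc_frac R I a f"
      and y: "b \<in> carrier R" "g \<in> carrier R - I" "y = loc_frac R I b g" unfolding loc_carrier by blast
    have c: "\<gamma> f \<in> carrier B" "\<gamma> g \<in> carrier B" using gc x y by auto
    note hx = \<eta>[OF x(1,2)] and hy = \<eta>[OF y(1,2)]
    have fg: "f \<in> carrier R" "g \<in> carrier R" using x y by auto
    show "\<eta> (x \<otimes>\<^bsub>localization R I\<^esub> y) = \<eta> x \<otimes>\<^bsub>B\<^esub> \<eta> y"
      unfolding x(3) y(3) loc_mult[OF x(1,2) y(1,2)]
    proof (rule \<eta>_eq)
      have "\<eta> (loc_frac R I a f) \<otimes>\<^bsub>B\<^esub> \<eta> (loc_frac R I b g) \<otimes>\<^bsub>B\<^esub> (\<gamma> f \<otimes>\<^bsub>B\<^esub> \<gamma> g) =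
        (\<eta> (loc_frac R I a f) \<otimes>\<^bsub>B\<^esub> \<gamma> f) \<otimes>\<^bsub>B\<^esub> (\<eta> (loc_frac R I b g) \<otimes>\<^bsub>B\<^esub> \<gamma> g)"
        using hx(1) hy(1) c by (simp add: B.m_ac)
      then show "\<eta> (loc_frac R I a f) \<otimes>\<^bsub>B\<^esub> \<eta> (loc_frac R I b g) \<otimes>\<^bsub>B\<^esub> \<gamma> (f \<otimes> g) = \<gamma> (a \<otimes> b)"
        using hx hy gm fg x(1) y(1) by simp
    qed (use x y compl_mult hx hy in auto)
    show "\<eta> (x \<oplus>\<^bsub>localization R I\<^esub> y) = \<eta> x \<oplus>\<^bsub>B\<^esub> \<eta> y"
      unfolding x(3) y(3) loc_add[OF x(1,2) y(1,2)]
    proof (rule \<eta>_eq)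
      have "(\<eta> (loc_frac R I a f) \<oplus>\<^bsub>B\<^esub> \<eta> (loc_frac R I b g)) \<otimes>\<^bsub>B\<^esub> (\<gamma> f \<otimes>\<^bsub>B\<^esub> \<gamma> g) =
        (\<eta> (loc_frac R I a f) \<otimes>\<^bsub>B\<^esub> \<gamma> f) \<otimes>\<^bsub>B\<^esub> \<gamma> g \<oplus>\<^bsub>B\<^esub> (\<eta> (loc_frac R I b g) \<otimes>\<^bsub>B\<^esub> \<gamma> g) \<otimes>\<^bsub>B\<^esub> \<gamma> f"
        using hx(1) hy(1) c by (simp add: B.l_distr B.r_distr B.m_ac)
      then show "(\<eta> (loc_frac R I a f) \<oplus>\<^bsub>B\<^esub> \<eta> (loc_frac R I b g)) \<otimes>\<^bsub>B\<^esub> \<gamma> (f \<otimes> g) = \<gamma> (a \<otimes> g \<oplus> b \<otimes> f)"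
        using hx hy gm ga fg x(1) y(1) by simp
    qed (use x y compl_mult hx hy in auto)
  next
    show "\<eta> \<one>\<^bsub>localization R I\<^esub> = \<one>\<^bsub>B\<^esub>" unfolding loc_one
      by (rule \<eta>_eq) (use one_compl g1 in auto)
  qed
  then show ?thesis using that \<eta> by blast
qed

text \<open>
  Pulled back fractions are determined by the pullbacks of the constant sections; so a morphism to
  \<open>Spec A\<close> is the same as a ring homomorphism from \<open>A\<close> to the global sections.
\<close>

definition glob :: "'r ring \<Rightarrow> ('a, 'b, 'r set, 'r set \<Rightarrow> ('r \<times> 'r) set) mor_data \<Rightarrow> 'r \<Rightarrow> 'b" where
  "glob A m a = on_sec m (points (Spec A)) (const_sec A (points (Spec A)) a)"

context spectrum
begin

lemma points_open [simp]: "openin (zariski A) (points (Spec A))"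
  using openin_points_self[of "Spec A"] by simp

lemma glob_hom:
  assumes m: "morphism X (Spec A) m"
  shows "glob A m \<in> ring_hom A (sections X (points X))"
proof -
  have "glob A m = on_sec m (points (Spec A)) \<circ> const_sec A (points (Spec A))" by (auto simp: glob_def)
  moreover have "on_sec m (points (Spec A)) \<in> ring_hom (spec_sections A (points (Spec A))) (sections X (points X))"
    using mor_hom[OF m, of "points (Spec A)"] inv_img_points[OF m] by simp
  ultimately show ?thesis using ring_hom_trans[OF const_hom[OF points_open]] by simp
qed

lemma glob_closed: "morphism X (Spec A) m \<Longrightarrow> a \<in> carrier A \<Longrightarrow> glob A m a \<in> carrier (sections X (points X))"
  by (rule ring_hom_closed[OF glob_hom])

lemma const_unit_near:
  assumes "\<pp> \<in> points (Spec A)" "a \<in> carrier A"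
  shows "unit_near (Spec A) \<pp> (points (Spec A)) (const_sec A (points (Spec A)) a) \<longleftrightarrow> a \<notin> \<pp>"
proof -
  interpret p: prime_spot \<pp> A using open_prime[OF points_open assms(1)] .
  show ?thesis using unit_near_Spec[OF points_open const_sec_closed[OF points_open assms(2)] assms(1)] assms
      p.loc_frac_unit_iff[OF assms(2) p.one_compl] by (simp add: const_sec_def)
qed

text \<open>Locality of the stalk maps is what makes the map on points a consequence of the map on
  functions: the prime attached to \<open>x\<close> consists of the elements whose pullbacks are not
  invertible near \<open>x\<close>.\<close>

lemma mor_spec_pts:
  assumes X: "locally_ringed X" and m: "morphism X (Spec A) m" and x: "x \<in> points X"
  shows "a \<in> on_pts m x \<longleftrightarrow> a \<in> carrier A \<and> \<not> unit_near X x (points X) (glob A m a)"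
proof -
  have p: "on_pts m x \<in> points (Spec A)" by (rule mor_pts[OF m x])
  interpret p: prime_spot "on_pts m x" A using open_prime[OF points_open p] .
  have "unit_near X x (points X) (glob A m a) \<longleftrightarrow> a \<notin> on_pts m x" if a: "a \<in> carrier A"
    using mor_unit_near[OF X spec_locally_ringed m x openin_points_self p] const_sec_closed[OF points_open a]
      const_unit_near[OF p a] inv_img_points[OF m] by (simp add: glob_def)
  then show ?thesis using p.Icarr by blast
qed

lemma mor_const:
  assumes m: "morphism X (Spec A) m" and V: "openin (zariski A) V" and a: "a \<in> carrier A"
  shows "on_sec m V (const_sec A V a) = restrn X (points X) (inv_img X m V) (glob A m a)"
proof -
  have "V \<subseteq> points (Spec A)" using openin_points[of "Spec A" V] V by simp
  then show ?thesis
    using mor_nat[OF m openin_points_self, of V "const_sec A (points (Spec A)) a"] V const_sec_closed[OF points_open a]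
      inv_img_points[OF m] restrict_const[of V "points (Spec A)" a] by (simp add: glob_def)
qed

text \<open>Pullback of the equation in \<open>const_mult_frac\<close>. As its coefficient is a
  unit, the pullback of \<open>s\<close> near \<open>x\<close> is determined by pullbacks of
  constants.\<close>

lemma mor_spec_frac:
  assumes X: "locally_ringed X" and m: "morphism X (Spec A) m" and U: "openin (zariski A) U"
    and s: "s \<in> carrier (spec_sections A U)" and x: "x \<in> inv_img X m U"
    and a: "a \<in> carrier A" and g: "g \<in> carrier A - on_pts m x" and e: "s (on_pts m x) = loc_frac A (on_pts m x) a g"
  obtains N where "openin (topol X) N" "x \<in> N" "N \<subseteq> inv_img X m U"
    "restrn X (points X) N (glob A m g) \<in> Units (sections X N)"
    "restrn X (points X) N (glob A m g) \<otimes>\<^bsub>sections X N\<^esub> restrn X (inv_img X m U) N (on_sec m U s)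
       = restrn X (points X) N (glob A m a)"
proof -
  have x': "x \<in> points X" "on_pts m x \<in> U" using x by (auto simp: inv_img_def)
  have g': "g \<in> carrier A" using g by blast
  obtain V where V: "openin (zariski A) V" "on_pts m x \<in> V" "V \<subseteq> U" "\<forall>\<qq>\<in>V. g \<notin> \<qq> \<and> s \<qq> = loc_frac A \<qq> a g"
    using sec_frac_near[OF U s x'(2) a g e] .
  have 1: "const_sec A V g \<otimes>\<^bsub>spec_sections A V\<^esub> restrict s V = const_sec A V a"
    "const_sec A V g \<in> Units (spec_sections A V)"
    using const_mult_frac[OF V(1) a g', of "restrict s V"] V(4) by auto
  have V': "openin (topol (Spec A)) V" using V(1) by simp
  have rs: "restrict s V \<in> carrier (spec_sections A V)" by (rule restrict_sec[OF V(1,3) s])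
  have hom: "on_sec m V \<in> ring_hom (spec_sections A V) (sections X (inv_img X m V))" using mor_hom[OF m V'] by simp
  have nat: "on_sec m V (restrict s V) = restrn X (inv_img X m U) (inv_img X m V) (on_sec m U s)"
    using mor_nat[OF m, of U V s] U V s by simp
  show ?thesis
  proof (rule that[of "inv_img X m V"])
    show "openin (topol X) (inv_img X m V)" by (rule mor_open[OF m V'])
    show "x \<in> inv_img X m V" using x' V(2) by (simp add: inv_img_def)
    show "inv_img X m V \<subseteq> inv_img X m U" by (rule inv_img_mono[OF V(3)])
    show "restrn X (points X) (inv_img X m V) (glob A m g) \<in> Units (sections X (inv_img X m V))"
      using ring_hom_Units[OF hom spec_cring[OF V(1)] presheaf.cring_sec[OF locally_ringed_presheaf[OF X] mor_open[OF m V']] 1(2)]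
        mor_const[OF m V(1) g'] by simp
    show "restrn X (points X) (inv_img X m V) (glob A m g) \<otimes>\<^bsub>sections X (inv_img X m V)\<^esub>
        restrn X (inv_img X m U) (inv_img X m V) (on_sec m U s) = restrn X (points X) (inv_img X m V) (glob A m a)"
      using ring_hom_mult[OF hom const_sec_closed[OF V(1) g'] rs] mor_const[OF m V(1) g'] mor_const[OF m V(1) a] 1(1) nat by simp
  qed
qed

text \<open>On points the claim is \<open>mor_spec_pts\<close>. On sections, both pullbacks solve
  near each point the same linear equation with a unit as coefficient.\<close>

lemma mor_spec_eqI:
  assumes X: "locally_ringed X" and m: "morphism X (Spec A) m" and n: "morphism X (Spec A) n"
    and eq: "\<And>a. a \<in> carrier A \<Longrightarrow> glob A m a = glob A n a"
  shows "m = n"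
proof (rule mor_eqI[OF m n])
  interpret X: presheaf X by (rule locally_ringed_presheaf[OF X])
  have P: "on_pts m x = on_pts n x" if x: "x \<in> points X" for x
  proof (rule Set.set_eqI)
    fix a show "a \<in> on_pts m x \<longleftrightarrow> a \<in> on_pts n x"
      using mor_spec_pts[OF X m x, of a] mor_spec_pts[OF X n x, of a] eq by auto
  qed
  then show "\<And>x. x \<in> points X \<Longrightarrow> on_pts m x = on_pts n x" .
  fix U s assume U0: "openin (topol (Spec A)) U" and "s \<in> carrier (sections (Spec A) U)"
  then have U: "openin (zariski A) U" and s: "s \<in> carrier (spec_sections A U)" by auto
  have e: "inv_img X n U = inv_img X m U" using P by (auto simp: inv_img_def)
  have sm: "on_sec m U s \<in> carrier (sections X (inv_img X m U))" using mor_sec[OF m U0] s by simp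
  have sn: "on_sec n U s \<in> carrier (sections X (inv_img X m U))" using mor_sec[OF n U0] s e by simp
  note O = mor_open[OF m U0]
  show "on_sec m U s = on_sec n U s"
  proof (rule sheaf_eqI[OF locally_ringed_sheaf[OF X] O sm sn])
    fix x assume x: "x \<in> inv_img X m U"
    then have x': "x \<in> points X" "on_pts m x \<in> U" by (auto simp: inv_img_def)
    interpret p: prime_spot "on_pts m x" A using open_prime[OF U x'(2)] .
    obtain a g where ag: "a \<in> carrier A" "g \<in> carrier A - on_pts m x" "s (on_pts m x) = loc_frac A (on_pts m x) a g"
      using spec_sec_val[OF s x'(2)] unfolding p.loc_carrier by blast
    obtain N where N: "openin (topol X) N" "x \<in> N" "N \<subseteq> inv_img X m U"
      "restrn X (points X) N (glob A m g) \<in> Units (sections X N)"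
      "restrn X (points X) N (glob A m g) \<otimes>\<^bsub>sections X N\<^esub> restrn X (inv_img X m U) N (on_sec m U s)
         = restrn X (points X) N (glob A m a)"
      using mor_spec_frac[OF X m U s x ag] .
    obtain N' where N': "openin (topol X) N'" "x \<in> N'" "N' \<subseteq> inv_img X m U"
      "restrn X (points X) N' (glob A n g) \<in> Units (sections X N')"
      "restrn X (points X) N' (glob A n g) \<otimes>\<^bsub>sections X N'\<^esub> restrn X (inv_img X m U) N' (on_sec n U s)
         = restrn X (points X) N' (glob A n a)"
      using mor_spec_frac[OF X n U s, of x a g] ag P[OF x'(1)] e x by (simp only: e) metis
    let ?M = "N \<inter> N'"
    have M: "openin (topol X) ?M" using N(1) N'(1) by blast
    interpret M: cring "sections X ?M" by (rule X.cring_sec[OF M])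
    have g: "g \<in> carrier A" using ag by blast
    have NP: "N \<subseteq> points X" "N' \<subseteq> points X" using N(1) N'(1) openin_points by blast+
    have gc: "glob A m g \<in> carrier (sections X (points X))" "glob A m a \<in> carrier (sections X (points X))"
      using glob_closed[OF m] g ag by auto
    have "restrn X N ?M (restrn X (points X) N (glob A m g) \<otimes>\<^bsub>sections X N\<^esub> restrn X (inv_img X m U) N (on_sec m U s))
      = restrn X (points X) ?M (glob A m a)"
      unfolding N(5) using N(1) M NP gc by simp
    then have 1: "restrn X (points X) ?M (glob A m g) \<otimes>\<^bsub>sections X ?M\<^esub> restrn X (inv_img X m U) ?M (on_sec m U s)
      = restrn X (points X) ?M (glob A m a)"
      using N(1,3) M NP gc sm O by simp
    have "restrn X N' ?M (restrn X (points X) N' (glob A m g) \<otimes>\<^bsub>sections X N'\<^esub> restrn X (inv_img X m U) N' (on_sec n U s))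
      = restrn X (points X) ?M (glob A m a)"
      using N'(5) eq[OF g] eq[OF ag(1)] N'(1) M NP gc by simp
    then have 2: "restrn X (points X) ?M (glob A m g) \<otimes>\<^bsub>sections X ?M\<^esub> restrn X (inv_img X m U) ?M (on_sec n U s)
      = restrn X (points X) ?M (glob A m a)"
      using N'(1,3) M NP gc sn O by simp
    have "restrn X N ?M (restrn X (points X) N (glob A m g)) \<in> Units (sections X ?M)"
      by (rule X.res_Units[OF N(1) M _ N(4)]) blast
    then have u: "restrn X (points X) ?M (glob A m g) \<in> Units (sections X ?M)" using N(1) M NP gc by simp
    have MU: "?M \<subseteq> inv_img X m U" using N(3) by blast
    have "restrn X (inv_img X m U) ?M (on_sec m U s) = restrn X (inv_img X m U) ?M (on_sec n U s)"
      using M.unit_cancel_eq[OF u X.res_closed[OF O M MU sm] X.res_closed[OF O M MU sn]] 1 2 by simp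
    then show "\<exists>W. openin (topol X) W \<and> x \<in> W \<and> W \<subseteq> inv_img X m U \<and>
       restrn X (inv_img X m U) W (on_sec m U s) = restrn X (inv_img X m U) W (on_sec n U s)"
      using M MU N(2) N'(2) by blast
  qed
qed

text \<open>The point over \<open>x\<close> is the inverse image in \<open>A\<close> of the maximal
  ideal of the stalk at \<open>x\<close>. The homomorphism from \<open>A\<close> to the stalk then
  extends to the localization at this prime, which prescribes all germs of the pullback of a
  section; it remains to find sections with the prescribed germs.\<close>

lemma hom_to_Spec:
  assumes X: "locally_ringed X" and \<rho>: "\<rho> \<in> ring_hom A (sections X (points X))"
  obtains m where "morphism X (Spec A) m" "\<And>a. a \<in> carrier A \<Longrightarrow> glob A m a = \<rho> a"
proof -
  interpret X: presheaf X by (rule locally_ringed_presheaf[OF X])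
  let ?P = "points X"
  note rc = ring_hom_closed[OF \<rho>]
  have rep: "(?P, \<rho> a) \<in> X.reps x" if "x \<in> ?P" "a \<in> carrier A" for x a
    using that rc unfolding X.reps_def by auto
  define \<gamma> where "\<gamma> x a = germ X x ?P (\<rho> a)" for x a
  have \<gamma>_hom: "\<gamma> x \<in> ring_hom A (stalk X x)" if x: "x \<in> ?P" for x
    using ring_hom_trans[OF \<rho> X.stalk_hom[OF x openin_points_self x]] unfolding \<gamma>_def comp_def .
  have \<gamma>_unit: "\<gamma> x a \<in> Units (stalk X x) \<longleftrightarrow> unit_near X x ?P (\<rho> a)" if "x \<in> ?P" "a \<in> carrier A" for x a
    unfolding \<gamma>_def by (rule X.germ_Units_iff[OF that(1) rep[OF that]])
  \<comment> \<open>The nonunits of the local ring \<open>stalk X x\<close> form a prime ideal; this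
    is its inverse image.\<close>
  define \<phi> where "\<phi> x = {a \<in> carrier A. \<gamma> x a \<notin> Units (stalk X x)}" for x
  have prime: "primeideal (\<phi> x) A" if x: "x \<in> ?P" for x
  proof -
    have loc: "is_local_ring (stalk X x)" using X x unfolding locally_ringed_def by blast
    interpret S: cring "stalk X x" by (rule X.stalk_cring[OF x])
    interpret h: ring_hom_ring A "stalk X x" "\<gamma> x" by (rule ring_hom_ringI2[OF ring_axioms S.ring_axioms \<gamma>_hom[OF x]])
    have "\<phi> x = {a \<in> carrier A. \<gamma> x a \<in> carrier (stalk X x) - Units (stalk X x)}" unfolding \<phi>_def by auto
    then show ?thesis using h.primeideal_vimage[OF A_cring local_ring_nonunits_prime[OF loc]] by simp
  qed
  have spot: "prime_spot (\<phi> x) A" if "x \<in> ?P" for x using primeideal_spot[OF prime[OF that]] .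
  have compl: "f \<in> carrier A - \<phi> x \<longleftrightarrow> f \<in> carrier A \<and> \<gamma> x f \<in> Units (stalk X x)" for f x unfolding \<phi>_def by auto
  have "\<exists>\<eta>. \<eta> \<in> ring_hom (localization A (\<phi> x)) (stalk X x) \<and>
    (\<forall>a f. a \<in> carrier A \<longrightarrow> f \<in> carrier A - \<phi> x \<longrightarrow> \<eta> (loc_frac A (\<phi> x) a f) \<otimes>\<^bsub>stalk X x\<^esub> \<gamma> x f = \<gamma> x a)"
    if x: "x \<in> ?P" for x
  proof -
    have u: "\<gamma> x f \<in> Units (stalk X x)" if "f \<in> carrier A - \<phi> x" for f using that compl by blast
    obtain \<eta> where "\<eta> \<in> ring_hom (localization A (\<phi> x)) (stalk X x)"
      "\<And>a f. a \<in> carrier A \<Longrightarrow> f \<in> carrier A - \<phi> x \<Longrightarrow> \<eta> (loc_frac A (\<phi> x) a f) \<otimes>\<^bsub>stalk X x\<^esub> \<gamma> x f = \<gamma> x a"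
      by (rule prime_spot.loc_lift[OF spot[OF x] X.stalk_cring[OF x] \<gamma>_hom[OF x] u]) auto
    then show ?thesis by blast
  qed
  then obtain \<eta> where \<eta>h: "\<And>x. x \<in> ?P \<Longrightarrow> \<eta> x \<in> ring_hom (localization A (\<phi> x)) (stalk X x)"
    and \<eta>f: "\<And>x a f. x \<in> ?P \<Longrightarrow> a \<in> carrier A \<Longrightarrow> f \<in> carrier A - \<phi> x \<Longrightarrow>
      \<eta> x (loc_frac A (\<phi> x) a f) \<otimes>\<^bsub>stalk X x\<^esub> \<gamma> x f = \<gamma> x a" by metis
  define \<Phi> where "\<Phi> U = {x \<in> ?P. \<phi> x \<in> U}" for U
  have \<Phi>_open: "openin (topol X) (\<Phi> U)" if U: "openin (zariski A) U" for U
  proof (subst openin_subopen, intro ballI)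
    fix x assume x: "x \<in> \<Phi> U"
    then have x': "x \<in> ?P" "\<phi> x \<in> U" unfolding \<Phi>_def by auto
    obtain f where f: "f \<in> carrier A" "\<phi> x \<in> basic_open A f" "basic_open A f \<subseteq> U"
      using U[unfolded openin_zariski[OF A_cring]] x'(2) by blast
    have "\<gamma> x f \<in> Units (stalk X x)" using f unfolding basic_open_def \<phi>_def by auto
    then obtain W where W: "openin (topol X) W" "x \<in> W" "W \<subseteq> ?P" "restrn X ?P W (\<rho> f) \<in> Units (sections X W)"
      using \<gamma>_unit[OF x'(1) f(1)] unfolding unit_near_def by blast
    have "y \<in> \<Phi> U" if y: "y \<in> W" for y
    proof -
      have yP: "y \<in> ?P" using y W(3) by blast
      have "unit_near X y ?P (\<rho> f)" unfolding unit_near_def using W y by blast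
      then have "f \<notin> \<phi> y" using \<gamma>_unit[OF yP f(1)] unfolding \<phi>_def by auto
      then show ?thesis using f(3) prime[OF yP] yP unfolding \<Phi>_def basic_open_def by blast
    qed
    then show "\<exists>T. openin (topol X) T \<and> x \<in> T \<and> T \<subseteq> \<Phi> U" using W by blast
  qed
  \<comment> \<open>\<open>G s W t\<close> says that \<open>t\<close> has at each point of
    \<open>W\<close> the germ which the pullback of \<open>s\<close> must have. Germs determine a
    section, so such \<open>t\<close> are unique, and it suffices to find them locally.\<close>
  define G where "G s W t \<longleftrightarrow> t \<in> carrier (sections X W) \<and> (\<forall>x\<in>W. germ X x W t = \<eta> x (s (\<phi> x)))" for s W t
  have G_res: "G s W' (restrn X W W' t)" if "G s W t" "openin (topol X) W" "openin (topol X) W'" "W' \<subseteq> W" for s W t W'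
    using that X.germ_res[of _ W W' t] openin_points[OF that(3)] unfolding G_def by (auto simp: subset_iff)
  have G_eq: "t = t'" if G: "G s W t" "G s W t'" and W: "openin (topol X) W" for s W t t'
  proof (rule sheaf_eqI[OF locally_ringed_sheaf[OF X] W])
    show t: "t \<in> carrier (sections X W)" "t' \<in> carrier (sections X W)" using G unfolding G_def by auto
    fix x assume x: "x \<in> W"
    have "germ X x W t = germ X x W t'" using G x unfolding G_def by auto
    moreover have "(W, t) \<in> X.reps x" "(W, t') \<in> X.reps x" using t W x unfolding X.reps_def by auto
    ultimately show "\<exists>V. openin (topol X) V \<and> x \<in> V \<and> V \<subseteq> W \<and> restrn X W V t = restrn X W V t'"
      using X.germ_eq_iff by auto
  qed
  have G_ex: "\<exists>t. G s (\<Phi> U) t" if U: "openin (zariski A) U" and s: "s \<in> carrier (spec_sections A U)" for U s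
  proof -
    define R where "R W t \<longleftrightarrow> openin (topol X) W \<and> W \<subseteq> \<Phi> U \<and> G s W t" for W t
    have loc: "\<exists>W t. x \<in> W \<and> R W t" if xU: "x \<in> \<Phi> U" for x
    proof -
      from xU have x: "x \<in> ?P" "\<phi> x \<in> U" unfolding \<Phi>_def by auto
      obtain V a f where V: "openin (zariski A) V" "\<phi> x \<in> V" "V \<subseteq> U" "a \<in> carrier A" "f \<in> carrier A"
        "\<forall>\<qq>\<in>V. f \<notin> \<qq> \<and> s \<qq> = loc_frac A \<qq> a f" using spec_secE[OF s x(2)] .
      have "\<gamma> x f \<in> Units (stalk X x)" using V compl[of f x] by auto
      then obtain W0 where W0: "openin (topol X) W0" "x \<in> W0" "W0 \<subseteq> ?P" "restrn X ?P W0 (\<rho> f) \<in> Units (sections X W0)"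
        using \<gamma>_unit[OF x(1) V(5)] unfolding unit_near_def by blast
      let ?W = "W0 \<inter> \<Phi> V"
      have W: "openin (topol X) ?W" "?W \<subseteq> ?P" using W0 \<Phi>_open[OF V(1)] by blast+
      interpret W: cring "sections X ?W" by (rule X.cring_sec[OF W(1)])
      have "restrn X W0 ?W (restrn X ?P W0 (\<rho> f)) \<in> Units (sections X ?W)"
        by (rule X.res_Units[OF W0(1) W(1) _ W0(4)]) blast
      then have u: "restrn X ?P ?W (\<rho> f) \<in> Units (sections X ?W)" using W0 W rc[OF V(5)] by simp
      let ?rf = "restrn X ?P ?W (\<rho> f)" let ?ra = "restrn X ?P ?W (\<rho> a)"
      have ra: "?ra \<in> carrier (sections X ?W)" "?rf \<in> carrier (sections X ?W)" using rc V(4,5) W by auto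
      \<comment> \<open>Near the chosen point \<open>s\<close> is the fraction of \<open>a\<close>
        by \<open>f\<close>, and the image of \<open>f\<close> is a unit on the neighbourhood; so
        the quotient of the images exists there.\<close>
      define t where "t = ?ra \<otimes>\<^bsub>sections X ?W\<^esub> inv\<^bsub>sections X ?W\<^esub> ?rf"
      have t: "t \<in> carrier (sections X ?W)" unfolding t_def using ra u by simp
      have tf: "t \<otimes>\<^bsub>sections X ?W\<^esub> ?rf = ?ra" unfolding t_def using ra u by (simp add: W.m_assoc)
      have "germ X y ?W t = \<eta> y (s (\<phi> y))" if y: "y \<in> ?W" for y
      proof -
        have yP: "y \<in> ?P" and yV: "\<phi> y \<in> V" using y W unfolding \<Phi>_def by auto
        interpret S: cring "stalk X y" by (rule X.stalk_cring[OF yP])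
        have r: "(?W, t) \<in> X.reps y" "(?W, ?rf) \<in> X.reps y" using t ra W y unfolding X.reps_def by auto
        have gf: "germ X y ?W ?rf = \<gamma> y f" "germ X y ?W ?ra = \<gamma> y a"
          unfolding \<gamma>_def using X.germ_res[OF yP openin_points_self W(1) y W(2)] rc V(4,5) by auto
        have 1: "germ X y ?W t \<otimes>\<^bsub>stalk X y\<^esub> \<gamma> y f = \<gamma> y a"
          using X.stalk_mult[OF yP r] tf gf by simp
        have f: "f \<in> carrier A - \<phi> y" using V(5,6) yV by blast
        have 2: "\<eta> y (s (\<phi> y)) \<otimes>\<^bsub>stalk X y\<^esub> \<gamma> y f = \<gamma> y a" using \<eta>f[OF yP V(4) f] V(6) yV by simp
        have c: "germ X y ?W t \<in> carrier (stalk X y)" unfolding X.stalk_carrier[OF yP] using r(1) by force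
        have d: "\<eta> y (s (\<phi> y)) \<in> carrier (stalk X y)"
          using ring_hom_closed[OF \<eta>h[OF yP]] spec_sec_val[OF s] yV V(3) by blast
        have gu: "\<gamma> y f \<in> Units (stalk X y)" using f compl by blast
        show ?thesis using S.unit_cancel_eq[OF gu c d] 1 2 S.m_comm[OF c S.Units_closed[OF gu]] S.m_comm[OF d S.Units_closed[OF gu]] by simp
      qed
      then have "R ?W t" unfolding R_def G_def using W t V(3) unfolding \<Phi>_def by auto
      moreover have "x \<in> ?W" using W0 x V unfolding \<Phi>_def by auto
      ultimately show ?thesis by blast
    qed
    obtain t where t: "t \<in> carrier (sections X (\<Phi> U))" "\<And>W t'. R W t' \<Longrightarrow> restrn X (\<Phi> U) W t = t'"
    proof (rule sheaf_glue[OF locally_ringed_sheaf[OF X] \<Phi>_open[OF U], of R])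
      show "openin (topol X) W \<and> W \<subseteq> \<Phi> U \<and> t \<in> carrier (sections X W)" if "R W t" for W t
        using that unfolding R_def G_def by blast
      show "R W' (restrn X W W' t)" if "R W t" "openin (topol X) W'" "W' \<subseteq> W" for W t W'
        using that G_res[of s W t W'] unfolding R_def by auto
      show "t = t'" if "R W t" "R W t'" for W t t' using that G_eq[of s W t t'] unfolding R_def by simp
      show "\<exists>W t. x \<in> W \<and> R W t" if "x \<in> \<Phi> U" for x by (rule loc[OF that])
    qed (rule that)
    have "germ X x (\<Phi> U) t = \<eta> x (s (\<phi> x))" if x: "x \<in> \<Phi> U" for x
    proof -
      have xP: "x \<in> ?P" using x unfolding \<Phi>_def by simp
      obtain W t' where W: "x \<in> W" "R W t'" using loc[OF x] by blast
      then have W': "openin (topol X) W" "W \<subseteq> \<Phi> U" "G s W t'" unfolding R_def by auto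
      have "germ X x (\<Phi> U) t = germ X x W t'"
        using X.germ_res[OF xP \<Phi>_open[OF U] W'(1) W(1) W'(2) t(1)] t(2)[OF W(2)] by simp
      then show ?thesis using W'(3) W(1) unfolding G_def by simp
    qed
    then show ?thesis unfolding G_def using t(1) by blast
  qed
  define F where "F U s = (SOME t. G s (\<Phi> U) t)" for U s
  have F: "G s (\<Phi> U) (F U s)" if "openin (zariski A) U" "s \<in> carrier (spec_sections A U)" for U s
    unfolding F_def by (rule someI_ex[OF G_ex[OF that]])
  have F_eq: "F U s = t" if "openin (zariski A) U" "s \<in> carrier (spec_sections A U)" "G s (\<Phi> U) t" for U s t
    using G_eq[OF F[OF that(1,2)] that(3) \<Phi>_open[OF that(1)]] .
  define m where "m = \<lparr>on_pts = (\<lambda>x\<in>?P. \<phi> x),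
     on_sec = (\<lambda>U\<in>{U. openin (zariski A) U}. \<lambda>s\<in>carrier (spec_sections A U). F U s)\<rparr>"
  have inv: "inv_img X m U = \<Phi> U" for U unfolding inv_img_def m_def \<Phi>_def by auto
  have sec: "on_sec m U s = F U s" if "openin (zariski A) U" "s \<in> carrier (spec_sections A U)" for U s
    using that unfolding m_def by simp
  have m: "morphism X (Spec A) m"
  proof (rule morphismI[OF X spec_locally_ringed], unfold Spec_simps inv)
    show "on_pts m \<in> extensional ?P" "on_sec m \<in> extensional {V. openin (zariski A) V}"
      "\<And>V. openin (zariski A) V \<Longrightarrow> on_sec m V \<in> extensional (carrier (spec_sections A V))"
      unfolding m_def by auto
    show "on_pts m x \<in> points (Spec A)" if "x \<in> ?P" for x
      using that prime unfolding points_Spec[OF A_cring] m_def by simp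
    fix U assume U: "openin (zariski A) U"
    show O: "openin (topol X) (\<Phi> U)" by (rule \<Phi>_open[OF U])
    interpret S: cring "spec_sections A U" by (rule spec_cring[OF U])
    interpret T: cring "sections X (\<Phi> U)" by (rule X.cring_sec[OF O])
    show "on_sec m U \<in> ring_hom (spec_sections A U) (sections X (\<Phi> U))"
    proof (rule ring_hom_memI)
      fix s t assume s: "s \<in> carrier (spec_sections A U)" and t: "t \<in> carrier (spec_sections A U)"
      have c: "F U s \<in> carrier (sections X (\<Phi> U))" "F U t \<in> carrier (sections X (\<Phi> U))"
        using F[OF U] s t unfolding G_def by auto
      then show "on_sec m U s \<in> carrier (sections X (\<Phi> U))" using sec[OF U s] by simp
      have *: "germ X x (\<Phi> U) (F U s \<otimes>\<^bsub>sections X (\<Phi> U)\<^esub> F U t) = \<eta> x ((s \<otimes>\<^bsub>spec_sections A U\<^esub> t) (\<phi> x)) \<and>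
          germ X x (\<Phi> U) (F U s \<oplus>\<^bsub>sections X (\<Phi> U)\<^esub> F U t) = \<eta> x ((s \<oplus>\<^bsub>spec_sections A U\<^esub> t) (\<phi> x))"
        if x: "x \<in> \<Phi> U" for x
      proof -
        have x': "x \<in> ?P" "\<phi> x \<in> U" using x unfolding \<Phi>_def by auto
        have r: "(\<Phi> U, F U s) \<in> X.reps x" "(\<Phi> U, F U t) \<in> X.reps x" using c O x unfolding X.reps_def by auto
        show ?thesis
          unfolding X.stalk_mult[OF x'(1) r, symmetric] X.stalk_add[OF x'(1) r, symmetric]
          using F[OF U s] F[OF U t] x x'(2) ring_hom_mult[OF \<eta>h[OF x'(1)] spec_sec_val[OF s x'(2)] spec_sec_val[OF t x'(2)]]
            ring_hom_add[OF \<eta>h[OF x'(1)] spec_sec_val[OF s x'(2)] spec_sec_val[OF t x'(2)]]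
          unfolding G_def by (simp add: spec_ops)
      qed
      have st: "s \<otimes>\<^bsub>spec_sections A U\<^esub> t \<in> carrier (spec_sections A U)" "s \<oplus>\<^bsub>spec_sections A U\<^esub> t \<in> carrier (spec_sections A U)"
        using s t by auto
      show "on_sec m U (s \<otimes>\<^bsub>spec_sections A U\<^esub> t) = on_sec m U s \<otimes>\<^bsub>sections X (\<Phi> U)\<^esub> on_sec m U t"
        unfolding sec[OF U s] sec[OF U t] sec[OF U st(1)]
        by (rule F_eq[OF U st(1)]) (use * c in \<open>simp add: G_def\<close>)
      show "on_sec m U (s \<oplus>\<^bsub>spec_sections A U\<^esub> t) = on_sec m U s \<oplus>\<^bsub>sections X (\<Phi> U)\<^esub> on_sec m U t"
        unfolding sec[OF U s] sec[OF U t] sec[OF U st(2)]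
        by (rule F_eq[OF U st(2)]) (use * c in \<open>simp add: G_def\<close>)
    next
      have "germ X x (\<Phi> U) \<one>\<^bsub>sections X (\<Phi> U)\<^esub> = \<eta> x (\<one>\<^bsub>spec_sections A U\<^esub> (\<phi> x))" if x: "x \<in> \<Phi> U" for x
      proof -
        have x': "x \<in> ?P" "\<phi> x \<in> U" using x unfolding \<Phi>_def by auto
        show ?thesis
          unfolding X.stalk_one_U[OF x'(1) O x, symmetric] using ring_hom_one[OF \<eta>h[OF x'(1)]] x'(2) by (simp add: spec_ops)
      qed
      then show "on_sec m U \<one>\<^bsub>spec_sections A U\<^esub> = \<one>\<^bsub>sections X (\<Phi> U)\<^esub>"
        unfolding sec[OF U S.one_closed] by (intro F_eq[OF U S.one_closed]) (simp add: G_def)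
    qed
    show "on_sec m W (restrict s W) = restrn X (\<Phi> U) (\<Phi> W) (on_sec m U s)"
      if W: "openin (zariski A) W" "W \<subseteq> U" and s: "s \<in> carrier (spec_sections A U)" for W s
    proof -
      have S: "\<Phi> W \<subseteq> \<Phi> U" using W(2) unfolding \<Phi>_def by auto
      have "G s (\<Phi> W) (restrn X (\<Phi> U) (\<Phi> W) (F U s))" by (rule G_res[OF F[OF U s] O \<Phi>_open[OF W(1)] S])
      moreover have "restrict s W (\<phi> x) = s (\<phi> x)" if "x \<in> \<Phi> W" for x using that unfolding \<Phi>_def by simp
      ultimately have "G (restrict s W) (\<Phi> W) (restrn X (\<Phi> U) (\<Phi> W) (F U s))" unfolding G_def by simp
      then show ?thesis unfolding sec[OF U s] sec[OF W(1) restrict_sec[OF W s]]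
        by (rule F_eq[OF W(1) restrict_sec[OF W s]])
    qed
    fix x s assume xP: "x \<in> ?P" and xU: "on_pts m x \<in> U" and s: "s \<in> carrier (spec_sections A U)"
      and u: "unit_near X x (\<Phi> U) (on_sec m U s)"
    have mx: "on_pts m x = \<phi> x" using xP unfolding m_def by simp
    have x: "x \<in> \<Phi> U" "\<phi> x \<in> U" using xP xU mx unfolding \<Phi>_def by auto
    interpret p: prime_spot "\<phi> x" A by (rule spot[OF xP])
    interpret St: cring "stalk X x" by (rule X.stalk_cring[OF xP])
    obtain a f where af: "a \<in> carrier A" "f \<in> carrier A - \<phi> x" "s (\<phi> x) = loc_frac A (\<phi> x) a f"
      using spec_sec_val[OF s x(2)] unfolding p.loc_carrier by blast
    have "(\<Phi> U, F U s) \<in> X.reps x" using F[OF U s] O x unfolding G_def X.reps_def by auto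
    then have "\<eta> x (s (\<phi> x)) \<in> Units (stalk X x)"
      using X.germ_Units_iff[OF xP, of "\<Phi> U" "F U s"] u sec[OF U s] F[OF U s] x unfolding G_def by simp
    \<comment> \<open>Equation \<open>\<eta>f\<close> exhibits the image of the numerator as the
      product of the germ of the pullback, a unit by assumption, and the image of the denominator, a
      unit by the choice of the prime.\<close>
    then have "\<gamma> x a \<in> Units (stalk X x)" using \<eta>f[OF xP af(1,2)] af(2,3) compl[of f x] by (metis St.Units_m_closed)
    then have "a \<notin> \<phi> x" unfolding \<phi>_def by auto
    then show "unit_near (Spec A) (on_pts m x) U s"
      using unit_near_Spec[OF U s x(2)] p.loc_frac_unit_iff[OF af(1,2)] af(3) mx by simp
  qed
  have "glob A m a = \<rho> a" if a: "a \<in> carrier A" for a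
  proof -
    have PP: "\<Phi> (points (Spec A)) = ?P" using prime unfolding \<Phi>_def points_Spec[OF A_cring] by auto
    have "germ X x ?P (\<rho> a) = \<eta> x (const_sec A (points (Spec A)) a (\<phi> x))" if x: "x \<in> ?P" for x
    proof -
      interpret p: prime_spot "\<phi> x" A by (rule spot[OF x])
      interpret St: cring "stalk X x" by (rule X.stalk_cring[OF x])
      have "\<eta> x (loc_frac A (\<phi> x) a \<one>) \<otimes>\<^bsub>stalk X x\<^esub> \<gamma> x \<one> = \<gamma> x a" by (rule \<eta>f[OF x a p.one_compl])
      moreover have "\<gamma> x \<one> = \<one>\<^bsub>stalk X x\<^esub>" by (rule ring_hom_one[OF \<gamma>_hom[OF x]])
      moreover have "\<eta> x (loc_frac A (\<phi> x) a \<one>) \<in> carrier (stalk X x)"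
        by (rule ring_hom_closed[OF \<eta>h[OF x] p.loc_frac_carrier[OF a p.one_compl]])
      ultimately have "\<eta> x (loc_frac A (\<phi> x) a \<one>) = \<gamma> x a" by simp
      then show ?thesis using prime[OF x] unfolding \<gamma>_def const_sec_def points_Spec[OF A_cring] by simp
    qed
    then have "G (const_sec A (points (Spec A)) a) (\<Phi> (points (Spec A))) (\<rho> a)"
      unfolding G_def PP using rc[OF a] by simp
    then show ?thesis unfolding glob_def using sec[OF points_open const_sec_closed[OF points_open a]]
        F_eq[OF points_open const_sec_closed[OF points_open a]] by simp
  qed
  then show ?thesis using that m by blast
qed

end

subsection \<open>Localization and quasi-compactness\<close>

text \<open>Otherwise the annihilator of \<open>b\<close> contains no power of \<open>g\<close> and
  lies in a prime that avoids \<open>g\<close>. At this prime \<open>loc\<close> supplies an element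
  of the annihilator outside the prime, a contradiction.\<close>

lemma (in spectrum) annihilated_by_power:
  assumes b: "b \<in> carrier A" and g: "g \<in> carrier A"
    and loc: "\<And>\<pp>. primeideal \<pp> A \<Longrightarrow> g \<notin> \<pp> \<Longrightarrow> \<exists>k\<in>carrier A - \<pp>. k \<otimes> b = \<zero>"
  shows "\<exists>n::nat. g [^] n \<otimes> b = \<zero>"
proof (rule ccontr)
  assume no: "\<not> ?thesis"
  define I where "I = {c \<in> carrier A. c \<otimes> b = \<zero>}"
  have I: "ideal I A"
  proof (rule idealI)
    show "ring A" by (rule ring_axioms)
    show "subgroup I (add_monoid A)"
    proof
      show "x \<otimes>\<^bsub>add_monoid A\<^esub> y \<in> I" if "x \<in> I" "y \<in> I" for x y
        using that b unfolding I_def by (auto simp: l_distr)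
      show "inv\<^bsub>add_monoid A\<^esub> x \<in> I" if "x \<in> I" for x
      proof -
        have "\<ominus> x \<in> I" using that b unfolding I_def by (auto simp: l_minus)
        then show ?thesis by (simp add: a_inv_def)
      qed
    qed (use b in \<open>auto simp: I_def\<close>)
    show "x \<otimes> a \<in> I" "a \<otimes> x \<in> I" if "a \<in> I" "x \<in> carrier A" for a x
      using that b m_assoc[of x a b] m_comm[of a x] unfolding I_def by auto
  qed
  have "g [^] n \<notin> I" for n :: nat using no g unfolding I_def by auto
  then obtain P where P: "primeideal P A" "I \<subseteq> P" "g \<notin> P" using prime_avoiding_powers[OF I g] by metis
  from loc[OF P(1,3)] obtain k where "k \<in> carrier A - P" "k \<otimes> b = \<zero>" by blast
  then show False using P(2) unfolding I_def by blast
qed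

text \<open>The elements whose basic open sets lie in a member of the cover generate the unit ideal,
  since a maximal ideal containing all of them would be an uncovered point. A relation that
  expresses the unit element involves finitely many of them.\<close>

lemma (in spectrum) Spec_compact:
  assumes op: "\<And>U. U \<in> \<U> \<Longrightarrow> openin (zariski A) U" and cov: "points (Spec A) \<subseteq> \<Union>\<U>"
  obtains \<F> where "finite \<F>" "\<F> \<subseteq> \<U>" "points (Spec A) \<subseteq> \<Union>\<F>"
proof -
  define K where "K = {f \<in> carrier A. \<exists>U\<in>\<U>. basic_open A f \<subseteq> U}"
  have KA: "K \<subseteq> carrier A" unfolding K_def by blast
  \<comment> \<open>The ideal generated by \<open>K\<close>, written as the union of the ideals
    generated by finite subsets. So membership of the unit element directly yields finitely many
    generators.\<close>
  define I where "I = {x. \<exists>F. finite F \<and> F \<subseteq> K \<and> x \<in> Idl F}"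
  have Fi: "ideal (Idl F) A" if "F \<subseteq> K" for F by (rule genideal_ideal[OF subset_trans[OF that KA]])
  have mono: "Idl F \<subseteq> Idl G" if "F \<subseteq> G" "G \<subseteq> K" for F G
    by (rule subset_Idl_subset[OF subset_trans[OF that(2) KA] that(1)])
  have I: "ideal I A"
  proof (rule idealI)
    show "ring A" by (rule ring_axioms)
    show "subgroup I (add_monoid A)"
    proof
      show "I \<subseteq> carrier (add_monoid A)"
      proof
        fix x assume "x \<in> I"
        then obtain F where F: "F \<subseteq> K" "x \<in> Idl F" unfolding I_def by blast
        show "x \<in> carrier (add_monoid A)" using ideal.Icarr[OF Fi[OF F(1)] F(2)] by simp
      qed
      show "x \<otimes>\<^bsub>add_monoid A\<^esub> y \<in> I" if xy: "x \<in> I" "y \<in> I" for x y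
      proof -
        obtain F G where "finite F" "F \<subseteq> K" "x \<in> Idl F" "finite G" "G \<subseteq> K" "y \<in> Idl G" using xy unfolding I_def by blast
        then have FG: "finite (F \<union> G)" "F \<union> G \<subseteq> K" "x \<in> Idl (F \<union> G)" "y \<in> Idl (F \<union> G)"
          using mono[of F "F \<union> G"] mono[of G "F \<union> G"] by auto
        interpret J: ideal "Idl (F \<union> G)" A by (rule Fi[OF FG(2)])
        have "x \<oplus> y \<in> Idl (F \<union> G)" using J.a_closed FG by blast
        then show ?thesis unfolding I_def using FG by auto
      qed
      interpret E: ideal "Idl {}" A by (rule Fi) simp
      have "\<zero> \<in> Idl {}" by (rule E.zero_closed)
      then show "\<one>\<^bsub>add_monoid A\<^esub> \<in> I" unfolding I_def by auto
      show "inv\<^bsub>add_monoid A\<^esub> x \<in> I" if x: "x \<in> I" for x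
      proof -
        obtain F where F: "finite F" "F \<subseteq> K" "x \<in> Idl F" using x unfolding I_def by blast
        interpret J: ideal "Idl F" A by (rule Fi[OF F(2)])
        have "\<ominus> x \<in> Idl F" using J.a_inv_closed F by blast
        then show ?thesis unfolding I_def a_inv_def using F by auto
      qed
    qed
    fix a x assume a: "a \<in> I" and x: "x \<in> carrier A"
    obtain F where F: "finite F" "F \<subseteq> K" "a \<in> Idl F" using a unfolding I_def by blast
    interpret J: ideal "Idl F" A by (rule Fi[OF F(2)])
    show "x \<otimes> a \<in> I" "a \<otimes> x \<in> I" unfolding I_def using J.I_l_closed[OF F(3) x] J.I_r_closed[OF F(3) x] F by auto
  qed
  have "\<one> \<in> I"
  proof (rule ccontr)
    assume "\<one> \<notin> I"
    then obtain M where M: "maximalideal M A" "I \<subseteq> M" using proper_ideal_in_maximalideal[OF I] by blast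
    have p: "primeideal M A" by (rule maximalideal_prime[OF M(1)])
    then have "M \<in> \<Union>\<U>" using cov points_Spec[OF A_cring] by blast
    then obtain U where U: "U \<in> \<U>" "M \<in> U" by blast
    then obtain f where f: "f \<in> carrier A" "M \<in> basic_open A f" "basic_open A f \<subseteq> U"
      using op[OF U(1)] unfolding openin_zariski[OF A_cring] by blast
    then have "f \<in> K" using U unfolding K_def by blast
    then have "f \<in> I" unfolding I_def using genideal_self'[OF f(1)] by (auto intro: exI[of _ "{f}"])
    then show False using f(2) M(2) unfolding basic_open_def by blast
  qed
  then obtain F where F: "finite F" "F \<subseteq> K" "\<one> \<in> Idl F" unfolding I_def by blast
  have "\<forall>f\<in>F. \<exists>U. U \<in> \<U> \<and> basic_open A f \<subseteq> U" using F(2) unfolding K_def by blast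
  then obtain c where c: "\<And>f. f \<in> F \<Longrightarrow> c f \<in> \<U> \<and> basic_open A f \<subseteq> c f" by metis
  have "\<pp> \<in> \<Union>(c ` F)" if p: "\<pp> \<in> points (Spec A)" for \<pp>
  proof (rule ccontr)
    assume no: "\<pp> \<notin> \<Union>(c ` F)"
    have pr: "primeideal \<pp> A" using p points_Spec[OF A_cring] by blast
    interpret p: primeideal \<pp> A by (rule pr)
    have "F \<subseteq> \<pp>" using no c pr unfolding basic_open_def by blast
    then have "Idl F \<subseteq> \<pp>" by (rule genideal_minimal[OF p.is_ideal])
    then show False using F(3) p.one_imp_carrier p.I_notcarr by blast
  qed
  then show ?thesis using that[of "c ` F"] F(1) c by blast
qed

lemma (in prime_spot) loc_frac_pow:
  assumes "a \<in> carrier R" "f \<in> carrier R - I"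
  shows "f [^] (n::nat) \<in> carrier R - I"
    and "loc_frac R I a f [^]\<^bsub>localization R I\<^esub> (n::nat) = loc_frac R I (a [^] n) (f [^] n)"
proof (induction n)
  case 0
  { case 1 show ?case using one_compl by simp }
  { case 2 show ?case by (simp add: loc_one) }
next
  case (Suc n)
  { case 1 show ?case using Suc compl_mult[of "f [^] n" f] assms by simp }
  { case 2 show ?case using Suc assms by (simp add: loc_mult) }
qed

lemma (in cring) pow_mult_zero_mono:
  assumes "(f::'a) \<in> carrier R" "s \<in> carrier R" "f [^] (k::nat) \<otimes> s = \<zero>" "k \<le> n"
  shows "f [^] n \<otimes> s = \<zero>"
proof -
  have "f [^] n = f [^] (n - k) \<otimes> f [^] k" using assms by (simp add: nat_pow_mult)
  then show ?thesis using assms by (simp add: m_assoc)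
qed

text \<open>\<open>f\<close> and \<open>s\<close> are arbitrary global sections, of which only the
  local form as fractions is used. On a small basic open set the claim is
  \<open>annihilated_by_power\<close> for the numerators; compactness then makes one exponent serve
  everywhere.\<close>

lemma (in spectrum) Spec_annihilator:
  assumes f: "f \<in> carrier (spec_sections A (points (Spec A)))" and s: "s \<in> carrier (spec_sections A (points (Spec A)))"
    and z: "\<And>\<pp>. \<pp> \<in> points (Spec A) \<Longrightarrow> f \<pp> \<in> Units (localization A \<pp>) \<Longrightarrow> s \<pp> = \<zero>\<^bsub>localization A \<pp>\<^esub>"
  shows "\<exists>n::nat. f [^]\<^bsub>spec_sections A (points (Spec A))\<^esub> n \<otimes>\<^bsub>spec_sections A (points (Spec A))\<^esub> s
     = \<zero>\<^bsub>spec_sections A (points (Spec A))\<^esub>"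
proof -
  let ?P = "points (Spec A)"
  define Q where "Q V n \<longleftrightarrow> openin (zariski A) V \<and>
     (\<forall>\<qq>\<in>V. f \<qq> [^]\<^bsub>localization A \<qq>\<^esub> (n::nat) \<otimes>\<^bsub>localization A \<qq>\<^esub> s \<qq> = \<zero>\<^bsub>localization A \<qq>\<^esub>)" for V n
  have loc: "\<exists>V n. \<pp> \<in> V \<and> Q V n" if p: "\<pp> \<in> ?P" for \<pp>
  proof -
    obtain V a e where V: "openin (zariski A) V" "\<pp> \<in> V" "V \<subseteq> ?P" "a \<in> carrier A" "e \<in> carrier A"
      "\<forall>\<qq>\<in>V. e \<notin> \<qq> \<and> f \<qq> = loc_frac A \<qq> a e" using spec_secE[OF f p] .
    obtain V' b e' where V': "openin (zariski A) V'" "\<pp> \<in> V'" "V' \<subseteq> ?P" "b \<in> carrier A" "e' \<in> carrier A"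
      "\<forall>\<qq>\<in>V'. e' \<notin> \<qq> \<and> s \<qq> = loc_frac A \<qq> b e'" using spec_secE[OF s p] .
    have "openin (zariski A) (V \<inter> V')" using V(1) V'(1) by blast
    then obtain g where g: "g \<in> carrier A" "\<pp> \<in> basic_open A g" "basic_open A g \<subseteq> V \<inter> V'"
      unfolding openin_zariski[OF A_cring] using V(2) V'(2) by blast
    \<comment> \<open>A prime avoids the product of \<open>g\<close> and \<open>a\<close> exactly if
      it lies in the small basic open set of \<open>g\<close> and \<open>f\<close> is invertible at
      it. There \<open>s\<close> vanishes, so \<open>b\<close> is annihilated by an element outside
      the prime.\<close>
    have "\<exists>n::nat. (g \<otimes> a) [^] n \<otimes> b = \<zero>"
    proof (rule annihilated_by_power)
      fix \<qq> assume q: "primeideal \<qq> A" and ga: "g \<otimes> a \<notin> \<qq>"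
      then have "\<qq> \<in> basic_open A g \<inter> basic_open A a" using basic_open_mult[OF A_cring g(1) V(4)] unfolding basic_open_def by blast
      then have qV: "\<qq> \<in> V" "\<qq> \<in> V'" "a \<notin> \<qq>" using g(3) unfolding basic_open_def by auto
      interpret q: prime_spot \<qq> A using primeideal_spot[OF q] .
      have "f \<qq> \<in> Units (localization A \<qq>)" using V qV q.loc_frac_unit_iff[of a e] by auto
      then have "s \<qq> = \<zero>\<^bsub>localization A \<qq>\<^esub>" using z qV V(3) by blast
      then show "\<exists>k\<in>carrier A - \<qq>. k \<otimes> b = \<zero>" using V' qV q.loc_frac_zero_iff[of b e'] by auto
    qed (use g V V' in auto)
    then obtain n :: nat where n: "(g \<otimes> a) [^] n \<otimes> b = \<zero>" by blast
    have "f \<qq> [^]\<^bsub>localization A \<qq>\<^esub> n \<otimes>\<^bsub>localization A \<qq>\<^esub> s \<qq> = \<zero>\<^bsub>localization A \<qq>\<^esub>"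
      if q: "\<qq> \<in> basic_open A g" for \<qq>
    proof -
      have qV: "\<qq> \<in> V" "\<qq> \<in> V'" using q g(3) by auto
      interpret q: prime_spot \<qq> A using open_prime[OF V(1) qV(1)] .
      have e: "e \<in> carrier A - \<qq>" "e' \<in> carrier A - \<qq>" "g \<in> carrier A - \<qq>"
        using V V' qV g q unfolding basic_open_def by auto
      have gn: "g [^] n \<in> carrier A - \<qq>" by (rule q.loc_frac_pow(1)[OF one_closed e(3)])
      have "g [^] n \<otimes> (a [^] n \<otimes> b) = \<zero>" using n g V(4) V'(4) by (simp add: nat_pow_distrib m_assoc)
      then show ?thesis
        using gn V(4,6) V'(4,6) qV e q.loc_frac_pow[OF V(4) e(1), of n] q.compl_mult[OF q.loc_frac_pow(1)[OF V(4) e(1), of n] e(2)]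
        by (simp add: q.loc_mult) (subst q.loc_frac_zero_iff; blast?; simp)
    qed
    then have "Q (basic_open A g) n" unfolding Q_def using g(1) A_cring by simp
    then show ?thesis using g(2) by blast
  qed
  define \<U> where "\<U> = {V. \<exists>n. Q V n}"
  obtain \<F> where F: "finite \<F>" "\<F> \<subseteq> \<U>" "?P \<subseteq> \<Union>\<F>"
  proof (rule Spec_compact)
    show "openin (zariski A) U" if "U \<in> \<U>" for U using that unfolding \<U>_def Q_def by blast
    show "?P \<subseteq> \<Union>\<U>" using loc unfolding \<U>_def by blast
  qed (rule that)
  have "\<forall>V\<in>\<F>. \<exists>n. Q V n" using F(2) unfolding \<U>_def by blast
  then obtain c where c: "\<And>V. V \<in> \<F> \<Longrightarrow> Q V (c V)" by metis
  \<comment> \<open>The sum bounds each of the finitely many exponents, and by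
    \<open>pow_mult_zero_mono\<close> a larger exponent annihilates as well.\<close>
  define n where "n = (\<Sum>V\<in>\<F>. c V)"
  interpret S: cring "spec_sections A ?P" by (rule spec_cring[OF points_open])
  have "f [^]\<^bsub>spec_sections A ?P\<^esub> n \<otimes>\<^bsub>spec_sections A ?P\<^esub> s = \<zero>\<^bsub>spec_sections A ?P\<^esub>"
  proof (rule spec_sec_eqI)
    show "f [^]\<^bsub>spec_sections A ?P\<^esub> n \<otimes>\<^bsub>spec_sections A ?P\<^esub> s \<in> carrier (spec_sections A ?P)"
      "\<zero>\<^bsub>spec_sections A ?P\<^esub> \<in> carrier (spec_sections A ?P)" using f s by auto
    fix \<pp> assume p: "\<pp> \<in> ?P"
    then obtain V where V: "V \<in> \<F>" "\<pp> \<in> V" using F(3) by blast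
    have le: "c V \<le> n" unfolding n_def using F(1) V(1) by (simp add: member_le_sum)
    interpret p: prime_spot \<pp> A using open_prime[OF points_open p] .
    interpret L: cring "localization A \<pp>" by (rule p.loc_cring)
    have fp: "f \<pp> \<in> carrier (localization A \<pp>)" "s \<pp> \<in> carrier (localization A \<pp>)" using spec_sec_val f s p by auto
    have "(f [^]\<^bsub>spec_sections A ?P\<^esub> n) \<pp> = f \<pp> [^]\<^bsub>localization A \<pp>\<^esub> n" for n :: nat
    proof (induction n)
      case (Suc n) then show ?case using p by (simp add: spec_ops)
    qed (use p in \<open>simp add: spec_ops\<close>)
    moreover have "f \<pp> [^]\<^bsub>localization A \<pp>\<^esub> n \<otimes>\<^bsub>localization A \<pp>\<^esub> s \<pp> = \<zero>\<^bsub>localization A \<pp>\<^esub>"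
      using L.pow_mult_zero_mono[OF fp _ le] c[OF V(1)] V(2) unfolding Q_def by blast
    ultimately show "(f [^]\<^bsub>spec_sections A ?P\<^esub> n \<otimes>\<^bsub>spec_sections A ?P\<^esub> s) \<pp> = \<zero>\<^bsub>spec_sections A ?P\<^esub> \<pp>"
      using p by (simp add: spec_ops)
  qed
  then show ?thesis by blast
qed

subsection \<open>Open subschemes\<close>

lemma Spec_locally_ringed: "cring A \<Longrightarrow> locally_ringed (Spec A)"
  by (simp add: spectrum.spec_locally_ringed spectrum_def)

lemma isomorphism_cancel:
  assumes W: "locally_ringed W" and X: "locally_ringed X" and Y: "locally_ringed Y"
    and f: "isomorphism X Y f" and u: "morphism W X u" and v: "morphism W X v"
    and e: "mor_comp W X Y f u = mor_comp W X Y f v"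
  shows "u = v"
proof -
  obtain g where g: "isomorphism Y X g" "mor_comp X Y X g f = mor_id X" using isomorphism_inverse[OF f] by metis
  have "mor_comp W X X (mor_id X) u = mor_comp W X X (mor_id X) v"
    unfolding g(2)[symmetric] using e
      mor_comp_assoc[OF W X Y X u isomorphism_morphism[OF f] isomorphism_morphism[OF g(1)]]
      mor_comp_assoc[OF W X Y X v isomorphism_morphism[OF f] isomorphism_morphism[OF g(1)]] by simp
  then show ?thesis unfolding mor_comp_id_left[OF W X u] mor_comp_id_left[OF W X v] .
qed

lemma glob_comp:
  assumes A: "cring A" and m: "morphism X (Spec A) m" and a: "a \<in> carrier A"
  shows "glob A (mor_comp Y X (Spec A) m t) a = on_sec t (points X) (glob A m a)"
proof -
  interpret A: spectrum A by (simp add: spectrum_def A)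
  show ?thesis unfolding glob_def
    using sec_comp[of "Spec A" "points (Spec A)" "const_sec A (points (Spec A)) a"] A.const_sec_closed[OF A.points_open a]
      inv_img_points[OF m] by simp
qed

lemma isomorphism_of_inverse:
  assumes "morphism X Y f" "morphism Y X g" "mor_comp X Y X g f = mor_id X" "mor_comp Y X Y f g = mor_id Y"
  shows "isomorphism X Y f"
  unfolding isomorphism_def using assms by blast

text \<open>
  The ring is taken to consist of those global sections that are fractions with a power of \<open>f\<close> as
  denominator, so that it need not be shown that all sections on a basic open set are of this form.
\<close>

lemma affine_basic_open:
  fixes Y :: "('a, 'b) ringed_data" and A :: "'r ring"
  assumes Y: "locally_ringed Y" and A: "cring A" and f: "f \<in> carrier A"
    and \<psi>: "isomorphism Y (open_sub (Spec A) (basic_open A f)) \<psi>"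
  shows "affine Y"
proof -
  interpret A: spectrum A by (simp add: spectrum_def A)
  interpret Y: presheaf Y by (rule locally_ringed_presheaf[OF Y])
  let ?D = "basic_open A f" and ?R = "sections Y (points Y)"
  have D: "openin (zariski A) ?D" "openin (topol (Spec A)) ?D" using A f by simp_all
  let ?S = "open_sub (Spec A) ?D"
  note lA = Spec_locally_ringed[OF A] and m\<psi> = isomorphism_morphism[OF \<psi>]
  note lD = locally_ringed_open_sub[OF lA D(2)] and iD = open_incl_morphism[OF lA D(2)]
  \<comment> \<open>The isomorphism regarded as a morphism to the whole spectrum, so that it is
    determined by the homomorphism \<open>\<rho>\<close> on functions. The element \<open>f\<close>
    becomes a unit under \<open>\<rho>\<close>.\<close>
  define k where "k = mor_comp Y ?S (Spec A) (open_incl (Spec A) ?D) \<psi>"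
  have k: "morphism Y (Spec A) k" unfolding k_def by (rule mor_comp_morphism[OF Y lD lA m\<psi> iD])
  define \<rho> where "\<rho> = glob A k"
  have \<rho>: "\<rho> \<in> ring_hom A ?R" unfolding \<rho>_def by (rule A.glob_hom[OF k])
  interpret R: cring ?R by (rule Y.cring_sec[OF openin_points_self])
  interpret h: ring_hom_cring A ?R \<rho> by unfold_locales (rule \<rho>)
  have kD: "inv_img Y k ?D = points Y"
    using inv_comp[OF m\<psi>, of "Spec A" "open_incl (Spec A) ?D" ?D] inv_incl[OF D(2), of ?D] inv_img_points[OF m\<psi>] D(2)
    unfolding k_def by simp
  have cu: "const_sec A ?D f \<in> Units (spec_sections A ?D)"
    using A.const_mult_frac(2)[OF D(1) A.one_closed f, of "\<lambda>q. loc_frac A q \<one>\<^bsub>A\<^esub> f"] unfolding basic_open_def by blast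
  have "on_sec k ?D \<in> ring_hom (spec_sections A ?D) ?R" using mor_hom[OF k D(2)] kD by simp
  then have "on_sec k ?D (const_sec A ?D f) \<in> Units ?R" by (rule ring_hom_Units[OF _ A.spec_cring[OF D(1)] R.is_cring cu])
  then have uf: "\<rho> f \<in> Units ?R" using A.mor_const[OF k D(1) f] f unfolding kD \<rho>_def[symmetric] by simp
  have hpow: "\<rho> (f [^]\<^bsub>A\<^esub> (n::nat)) = \<rho> f [^]\<^bsub>?R\<^esub> n" for n
    by (induction n) (use f in auto)
  \<comment> \<open>Fractions with a power of \<open>f\<close> as denominator, in multiplied form so
    that no inverses are involved in the closure properties.\<close>
  define H where "H = {r \<in> carrier ?R. \<exists>a\<in>carrier A. \<exists>n::nat. \<rho> f [^]\<^bsub>?R\<^esub> n \<otimes>\<^bsub>?R\<^esub> r = \<rho> a}"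
  have hpow: "\<rho> (f [^]\<^bsub>A\<^esub> (n::nat)) = \<rho> f [^]\<^bsub>?R\<^esub> n" for n
    by (induction n) (use f in auto)
  have HI: "r \<in> H" if "r \<in> carrier ?R" "a \<in> carrier A" "\<rho> f [^]\<^bsub>?R\<^esub> (n::nat) \<otimes>\<^bsub>?R\<^esub> r = \<rho> a" for r a n
    using that unfolding H_def by blast
  have HR: "H \<subseteq> carrier ?R" unfolding H_def by blast
  have sub: "subcring H ?R"
  proof (intro R.subcringI' R.subringI HR)
    show "\<one>\<^bsub>?R\<^esub> \<in> H" by (rule HI[of _ "\<one>\<^bsub>A\<^esub>" 0]) auto
    fix r assume "r \<in> H"
    then obtain a n where r: "r \<in> carrier ?R" "a \<in> carrier A" "\<rho> f [^]\<^bsub>?R\<^esub> (n::nat) \<otimes>\<^bsub>?R\<^esub> r = \<rho> a" unfolding H_def by blast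
    show "\<ominus>\<^bsub>?R\<^esub> r \<in> H" by (rule HI[of _ "\<ominus>\<^bsub>A\<^esub> a" n]) (use r f in \<open>auto simp: R.r_minus\<close>)
    fix r' assume "r' \<in> H"
    then obtain a' k where r': "r' \<in> carrier ?R" "a' \<in> carrier A" "\<rho> f [^]\<^bsub>?R\<^esub> (k::nat) \<otimes>\<^bsub>?R\<^esub> r' = \<rho> a'" unfolding H_def by blast
    have fc: "\<rho> f [^]\<^bsub>?R\<^esub> n \<in> carrier ?R" "\<rho> f [^]\<^bsub>?R\<^esub> k \<in> carrier ?R" using f by auto
    have sp: "\<rho> f [^]\<^bsub>?R\<^esub> (n + k) = \<rho> f [^]\<^bsub>?R\<^esub> n \<otimes>\<^bsub>?R\<^esub> \<rho> f [^]\<^bsub>?R\<^esub> k" using f by (simp add: R.nat_pow_mult)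
    have "\<rho> f [^]\<^bsub>?R\<^esub> n \<otimes>\<^bsub>?R\<^esub> \<rho> f [^]\<^bsub>?R\<^esub> k \<otimes>\<^bsub>?R\<^esub> (r \<otimes>\<^bsub>?R\<^esub> r') = (\<rho> f [^]\<^bsub>?R\<^esub> n \<otimes>\<^bsub>?R\<^esub> r) \<otimes>\<^bsub>?R\<^esub> (\<rho> f [^]\<^bsub>?R\<^esub> k \<otimes>\<^bsub>?R\<^esub> r')"
      using r(1) r'(1) fc by algebra
    also have "\<dots> = \<rho> (a \<otimes>\<^bsub>A\<^esub> a')" unfolding r(3) r'(3) using r r' by simp
    finally show "r \<otimes>\<^bsub>?R\<^esub> r' \<in> H" using r r' sp by (intro HI[of _ "a \<otimes>\<^bsub>A\<^esub> a'" "n + k"]) auto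
    have "\<rho> f [^]\<^bsub>?R\<^esub> n \<otimes>\<^bsub>?R\<^esub> \<rho> f [^]\<^bsub>?R\<^esub> k \<otimes>\<^bsub>?R\<^esub> (r \<oplus>\<^bsub>?R\<^esub> r') =
       \<rho> f [^]\<^bsub>?R\<^esub> k \<otimes>\<^bsub>?R\<^esub> (\<rho> f [^]\<^bsub>?R\<^esub> n \<otimes>\<^bsub>?R\<^esub> r) \<oplus>\<^bsub>?R\<^esub> \<rho> f [^]\<^bsub>?R\<^esub> n \<otimes>\<^bsub>?R\<^esub> (\<rho> f [^]\<^bsub>?R\<^esub> k \<otimes>\<^bsub>?R\<^esub> r')"
      using r(1) r'(1) fc by algebra
    also have "\<dots> = \<rho> (f [^]\<^bsub>A\<^esub> k \<otimes>\<^bsub>A\<^esub> a \<oplus>\<^bsub>A\<^esub> f [^]\<^bsub>A\<^esub> n \<otimes>\<^bsub>A\<^esub> a')" unfolding r(3) r'(3) using r r' f by (simp add: hpow)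
    finally show "r \<oplus>\<^bsub>?R\<^esub> r' \<in> H" using r r' f sp
      by (intro HI[of _ "f [^]\<^bsub>A\<^esub> k \<otimes>\<^bsub>A\<^esub> a \<oplus>\<^bsub>A\<^esub> f [^]\<^bsub>A\<^esub> n \<otimes>\<^bsub>A\<^esub> a'" "n + k"]) auto
  qed
  let ?B = "?R\<lparr>carrier := H\<rparr>"
  have B: "cring ?B" using sub R.subcring_iff[OF HR] by blast
  have \<rho>H: "\<rho> a \<in> H" if "a \<in> carrier A" for a using that by (intro HI[of _ a 0]) auto
  have \<rho>B: "\<rho> \<in> ring_hom A ?B" by (rule ring_hom_memI) (auto simp: \<rho>H)
  have Bpow: "x [^]\<^bsub>?B\<^esub> (n::nat) = x [^]\<^bsub>?R\<^esub> n" for x n by (induction n) auto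
  obtain i where i: "i \<in> carrier ?R" "\<rho> f \<otimes>\<^bsub>?R\<^esub> i = \<one>\<^bsub>?R\<^esub>" "i \<otimes>\<^bsub>?R\<^esub> \<rho> f = \<one>\<^bsub>?R\<^esub>"
    using uf unfolding Units_def by blast
  \<comment> \<open>The inverse of the image of \<open>f\<close> is itself such a fraction, with
    exponent 1, so the image of \<open>f\<close> stays a unit in the smaller ring.\<close>
  have iH: "i \<in> H" by (rule HI[of _ "\<one>\<^bsub>A\<^esub>" 1]) (use i f in auto)
  have ufB: "\<rho> f \<in> Units ?B" unfolding Units_def using \<rho>H[OF f(1)] iH i by auto
  note lB = Spec_locally_ringed[OF B]
  interpret B: spectrum ?B by (simp add: spectrum_def B)
  let ?PB = "points (Spec ?B)"
  have "const_sec ?B ?PB \<circ> \<rho> \<in> ring_hom A (sections (Spec ?B) ?PB)"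
    using ring_hom_trans[OF \<rho>B B.const_hom[OF B.points_open]] by simp
  then obtain n where n: "morphism (Spec ?B) (Spec A) n" and gn: "\<And>a. a \<in> carrier A \<Longrightarrow> glob A n a = const_sec ?B ?PB (\<rho> a)"
    using A.hom_to_Spec[OF lB] by (metis comp_apply)
  \<comment> \<open>No prime of the new ring contains the unit \<open>\<rho> f\<close>, so the
    morphism of spectra lands in the basic open set.\<close>
  have nD: "\<forall>q\<in>?PB. on_pts n q \<in> ?D"
  proof
    fix q assume q: "q \<in> ?PB"
    interpret q: primeideal q ?B using q points_Spec[OF B] by blast
    have "\<rho> f \<notin> q" using B.ideal_with_unit[OF q.is_ideal ufB] q.I_notcarr by blast
    then have "unit_near (Spec ?B) q ?PB (glob A n f)" using B.const_unit_near[OF q] \<rho>H[OF f] gn[OF f] by simp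
    then show "on_pts n q \<in> ?D"
      using A.mor_spec_pts[OF lB n q, of f] mor_pts[OF n q] points_Spec[OF A] unfolding basic_open_def by simp
  qed
  note r = corestrict[OF lB lA n D(2) nD]
  let ?r = "mor_restrict (Spec ?B) (Spec A) n ?PB ?D"
  obtain \<phi> where \<phi>: "isomorphism ?S Y \<phi>" "mor_comp ?S Y ?S \<psi> \<phi> = mor_id ?S" using isomorphism_inverse[OF \<psi>] by metis
  note m\<phi> = isomorphism_morphism[OF \<phi>(1)]
  \<comment> \<open>The candidate for the inverse: the morphism from the new spectrum to the basic
    open set, moved to \<open>Y\<close> by the inverse of \<open>\<psi>\<close>.\<close>
  define w where "w = mor_comp (Spec ?B) ?S Y \<phi> ?r"
  have w: "morphism (Spec ?B) Y w" unfolding w_def by (rule mor_comp_morphism[OF lB lD Y r(1) m\<phi>])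
  have \<psi>w: "mor_comp (Spec ?B) Y ?S \<psi> w = ?r"
    using mor_comp_assoc[OF lB lD Y lD r(1) m\<phi> m\<psi>] \<phi>(2) mor_comp_id_left[OF lB lD r(1)] unfolding w_def by simp
  have kw: "mor_comp (Spec ?B) Y (Spec A) k w = n"
    using mor_comp_assoc[OF lB Y lD lA w m\<psi> iD] \<psi>w r(2) unfolding k_def by simp
  have "(\<lambda>b. b) \<in> ring_hom ?B ?R" by (rule ring_hom_memI) (use HR in auto)
  then obtain m where m: "morphism Y (Spec ?B) m" and gm: "\<And>b. b \<in> carrier ?B \<Longrightarrow> glob ?B m b = b"
    using B.hom_to_Spec[OF Y] by metis
  have gid: "glob ?B (mor_id (Spec ?B)) b = const_sec ?B ?PB b" if "b \<in> carrier ?B" for b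
    using B.const_sec_closed[OF B.points_open that] openin_points_self[of "Spec ?B"] unfolding glob_def by simp
  have "inv_img (Spec ?B) w (points Y) = ?PB" by (rule inv_img_points[OF w])
  then have wh: "on_sec w (points Y) \<in> ring_hom ?R (spec_sections ?B ?PB)" using mor_hom[OF w openin_points_self] by simp
  have w\<rho>: "on_sec w (points Y) (\<rho> a) = const_sec ?B ?PB (\<rho> a)" if a: "a \<in> carrier A" for a
    using glob_comp[OF A k a, of "Spec ?B" w] unfolding kw gn[OF a] \<rho>_def by simp
  interpret S: cring "spec_sections ?B ?PB" by (rule B.spec_cring[OF B.points_open])
  \<comment> \<open>For \<open>b\<close> in the new ring the pullback along \<open>w\<close> is only
    known on images of \<open>A\<close>; the equation that multiplies \<open>b\<close> by a power of
    \<open>f\<close> into such an image determines it, since that power is a unit.\<close>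
  have mw: "mor_comp (Spec ?B) Y (Spec ?B) m w = mor_id (Spec ?B)"
  proof (rule B.mor_spec_eqI[OF lB mor_comp_morphism[OF lB Y lB w m] mor_id_morphism[OF lB]])
    fix b assume b: "b \<in> carrier ?B"
    then obtain a n where a: "a \<in> carrier A" "\<rho> f [^]\<^bsub>?R\<^esub> (n::nat) \<otimes>\<^bsub>?R\<^esub> b = \<rho> a" unfolding H_def by auto
    let ?u = "\<rho> (f [^]\<^bsub>A\<^esub> n)" and ?c = "const_sec ?B ?PB"
    have fn: "f [^]\<^bsub>A\<^esub> n \<in> carrier A" using f by simp
    have u: "?u \<in> Units ?B" unfolding hpow using B.Units_pow_closed[OF ufB, of n] unfolding Bpow .
    have e: "?u \<otimes>\<^bsub>?R\<^esub> b = \<rho> a" using a(2) unfolding hpow .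
    have bR: "b \<in> carrier ?R" using b HR by auto
    note ch = B.const_hom[OF B.points_open]
    have 1: "?c ?u \<otimes>\<^bsub>spec_sections ?B ?PB\<^esub> on_sec w (points Y) b = ?c (\<rho> a)"
      using ring_hom_mult[OF wh h.hom_closed[OF fn] bR] unfolding e w\<rho>[OF a(1)] w\<rho>[OF fn] by simp
    have 2: "?c ?u \<otimes>\<^bsub>spec_sections ?B ?PB\<^esub> ?c b = ?c (\<rho> a)"
      using ring_hom_mult[OF ch, of ?u b] \<rho>H[OF fn] b e by simp
    have "on_sec w (points Y) b = ?c b"
      by (rule S.unit_cancel_eq[OF ring_hom_Units[OF ch B S.is_cring u] ring_hom_closed[OF wh bR] ring_hom_closed[OF ch b]])
        (use 1 2 in simp)
    then show "glob ?B (mor_comp (Spec ?B) Y (Spec ?B) m w) b = glob ?B (mor_id (Spec ?B)) b"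
      using glob_comp[OF B m b, of "Spec ?B" w] gm[OF b] gid[OF b] by simp
  qed
  note mnm = mor_comp_morphism[OF Y lB lA m n]
  have nm: "mor_comp Y (Spec ?B) (Spec A) n m = k"
  proof (rule A.mor_spec_eqI[OF Y mnm k])
    fix a assume a: "a \<in> carrier A"
    have "\<rho> a \<in> carrier ?B" using \<rho>H[OF a] by simp
    then show "glob A (mor_comp Y (Spec ?B) (Spec A) n m) a = glob A k a"
      using glob_comp[OF A n a, of Y m] gn[OF a] gm[of "\<rho> a"] unfolding glob_def[of ?B] \<rho>_def by simp
  qed
  \<comment> \<open>Composing with the monomorphisms \<open>\<psi>\<close> and the inclusion turns
    both sides into \<open>k\<close>, because \<open>n\<close> after \<open>m\<close> is
    \<open>k\<close>.\<close>
  have wm: "mor_comp Y (Spec ?B) Y w m = mor_id Y"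
  proof (rule isomorphism_cancel[OF Y Y lD \<psi> mor_comp_morphism[OF Y lB Y m w] mor_id_morphism[OF Y]],
      rule open_incl_mono[OF lA D(2) mor_comp_morphism[OF Y Y lD mor_comp_morphism[OF Y lB Y m w] m\<psi>] mor_comp_morphism[OF Y Y lD mor_id_morphism[OF Y] m\<psi>]])
    show "mor_comp Y ?S (Spec A) (open_incl (Spec A) ?D) (mor_comp Y Y ?S \<psi> (mor_comp Y (Spec ?B) Y w m)) =
      mor_comp Y ?S (Spec A) (open_incl (Spec A) ?D) (mor_comp Y Y ?S \<psi> (mor_id Y))"
      using mor_comp_assoc[OF Y lB Y lD m w m\<psi>] mor_comp_assoc[OF Y lB lD lA m r(1) iD] nm mor_comp_id_right[OF Y lD m\<psi>]
      unfolding \<psi>w r(2) k_def by simp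
  qed
  show ?thesis unfolding affine_def using B isomorphism_of_inverse[OF m w wm mw] by blast
qed

lemma bij_betw_preimageE:
  assumes "bij_betw f A B" "b \<in> B" obtains a where "a \<in> A" "f a = b"
  using assms by (metis bij_betw_iff_bijections)

text \<open>\<open>Spec_annihilator\<close> transported along the isomorphism. Vanishing is tested
  on open sets instead of at points, a condition that passes through the isomorphism on sections
  without any comparison of stalks.\<close>

lemma affine_annihilator:
  assumes X: "locally_ringed X" and A: "cring A" and m: "isomorphism X (Spec A) m"
    and f: "f \<in> carrier (sections X (points X))" and s: "s \<in> carrier (sections X (points X))"
    and z: "\<And>W. openin (topol X) W \<Longrightarrow> restrn X (points X) W f \<in> Units (sections X W) \<Longrightarrow>
      restrn X (points X) W s = \<zero>\<^bsub>sections X W\<^esub>"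
  shows "\<exists>n::nat. f [^]\<^bsub>sections X (points X)\<^esub> n \<otimes>\<^bsub>sections X (points X)\<^esub> s = \<zero>\<^bsub>sections X (points X)\<^esub>"
proof -
  interpret A: spectrum A by (simp add: spectrum_def A)
  interpret X: presheaf X by (rule locally_ringed_presheaf[OF X])
  let ?P = "points (Spec A)" and ?S = "spec_sections A (points (Spec A))" and ?T = "sections X (points X)"
  note mm = isomorphism_morphism[OF m]
  have iP: "inv_img X m ?P = points X" by (rule inv_img_points[OF mm])
  have bij: "bij_betw (on_sec m ?P) (carrier ?S) (carrier ?T)"
    using isomorphism_sec[OF m openin_points_self] iP by simp
  obtain f' where f': "f' \<in> carrier ?S" "on_sec m ?P f' = f" using bij_betw_preimageE[OF bij f] .
  obtain s' where s': "s' \<in> carrier ?S" "on_sec m ?P s' = s" using bij_betw_preimageE[OF bij s] .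
  interpret S: cring ?S by (rule A.spec_cring[OF A.points_open])
  interpret T: cring ?T by (rule X.cring_sec) simp
  have hom: "on_sec m ?P \<in> ring_hom ?S ?T" using mor_hom[OF mm openin_points_self] iP by simp
  interpret h: ring_hom_cring ?S ?T "on_sec m ?P" by unfold_locales (rule hom)
  obtain n :: nat where n: "f' [^]\<^bsub>?S\<^esub> n \<otimes>\<^bsub>?S\<^esub> s' = \<zero>\<^bsub>?S\<^esub>"
  proof -
    have "\<exists>n::nat. f' [^]\<^bsub>?S\<^esub> n \<otimes>\<^bsub>?S\<^esub> s' = \<zero>\<^bsub>?S\<^esub>"
    proof (rule A.Spec_annihilator[OF f'(1) s'(1)])
      fix p assume p: "p \<in> ?P" and u: "f' p \<in> Units (localization A p)"
      then obtain W where W: "openin (zariski A) W" "p \<in> W" "W \<subseteq> ?P" "restrict f' W \<in> Units (spec_sections A W)"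
        using A.unit_near_Spec[OF A.points_open f'(1) p] unfolding unit_near_def by auto
      have W': "openin (topol (Spec A)) W" using W(1) by simp
      let ?V = "inv_img X m W"
      have V: "openin (topol X) ?V" by (rule mor_open[OF mm W'])
      have homW: "on_sec m W \<in> ring_hom (spec_sections A W) (sections X ?V)" using mor_hom[OF mm W'] by simp
      have nat: "on_sec m W (restrict t W) = restrn X (points X) ?V (on_sec m ?P t)" if "t \<in> carrier ?S" for t
        using mor_nat[OF mm openin_points_self W' , of t] that W(3) iP by simp
      have "restrn X (points X) ?V f \<in> Units (sections X ?V)"
        using ring_hom_Units[OF homW A.spec_cring[OF W(1)] X.cring_sec[OF V] W(4)] nat[OF f'(1)] f'(2) by simp
      then have "on_sec m W (restrict s' W) = \<zero>\<^bsub>sections X ?V\<^esub>" using z[OF V] nat[OF s'(1)] s'(2) by simp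
      moreover have "on_sec m W \<zero>\<^bsub>spec_sections A W\<^esub> = \<zero>\<^bsub>sections X ?V\<^esub>"
        by (rule ring_hom_zero[OF homW A.spec_cring[OF W(1), THEN cring.axioms(1)] X.cring_sec[OF V, THEN cring.axioms(1)]])
      moreover have "inj_on (on_sec m W) (carrier (spec_sections A W))"
        using isomorphism_sec[OF m W'] by (simp add: bij_betw_def)
      moreover have "\<zero>\<^bsub>spec_sections A W\<^esub> \<in> carrier (spec_sections A W)"
        using ring.ring_simprules(2)[OF A.spec_cring[OF W(1), THEN cring.axioms(1)]] .
      ultimately have "restrict s' W = \<zero>\<^bsub>spec_sections A W\<^esub>"
        using A.restrict_sec[OF W(1,3) s'(1)] inj_onD[of "on_sec m W" "carrier (spec_sections A W)" "restrict s' W" "\<zero>\<^bsub>spec_sections A W\<^esub>"]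
        by simp
      then show "s' p = \<zero>\<^bsub>localization A p\<^esub>" using W(2) by (metis A.spec_ops(4) restrict_apply')
    qed
    then show thesis using that by blast
  qed
  have "on_sec m ?P (f' [^]\<^bsub>?S\<^esub> n) = f [^]\<^bsub>?T\<^esub> n" for n :: nat
    by (induction n) (use f' in auto)
  then have "f [^]\<^bsub>?T\<^esub> n \<otimes>\<^bsub>?T\<^esub> s = on_sec m ?P (f' [^]\<^bsub>?S\<^esub> n \<otimes>\<^bsub>?S\<^esub> s')"
    using f' s' by simp
  then show ?thesis using n by (intro exI[of _ n]) simp
qed

lemma scheme_locally_ringed: "scheme X \<Longrightarrow> locally_ringed X"
  by (simp add: scheme_def)

text \<open>Inside an affine open set around \<open>x\<close> the trace of \<open>U\<close> contains
  a basic open set around \<open>x\<close>, which is affine by \<open>affine_basic_open\<close>. So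
  affine open sets form a basis of the topology.\<close>

lemma affine_neighbourhood:
  fixes X :: "('a, 'b) ringed_data"
  assumes X: "scheme X" and U: "openin (topol X) U" and x: "x \<in> U"
  obtains V where "openin (topol X) V" "x \<in> V" "V \<subseteq> U" "affine (open_sub X V)"
proof -
  note lX = scheme_locally_ringed[OF X]
  interpret X: presheaf X by (rule locally_ringed_presheaf[OF lX])
  have "x \<in> points X" using x openin_points[OF U] by blast
  then obtain U0 where U0: "openin (topol X) U0" "x \<in> U0" "affine (open_sub X U0)" using X unfolding scheme_def by blast
  obtain A :: "'b ring" and \<phi> where A: "cring A" and \<phi>: "isomorphism (open_sub X U0) (Spec A) \<phi>"
    using U0(3) unfolding affine_def by blast
  interpret A: spectrum A by (simp add: spectrum_def A)
  let ?X0 = "open_sub X U0"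
  have lX0: "locally_ringed ?X0" by (rule locally_ringed_open_sub[OF lX U0(1)])
  note m\<phi> = isomorphism_morphism[OF \<phi>]
  have "openin (topol ?X0) (U \<inter> U0)" using openin_open_sub[OF U0(1)] U U0(1) by blast
  then have "openin (zariski A) (on_pts \<phi> ` (U \<inter> U0))" using isomorphism_open[OF \<phi>] by simp
  then obtain f where f: "f \<in> carrier A" "on_pts \<phi> x \<in> basic_open A f" "basic_open A f \<subseteq> on_pts \<phi> ` (U \<inter> U0)"
    unfolding openin_zariski[OF A] using x U0(2) by blast
  let ?D = "basic_open A f"
  have D: "openin (zariski A) ?D" using A f by simp
  have D': "openin (topol (Spec A)) ?D" using D by simp
  let ?V = "inv_img ?X0 \<phi> ?D"
  have bij: "bij_betw (on_pts \<phi>) U0 (points (Spec A))" using isomorphism_pts[OF \<phi>] U0(1) by simp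
  have V0: "openin (topol ?X0) ?V" by (rule mor_open[OF m\<phi> D'])
  have V: "openin (topol X) ?V" "?V \<subseteq> U0" using V0 openin_open_sub[OF U0(1)] by auto
  have xV: "x \<in> ?V" using f(2) U0 by (simp add: inv_img_def)
  have VU: "?V \<subseteq> U"
  proof
    fix y assume y: "y \<in> ?V"
    then have y': "y \<in> U0" "on_pts \<phi> y \<in> on_pts \<phi> ` (U \<inter> U0)" using V(2) f(3) by (auto simp: inv_img_def)
    have "inj_on (on_pts \<phi>) U0" using bij by (simp add: bij_betw_def)
    then have "y \<in> U \<inter> U0" using inj_on_image_mem_iff[of "on_pts \<phi>" U0 y "U \<inter> U0"] y' by simp
    then show "y \<in> U" by simp
  qed
  have im: "on_pts \<phi> ` ?V = ?D"
  proof (intro equalityI subsetI)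
    show "p \<in> ?D" if "p \<in> on_pts \<phi> ` ?V" for p using that by (auto simp: inv_img_def)
    show "p \<in> on_pts \<phi> ` ?V" if p: "p \<in> ?D" for p
    proof -
      have "p \<in> points (Spec A)" using p openin_points[OF D'] by blast
      then obtain y where "y \<in> U0" "on_pts \<phi> y = p" using bij_betw_preimageE[OF bij] by metis
      then show ?thesis using p U0(1) by (auto simp: inv_img_def)
    qed
  qed
  define \<psi> where "\<psi> = mor_restrict ?X0 (Spec A) \<phi> ?V ?D"
  have \<psi>: "isomorphism (open_sub X ?V) (open_sub (Spec A) ?D) \<psi>"
    using isomorphism_restrict[OF lX0 A.spec_locally_ringed \<phi> V0] unfolding im \<psi>_def open_sub_open_sub[OF V(2)] .
  have "affine (open_sub X ?V)"
    by (rule affine_basic_open[OF locally_ringed_open_sub[OF lX V(1)] A f(1) \<psi>])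
  then show ?thesis using that[OF V(1) xV VU] by blast
qed

lemma scheme_open_sub:
  assumes X: "scheme X" and U: "openin (topol X) U"
  shows "scheme (open_sub X U)"
  unfolding scheme_def
proof (intro conjI ballI)
  show "locally_ringed (open_sub X U)" by (rule locally_ringed_open_sub[OF scheme_locally_ringed[OF X] U])
  fix x assume "x \<in> points (open_sub X U)"
  then have x: "x \<in> U" using U by simp
  obtain V where V: "openin (topol X) V" "x \<in> V" "V \<subseteq> U" "affine (open_sub X V)" using affine_neighbourhood[OF X U x] .
  then show "\<exists>V. openin (topol (open_sub X U)) V \<and> x \<in> V \<and> affine (open_sub (open_sub X U) V)"
    using openin_open_sub[OF U] open_sub_open_sub[OF V(3), of X] by (intro exI[of _ V]) simp
qed

subsection \<open>Transport along injections of the underlying types\<close>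

text \<open>A copy of \<open>X\<close> in other types, with the points renamed by
  \<open>\<phi>\<close> and the sections over \<open>U\<close> by \<open>\<psi> U\<close>. The
  renaming of sections may depend on \<open>U\<close> because only injectivity on each ring of
  sections is demanded. It serves to place a spectrum in the types over which test schemes
  range.\<close>

definition transport ::
  "('a \<Rightarrow> 'c) \<Rightarrow> ('a set \<Rightarrow> 'b \<Rightarrow> 'd) \<Rightarrow> ('a, 'b) ringed_data \<Rightarrow> ('c, 'd) ringed_data" where
  "transport \<phi> \<psi> X =
     (let pre = (\<lambda>V. {x \<in> points X. \<phi> x \<in> V}) in
     \<lparr>topol = pullback_topology (\<phi> ` points X) (inv_into (points X) \<phi>) (topol X),
      sections = (\<lambda>V. image_ring (\<psi> (pre V)) (sections X (pre V))),
      restrn = (\<lambda>V W t. \<psi> (pre W)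
        (restrn X (pre V) (pre W) (inv_into (carrier (sections X (pre V))) (\<psi> (pre V)) t)))\<rparr>)"

lemma transport_isomorphism:
  fixes X :: "('a, 'b) ringed_data" and \<phi> :: "'a \<Rightarrow> 'c" and \<psi> :: "'a set \<Rightarrow> 'b \<Rightarrow> 'd"
  assumes X: "locally_ringed X" and \<phi>: "inj_on \<phi> (points X)"
    and \<psi>: "\<And>U. openin (topol X) U \<Longrightarrow> inj_on (\<psi> U) (carrier (sections X U))"
  shows "locally_ringed (transport \<phi> \<psi> X)" and "\<exists>m. isomorphism X (transport \<phi> \<psi> X) m"
proof -
  interpret X: presheaf X by (rule locally_ringed_presheaf[OF X])
  let ?Y = "transport \<phi> \<psi> X"
  define pre where "pre V = {x \<in> points X. \<phi> x \<in> V}" for V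
  define \<kappa> where "\<kappa> U = inv_into (carrier (sections X U)) (\<psi> U)" for U
  have secY: "sections ?Y V = image_ring (\<psi> (pre V)) (sections X (pre V))" for V
    by (simp add: transport_def pre_def)
  have resY: "restrn ?Y V W t = \<psi> (pre W) (restrn X (pre V) (pre W) (\<kappa> (pre V) t))" for V W t
    by (simp add: transport_def pre_def \<kappa>_def)
  have pre_im: "pre (\<phi> ` U) = U" if "openin (topol X) U" for U
    using \<phi> openin_points[OF that] unfolding pre_def by (auto dest: inj_onD)
  have openY: "openin (topol ?Y) V \<longleftrightarrow> openin (topol X) (pre V) \<and> V = \<phi> ` pre V" for V
  proof -
    have vi: "inv_into (points X) \<phi> -` U \<inter> \<phi> ` points X = \<phi> ` U" if U: "openin (topol X) U" for U
      using \<phi> openin_points[OF U] by (auto simp: image_iff subset_iff)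
    have "openin (topol ?Y) V \<longleftrightarrow> (\<exists>U. openin (topol X) U \<and> V = inv_into (points X) \<phi> -` U \<inter> \<phi> ` points X)"
      by (simp add: transport_def openin_pullback_topology)
    also have "\<dots> \<longleftrightarrow> (\<exists>U. openin (topol X) U \<and> V = \<phi> ` U)" by (intro ex_cong1 conj_cong refl) (simp add: vi)
    also have "\<dots> \<longleftrightarrow> openin (topol X) (pre V) \<and> V = \<phi> ` pre V" using pre_im by metis
    finally show ?thesis .
  qed
  have opre: "openin (topol X) (pre V)" if "openin (topol ?Y) V" for V using that openY by blast
  have pmono: "pre W \<subseteq> pre V" if "W \<subseteq> V" for V W using that unfolding pre_def by blast
  have carY: "carrier (sections ?Y V) = \<psi> (pre V) ` carrier (sections X (pre V))" for V
    by (simp add: secY image_ring_carrier)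
  have \<psi>iso: "\<psi> U \<in> ring_iso (sections X U) (image_ring (\<psi> U) (sections X U))" if "openin (topol X) U" for U
    by (rule inj_imp_image_ring_iso[OF \<psi>[OF that]])
  have \<psi>hom: "\<psi> U \<in> ring_hom (sections X U) (image_ring (\<psi> U) (sections X U))" if "openin (topol X) U" for U
    using \<psi>iso[OF that] unfolding ring_iso_def by blast
  have \<kappa>\<psi>: "\<kappa> U (\<psi> U s) = s" if "openin (topol X) U" "s \<in> carrier (sections X U)" for U s
    unfolding \<kappa>_def by (rule inv_into_f_f[OF \<psi>[OF that(1)] that(2)])
  have cringY: "cring (sections ?Y V)" if V: "openin (topol ?Y) V" for V
    using cring.ring_iso_imp_img_cring[OF X.cring_sec[OF opre[OF V]] \<psi>iso[OF opre[OF V]]]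
    by (simp add: secY image_ring_zero[symmetric])
  have hom: "\<psi> (pre V) \<in> ring_hom (sections X (pre V)) (sections ?Y V)" if "openin (topol ?Y) V" for V
    unfolding secY by (rule \<psi>hom[OF opre[OF that]])
  have \<kappa>hom: "\<kappa> (pre V) \<in> ring_hom (sections ?Y V) (sections X (pre V))" if V: "openin (topol ?Y) V" for V
    using ring_iso_set_sym[OF X.cring_sec[OF opre[OF V], THEN cring.axioms(1)] \<psi>iso[OF opre[OF V]]]
    unfolding secY \<kappa>_def ring_iso_def by blast
  have \<kappa>c: "\<kappa> (pre V) t \<in> carrier (sections X (pre V))" if "openin (topol ?Y) V" "t \<in> carrier (sections ?Y V)" for V t
    by (rule ring_hom_closed[OF \<kappa>hom[OF that(1)] that(2)])
  have \<psi>\<kappa>: "\<psi> (pre V) (\<kappa> (pre V) t) = t" if "t \<in> carrier (sections ?Y V)" for V t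
    using that unfolding carY \<kappa>_def by (rule f_inv_into_f)
  have \<psi>c: "\<psi> (pre V) s \<in> carrier (sections ?Y V)" if "s \<in> carrier (sections X (pre V))" for V s
    unfolding carY using that by blast
  have \<kappa>res: "\<kappa> (pre W) (restrn ?Y V W t) = restrn X (pre V) (pre W) (\<kappa> (pre V) t)"
    if "openin (topol ?Y) V" "openin (topol ?Y) W" "W \<subseteq> V" "t \<in> carrier (sections ?Y V)" for V W t
    unfolding resY using \<kappa>\<psi>[OF opre[OF that(2)]] X.res_closed[OF opre[OF that(1)] opre[OF that(2)] pmono[OF that(3)] \<kappa>c[OF that(1,4)]] by simp
  have pY: "is_presheaf ?Y"
    unfolding is_presheaf_def
  proof (intro conjI allI impI ballI, goal_cases)
    case (1 U) then show ?case by (rule cringY)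
  next
    case (2 V W)
    then have VW: "openin (topol ?Y) V" "openin (topol ?Y) W" "W \<subseteq> V" by auto
    have r: "restrn ?Y V W = (\<psi> (pre W) \<circ> restrn X (pre V) (pre W)) \<circ> \<kappa> (pre V)" by (auto simp: resY)
    show ?case unfolding r
      by (rule ring_hom_trans[OF \<kappa>hom[OF VW(1)] ring_hom_trans[OF X.res_hom[OF opre[OF VW(1)] opre[OF VW(2)] pmono[OF VW(3)]] hom[OF VW(2)]]])
  next
    case (3 V t) then show ?case unfolding resY using X.res_id[OF opre \<kappa>c] \<psi>\<kappa> by simp
  next
    case (4 U V W t)
    then have O: "openin (topol ?Y) U" "openin (topol ?Y) V" "openin (topol ?Y) W" "V \<subseteq> U" "W \<subseteq> V" by auto
    show ?case unfolding resY[of V W] \<kappa>res[OF O(1,2,4) 4(2)] unfolding resY[of U W]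
      using X.res_res[OF opre[OF O(1)] opre[OF O(2)] opre[OF O(3)] pmono[OF O(4)] pmono[OF O(5)] \<kappa>c[OF O(1) 4(2)]] by simp
  qed
  interpret Y: presheaf ?Y by unfold_locales (rule pY)
  have pU: "pre (\<Union>C) = \<Union>(pre ` C)" for C unfolding pre_def by blast
  have pI: "pre (V \<inter> W) = pre V \<inter> pre W" for V W unfolding pre_def by blast
  have sY: "is_sheaf ?Y"
    unfolding is_sheaf_def
  proof (rule conjI, rule pY, rule allI, rule impI)
    fix C assume C: "\<forall>V\<in>C. openin (topol ?Y) V"
    have UC: "openin (topol ?Y) (\<Union>C)" using C by blast
    have C': "\<forall>V\<in>pre ` C. openin (topol X) V" using C opre by blast
    note shX = locally_ringed_sheaf[OF X, unfolded is_sheaf_def, THEN conjunct2, THEN spec, THEN mp, OF C', folded pU]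
    show "(\<forall>s\<in>carrier (sections ?Y (\<Union>C)). \<forall>t\<in>carrier (sections ?Y (\<Union>C)).
           (\<forall>V\<in>C. restrn ?Y (\<Union>C) V s = restrn ?Y (\<Union>C) V t) \<longrightarrow> s = t) \<and>
        (\<forall>\<sigma>. (\<forall>V\<in>C. \<sigma> V \<in> carrier (sections ?Y V)) \<and>
             (\<forall>V\<in>C. \<forall>W\<in>C. restrn ?Y V (V \<inter> W) (\<sigma> V) = restrn ?Y W (V \<inter> W) (\<sigma> W)) \<longrightarrow>
             (\<exists>s\<in>carrier (sections ?Y (\<Union>C)). \<forall>V\<in>C. restrn ?Y (\<Union>C) V s = \<sigma> V))"
    proof (intro conjI ballI allI impI, goal_cases)
      case (1 s t)
      have "restrn X (pre (\<Union>C)) (pre V) (\<kappa> (pre (\<Union>C)) s) = restrn X (pre (\<Union>C)) (pre V) (\<kappa> (pre (\<Union>C)) t)" if V: "V \<in> C" for V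
      proof -
        have V': "openin (topol ?Y) V" "V \<subseteq> \<Union>C" using V C by auto
        show ?thesis using \<kappa>res[OF UC V' 1(1)] \<kappa>res[OF UC V' 1(2)] 1(3) V by simp
      qed
      then have "\<kappa> (pre (\<Union>C)) s = \<kappa> (pre (\<Union>C)) t"
        using shX[THEN conjunct1, THEN bspec, OF \<kappa>c[OF UC 1(1)], THEN bspec, OF \<kappa>c[OF UC 1(2)]] by simp
      then have "\<psi> (pre (\<Union>C)) (\<kappa> (pre (\<Union>C)) s) = \<psi> (pre (\<Union>C)) (\<kappa> (pre (\<Union>C)) t)" by (rule arg_cong)
      then show ?case unfolding \<psi>\<kappa>[OF 1(1)] \<psi>\<kappa>[OF 1(2)] .
    next
      case (2 \<sigma>)
      then have \<sigma>: "\<And>V. V \<in> C \<Longrightarrow> \<sigma> V \<in> carrier (sections ?Y V)"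
        and comp: "\<And>V W. V \<in> C \<Longrightarrow> W \<in> C \<Longrightarrow> restrn ?Y V (V \<inter> W) (\<sigma> V) = restrn ?Y W (V \<inter> W) (\<sigma> W)" by blast+
      define \<tau> where "\<tau> U = \<kappa> U (\<sigma> (\<phi> ` U))" for U
      have im: "\<phi> ` pre V = V" if "V \<in> C" for V using that C openY by metis
      have \<tau>: "\<tau> (pre V) = \<kappa> (pre V) (\<sigma> V)" if "V \<in> C" for V unfolding \<tau>_def im[OF that] ..
      have "\<exists>s\<in>carrier (sections X (pre (\<Union>C))). \<forall>V\<in>pre ` C. restrn X (pre (\<Union>C)) V s = \<tau> V"
      proof (rule shX[THEN conjunct2, THEN spec, THEN mp], intro conjI ballI)
        show "\<tau> U \<in> carrier (sections X U)" if U: "U \<in> pre ` C" for U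
        proof -
          obtain V where V: "V \<in> C" "U = pre V" using U by blast
          show ?thesis unfolding V(2) \<tau>[OF V(1)] by (rule \<kappa>c[OF bspec[OF C V(1)] \<sigma>[OF V(1)]])
        qed
        show "restrn X U (U \<inter> U') (\<tau> U) = restrn X U' (U \<inter> U') (\<tau> U')" if U: "U \<in> pre ` C" "U' \<in> pre ` C" for U U'
        proof -
          obtain V V' where V: "V \<in> C" "U = pre V" "V' \<in> C" "U' = pre V'" using U by blast
          have O: "openin (topol ?Y) V" "openin (topol ?Y) V'" using V C by auto
          have OI: "openin (topol ?Y) (V \<inter> V')" using O by blast
          show ?thesis unfolding V(2,4) \<tau>[OF V(1)] \<tau>[OF V(3)] pI[symmetric]
            using \<kappa>res[OF O(1) OI Int_lower1 \<sigma>[OF V(1)]] \<kappa>res[OF O(2) OI Int_lower2 \<sigma>[OF V(3)]] comp[OF V(1,3)] by simp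
        qed
      qed
      then obtain s where s: "s \<in> carrier (sections X (pre (\<Union>C)))" "\<And>V. V \<in> C \<Longrightarrow> restrn X (pre (\<Union>C)) (pre V) s = \<tau> (pre V)" by blast
      have "restrn ?Y (\<Union>C) V (\<psi> (pre (\<Union>C)) s) = \<sigma> V" if V: "V \<in> C" for V
        unfolding resY \<kappa>\<psi>[OF opre[OF UC] s(1)] s(2)[OF V] \<tau>[OF V] by (rule \<psi>\<kappa>[OF \<sigma>[OF V]])
      then show ?case using \<psi>c[OF s(1)] by blast
    qed
  qed
  have ptsY: "points ?Y = \<phi> ` points X"
  proof -
    have "pre (\<phi> ` points X) = points X" using pre_im[OF openin_points_self] .
    then have "openin (topol ?Y) (\<phi> ` points X)" using openY by simp
    then have "\<phi> ` points X \<subseteq> points ?Y" by (rule openin_points)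
    moreover have "points ?Y \<subseteq> \<phi> ` points X" using openY[of "points ?Y"] openin_points_self[of ?Y] unfolding pre_def by blast
    ultimately show ?thesis by blast
  qed
  have uY: "unit_near ?Y (\<phi> x) V t \<longleftrightarrow> unit_near X x (pre V) (\<kappa> (pre V) t)"
    if V: "openin (topol ?Y) V" and t: "t \<in> carrier (sections ?Y V)" and x: "x \<in> pre V" for x V t
  proof
    assume "unit_near ?Y (\<phi> x) V t"
    then obtain W where W: "openin (topol ?Y) W" "\<phi> x \<in> W" "W \<subseteq> V" "restrn ?Y V W t \<in> Units (sections ?Y W)"
      unfolding unit_near_def by blast
    have "restrn X (pre V) (pre W) (\<kappa> (pre V) t) \<in> Units (sections X (pre W))"
      using ring_hom_Units[OF \<kappa>hom[OF W(1)] cringY[OF W(1)] X.cring_sec[OF opre[OF W(1)]] W(4)] \<kappa>res[OF V W(1,3) t] by simp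
    then show "unit_near X x (pre V) (\<kappa> (pre V) t)" unfolding unit_near_def
      using opre[OF W(1)] pmono[OF W(3)] W(2) x by (intro exI[of _ "pre W"]) (auto simp: pre_def)
  next
    assume "unit_near X x (pre V) (\<kappa> (pre V) t)"
    then obtain U where U: "openin (topol X) U" "x \<in> U" "U \<subseteq> pre V" "restrn X (pre V) U (\<kappa> (pre V) t) \<in> Units (sections X U)"
      unfolding unit_near_def by blast
    let ?W = "\<phi> ` U"
    have W: "openin (topol ?Y) ?W" using openY pre_im[OF U(1)] U(1) by simp
    have "restrn ?Y V ?W t \<in> Units (sections ?Y ?W)"
      using ring_hom_Units[OF hom[OF W] X.cring_sec[OF opre[OF W]] cringY[OF W]] U(4) unfolding resY pre_im[OF U(1)] by blast
    moreover have "?W \<subseteq> V" using U(3) unfolding pre_def by blast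
    ultimately show "unit_near ?Y (\<phi> x) V t" unfolding unit_near_def using W U(2) by blast
  qed
  show lY: "locally_ringed ?Y"
    unfolding locally_ringed_iff
  proof (intro conjI ballI allI impI, goal_cases)
    case 1 show ?case by (rule sY)
  next
    case (2 y V)
    then obtain x where x: "x \<in> points X" "y = \<phi> x" unfolding ptsY by blast
    have V: "openin (topol ?Y) V" and xV: "x \<in> pre V" using 2 x unfolding pre_def by auto
    have "\<one>\<^bsub>sections X (pre V)\<^esub> \<noteq> \<zero>\<^bsub>sections X (pre V)\<^esub>"
      using X[unfolded locally_ringed_iff] x(1) opre[OF V] xV by blast
    moreover have "\<kappa> (pre V) \<one>\<^bsub>sections ?Y V\<^esub> = \<one>\<^bsub>sections X (pre V)\<^esub>" by (rule ring_hom_one[OF \<kappa>hom[OF V]])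
    moreover have "\<kappa> (pre V) \<zero>\<^bsub>sections ?Y V\<^esub> = \<zero>\<^bsub>sections X (pre V)\<^esub>"
      by (rule ring_hom_zero[OF \<kappa>hom[OF V] cringY[OF V, THEN cring.axioms(1)] X.cring_sec[OF opre[OF V], THEN cring.axioms(1)]])
    ultimately show ?case by metis
  next
    case (3 y V s t)
    then obtain x where x: "x \<in> points X" "y = \<phi> x" unfolding ptsY by blast
    have V: "openin (topol ?Y) V" and xV: "x \<in> pre V" using 3 x unfolding pre_def by auto
    interpret R: cring "sections ?Y V" by (rule cringY[OF V])
    have "unit_near X x (pre V) (\<kappa> (pre V) s \<oplus>\<^bsub>sections X (pre V)\<^esub> \<kappa> (pre V) t)"
      using 3(5) uY[OF V R.a_closed[OF 3(3,4)] xV] ring_hom_add[OF \<kappa>hom[OF V] 3(3,4)] x(2) by simp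
    then have "unit_near X x (pre V) (\<kappa> (pre V) s) \<or> unit_near X x (pre V) (\<kappa> (pre V) t)"
      using X[unfolded locally_ringed_iff, THEN conjunct2, THEN bspec, OF x(1), THEN spec, of "pre V"]
        opre[OF V] xV \<kappa>c[OF V 3(3)] \<kappa>c[OF V 3(4)] by blast
    then show ?case using uY[OF V 3(3) xV] uY[OF V 3(4) xV] x(2) by simp
  qed
  define m where "m = \<lparr>on_pts = (\<lambda>x\<in>points X. \<phi> x),
     on_sec = (\<lambda>V\<in>{V. openin (topol ?Y) V}. \<lambda>t\<in>carrier (sections ?Y V). \<kappa> (pre V) t)\<rparr>"
  have m_inv: "inv_img X m V = pre V" for V unfolding m_def inv_img_def pre_def by auto
  have m_sec: "on_sec m V t = \<kappa> (pre V) t" if "openin (topol ?Y) V" "t \<in> carrier (sections ?Y V)" for V t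
    using that unfolding m_def by simp
  have m_pts: "on_pts m x = \<phi> x" if "x \<in> points X" for x using that unfolding m_def by simp
  have m: "morphism X ?Y m"
  proof (rule morphismI[OF X lY], unfold m_inv)
    show "on_pts m \<in> extensional (points X)" "on_sec m \<in> extensional {V. openin (topol ?Y) V}"
      "\<And>V. openin (topol ?Y) V \<Longrightarrow> on_sec m V \<in> extensional (carrier (sections ?Y V))" unfolding m_def by auto
    show "on_pts m x \<in> points ?Y" if "x \<in> points X" for x using that m_pts ptsY by simp
    fix V assume V: "openin (topol ?Y) V"
    show "openin (topol X) (pre V)" by (rule opre[OF V])
    interpret R: cring "sections ?Y V" by (rule cringY[OF V])
    note kh = ring_hom_closed[OF \<kappa>hom[OF V]] ring_hom_mult[OF \<kappa>hom[OF V]] ring_hom_add[OF \<kappa>hom[OF V]] ring_hom_one[OF \<kappa>hom[OF V]]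
    show "on_sec m V \<in> ring_hom (sections ?Y V) (sections X (pre V))"
      by (rule ring_hom_memI) (simp_all add: m_sec[OF V] kh)
    show "on_sec m W (restrn ?Y V W t) = restrn X (pre V) (pre W) (on_sec m V t)"
      if W: "openin (topol ?Y) W" "W \<subseteq> V" and t: "t \<in> carrier (sections ?Y V)" for W t
      using m_sec[OF W(1) Y.res_closed[OF V W t]] m_sec[OF V t] \<kappa>res[OF V W t] by simp
    fix x t assume "x \<in> points X" "on_pts m x \<in> V" and t: "t \<in> carrier (sections ?Y V)" and u: "unit_near X x (pre V) (on_sec m V t)"
    then have x: "x \<in> pre V" "on_pts m x = \<phi> x" unfolding pre_def using m_pts by auto
    show "unit_near ?Y (on_pts m x) V t" using uY[OF V t x(1)] u m_sec[OF V t] x(2) by simp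
  qed
  have "isomorphism X ?Y m"
  proof (rule isomorphismI[OF X lY m])
    show "bij_betw (on_pts m) (points X) (points ?Y)"
      unfolding ptsY bij_betw_def using \<phi> m_pts by (auto simp: inj_on_def)
    show "openin (topol ?Y) (on_pts m ` U)" if U: "openin (topol X) U" for U
    proof -
      have "on_pts m ` U = \<phi> ` U" using m_pts openin_points[OF U] by (auto simp: subset_iff image_iff)
      then show ?thesis using openY pre_im[OF U] U by simp
    qed
    fix V assume V: "openin (topol ?Y) V"
    show "inj_on (on_sec m V) (carrier (sections ?Y V))"
      by (rule inj_onI) (metis m_sec[OF V] \<psi>\<kappa>)
    fix s y assume s: "s \<in> carrier (sections X (inv_img X m V))" and y: "y \<in> V"
    have s': "s \<in> carrier (sections X (pre V))" using s m_inv by simp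
    have "on_sec m V (\<psi> (pre V) s) = restrn X (pre V) (pre V) s"
      using m_sec[OF V \<psi>c[OF s']] \<kappa>\<psi>[OF opre[OF V] s'] X.res_id[OF opre[OF V] s'] by simp
    then show "\<exists>W t. openin (topol ?Y) W \<and> y \<in> W \<and> W \<subseteq> V \<and> t \<in> carrier (sections ?Y W) \<and>
        on_sec m W t = restrn X (inv_img X m V) (inv_img X m W) s"
      unfolding m_inv using V y \<psi>c[OF s'] by (intro exI[of _ V] exI[of _ "\<psi> (pre V) s"]) simp
  qed
  then show "\<exists>m. isomorphism X ?Y m" by blast
qed

text \<open>
  A ring whose elements are named by lists has a spectrum that fits into the types of the test
  schemes: a prime is encoded by the names of its elements, a section by names for the numerators
  and denominators of its germs.
\<close>

lemma small_spectrum: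
  fixes C :: "'c ring" and ev :: "'l \<Rightarrow> 'c"
  assumes C: "cring C" and ev: "carrier C \<subseteq> range ev"
  obtains Z :: "('i \<times> 'k \<times> 'l set, 'i \<times> 'k \<times> 'l set \<Rightarrow> 'l \<times> 'l) ringed_data" and m
  where "scheme Z" "isomorphism Z (Spec C) m"
proof -
  interpret C: spectrum C by (simp add: spectrum_def C)
  \<comment> \<open>Only the third component carries information; the other two merely fill the type
    of the points of test schemes.\<close>
  define \<phi> :: "'c set \<Rightarrow> 'i \<times> 'k \<times> 'l set" where "\<phi> p = (undefined, undefined, {l. ev l \<in> p})" for p
  have \<phi>: "inj_on \<phi> (points (Spec C))"
  proof (rule inj_onI)
    fix p q assume p: "p \<in> points (Spec C)" and q: "q \<in> points (Spec C)" and e: "\<phi> p = \<phi> q"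
    have "p \<subseteq> carrier C" "q \<subseteq> carrier C" using p q ideal_carrier_subset primeideal.axioms(1) unfolding points_Spec[OF C] by blast+
    moreover have "ev l \<in> p \<longleftrightarrow> ev l \<in> q" for l using e unfolding \<phi>_def by auto
    ultimately show "p = q" using ev by (auto simp: subset_iff image_iff)
  qed
  \<comment> \<open>The encoded section is a function of the encoded point \<open>z\<close>, so the
    prime has to be recovered from \<open>z\<close>; this is possible since \<open>\<phi>\<close> is
    injective on primes.\<close>
  define P where "P U s z ll \<longleftrightarrow> (\<exists>p\<in>U. \<phi> p = z \<and> ev (fst ll) \<in> carrier C \<and> ev (snd ll) \<in> carrier C - p \<and>
     s p = loc_frac C p (ev (fst ll)) (ev (snd ll)))" for U and s :: "'c set \<Rightarrow> ('c \<times> 'c) set" and z and ll :: "'l \<times> 'l"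
  define \<psi> :: "'c set set \<Rightarrow> ('c set \<Rightarrow> ('c \<times> 'c) set) \<Rightarrow> 'i \<times> 'k \<times> 'l set \<Rightarrow> 'l \<times> 'l"
    where "\<psi> U s z = (SOME ll. P U s z ll)" for U s z
  have \<psi>: "inj_on (\<psi> U) (carrier (sections (Spec C) U))" if U0: "openin (topol (Spec C)) U" for U
  proof (rule inj_onI)
    have U: "openin (zariski C) U" using U0 by simp
    fix s t assume "s \<in> carrier (sections (Spec C) U)" and "t \<in> carrier (sections (Spec C) U)" and e: "\<psi> U s = \<psi> U t"
    then have s: "s \<in> carrier (spec_sections C U)" and t: "t \<in> carrier (spec_sections C U)" by auto
    have *: "r p = loc_frac C p (ev (fst (\<psi> U r (\<phi> p)))) (ev (snd (\<psi> U r (\<phi> p))))"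
      if r: "r \<in> carrier (spec_sections C U)" and p: "p \<in> U" for r p
    proof -
      interpret p: prime_spot p C using C.open_prime[OF U p] .
      obtain a f where af: "a \<in> carrier C" "f \<in> carrier C - p" "r p = loc_frac C p a f"
        using C.spec_sec_val[OF r p] unfolding p.loc_carrier by blast
      obtain l l' where l: "a = ev l" "f = ev l'" using af ev by blast
      have "P U r (\<phi> p) (l, l')" unfolding P_def using p af l by auto
      then have "P U r (\<phi> p) (\<psi> U r (\<phi> p))" unfolding \<psi>_def by (rule someI)
      then obtain q where q: "q \<in> U" "\<phi> q = \<phi> p" "r q = loc_frac C q (ev (fst (\<psi> U r (\<phi> p)))) (ev (snd (\<psi> U r (\<phi> p))))"
        unfolding P_def by blast
      have "q = p" using inj_onD[OF \<phi> q(2)] q(1) p openin_points[OF U0] by blast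
      then show ?thesis using q(3) by simp
    qed
    show "s = t" by (rule C.spec_sec_eqI[OF s t]) (metis * e s t)
  qed
  let ?Z = "transport \<phi> \<psi> (Spec C)"
  have lZ: "locally_ringed ?Z" by (rule transport_isomorphism(1)[OF C.spec_locally_ringed \<phi> \<psi>])
  obtain m' where "isomorphism (Spec C) ?Z m'" using transport_isomorphism(2)[OF C.spec_locally_ringed \<phi> \<psi>] by blast
  then obtain m where m: "isomorphism ?Z (Spec C) m" using isomorphism_inverse by metis
  \<comment> \<open>The ring in \<open>affine\<close> must live in the type of sections of the copy,
    and \<open>C\<close> does not. With the unit element as \<open>f\<close>,
    \<open>affine_basic_open\<close> replaces \<open>C\<close> by a ring of sections of the copy
    itself.\<close>
  have "basic_open C \<one>\<^bsub>C\<^esub> = points (Spec C)" using basic_open_one[OF C] points_Spec[OF C] by simp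
  then have "affine ?Z" using affine_basic_open[OF lZ C C.one_closed, of m] m by simp
  then have "affine (open_sub ?Z (points ?Z))" by simp
  then have "scheme ?Z" unfolding scheme_def using lZ openin_points_self by blast
  then show ?thesis using that m by blast
qed

section \<open>Schematically dominant morphisms and separatedness\<close>

lemma dominant_morphism: "schematically_dominant Y X t \<Longrightarrow> morphism Y X t"
  by (simp add: schematically_dominant_def)

lemma dominant_inj: "schematically_dominant Y X t \<Longrightarrow> openin (topol X) V \<Longrightarrow>
    s \<in> carrier (sections X V) \<Longrightarrow> s' \<in> carrier (sections X V) \<Longrightarrow> on_sec t V s = on_sec t V s' \<Longrightarrow> s = s'"
  unfolding schematically_dominant_def by (elim conjE) (metis inj_onD)

lemma dominantI:
  assumes X: "locally_ringed X" and Y: "locally_ringed Y" and t: "morphism Y X t"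
    and ker: "\<And>V s. openin (topol X) V \<Longrightarrow> s \<in> carrier (sections X V) \<Longrightarrow>
      on_sec t V s = \<zero>\<^bsub>sections Y (inv_img Y t V)\<^esub> \<Longrightarrow> s = \<zero>\<^bsub>sections X V\<^esub>"
  shows "schematically_dominant Y X t"
  unfolding schematically_dominant_def
proof (intro conjI allI impI inj_onI)
  show "morphism Y X t" by (rule t)
  fix V s s' assume V: "openin (topol X) V" and s: "s \<in> carrier (sections X V)" "s' \<in> carrier (sections X V)"
    and e: "on_sec t V s = on_sec t V s'"
  interpret R: cring "sections X V" by (rule presheaf.cring_sec[OF locally_ringed_presheaf[OF X] V])
  interpret R': cring "sections Y (inv_img Y t V)" by (rule presheaf.cring_sec[OF locally_ringed_presheaf[OF Y] mor_open[OF t V]])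
  interpret h: ring_hom_cring "sections X V" "sections Y (inv_img Y t V)" "on_sec t V"
    by unfold_locales (rule mor_hom[OF t V])
  have "on_sec t V (s \<ominus>\<^bsub>sections X V\<^esub> s') = \<zero>\<^bsub>sections Y (inv_img Y t V)\<^esub>"
    using s e by (simp add: R.minus_eq R'.r_neg)
  then have "s \<ominus>\<^bsub>sections X V\<^esub> s' = \<zero>\<^bsub>sections X V\<^esub>" using ker[OF V] s by simp
  then show "s = s'" using s by (simp add: R.r_right_minus_eq)
qed

lemma dominant_comp:
  assumes X: "locally_ringed X" and Y: "locally_ringed Y" and Z: "locally_ringed Z"
    and f: "schematically_dominant X Y f" and g: "schematically_dominant Y Z g"
  shows "schematically_dominant X Z (mor_comp X Y Z g f)"
  unfolding schematically_dominant_def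
proof (intro conjI allI impI inj_onI)
  note mf = dominant_morphism[OF f] and mg = dominant_morphism[OF g]
  show "morphism X Z (mor_comp X Y Z g f)" by (rule mor_comp_morphism[OF X Y Z mf mg])
  fix V s s' assume V: "openin (topol Z) V" and s: "s \<in> carrier (sections Z V)" "s' \<in> carrier (sections Z V)"
    and e: "on_sec (mor_comp X Y Z g f) V s = on_sec (mor_comp X Y Z g f) V s'"
  have "on_sec g V s = on_sec g V s'"
    by (rule dominant_inj[OF f mor_open[OF mg V] mor_sec[OF mg V s(1)] mor_sec[OF mg V s(2)]]) (use e V s in simp)
  then show "s = s'" by (rule dominant_inj[OF g V s])
qed

lemma isomorphism_dominant: "isomorphism X Y f \<Longrightarrow> schematically_dominant X Y f"
  unfolding schematically_dominant_def using isomorphism_sec[of X Y f] isomorphism_morphism[of X Y f]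
  by (auto simp: bij_betw_def)

lemma dominant_restrict:
  assumes X: "locally_ringed X" and Y: "locally_ringed Y" and t: "schematically_dominant Y X t" and N: "openin (topol X) N"
  shows "schematically_dominant (open_sub Y (inv_img Y t N)) (open_sub X N) (mor_restrict Y X t (inv_img Y t N) N)"
  unfolding schematically_dominant_def
proof (intro conjI allI impI inj_onI)
  interpret Y: presheaf Y by (rule locally_ringed_presheaf[OF Y])
  note mt = dominant_morphism[OF t] note O = mor_open[OF mt N]
  show "morphism (open_sub Y (inv_img Y t N)) (open_sub X N) (mor_restrict Y X t (inv_img Y t N) N)"
    by (rule mor_restrict_morphism[OF Y X mt O N]) (simp add: inv_img_def)
  fix V s s' assume "openin (topol (open_sub X N)) V" and s: "s \<in> carrier (sections (open_sub X N) V)" "s' \<in> carrier (sections (open_sub X N) V)"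
    and e: "on_sec (mor_restrict Y X t (inv_img Y t N) N) V s = on_sec (mor_restrict Y X t (inv_img Y t N) N) V s'"
  then have V: "openin (topol X) V" "V \<subseteq> N" using openin_open_sub[OF N] by auto
  have i: "inv_img Y t N \<inter> inv_img Y t V = inv_img Y t V" using inv_img_mono[OF V(2), of Y t] by blast
  have s': "s \<in> carrier (sections X V)" "s' \<in> carrier (sections X V)" using s by auto
  have "on_sec (mor_restrict Y X t (inv_img Y t N) N) V r = on_sec t V r" if "r \<in> carrier (sections X V)" for r
    using that sec_restrict[OF N V, of r Y t "inv_img Y t N"] i mor_sec[OF mt V(1) that] mor_open[OF mt V(1)] by simp
  then show "s = s'" using e s' dominant_inj[OF t V(1) s'] by simp
qed

lemma restrict_comp_incl:
  assumes X: "locally_ringed X" and Y: "locally_ringed Y" and Z: "locally_ringed Z"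
    and t: "morphism Y X t" and a: "morphism X Z a" and b: "morphism X Z b" and N: "openin (topol X) N"
    and e: "mor_comp Y X Z a t = mor_comp Y X Z b t"
  shows "mor_comp (open_sub Y (inv_img Y t N)) (open_sub X N) Z (mor_comp (open_sub X N) X Z a (open_incl X N)) (mor_restrict Y X t (inv_img Y t N) N) =
    mor_comp (open_sub Y (inv_img Y t N)) (open_sub X N) Z (mor_comp (open_sub X N) X Z b (open_incl X N)) (mor_restrict Y X t (inv_img Y t N) N)"
proof -
  let ?M = "inv_img Y t N" let ?r = "mor_restrict Y X t ?M N"
  note O = mor_open[OF t N]
  note YM = locally_ringed_open_sub[OF Y O] and XN = locally_ringed_open_sub[OF X N]
  have tN: "\<And>y. y \<in> ?M \<Longrightarrow> on_pts t y \<in> N" by (simp add: inv_img_def)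
  note r = mor_restrict_morphism[OF Y X t O N tN] and ic = incl_comp_restrict[OF Y X t O N tN]
  have "mor_comp (open_sub Y ?M) (open_sub X N) Z (mor_comp (open_sub X N) X Z c (open_incl X N)) ?r =
     mor_comp (open_sub Y ?M) Y Z (mor_comp Y X Z c t) (open_incl Y ?M)" if c: "morphism X Z c" for c
    using mor_comp_assoc[OF YM XN X Z r open_incl_morphism[OF X N] c] ic
      mor_comp_assoc[OF YM Y X Z open_incl_morphism[OF Y O] t c] by simp
  then show ?thesis using a b e by simp
qed

text \<open>Morphisms to an affine scheme are determined by the pullbacks of global functions, and
  on these the pullback along a schematically dominant morphism is injective.\<close>

lemma dominant_eq_affine:
  assumes X: "locally_ringed X" and Y: "locally_ringed Y" and Z: "locally_ringed Z"
    and a: "morphism X Z a" and b: "morphism X Z b" and t: "schematically_dominant Y X t"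
    and e: "mor_comp Y X Z a t = mor_comp Y X Z b t"
    and R: "openin (topol Z) R" and A: "cring A" and r: "isomorphism (open_sub Z R) (Spec A) r"
    and aR: "\<forall>x\<in>points X. on_pts a x \<in> R" and bR: "\<forall>x\<in>points X. on_pts b x \<in> R"
  shows "a = b"
proof -
  interpret A: spectrum A by (simp add: spectrum_def A)
  note mt = dominant_morphism[OF t] and mr = isomorphism_morphism[OF r]
  note ZR = locally_ringed_open_sub[OF Z R]
  let ?a = "mor_restrict X Z a (points X) R" let ?b = "mor_restrict X Z b (points X) R"
  note ca = corestrict[OF X Z a R aR] and cb = corestrict[OF X Z b R bR]
  have "mor_comp Y X (open_sub Z R) ?a t = mor_comp Y X (open_sub Z R) ?b t"
  proof (rule open_incl_mono[OF Z R])
    show "morphism Y (open_sub Z R) (mor_comp Y X (open_sub Z R) ?a t)" "morphism Y (open_sub Z R) (mor_comp Y X (open_sub Z R) ?b t)"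
      using mor_comp_morphism[OF Y X ZR mt ca(1)] mor_comp_morphism[OF Y X ZR mt cb(1)] .
    show "mor_comp Y (open_sub Z R) Z (open_incl Z R) (mor_comp Y X (open_sub Z R) ?a t) =
      mor_comp Y (open_sub Z R) Z (open_incl Z R) (mor_comp Y X (open_sub Z R) ?b t)"
      using mor_comp_assoc[OF Y X ZR Z mt ca(1) open_incl_morphism[OF Z R]]
        mor_comp_assoc[OF Y X ZR Z mt cb(1) open_incl_morphism[OF Z R]] ca(2) cb(2) e by simp
  qed
  then have e1: "mor_comp Y X (Spec A) (mor_comp X (open_sub Z R) (Spec A) r ?a) t = mor_comp Y X (Spec A) (mor_comp X (open_sub Z R) (Spec A) r ?b) t"
    using mor_comp_assoc[OF Y X ZR A.spec_locally_ringed mt ca(1) mr] mor_comp_assoc[OF Y X ZR A.spec_locally_ringed mt cb(1) mr] by simp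
  note ma = mor_comp_morphism[OF X ZR A.spec_locally_ringed ca(1) mr] and mb = mor_comp_morphism[OF X ZR A.spec_locally_ringed cb(1) mr]
  have "mor_comp X (open_sub Z R) (Spec A) r ?a = mor_comp X (open_sub Z R) (Spec A) r ?b"
  proof (rule A.mor_spec_eqI[OF X ma mb])
    fix c assume c: "c \<in> carrier A"
    show "glob A (mor_comp X (open_sub Z R) (Spec A) r ?a) c = glob A (mor_comp X (open_sub Z R) (Spec A) r ?b) c"
      by (rule dominant_inj[OF t openin_points_self A.glob_closed[OF ma c] A.glob_closed[OF mb c]])
        (use glob_comp[OF A ma c, of Y t] glob_comp[OF A mb c, of Y t] e1 in simp)
  qed
  then have "?a = ?b" by (rule isomorphism_cancel[OF X ZR A.spec_locally_ringed r ca(1) cb(1)])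
  then have "mor_comp X (open_sub Z R) Z (open_incl Z R) ?a = mor_comp X (open_sub Z R) Z (open_incl Z R) ?b" by (rule arg_cong)
  then show ?thesis unfolding ca(2) cb(2) .
qed

text \<open>Equality of the images of \<open>x\<close> ensures that both inverse images of one
  affine open set contain \<open>x\<close>. On their intersection both morphisms have this affine
  set as target. What is left for the global statement is equality on points, where separatedness is
  needed.\<close>

lemma dominant_eq_near:
  fixes Z :: "('i, 'j) ringed_data"
  assumes X: "locally_ringed X" and Y: "locally_ringed Y" and Z: "scheme Z"
    and a: "morphism X Z a" and b: "morphism X Z b" and t: "schematically_dominant Y X t"
    and e: "mor_comp Y X Z a t = mor_comp Y X Z b t"
    and x: "x \<in> points X" and ab: "on_pts a x = on_pts b x"
  obtains N where "openin (topol X) N" "x \<in> N"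
    "mor_comp (open_sub X N) X Z a (open_incl X N) = mor_comp (open_sub X N) X Z b (open_incl X N)"
proof -
  note lZ = scheme_locally_ringed[OF Z]
  obtain G where G: "openin (topol Z) G" "on_pts a x \<in> G" "affine (open_sub Z G)"
    using affine_neighbourhood[OF Z openin_points_self mor_pts[OF a x]] by metis
  obtain A :: "'j ring" and r where A: "cring A" and r: "isomorphism (open_sub Z G) (Spec A) r"
    using G(3) unfolding affine_def by blast
  let ?N = "inv_img X a G \<inter> inv_img X b G"
  have N: "openin (topol X) ?N" using mor_open[OF a G(1)] mor_open[OF b G(1)] by blast
  have xN: "x \<in> ?N" using x ab G(2) by (simp add: inv_img_def)
  note mt = dominant_morphism[OF t]
  note XN = locally_ringed_open_sub[OF X N] and YM = locally_ringed_open_sub[OF Y mor_open[OF mt N]]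
  have i: "morphism (open_sub X ?N) X (open_incl X ?N)" by (rule open_incl_morphism[OF X N])
  have "mor_comp (open_sub X ?N) X Z a (open_incl X ?N) = mor_comp (open_sub X ?N) X Z b (open_incl X ?N)"
  proof (rule dominant_eq_affine[OF XN YM lZ _ _ dominant_restrict[OF X Y t N] restrict_comp_incl[OF X Y lZ mt a b N e] G(1) A r])
    show "morphism (open_sub X ?N) Z (mor_comp (open_sub X ?N) X Z a (open_incl X ?N))"
      "morphism (open_sub X ?N) Z (mor_comp (open_sub X ?N) X Z b (open_incl X ?N))"
      using mor_comp_morphism[OF XN X lZ i] a b by auto
    show "\<forall>y\<in>points (open_sub X ?N). on_pts (mor_comp (open_sub X ?N) X Z a (open_incl X ?N)) y \<in> G"
      "\<forall>y\<in>points (open_sub X ?N). on_pts (mor_comp (open_sub X ?N) X Z b (open_incl X ?N)) y \<in> G"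
      using points_open_sub[OF N] pts_incl[OF N] by (auto simp: inv_img_def)
  qed
  then show ?thesis using that[OF N xN] by blast
qed

lemma separatedE:
  assumes "separated E S g"
  obtains P p q d where "is_fibre_product E E S g g P p q" "morphism E P d"
    "mor_comp E P E p d = mor_id E" "mor_comp E P E q d = mor_id E" "closed_immersion E P d"
  using assms unfolding separated_def is_diagonal_def by blast

text \<open>The pair of \<open>a\<close> and \<open>b\<close> defines a morphism \<open>m\<close> to
  the fibre product, and the inverse image of the complement of the closed diagonal is open. No
  point of \<open>Y\<close> lies over it: there \<open>a\<close> and \<open>b\<close> agree near the
  image point, so \<open>m\<close> factors through the diagonal. Hence one equals zero after
  pullback to \<open>Y\<close>, by dominance already on this open set, which is therefore
  empty.\<close>

lemma separated_eq_pts_small: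
  fixes E :: "('i, 'j) ringed_data" and Z :: "('i, 'j, 'i, 'j) fp"
  assumes E: "scheme E" and S: "locally_ringed S" and sep: "separated E S g" and Z: "scheme Z"
    and a: "morphism Z E a" and b: "morphism Z E b" and gab: "mor_comp Z E S g a = mor_comp Z E S g b"
    and Y: "locally_ringed Y" and t: "schematically_dominant Y Z t" and e: "mor_comp Y Z E a t = mor_comp Y Z E b t"
    and z: "z \<in> points Z"
  shows "on_pts a z = on_pts b z"
proof -
  note lE = scheme_locally_ringed[OF E] and lZ = scheme_locally_ringed[OF Z]
  obtain P p q d where fp: "is_fibre_product E E S g g P p q" and d: "morphism E P d"
    and pd: "mor_comp E P E p d = mor_id E" and qd: "mor_comp E P E q d = mor_id E" and cl: "closed_immersion E P d"
    using separatedE[OF sep] .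
  have sP: "scheme P" and p: "morphism P E p" and q: "morphism P E q" using fp unfolding is_fibre_product_def by auto
  note lP = scheme_locally_ringed[OF sP]
  have univ: "\<exists>!u. morphism W P u \<and> mor_comp W P E p u = v \<and> mor_comp W P E q u = w"
    if "scheme W" "morphism W E v" "morphism W E w" "mor_comp W E S g v = mor_comp W E S g w"
    for W :: "('i, 'j, 'i, 'j) fp" and v w
    using fp that unfolding is_fibre_product_def by blast
  obtain m where m: "morphism Z P m" "mor_comp Z P E p m = a" "mor_comp Z P E q m = b"
    using univ[OF Z a b gab] by blast
  let ?D = "on_pts d ` points E"
  have D: "closedin (topol P) ?D" using cl unfolding closed_immersion_def by blast
  have PD: "openin (topol P) (points P - ?D)" using D unfolding points_def by (simp add: closedin_def)
  let ?O = "inv_img Z m (points P - ?D)"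
  have O: "openin (topol Z) ?O" by (rule mor_open[OF m(1) PD])
  note mt = dominant_morphism[OF t]
  have empty: "inv_img Y t ?O = {}"
  proof (rule ccontr)
    assume "inv_img Y t ?O \<noteq> {}"
    then obtain y where y: "y \<in> points Y" "on_pts t y \<in> ?O" by (auto simp: inv_img_def)
    let ?z = "on_pts t y"
    have zP: "?z \<in> points Z" by (rule mor_pts[OF mt y(1)])
    have ab: "on_pts a ?z = on_pts b ?z" using arg_cong[OF e, of "\<lambda>m. on_pts m y"] y(1) by simp
    obtain N where N: "openin (topol Z) N" "?z \<in> N"
      "mor_comp (open_sub Z N) Z E a (open_incl Z N) = mor_comp (open_sub Z N) Z E b (open_incl Z N)"
      using dominant_eq_near[OF lZ Y E a b t e zP ab] .
    \<comment> \<open>The universal property cannot be tested with \<open>Y\<close>, whose types are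
      arbitrary. A neighbourhood of the image point in \<open>Z\<close> has the right types, and
      \<open>a\<close> and \<open>b\<close> agree on it.\<close>
    let ?ZN = "open_sub Z N" let ?i = "open_incl Z N" let ?n = "mor_comp (open_sub Z N) Z E a (open_incl Z N)"
    note sN = scheme_open_sub[OF Z N(1)] note lN = scheme_locally_ringed[OF sN]
    note i = open_incl_morphism[OF lZ N(1)]
    have n: "morphism ?ZN E ?n" by (rule mor_comp_morphism[OF lN lZ lE i a])
    have mi: "morphism ?ZN P (mor_comp ?ZN Z P m ?i)" by (rule mor_comp_morphism[OF lN lZ lP i m(1)])
    have dn: "morphism ?ZN P (mor_comp ?ZN E P d ?n)" by (rule mor_comp_morphism[OF lN lE lP n d])
    have "mor_comp ?ZN P E p (mor_comp ?ZN Z P m ?i) = ?n" "mor_comp ?ZN P E q (mor_comp ?ZN Z P m ?i) = ?n"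
      using mor_comp_assoc[OF lN lZ lP lE i m(1) p] mor_comp_assoc[OF lN lZ lP lE i m(1) q] m(2,3) N(3) by auto
    moreover have "mor_comp ?ZN P E p (mor_comp ?ZN E P d ?n) = ?n" "mor_comp ?ZN P E q (mor_comp ?ZN E P d ?n) = ?n"
      using mor_comp_assoc[OF lN lE lP lE n d p] mor_comp_assoc[OF lN lE lP lE n d q] pd qd mor_comp_id_left[OF lN lE n] by auto
    ultimately have mdn: "mor_comp ?ZN Z P m ?i = mor_comp ?ZN E P d ?n"
      using univ[OF sN n n refl] mi dn by blast
    have "on_pts m ?z = on_pts d (on_pts ?n ?z)"
      using arg_cong[OF mdn, of "\<lambda>m. on_pts m ?z"] N(1,2) by simp
    moreover have "on_pts ?n ?z \<in> points E" using mor_pts[OF n] N(1,2) by simp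
    ultimately show False using y(2) by (auto simp: inv_img_def)
  qed
  \<comment> \<open>A nonempty open set of a locally ringed space has distinct one and zero, while
    dominance identifies them, as every section pulls back to the empty set.\<close>
  have "?O = {}"
  proof (rule ccontr)
    assume "?O \<noteq> {}"
    then obtain w where w: "w \<in> ?O" by blast
    then have "\<one>\<^bsub>sections Z ?O\<^esub> \<noteq> \<zero>\<^bsub>sections Z ?O\<^esub>"
      using lZ[unfolded locally_ringed_iff] O openin_points[OF O] by blast
    moreover interpret R: cring "sections Z ?O" by (rule presheaf.cring_sec[OF locally_ringed_presheaf[OF lZ] O])
    have "on_sec t ?O \<one>\<^bsub>sections Z ?O\<^esub> = on_sec t ?O \<zero>\<^bsub>sections Z ?O\<^esub>"
      using sheaf_zero_of_empty[OF locally_ringed_sheaf[OF Y]] mor_sec[OF mt O] unfolding empty by simp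
    then have "\<one>\<^bsub>sections Z ?O\<^esub> = \<zero>\<^bsub>sections Z ?O\<^esub>" by (rule dominant_inj[OF t O R.one_closed R.zero_closed])
    ultimately show False by simp
  qed
  then have "z \<notin> ?O" by simp
  then have "on_pts m z \<in> ?D" using z mor_pts[OF m(1) z] unfolding inv_img_def by simp
  then obtain x where x: "x \<in> points E" "on_pts m z = on_pts d x" by blast
  have "on_pts a z = on_pts p (on_pts m z)" "on_pts b z = on_pts q (on_pts m z)" using m(2,3) z by auto
  moreover have "on_pts p (on_pts d x) = x" "on_pts q (on_pts d x) = x"
    using arg_cong[OF pd, of "\<lambda>m. on_pts m x"] arg_cong[OF qd, of "\<lambda>m. on_pts m x"] x(1) by auto
  ultimately show ?thesis using x(2) by simp
qed

section \<open>Reduction to the spectrum of a ring generated by pulled back functions\<close>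

definition sum_of_products :: "('y, 'z) ring_scheme \<Rightarrow> ('r \<Rightarrow> 'y) \<Rightarrow> ('s \<Rightarrow> 'y) \<Rightarrow> ('r \<times> 's) list \<Rightarrow> 'y" where
  "sum_of_products T \<alpha> \<beta> l = foldr (\<lambda>(u, v) x. (\<alpha> u \<otimes>\<^bsub>T\<^esub> \<beta> v) \<oplus>\<^bsub>T\<^esub> x) l \<zero>\<^bsub>T\<^esub>"

text \<open>\<open>H\<close> is the image of the tensor product of \<open>A\<close> and
  \<open>B\<close> in \<open>T\<close>. The lists name its elements: concatenation of lists
  represents sums, and multiplication by one pure product acts termwise.\<close>

lemma sums_of_products_subcring:
  fixes T :: "'y ring"
  assumes T: "cring T" and A: "cring A" and B: "cring B" and \<alpha>: "\<alpha> \<in> ring_hom A T" and \<beta>: "\<beta> \<in> ring_hom B T"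
  defines "H \<equiv> sum_of_products T \<alpha> \<beta> ` {l. set l \<subseteq> carrier A \<times> carrier B}"
  shows "subcring H T" and "\<And>u. u \<in> carrier A \<Longrightarrow> \<alpha> u \<in> H" and "\<And>v. v \<in> carrier B \<Longrightarrow> \<beta> v \<in> H"
proof -
  interpret T: cring T by (rule T)
  interpret A: cring A by (rule A)
  interpret B: cring B by (rule B)
  interpret a: ring_hom_cring A T \<alpha> by unfold_locales (rule \<alpha>)
  interpret b: ring_hom_cring B T \<beta> by unfold_locales (rule \<beta>)
  let ?e = "sum_of_products T \<alpha> \<beta>" and ?L = "{l. set l \<subseteq> carrier A \<times> carrier B}"
  have nil: "?e [] = \<zero>\<^bsub>T\<^esub>" and cons: "?e ((u, v) # l) = (\<alpha> u \<otimes>\<^bsub>T\<^esub> \<beta> v) \<oplus>\<^bsub>T\<^esub> ?e l" for u v l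
    by (simp_all add: sum_of_products_def)
  have c: "?e l \<in> carrier T" if "l \<in> ?L" for l
    using that by (induction l) (auto simp: nil cons)
  have HT: "H \<subseteq> carrier T" unfolding H_def using c by blast
  have app: "?e (l @ l') = ?e l \<oplus>\<^bsub>T\<^esub> ?e l'" if "l \<in> ?L" "l' \<in> ?L" for l l'
    using that(1) by (induction l) (use that(2) c in \<open>auto simp: nil cons T.a_assoc\<close>)
  have add: "x \<oplus>\<^bsub>T\<^esub> y \<in> H" if xy: "x \<in> H" "y \<in> H" for x y
  proof -
    obtain l l' where l: "l \<in> ?L" "l' \<in> ?L" "x = ?e l" "y = ?e l'" using xy unfolding H_def by blast
    have "l @ l' \<in> ?L" using l by auto
    then show ?thesis unfolding H_def l(3,4) app[OF l(1,2), symmetric] by (rule imageI)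
  qed
  have zero: "\<zero>\<^bsub>T\<^esub> \<in> H" unfolding H_def nil[symmetric] by (rule imageI) simp
  \<comment> \<open>Both factors of every pair in the list are multiplied, which is possible without
    leaving the carriers of \<open>A\<close> and \<open>B\<close>; general products follow by
    distributing over a list.\<close>
  have scale: "(\<alpha> u \<otimes>\<^bsub>T\<^esub> \<beta> v) \<otimes>\<^bsub>T\<^esub> y \<in> H" if u: "u \<in> carrier A" "v \<in> carrier B" and y: "y \<in> H" for u v y
  proof -
    obtain l where l: "l \<in> ?L" "y = ?e l" using y unfolding H_def by blast
    let ?m = "map (\<lambda>(x, y). (u \<otimes>\<^bsub>A\<^esub> x, v \<otimes>\<^bsub>B\<^esub> y))"
    have "?e (?m l) = (\<alpha> u \<otimes>\<^bsub>T\<^esub> \<beta> v) \<otimes>\<^bsub>T\<^esub> ?e l \<and> ?m l \<in> ?L"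
      using l(1)
    proof (induction l)
      case Nil then show ?case using u by (simp add: nil)
    next
      case (Cons z l)
      obtain x y where z: "z = (x, y)" by (metis surj_pair)
      have xy: "x \<in> carrier A" "y \<in> carrier B" "l \<in> ?L" using Cons.prems z by auto
      have "\<alpha> (u \<otimes>\<^bsub>A\<^esub> x) \<otimes>\<^bsub>T\<^esub> \<beta> (v \<otimes>\<^bsub>B\<^esub> y) = (\<alpha> u \<otimes>\<^bsub>T\<^esub> \<beta> v) \<otimes>\<^bsub>T\<^esub> (\<alpha> x \<otimes>\<^bsub>T\<^esub> \<beta> y)"
        using u xy by (simp add: T.m_ac)
      then show ?case using Cons.IH[OF xy(3)] u xy c[OF xy(3)] z by (simp add: cons T.r_distr)
    qed
    then have "(\<alpha> u \<otimes>\<^bsub>T\<^esub> \<beta> v) \<otimes>\<^bsub>T\<^esub> y = ?e (?m l)" and "?m l \<in> ?L" using l(2) by auto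
    then show ?thesis unfolding H_def by (rule image_eqI)
  qed
  have gen: "\<alpha> u \<otimes>\<^bsub>T\<^esub> \<beta> v \<in> H" if "u \<in> carrier A" "v \<in> carrier B" for u v
  proof -
    have "?e [(u, v)] = \<alpha> u \<otimes>\<^bsub>T\<^esub> \<beta> v" using that by (simp add: cons nil)
    moreover have "[(u, v)] \<in> ?L" using that by simp
    ultimately show ?thesis unfolding H_def by (intro image_eqI[OF sym])
  qed
  show aH: "\<alpha> u \<in> H" if "u \<in> carrier A" for u using gen[OF that B.one_closed] that by simp
  show "\<beta> v \<in> H" if "v \<in> carrier B" for v using gen[OF A.one_closed that] that by simp
  have mult: "x \<otimes>\<^bsub>T\<^esub> y \<in> H" if x: "x \<in> H" and y: "y \<in> H" for x y
  proof -
    obtain l where l: "l \<in> ?L" "x = ?e l" using x unfolding H_def by blast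
    have yT: "y \<in> carrier T" using y HT by blast
    have "?e l \<otimes>\<^bsub>T\<^esub> y \<in> H" using l(1)
    proof (induction l)
      case Nil then show ?case using zero yT by (simp add: nil)
    next
      case (Cons z l)
      obtain u v where z: "z = (u, v)" by (metis surj_pair)
      have uv: "u \<in> carrier A" "v \<in> carrier B" "l \<in> ?L" using Cons.prems z by auto
      have "?e (z # l) \<otimes>\<^bsub>T\<^esub> y = (\<alpha> u \<otimes>\<^bsub>T\<^esub> \<beta> v) \<otimes>\<^bsub>T\<^esub> y \<oplus>\<^bsub>T\<^esub> ?e l \<otimes>\<^bsub>T\<^esub> y"
        unfolding z cons using uv yT c[OF uv(3)] by (simp add: T.l_distr)
      then show ?case using add[OF scale[OF uv(1,2) y] Cons.IH[OF uv(3)]] by simp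
    qed
    then show ?thesis using l(2) by simp
  qed
  have one: "\<one>\<^bsub>T\<^esub> \<in> H" using aH[OF A.one_closed] by simp
  have neg: "\<ominus>\<^bsub>T\<^esub> x \<in> H" if x: "x \<in> H" for x
  proof -
    have m1: "\<ominus>\<^bsub>T\<^esub> \<one>\<^bsub>T\<^esub> \<in> H" using aH[of "\<ominus>\<^bsub>A\<^esub> \<one>\<^bsub>A\<^esub>"] by simp
    have "\<ominus>\<^bsub>T\<^esub> x = (\<ominus>\<^bsub>T\<^esub> \<one>\<^bsub>T\<^esub>) \<otimes>\<^bsub>T\<^esub> x" using x HT by (simp add: T.l_minus subset_iff)
    then show ?thesis using mult[OF m1 x] by simp
  qed
  show "subcring H T" by (rule T.subcringI'[OF T.subringI[OF HT one neg mult add]])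
qed

text \<open>Let \<open>u\<close> be killed by the pullback and be \<open>c\<close> over
  \<open>e\<close> on the basic open set of \<open>k\<close>. Then \<open>c\<close> vanishes on its
  inverse image, in particular wherever \<open>k\<close> is invertible; by \<open>ann\<close> a
  power of \<open>k\<close> kills \<open>c\<close>, so the fraction is zero at each prime that
  avoids \<open>k\<close>. For affine \<open>X\<close> the hypothesis \<open>ann\<close> is
  \<open>affine_annihilator\<close>.\<close>

lemma subring_spectrum_dominant:
  fixes X :: "('a, 'b) ringed_data"
  assumes X: "locally_ringed X" and H: "subcring H (sections X (points X))"
    and ann: "\<And>f s. f \<in> H \<Longrightarrow> s \<in> H \<Longrightarrow>
      (\<And>W. openin (topol X) W \<Longrightarrow> restrn X (points X) W f \<in> Units (sections X W) \<Longrightarrow> restrn X (points X) W s = \<zero>\<^bsub>sections X W\<^esub>) \<Longrightarrow>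
      \<exists>n::nat. f [^]\<^bsub>sections X (points X)\<^esub> n \<otimes>\<^bsub>sections X (points X)\<^esub> s = \<zero>\<^bsub>sections X (points X)\<^esub>"
    and m: "morphism X (Spec (sections X (points X)\<lparr>carrier := H\<rparr>)) m"
    and gl: "\<And>c. c \<in> H \<Longrightarrow> glob (sections X (points X)\<lparr>carrier := H\<rparr>) m c = c"
  shows "schematically_dominant X (Spec (sections X (points X)\<lparr>carrier := H\<rparr>)) m"
proof -
  let ?T = "sections X (points X)" let ?C = "?T\<lparr>carrier := H\<rparr>"
  interpret X: presheaf X by (rule locally_ringed_presheaf[OF X])
  interpret T: cring ?T by (rule X.cring_sec) simp
  have HT: "H \<subseteq> carrier ?T" by (rule subcringE(1)[OF H])
  have C: "cring ?C" using T.subcring_iff[OF HT] H by blast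
  interpret C: spectrum ?C by (simp add: spectrum_def C)
  have Cpow: "x [^]\<^bsub>?C\<^esub> (n::nat) = x [^]\<^bsub>?T\<^esub> n" for x n by (induction n) auto
  show ?thesis
  proof (rule dominantI[OF C.spec_locally_ringed X m])
    fix N u assume N0: "openin (topol (Spec ?C)) N" and u0: "u \<in> carrier (sections (Spec ?C) N)"
      and z: "on_sec m N u = \<zero>\<^bsub>sections X (inv_img X m N)\<^esub>"
    have N: "openin (zariski ?C) N" and u: "u \<in> carrier (spec_sections ?C N)" using N0 u0 by auto
    interpret SN: cring "spec_sections ?C N" by (rule C.spec_cring[OF N])
    have "u = \<zero>\<^bsub>spec_sections ?C N\<^esub>"
    proof (rule C.spec_sec_eqI[OF u SN.zero_closed])
      fix q assume q: "q \<in> N"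
      interpret q: prime_spot q ?C by (rule C.open_prime[OF N q])
      obtain V c e where V: "openin (zariski ?C) V" "q \<in> V" "V \<subseteq> N" "c \<in> carrier ?C" "e \<in> carrier ?C"
        "\<forall>q'\<in>V. e \<notin> q' \<and> u q' = loc_frac ?C q' c e" using C.spec_secE[OF u q] .
      obtain k where k: "k \<in> carrier ?C" "q \<in> basic_open ?C k" "basic_open ?C k \<subseteq> V"
        using V(1,2) unfolding openin_zariski[OF C] by blast
      let ?K = "basic_open ?C k" let ?V = "inv_img X m ?K"
      have K: "openin (zariski ?C) ?K" using C k(1) by simp
      have K': "openin (topol (Spec ?C)) ?K" using K by simp
      have KN: "?K \<subseteq> N" using k(3) V(3) by blast
      have VO: "openin (topol X) ?V" by (rule mor_open[OF m K'])
      interpret R: cring "sections X ?V" by (rule X.cring_sec[OF VO])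
      have hom: "on_sec m ?K \<in> ring_hom (spec_sections ?C ?K) (sections X ?V)" using mor_hom[OF m K'] by simp
      have uK: "restrict u ?K \<in> carrier (spec_sections ?C ?K)" by (rule C.restrict_sec[OF K KN u])
      have ce: "const_sec ?C ?K e \<otimes>\<^bsub>spec_sections ?C ?K\<^esub> restrict u ?K = const_sec ?C ?K c"
        by (rule C.const_mult_frac(1)[OF K V(4,5)]) (use V(6) k(3) in auto)
      have NX: "openin (topol X) (inv_img X m N)" by (rule mor_open[OF m N0])
      have "on_sec m ?K (restrict u ?K) = restrn X (inv_img X m N) ?V (on_sec m N u)"
        using mor_nat[OF m N0 K' KN, of u] u by simp
      then have uz: "on_sec m ?K (restrict u ?K) = \<zero>\<^bsub>sections X ?V\<^esub>"
        using X.res_zero[OF NX VO inv_img_mono[OF KN]] z by simp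
      have "on_sec m ?K (const_sec ?C ?K c) = \<zero>\<^bsub>sections X ?V\<^esub>"
        using ring_hom_mult[OF hom C.const_sec_closed[OF K V(5)] uK] ring_hom_closed[OF hom C.const_sec_closed[OF K V(5)]]
        unfolding ce uz by simp
      then have cz: "restrn X (points X) ?V c = \<zero>\<^bsub>sections X ?V\<^esub>"
        using C.mor_const[OF m K V(4)] gl[of c] V(4) by simp
      have cT: "c \<in> carrier ?T" "k \<in> carrier ?T" using V(4) k(1) HT by auto
      have "\<exists>n::nat. k [^]\<^bsub>?T\<^esub> n \<otimes>\<^bsub>?T\<^esub> c = \<zero>\<^bsub>?T\<^esub>"
      proof (rule ann)
        show "k \<in> H" "c \<in> H" using k(1) V(4) by auto
        fix W assume W: "openin (topol X) W" and uW: "restrn X (points X) W k \<in> Units (sections X W)"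
        have WP: "W \<subseteq> points X" by (rule openin_points[OF W])
        \<comment> \<open>Where \<open>k\<close> is invertible, \<open>mor_spec_pts\<close> puts the
          image point into the basic open set of \<open>k\<close>, and there \<open>c\<close> is
          already known to vanish.\<close>
        have WV: "W \<subseteq> ?V"
        proof
          fix x assume x: "x \<in> W"
          have xP: "x \<in> points X" using x WP by blast
          have "unit_near X x (points X) k" unfolding unit_near_def using W x WP uW by blast
          then have "k \<notin> on_pts m x" using C.mor_spec_pts[OF X m xP, of k] gl[of k] k(1) by simp
          moreover have "primeideal (on_pts m x) ?C" using mor_pts[OF m xP] unfolding points_Spec[OF C] by simp
          ultimately show "x \<in> ?V" using xP by (simp add: inv_img_def basic_open_def)
        qed
        have "restrn X (points X) W c = restrn X ?V W (restrn X (points X) ?V c)"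
          using X.res_res[OF openin_points_self VO W openin_points[OF VO] WV cT(1)] by simp
        then show "restrn X (points X) W c = \<zero>\<^bsub>sections X W\<^esub>" unfolding cz using X.res_zero[OF VO W WV] by simp
      qed
      then obtain n :: nat where n: "k [^]\<^bsub>?T\<^esub> n \<otimes>\<^bsub>?T\<^esub> c = \<zero>\<^bsub>?T\<^esub>" by blast
      have kq: "k \<in> carrier ?C - q" using k(1,2) unfolding basic_open_def by blast
      have eq: "e \<in> carrier ?C - q" using V(2,5,6) by blast
      have kn: "k [^]\<^bsub>?C\<^esub> n \<in> carrier ?C - q" by (rule q.loc_frac_pow(1)[OF C.one_closed kq])
      have "k [^]\<^bsub>?C\<^esub> n \<otimes>\<^bsub>?C\<^esub> c = \<zero>\<^bsub>?C\<^esub>" using n unfolding Cpow by simp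
      then have "loc_frac ?C q c e = \<zero>\<^bsub>localization ?C q\<^esub>" using q.loc_frac_zero_iff[OF V(4) eq] kn by blast
      then show "u q = \<zero>\<^bsub>spec_sections ?C N\<^esub> q" using V(2,6) q by (simp add: C.spec_ops)
    qed
    then show "u = \<zero>\<^bsub>sections (Spec ?C) N\<^esub>" by simp
  qed
qed

text \<open>By \<open>gl\<close> the pullback of functions along \<open>a\<close> factors through
  \<open>C\<close>. The factor \<open>\<alpha>\<close> gives a morphism of spectra, which the
  inverse of \<open>r\<close> carries into \<open>G\<close>; it extends \<open>a\<close> because
  morphisms to \<open>Spec A\<close> are determined by functions.\<close>

lemma extend_to_spectrum:
  assumes X: "locally_ringed X" and E: "locally_ringed E" and C: "cring C" and A: "cring A"
    and a: "morphism X E a" and G: "openin (topol E) G" and r: "isomorphism (open_sub E G) (Spec A) r"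
    and aG: "\<forall>x\<in>points X. on_pts a x \<in> G"
    and \<alpha>: "\<alpha> \<in> ring_hom A C" and m: "morphism X (Spec C) m"
    and gl: "\<And>u. u \<in> carrier A \<Longrightarrow>
      glob C m (\<alpha> u) = glob A (mor_comp X (open_sub E G) (Spec A) r (mor_restrict X E a (points X) G)) u"
  obtains a' where "morphism (Spec C) E a'" "mor_comp X (Spec C) E a' m = a" "\<forall>z\<in>points (Spec C). on_pts a' z \<in> G"
proof -
  interpret A: spectrum A by (simp add: spectrum_def A)
  interpret C: spectrum C by (simp add: spectrum_def C)
  note EG = locally_ringed_open_sub[OF E G] and lA = A.spec_locally_ringed and lC = C.spec_locally_ringed
  note mr = isomorphism_morphism[OF r]
  let ?c = "mor_restrict X E a (points X) G"
  note c = corestrict[OF X E a G aG]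
  let ?a1 = "mor_comp X (open_sub E G) (Spec A) r ?c"
  have a1: "morphism X (Spec A) ?a1" by (rule mor_comp_morphism[OF X EG lA c(1) mr])
  have "const_sec C (points (Spec C)) \<circ> \<alpha> \<in> ring_hom A (sections (Spec C) (points (Spec C)))"
    using ring_hom_trans[OF \<alpha> C.const_hom[OF C.points_open]] by simp
  from A.hom_to_Spec[OF lC this] obtain n where n: "morphism (Spec C) (Spec A) n"
    and gn: "\<And>u. u \<in> carrier A \<Longrightarrow> glob A n u = const_sec C (points (Spec C)) (\<alpha> u)" by auto
  have nm: "mor_comp X (Spec C) (Spec A) n m = ?a1"
  proof (rule A.mor_spec_eqI[OF X mor_comp_morphism[OF X lC lA m n] a1])
    fix u assume u: "u \<in> carrier A"
    show "glob A (mor_comp X (Spec C) (Spec A) n m) u = glob A ?a1 u"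
    proof -
      have "glob A (mor_comp X (Spec C) (Spec A) n m) u = glob C m (\<alpha> u)"
        unfolding glob_comp[OF A n u] gn[OF u] by (simp add: glob_def)
      then show ?thesis unfolding gl[OF u] .
    qed
  qed
  obtain r' where r': "isomorphism (Spec A) (open_sub E G) r'" "mor_comp (open_sub E G) (Spec A) (open_sub E G) r' r = mor_id (open_sub E G)"
    using isomorphism_inverse[OF r] by metis
  note mr' = isomorphism_morphism[OF r'(1)]
  let ?n' = "mor_comp (Spec C) (Spec A) (open_sub E G) r' n"
  have n': "morphism (Spec C) (open_sub E G) ?n'" by (rule mor_comp_morphism[OF lC lA EG n mr'])
  note i = open_incl_morphism[OF E G]
  let ?a = "mor_comp (Spec C) (open_sub E G) E (open_incl E G) ?n'"
  have 1: "morphism (Spec C) E ?a" by (rule mor_comp_morphism[OF lC EG E n' i])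
  have "mor_comp X (Spec C) (open_sub E G) ?n' m = mor_comp X (Spec A) (open_sub E G) r' ?a1"
    using mor_comp_assoc[OF X lC lA EG m n mr'] nm by simp
  also have "\<dots> = ?c"
    using mor_comp_assoc[OF X EG lA EG c(1) mr mr'] r'(2) mor_comp_id_left[OF X EG c(1)] by simp
  finally have "mor_comp X (Spec C) E ?a m = mor_comp X (open_sub E G) E (open_incl E G) ?c"
    using mor_comp_assoc[OF X lC EG E m n' i] by simp
  then have 2: "mor_comp X (Spec C) E ?a m = a" unfolding c(2) .
  have "on_pts ?a z \<in> G" if z: "z \<in> points (Spec C)" for z
  proof -
    have "on_pts ?n' z \<in> G" using mor_pts[OF n' z] points_open_sub[OF G] by simp
    moreover have "on_pts ?a z = on_pts (open_incl E G) (on_pts ?n' z)" by (rule pts_comp[OF z])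
    ultimately show ?thesis using pts_incl[OF G] by simp
  qed
  then show ?thesis using that 1 2 by blast
qed

text \<open>Both morphisms extend to the spectrum of the ring \<open>H\<close> generated by the
  functions pulled back from \<open>G\<close> and \<open>G'\<close>. Since \<open>X\<close> is
  schematically dominant over this spectrum, so is \<open>Y\<close>, and the claim becomes
  \<open>separated_eq_pts_small\<close> for a copy of the spectrum in the types of test
  schemes.\<close>

lemma separated_eq_pts_affine:
  fixes E :: "('i, 'j) ringed_data" and A B :: "'j ring" and D :: "'r ring" and R0 :: "'k ring"
  assumes X: "locally_ringed X" and D: "cring D" and iD: "isomorphism X (Spec D) iD"
    and E: "scheme E" and S: "locally_ringed S" and sep: "separated E S g"
    and a: "morphism X E a" and b: "morphism X E b" and gab: "mor_comp X E S g a = mor_comp X E S g b"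
    and G: "openin (topol E) G" and A: "cring A" and r: "isomorphism (open_sub E G) (Spec A) r" and aG: "\<forall>x\<in>points X. on_pts a x \<in> G"
    and G': "openin (topol E) G'" and B: "cring B" and r': "isomorphism (open_sub E G') (Spec B) r'" and bG: "\<forall>x\<in>points X. on_pts b x \<in> G'"
    and R: "openin (topol S) R" and R0: "cring R0" and iR: "isomorphism (open_sub S R) (Spec R0) iR"
    and gG: "\<forall>e\<in>G. on_pts g e \<in> R" and gG': "\<forall>e\<in>G'. on_pts g e \<in> R"
    and Y: "locally_ringed Y" and t: "schematically_dominant Y X t" and e: "mor_comp Y X E a t = mor_comp Y X E b t"
    and x: "x \<in> points X"
  shows "on_pts a x = on_pts b x"
proof -
  interpret X: presheaf X by (rule locally_ringed_presheaf[OF X])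
  note lE = scheme_locally_ringed[OF E]
  have g: "morphism E S g" using sep unfolding separated_def by blast
  interpret A: spectrum A by (simp add: spectrum_def A)
  interpret B: spectrum B by (simp add: spectrum_def B)
  let ?T = "sections X (points X)"
  have T: "cring ?T" by (rule X.cring_sec) simp
  interpret T: cring ?T by (rule T)
  note EG = locally_ringed_open_sub[OF lE G] and EG' = locally_ringed_open_sub[OF lE G']
  let ?a1 = "mor_comp X (open_sub E G) (Spec A) r (mor_restrict X E a (points X) G)"
  let ?b1 = "mor_comp X (open_sub E G') (Spec B) r' (mor_restrict X E b (points X) G')"
  have a1: "morphism X (Spec A) ?a1"
    by (rule mor_comp_morphism[OF X EG A.spec_locally_ringed corestrict(1)[OF X lE a G aG] isomorphism_morphism[OF r]])
  have b1: "morphism X (Spec B) ?b1"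
    by (rule mor_comp_morphism[OF X EG' B.spec_locally_ringed corestrict(1)[OF X lE b G' bG] isomorphism_morphism[OF r']])
  define \<alpha> where "\<alpha> = glob A ?a1"
  define \<beta> where "\<beta> = glob B ?b1"
  have \<alpha>: "\<alpha> \<in> ring_hom A ?T" unfolding \<alpha>_def by (rule A.glob_hom[OF a1])
  have \<beta>: "\<beta> \<in> ring_hom B ?T" unfolding \<beta>_def by (rule B.glob_hom[OF b1])
  define H where "H = sum_of_products ?T \<alpha> \<beta> ` {l. set l \<subseteq> carrier A \<times> carrier B}"
  note sub = sums_of_products_subcring[OF T A B \<alpha> \<beta>, folded H_def]
  have HT: "H \<subseteq> carrier ?T" by (rule subcringE(1)[OF sub(1)])
  let ?C = "?T\<lparr>carrier := H\<rparr>"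
  have C: "cring ?C" using T.subcring_iff[OF HT] sub(1) by blast
  interpret C: spectrum ?C by (simp add: spectrum_def C)
  note lC = C.spec_locally_ringed
  have "(\<lambda>c. c) \<in> ring_hom ?C ?T" by (rule ring_hom_memI) (use HT in auto)
  from C.hom_to_Spec[OF X this] obtain m where m: "morphism X (Spec ?C) m" and gl: "\<And>c. c \<in> H \<Longrightarrow> glob ?C m c = c" by auto
  have dm: "schematically_dominant X (Spec ?C) m"
  proof (rule subring_spectrum_dominant[OF X sub(1) _ m gl])
    fix f s assume "f \<in> H" "s \<in> H" and z: "\<And>W. openin (topol X) W \<Longrightarrow> restrn X (points X) W f \<in> Units (sections X W) \<Longrightarrow> restrn X (points X) W s = \<zero>\<^bsub>sections X W\<^esub>"
    then show "\<exists>n::nat. f [^]\<^bsub>?T\<^esub> n \<otimes>\<^bsub>?T\<^esub> s = \<zero>\<^bsub>?T\<^esub>" using affine_annihilator[OF X D iD _ _ z] HT by blast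
  qed
  have \<alpha>C: "\<alpha> \<in> ring_hom A ?C" by (rule ring_hom_memI)
      (simp_all add: sub(2) ring_hom_mult[OF \<alpha>] ring_hom_add[OF \<alpha>] ring_hom_one[OF \<alpha>])
  have \<beta>C: "\<beta> \<in> ring_hom B ?C" by (rule ring_hom_memI)
      (simp_all add: sub(3) ring_hom_mult[OF \<beta>] ring_hom_add[OF \<beta>] ring_hom_one[OF \<beta>])
  obtain a' where a': "morphism (Spec ?C) E a'" "mor_comp X (Spec ?C) E a' m = a" "\<forall>z\<in>points (Spec ?C). on_pts a' z \<in> G"
    using extend_to_spectrum[OF X lE C A a G r aG \<alpha>C m] gl[OF sub(2)] unfolding \<alpha>_def by metis
  obtain b' where b': "morphism (Spec ?C) E b'" "mor_comp X (Spec ?C) E b' m = b" "\<forall>z\<in>points (Spec ?C). on_pts b' z \<in> G'"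
    using extend_to_spectrum[OF X lE C B b G' r' bG \<beta>C m] gl[OF sub(3)] unfolding \<beta>_def by metis
  \<comment> \<open>The extensions agree over \<open>S\<close> because they do so after the dominant
    morphism from \<open>X\<close>, and both composites land in the affine open set
    \<open>R\<close>. Here no separatedness is available, so a common affine target over
    \<open>S\<close> is needed.\<close>
  have gab': "mor_comp (Spec ?C) E S g a' = mor_comp (Spec ?C) E S g b'"
  proof (rule dominant_eq_affine[OF lC X S mor_comp_morphism[OF lC lE S a'(1) g] mor_comp_morphism[OF lC lE S b'(1) g] dm _ R R0 iR])
    show "mor_comp X (Spec ?C) S (mor_comp (Spec ?C) E S g a') m = mor_comp X (Spec ?C) S (mor_comp (Spec ?C) E S g b') m"
      unfolding mor_comp_assoc[OF X lC lE S m a'(1) g] mor_comp_assoc[OF X lC lE S m b'(1) g] a'(2) b'(2) by (rule gab)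
    show "\<forall>z\<in>points (Spec ?C). on_pts (mor_comp (Spec ?C) E S g a') z \<in> R" using a'(3) gG by simp
    show "\<forall>z\<in>points (Spec ?C). on_pts (mor_comp (Spec ?C) E S g b') z \<in> R" using b'(3) gG' by simp
  qed
  \<comment> \<open>Every element of the ring is named by a list of pairs over \<open>'j\<close>,
    which is exactly the shape that the points and sections of the fibre product of \<open>E\<close>
    with itself provide for.\<close>
  have "carrier ?C \<subseteq> range (sum_of_products ?T \<alpha> \<beta>)" unfolding H_def by auto
  then obtain Z :: "('i, 'j, 'i, 'j) fp" and \<zeta> where Z: "scheme Z" and \<zeta>: "isomorphism Z (Spec ?C) \<zeta>"
    by (rule small_spectrum[OF C])
  obtain \<xi> where \<xi>: "isomorphism (Spec ?C) Z \<xi>" "mor_comp (Spec ?C) Z (Spec ?C) \<zeta> \<xi> = mor_id (Spec ?C)"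
    using isomorphism_inverse[OF \<zeta>] by metis
  note lZ = scheme_locally_ringed[OF Z] and m\<zeta> = isomorphism_morphism[OF \<zeta>] and m\<xi> = isomorphism_morphism[OF \<xi>(1)]
  let ?u = "mor_comp X (Spec ?C) Z \<xi> m"
  have u: "schematically_dominant X Z ?u" by (rule dominant_comp[OF X lC lZ dm isomorphism_dominant[OF \<xi>(1)]])
  note mu = dominant_morphism[OF u]
  let ?a = "mor_comp Z (Spec ?C) E a' \<zeta>" and ?b = "mor_comp Z (Spec ?C) E b' \<zeta>"
  have ma: "morphism Z E ?a" and mb: "morphism Z E ?b"
    by (rule mor_comp_morphism[OF lZ lC lE m\<zeta> a'(1)], rule mor_comp_morphism[OF lZ lC lE m\<zeta> b'(1)])
  have "mor_comp X Z (Spec ?C) \<zeta> ?u = m"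
    using mor_comp_assoc[OF X lC lZ lC m m\<xi> m\<zeta>] \<xi>(2) mor_comp_id_left[OF X lC m] by simp
  then have au: "mor_comp X Z E ?a ?u = a" and bu: "mor_comp X Z E ?b ?u = b"
    using mor_comp_assoc[OF X lZ lC lE mu m\<zeta> a'(1)] mor_comp_assoc[OF X lZ lC lE mu m\<zeta> b'(1)] a'(2) b'(2) by auto
  note mt = dominant_morphism[OF t]
  have "on_pts ?a (on_pts ?u x) = on_pts ?b (on_pts ?u x)"
  proof (rule separated_eq_pts_small[OF E S sep Z ma mb _ Y dominant_comp[OF Y X lZ t u]])
    show "mor_comp Z E S g ?a = mor_comp Z E S g ?b"
      using mor_comp_assoc[OF lZ lC lE S m\<zeta> a'(1) g] mor_comp_assoc[OF lZ lC lE S m\<zeta> b'(1) g] gab' by simp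
    show "mor_comp Y Z E ?a (mor_comp Y X Z ?u t) = mor_comp Y Z E ?b (mor_comp Y X Z ?u t)"
      using mor_comp_assoc[OF Y X lZ lE mt mu ma] mor_comp_assoc[OF Y X lZ lE mt mu mb] au bu e by simp
    show "on_pts ?u x \<in> points Z" by (rule mor_pts[OF mu x])
  qed
  moreover have "on_pts a x = on_pts ?a (on_pts ?u x)"
    using arg_cong[OF au, of "\<lambda>m. on_pts m x"] pts_comp[OF x, of Z E ?a ?u] by simp
  moreover have "on_pts b x = on_pts ?b (on_pts ?u x)"
    using arg_cong[OF bu, of "\<lambda>m. on_pts m x"] pts_comp[OF x, of Z E ?b ?u] by simp
  ultimately show ?thesis by simp
qed

text \<open>
  The fibre product that witnesses separatedness is only known to be universal for test schemes in
  its own types; so the two morphisms are first extended to the spectrum of a ring generated by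
  pullbacks of functions on the target.
\<close>

theorem separated_dominant_eq:
  fixes E :: "('i, 'j) ringed_data" and X :: "('a, 'b) ringed_data"
  assumes X: "scheme X" and E: "scheme E" and S: "locally_ringed S" and sep: "separated E S g"
    and aff: "\<forall>s\<in>points S. \<exists>R (R0 :: 'k ring) r. openin (topol S) R \<and> s \<in> R \<and> cring R0 \<and> isomorphism (open_sub S R) (Spec R0) r"
    and a: "morphism X E a" and b: "morphism X E b" and gab: "mor_comp X E S g a = mor_comp X E S g b"
    and Y: "locally_ringed Y" and t: "schematically_dominant Y X t" and e: "mor_comp Y X E a t = mor_comp Y X E b t"
  shows "a = b"
proof -
  note lX = scheme_locally_ringed[OF X] and lE = scheme_locally_ringed[OF E]
  have g: "morphism E S g" using sep unfolding separated_def by blast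
  note mt = dominant_morphism[OF t]
  have pts: "on_pts a x = on_pts b x" if x: "x \<in> points X" for x
  proof -
    have "on_pts g (on_pts a x) = on_pts g (on_pts b x)"
      using arg_cong[OF gab, of "\<lambda>m. on_pts m x"] x by simp
    moreover obtain R and R0 :: "'k ring" and iR where R: "openin (topol S) R" "on_pts g (on_pts a x) \<in> R"
      and R0: "cring R0" and iR: "isomorphism (open_sub S R) (Spec R0) iR"
      using aff[THEN bspec, OF mor_pts[OF g mor_pts[OF a x]]] by blast
    ultimately have ax: "on_pts a x \<in> inv_img E g R" "on_pts b x \<in> inv_img E g R"
      using mor_pts[OF a x] mor_pts[OF b x] by (auto simp: inv_img_def)
    have gR: "openin (topol E) (inv_img E g R)" by (rule mor_open[OF g R(1)])
    \<comment> \<open>The affine open sets around the two image points are taken over one affine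
      open set \<open>R\<close> of the base, as \<open>separated_eq_pts_affine\<close> demands; the
      two image points have the same image in \<open>S\<close>.\<close>
    obtain G where G: "openin (topol E) G" "on_pts a x \<in> G" "G \<subseteq> inv_img E g R" "affine (open_sub E G)"
      using affine_neighbourhood[OF E gR ax(1)] .
    obtain G' where G': "openin (topol E) G'" "on_pts b x \<in> G'" "G' \<subseteq> inv_img E g R" "affine (open_sub E G')"
      using affine_neighbourhood[OF E gR ax(2)] .
    obtain A :: "'j ring" and r where A: "cring A" "isomorphism (open_sub E G) (Spec A) r" using G(4) unfolding affine_def by blast
    obtain B :: "'j ring" and r' where B: "cring B" "isomorphism (open_sub E G') (Spec B) r'" using G'(4) unfolding affine_def by blast
    have U: "openin (topol X) (inv_img X a G \<inter> inv_img X b G')" using mor_open[OF a G(1)] mor_open[OF b G'(1)] by blast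
    have xU: "x \<in> inv_img X a G \<inter> inv_img X b G'" using x G(2) G'(2) by (simp add: inv_img_def)
    obtain V where V: "openin (topol X) V" "x \<in> V" "V \<subseteq> inv_img X a G \<inter> inv_img X b G'" "affine (open_sub X V)"
      using affine_neighbourhood[OF X U xU] .
    obtain D :: "'b ring" and d where D: "cring D" "isomorphism (open_sub X V) (Spec D) d" using V(4) unfolding affine_def by blast
    let ?XV = "open_sub X V" let ?i = "open_incl X V"
    note XV = locally_ringed_open_sub[OF lX V(1)] and i = open_incl_morphism[OF lX V(1)]
    let ?a = "mor_comp ?XV X E a ?i" and ?b = "mor_comp ?XV X E b ?i"
    have ma: "morphism ?XV E ?a" and mb: "morphism ?XV E ?b"
      by (rule mor_comp_morphism[OF XV lX lE i a], rule mor_comp_morphism[OF XV lX lE i b])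
    have "on_pts ?a x = on_pts ?b x"
    proof (rule separated_eq_pts_affine[OF XV D E S sep ma mb _ G(1) A _ G'(1) B _ R(1) R0 iR _ _
          locally_ringed_open_sub[OF Y mor_open[OF mt V(1)]] dominant_restrict[OF lX Y t V(1)] restrict_comp_incl[OF lX Y lE mt a b V(1) e]])
      show "mor_comp ?XV E S g ?a = mor_comp ?XV E S g ?b"
        using mor_comp_assoc[OF XV lX lE S i a g] mor_comp_assoc[OF XV lX lE S i b g] gab by simp
      show "\<forall>y\<in>points ?XV. on_pts ?a y \<in> G" "\<forall>y\<in>points ?XV. on_pts ?b y \<in> G'"
        using V(3) points_open_sub[OF V(1)] pts_incl[OF V(1)] by (auto simp: inv_img_def)
      show "\<forall>e\<in>G. on_pts g e \<in> R" "\<forall>e\<in>G'. on_pts g e \<in> R" using G(3) G'(3) by (auto simp: inv_img_def)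
      show "x \<in> points ?XV" using V(1,2) by simp
    qed
    then show ?thesis using V(1,2) by simp
  qed
  show ?thesis
  proof (rule mor_eq_locally[OF lX lE a b])
    fix x assume x: "x \<in> points X"
    show "\<exists>N. openin (topol X) N \<and> x \<in> N \<and> mor_comp (open_sub X N) X E a (open_incl X N) = mor_comp (open_sub X N) X E b (open_incl X N)"
      using dominant_eq_near[OF lX Y E a b t e x pts[OF x]] by metis
  qed
qed

section \<open>Charts of a local isomorphism\<close>

text \<open>An open set on which \<open>h\<close> is an open immersion. The isomorphism onto the
  open image is made explicit, since transitions between charts are built from its inverse.\<close>

definition chart ::
  "('a, 'b) ringed_data \<Rightarrow> ('c, 'd) ringed_data \<Rightarrow> ('a, 'b, 'c, 'd) mor_data \<Rightarrow> 'a set \<Rightarrow> bool" where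
  "chart T E h W \<longleftrightarrow> openin (topol T) W \<and> openin (topol E) (on_pts h ` W) \<and>
     isomorphism (open_sub T W) (open_sub E (on_pts h ` W)) (mor_restrict T E h W (on_pts h ` W))"

lemma image_restrict: "openin (topol T) U \<Longrightarrow> W \<subseteq> U \<Longrightarrow> on_pts (mor_restrict T E h U V) ` W = on_pts h ` W"
  by (intro image_cong refl) (auto simp: subset_iff)

locale local_iso =
  fixes T :: "('a, 'b) ringed_data" and E :: "('e, 'f) ringed_data" and h :: "('a, 'b, 'e, 'f) mor_data"
  assumes T: "scheme T" and E: "scheme E" and h_local: "local_isomorphism T E h"
begin

lemma lT: "locally_ringed T" and lE: "locally_ringed E"
  using T E scheme_locally_ringed by auto

lemma h: "morphism T E h"
  using h_local by (simp add: local_isomorphism_def)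

lemma h_open_sub:
  assumes "openin (topol T) U" "openin (topol E) V" "on_pts h ` U \<subseteq> V"
  shows "morphism (open_sub T U) (open_sub E V) (mor_restrict T E h U V)"
    and "mor_comp (open_sub T U) (open_sub E V) E (open_incl E V) (mor_restrict T E h U V) =
      mor_comp (open_sub T U) T E h (open_incl T U)"
  using mor_restrict_morphism[OF lT lE h assms(1,2)] incl_comp_restrict[OF lT lE h assms(1,2)] assms(3) by auto

lemma chart_iff_open_immersion:
  assumes U: "openin (topol T) U"
  shows "open_immersion (open_sub T U) E (mor_restrict T E h U (points E)) \<longleftrightarrow> chart T E h U"
proof -
  have hP: "on_pts h x \<in> points E" if "x \<in> U" for x using mor_pts[OF h] openin_points[OF U] that by blast
  have m: "morphism (open_sub T U) E (mor_restrict T E h U (points E))"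
    using h_open_sub(1)[OF U openin_points_self] hP by auto
  have r: "mor_restrict (open_sub T U) E (mor_restrict T E h U (points E)) U (on_pts h ` U) = mor_restrict T E h U (on_pts h ` U)"
    if V: "openin (topol E) (on_pts h ` U)"
    using restrict_restrict[OF lT lE h U openin_points_self hP U subset_refl V] openin_points[OF V] by simp
  show ?thesis unfolding open_immersion_def chart_def
    using m U r by (simp add: image_restrict[OF U] points_open_sub[OF U] cong: conj_cong)
qed

lemma chart_open: "chart T E h W \<Longrightarrow> openin (topol T) W" "chart T E h W \<Longrightarrow> openin (topol E) (on_pts h ` W)"
  by (simp_all add: chart_def)

lemma chart_inj: assumes W: "chart T E h W" shows "inj_on (on_pts h) W"
proof -
  have "inj_on (on_pts (mor_restrict T E h W (on_pts h ` W))) W"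
    using isomorphism_pts[of "open_sub T W"] W unfolding chart_def by (metis bij_betw_def points_open_sub)
  then show ?thesis using chart_open(1)[OF W] by (simp add: inj_on_def)
qed

lemma chart_sub:
  assumes W: "chart T E h W" and W': "openin (topol T) W'" "W' \<subseteq> W"
  shows "chart T E h W'"
proof -
  let ?V = "on_pts h ` W" and ?k = "mor_restrict T E h W (on_pts h ` W)"
  note O = chart_open[OF W]
  have iso: "isomorphism (open_sub T W) (open_sub E ?V) ?k" using W by (simp add: chart_def)
  have W'W: "openin (topol (open_sub T W)) W'" using W' openin_open_sub[OF O(1)] by simp
  have im: "on_pts ?k ` W' = on_pts h ` W'" by (rule image_restrict[OF O(1) W'(2)])
  have "openin (topol (open_sub E ?V)) (on_pts h ` W')" using isomorphism_open[OF iso W'W] im by simp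
  then have V': "openin (topol E) (on_pts h ` W')" "on_pts h ` W' \<subseteq> ?V" using openin_open_sub[OF O(2)] by auto
  have r: "mor_restrict (open_sub T W) (open_sub E ?V) ?k W' (on_pts h ` W') = mor_restrict T E h W' (on_pts h ` W')"
    by (rule restrict_restrict[OF lT lE h O _ W' V']) auto
  have "isomorphism (open_sub T W') (open_sub E (on_pts h ` W')) (mor_restrict T E h W' (on_pts h ` W'))"
    using isomorphism_restrict[OF locally_ringed_open_sub[OF lT O(1)] locally_ringed_open_sub[OF lE O(2)] iso W'W]
    unfolding im r open_sub_open_sub[OF W'(2)] open_sub_open_sub[OF V'(2)] .
  then show ?thesis unfolding chart_def using W'(1) V'(1) by simp
qed

lemma chart_near:
  assumes N: "openin (topol T) N" and x: "x \<in> N"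
  obtains W where "chart T E h W" "x \<in> W" "W \<subseteq> N"
proof -
  have "x \<in> points T" using N x openin_points by blast
  then obtain U where U: "openin (topol T) U" "x \<in> U" "open_immersion (open_sub T U) E (mor_restrict T E h U (points E))"
    using h_local unfolding local_isomorphism_def by blast
  then have c: "chart T E h U" using chart_iff_open_immersion by blast
  have "openin (topol T) (U \<inter> N)" using U(1) N by blast
  then have "chart T E h (U \<inter> N)" using chart_sub[OF c] by blast
  then show ?thesis using that[of "U \<inter> N"] U(2) x by blast
qed

lemma h_image_open:
  assumes U: "openin (topol T) U" shows "openin (topol E) (on_pts h ` U)"
proof (subst openin_subopen, intro ballI)
  fix e assume "e \<in> on_pts h ` U"
  then obtain x where x: "x \<in> U" "e = on_pts h x" by blast
  obtain W where "chart T E h W" "x \<in> W" "W \<subseteq> U" using chart_near[OF U x(1)] .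
  then show "\<exists>V. openin (topol E) V \<and> e \<in> V \<and> V \<subseteq> on_pts h ` U" using chart_open(2) x(2) by blast
qed

text \<open>Charts around two points of the same fibre are cut down to the inverse image of the
  intersection of their images. Having the same image, they are related by a transition
  isomorphism.\<close>

lemma chart_pair:
  assumes N: "openin (topol T) N" "x \<in> N" and N': "openin (topol T) N'" "y \<in> N'" and e: "on_pts h x = on_pts h y"
  obtains W W' where "chart T E h W" "x \<in> W" "W \<subseteq> N" "chart T E h W'" "y \<in> W'" "W' \<subseteq> N'" "on_pts h ` W = on_pts h ` W'"
proof -
  obtain W where W: "chart T E h W" "x \<in> W" "W \<subseteq> N" using chart_near[OF N] .
  obtain W' where W': "chart T E h W'" "y \<in> W'" "W' \<subseteq> N'" using chart_near[OF N'] .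
  let ?V = "on_pts h ` W \<inter> on_pts h ` W'"
  have V: "openin (topol E) ?V" using chart_open(2) W(1) W'(1) by blast
  let ?W = "W \<inter> inv_img T h ?V" and ?W' = "W' \<inter> inv_img T h ?V"
  have O: "openin (topol T) ?W" "openin (topol T) ?W'" using chart_open(1) W(1) W'(1) mor_open[OF h V] by blast+
  have sub: "W \<subseteq> points T" "W' \<subseteq> points T" using chart_open(1) W(1) W'(1) openin_points by blast+
  have "on_pts h ` (M \<inter> inv_img T h ?V) = ?V" if M: "M \<subseteq> points T" "?V \<subseteq> on_pts h ` M" for M
  proof
    show "?V \<subseteq> on_pts h ` (M \<inter> inv_img T h ?V)"
    proof
      fix e assume e: "e \<in> ?V"
      then obtain m where m: "m \<in> M" "e = on_pts h m" using M(2) by blast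
      then have "m \<in> inv_img T h ?V" using M(1) e by (auto simp: inv_img_def)
      then show "e \<in> on_pts h ` (M \<inter> inv_img T h ?V)" using m by blast
    qed
  qed (auto simp: inv_img_def)
  then have "on_pts h ` ?W = ?V" "on_pts h ` ?W' = ?V" using sub by blast+
  moreover have "on_pts h x \<in> ?V" "on_pts h y \<in> ?V" using imageI[OF W(2), of "on_pts h"] imageI[OF W'(2), of "on_pts h"] e by simp_all
  then have "x \<in> ?W" "y \<in> ?W'" using W(2) W'(2) sub by (auto simp: inv_img_def)
  ultimately show ?thesis
    using that[of ?W ?W'] chart_sub[OF W(1) O(1)] chart_sub[OF W'(1) O(2)] W(3) W'(3) by (simp add: le_infI1)
qed

text \<open>Among morphisms that land in one chart, \<open>h\<close> can be cancelled: it is the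
  composite of an isomorphism with the inclusion of an open set of \<open>E\<close>, and both can be
  cancelled.\<close>

lemma chart_mono:
  assumes Y: "locally_ringed Y" and W: "chart T E h W" and a: "morphism Y T a" and b: "morphism Y T b"
    and aW: "\<forall>y\<in>points Y. on_pts a y \<in> W" and bW: "\<forall>y\<in>points Y. on_pts b y \<in> W"
    and e: "mor_comp Y T E h a = mor_comp Y T E h b"
  shows "a = b"
proof -
  note O = chart_open[OF W]
  let ?V = "on_pts h ` W" let ?k = "mor_restrict T E h W ?V"
  have k: "isomorphism (open_sub T W) (open_sub E ?V) ?k" using W by (simp add: chart_def)
  note TW = locally_ringed_open_sub[OF lT O(1)] and EV = locally_ringed_open_sub[OF lE O(2)]
  note ca = corestrict[OF Y lT a O(1) aW] and cb = corestrict[OF Y lT b O(1) bW]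
  note mk = isomorphism_morphism[OF k] and kk = h_open_sub(2)[OF O subset_refl]
  note iW = open_incl_morphism[OF lT O(1)] and iV = open_incl_morphism[OF lE O(2)]
  let ?a = "mor_restrict Y T a (points Y) W" and ?b = "mor_restrict Y T b (points Y) W"
  have *: "mor_comp Y (open_sub E ?V) E (open_incl E ?V) (mor_comp Y (open_sub T W) (open_sub E ?V) ?k c) =
      mor_comp Y T E h (mor_comp Y (open_sub T W) T (open_incl T W) c)" if c: "morphism Y (open_sub T W) c" for c
    using mor_comp_assoc[OF Y TW EV lE c mk iV] mor_comp_assoc[OF Y TW lT lE c iW h] kk by simp
  have "mor_comp Y (open_sub T W) (open_sub E ?V) ?k ?a = mor_comp Y (open_sub T W) (open_sub E ?V) ?k ?b"
  proof (rule open_incl_mono[OF lE O(2) mor_comp_morphism[OF Y TW EV ca(1) mk] mor_comp_morphism[OF Y TW EV cb(1) mk]])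
    show "mor_comp Y (open_sub E ?V) E (open_incl E ?V) (mor_comp Y (open_sub T W) (open_sub E ?V) ?k ?a) =
      mor_comp Y (open_sub E ?V) E (open_incl E ?V) (mor_comp Y (open_sub T W) (open_sub E ?V) ?k ?b)"
      unfolding *[OF ca(1)] *[OF cb(1)] ca(2) cb(2) by (rule e)
  qed
  then have "?a = ?b" by (rule isomorphism_cancel[OF Y TW EV k ca(1) cb(1)])
  then have "mor_comp Y (open_sub T W) T (open_incl T W) ?a = mor_comp Y (open_sub T W) T (open_incl T W) ?b" by (rule arg_cong)
  then show ?thesis unfolding ca(2) cb(2) .
qed

lemma chart_transition:
  assumes W: "chart T E h W" and W': "chart T E h W'" and e: "on_pts h ` W = on_pts h ` W'"
  obtains \<sigma> where "morphism (open_sub T W) T \<sigma>"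
    "mor_comp (open_sub T W) T E h \<sigma> = mor_comp (open_sub T W) T E h (open_incl T W)"
    "\<forall>x\<in>W. on_pts \<sigma> x \<in> W'"
    "mor_comp (open_sub T (W \<inter> W')) (open_sub T W) T \<sigma> (open_incl (open_sub T W) (W \<inter> W')) =
     mor_comp (open_sub T (W \<inter> W')) (open_sub T W) T (open_incl T W) (open_incl (open_sub T W) (W \<inter> W'))"
proof -
  note O = chart_open[OF W] and O' = chart_open[OF W']
  let ?V = "on_pts h ` W"
  let ?k = "mor_restrict T E h W ?V" and ?k' = "mor_restrict T E h W' ?V"
  have k: "morphism (open_sub T W) (open_sub E ?V) ?k" using W isomorphism_morphism unfolding chart_def by blast
  have k': "isomorphism (open_sub T W') (open_sub E ?V) ?k'" using W' e by (simp add: chart_def)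
  \<comment> \<open>The transition is the isomorphism of \<open>W\<close> onto the common image,
    followed by the inverse \<open>s\<close> of the one of \<open>W'\<close>.\<close>
  obtain s where s: "isomorphism (open_sub E ?V) (open_sub T W') s" "mor_comp (open_sub E ?V) (open_sub T W') (open_sub E ?V) ?k' s = mor_id (open_sub E ?V)"
    using isomorphism_inverse[OF k'] by metis
  note TW = locally_ringed_open_sub[OF lT O(1)] and TW' = locally_ringed_open_sub[OF lT O'(1)] and EV = locally_ringed_open_sub[OF lE O(2)]
  note ms = isomorphism_morphism[OF s(1)] and mk' = isomorphism_morphism[OF k']
  note iW = open_incl_morphism[OF lT O(1)] and iW' = open_incl_morphism[OF lT O'(1)] and iV = open_incl_morphism[OF lE O(2)]
  let ?sk = "mor_comp (open_sub T W) (open_sub E ?V) (open_sub T W') s ?k"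
  have sk: "morphism (open_sub T W) (open_sub T W') ?sk" by (rule mor_comp_morphism[OF TW EV TW' k ms])
  let ?\<sigma> = "mor_comp (open_sub T W) (open_sub T W') T (open_incl T W') ?sk"
  have m: "morphism (open_sub T W) T ?\<sigma>" by (rule mor_comp_morphism[OF TW TW' lT sk iW'])
  have hW': "mor_comp (open_sub T W') T E h (open_incl T W') = mor_comp (open_sub T W') (open_sub E ?V) E (open_incl E ?V) ?k'"
    using h_open_sub(2)[OF O'(1) O(2)] e by simp
  have hW: "mor_comp (open_sub T W) T E h (open_incl T W) = mor_comp (open_sub T W) (open_sub E ?V) E (open_incl E ?V) ?k"
    using h_open_sub(2)[OF O subset_refl] by simp
  have "mor_comp (open_sub T W) (open_sub T W') (open_sub E ?V) ?k' ?sk = ?k"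
    using mor_comp_assoc[OF TW EV TW' EV k ms mk'] s(2) mor_comp_id_left[OF TW EV k] by simp
  then have 2: "mor_comp (open_sub T W) T E h ?\<sigma> = mor_comp (open_sub T W) T E h (open_incl T W)"
    using mor_comp_assoc[OF TW TW' lT lE sk iW' h] mor_comp_assoc[OF TW TW' EV lE sk mk' iV] hW hW' by simp
  have 3: "on_pts ?\<sigma> x \<in> W'" if x: "x \<in> W" for x
  proof -
    have "on_pts ?sk x \<in> W'" using mor_pts[OF sk] x O(1) O'(1) by simp
    then show ?thesis using pts_comp[of x "open_sub T W" "open_sub T W'" T "open_incl T W'" ?sk] x O(1) O'(1) by simp
  qed
  have I: "openin (topol (open_sub T W)) (W \<inter> W')" using openin_open_sub[OF O(1)] O(1) O'(1) by blast
  have eI: "open_sub (open_sub T W) (W \<inter> W') = open_sub T (W \<inter> W')" by (rule open_sub_open_sub) blast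
  have OI: "openin (topol T) (W \<inter> W')" using O(1) O'(1) by blast
  note TI = locally_ringed_open_sub[OF lT OI]
  have iI: "morphism (open_sub T (W \<inter> W')) (open_sub T W) (open_incl (open_sub T W) (W \<inter> W'))"
    using open_incl_morphism[OF TW I] eI by simp
  \<comment> \<open>On the overlap the transition and the inclusion both land in the chart
    \<open>W'\<close> and agree after \<open>h\<close>, so \<open>chart_mono\<close>
    applies.\<close>
  have 4: "mor_comp (open_sub T (W \<inter> W')) (open_sub T W) T ?\<sigma> (open_incl (open_sub T W) (W \<inter> W')) =
     mor_comp (open_sub T (W \<inter> W')) (open_sub T W) T (open_incl T W) (open_incl (open_sub T W) (W \<inter> W'))"
  proof (rule chart_mono[OF TI W' mor_comp_morphism[OF TI TW lT iI m] mor_comp_morphism[OF TI TW lT iI iW]])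
    show "\<forall>y\<in>points (open_sub T (W \<inter> W')). on_pts (mor_comp (open_sub T (W \<inter> W')) (open_sub T W) T ?\<sigma> (open_incl (open_sub T W) (W \<inter> W'))) y \<in> W'"
      using 3 points_open_sub[OF OI] pts_incl[OF I] by simp
    show "\<forall>y\<in>points (open_sub T (W \<inter> W')). on_pts (mor_comp (open_sub T (W \<inter> W')) (open_sub T W) T (open_incl T W) (open_incl (open_sub T W) (W \<inter> W'))) y \<in> W'"
      using points_open_sub[OF OI] pts_incl[OF I] pts_incl[OF O(1)] by simp
    show "mor_comp (open_sub T (W \<inter> W')) T E h (mor_comp (open_sub T (W \<inter> W')) (open_sub T W) T ?\<sigma> (open_incl (open_sub T W) (W \<inter> W'))) =
      mor_comp (open_sub T (W \<inter> W')) T E h (mor_comp (open_sub T (W \<inter> W')) (open_sub T W) T (open_incl T W) (open_incl (open_sub T W) (W \<inter> W')))"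
      using mor_comp_assoc[OF TI TW lT lE iI m h] mor_comp_assoc[OF TI TW lT lE iI iW h] 2 by simp
  qed
  show ?thesis using that[OF m 2 _ 4] 3 by blast
qed

text \<open>
  The graph of the transition is a morphism to the fibre product. The test scheme for it must have
  the types of the fibre product, so the chart is replaced by its image under the diagonal, which is
  an open immersion.
\<close>

lemma chart_overlap_dominant:
  assumes diag: "is_diagonal T E h P d" and dom: "schematically_dominant T P d"
    and W: "chart T E h W" and W': "chart T E h W'" and e: "on_pts h ` W = on_pts h ` W'"
  shows "schematically_dominant (open_sub T (W \<inter> W')) (open_sub T W) (open_incl (open_sub T W) (W \<inter> W'))"
proof -
  obtain p q where fp: "is_fibre_product T T E h h P p q" and d: "morphism T P d"
    and pd: "mor_comp T P T p d = mor_id T" and qd: "mor_comp T P T q d = mor_id T"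
    using diag unfolding is_diagonal_def by blast
  have sP: "scheme P" and p: "morphism P T p" and q: "morphism P T q" and hpq: "mor_comp P T E h p = mor_comp P T E h q"
    using fp unfolding is_fibre_product_def by auto
  note lP = scheme_locally_ringed[OF sP]
  interpret T': presheaf T by (rule locally_ringed_presheaf[OF lT])
  interpret P': presheaf P by (rule locally_ringed_presheaf[OF lP])
  have univ: "\<exists>!u. morphism Z P u \<and> mor_comp Z P T p u = v \<and> mor_comp Z P T q u = w"
    if "scheme Z" "morphism Z T v" "morphism Z T w" "mor_comp Z T E h v = mor_comp Z T E h w"
    for Z :: "('a, 'b, 'a, 'b) fp" and v w
    using fp that unfolding is_fibre_product_def by blast
  have pd_pt: "on_pts p (on_pts d x) = x" "on_pts q (on_pts d x) = x" if "x \<in> points T" for x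
    using arg_cong[OF pd, of "\<lambda>m. on_pts m x"] arg_cong[OF qd, of "\<lambda>m. on_pts m x"] that by auto
  \<comment> \<open>The diagonal of a local isomorphism is open. Near a point with equal projections
    both projections land in one chart and agree after \<open>h\<close>, so they coincide; by
    uniqueness in the universal property the inclusion of the neighbourhood is the diagonal after
    the projection.\<close>
  have diag_near: "\<exists>N. openin (topol P) N \<and> z \<in> N \<and> (\<forall>z'\<in>N. z' = on_pts d (on_pts p z'))"
    if z: "z \<in> points P" "on_pts p z = on_pts q z" for z
  proof -
    obtain U where U: "chart T E h U" "on_pts p z \<in> U" using chart_near[OF openin_points_self mor_pts[OF p z(1)]] .
    note OU = chart_open(1)[OF U(1)]
    let ?N = "inv_img P p U \<inter> inv_img P q U"
    have N: "openin (topol P) ?N" using mor_open[OF p OU] mor_open[OF q OU] by blast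
    have zN: "z \<in> ?N" using z U(2) by (simp add: inv_img_def)
    note sN = scheme_open_sub[OF sP N] note lN = scheme_locally_ringed[OF sN] and i = open_incl_morphism[OF lP N]
    let ?PN = "open_sub P ?N" let ?i = "open_incl P ?N"
    let ?p = "mor_comp ?PN P T p ?i" and ?q = "mor_comp ?PN P T q ?i"
    have mp: "morphism ?PN T ?p" and mq: "morphism ?PN T ?q"
      by (rule mor_comp_morphism[OF lN lP lT i p], rule mor_comp_morphism[OF lN lP lT i q])
    have pq: "?p = ?q"
    proof (rule chart_mono[OF lN U(1) mp mq])
      show "\<forall>y\<in>points ?PN. on_pts ?p y \<in> U" "\<forall>y\<in>points ?PN. on_pts ?q y \<in> U"
        using points_open_sub[OF N] pts_incl[OF N] by (auto simp: inv_img_def)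
      show "mor_comp ?PN T E h ?p = mor_comp ?PN T E h ?q"
        using mor_comp_assoc[OF lN lP lT lE i p h] mor_comp_assoc[OF lN lP lT lE i q h] hpq by simp
    qed
    have md: "morphism ?PN P (mor_comp ?PN T P d ?p)" by (rule mor_comp_morphism[OF lN lT lP mp d])
    have "mor_comp ?PN P T p (mor_comp ?PN T P d ?p) = ?p" "mor_comp ?PN P T q (mor_comp ?PN T P d ?p) = ?p"
      using mor_comp_assoc[OF lN lT lP lT mp d p] mor_comp_assoc[OF lN lT lP lT mp d q] pd qd mor_comp_id_left[OF lN lT mp] by auto
    then have eq: "?i = mor_comp ?PN T P d ?p"
      using univ[OF sN mp mp refl] i md pq by metis
    have "z' = on_pts d (on_pts p z')" if z': "z' \<in> ?N" for z'
      using arg_cong[OF eq, of "\<lambda>m. on_pts m z'"] z' points_open_sub[OF N] pts_incl[OF N z'] by simp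
    then show ?thesis using N zN by blast
  qed
  note O = chart_open[OF W] and O' = chart_open[OF W']
  have WP: "W \<subseteq> points T" by (rule openin_points[OF O(1)])
  \<comment> \<open>As an open part of the fibre product this copy of the chart has the types of a
    test scheme, which \<open>W\<close> itself does not have. The first projection identifies it
    with \<open>W\<close>.\<close>
  let ?D = "on_pts d ` W"
  have D: "openin (topol P) ?D"
  proof (subst openin_subopen, intro ballI)
    fix z assume "z \<in> ?D"
    then obtain x where x: "x \<in> W" "z = on_pts d x" by blast
    have xT: "x \<in> points T" using x WP by blast
    have zP: "z \<in> points P" using mor_pts[OF d xT] x(2) by simp
    obtain N where N: "openin (topol P) N" "z \<in> N" "\<forall>z'\<in>N. z' = on_pts d (on_pts p z')"
      using diag_near[OF zP] pd_pt[OF xT] x(2) by auto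
    let ?M = "N \<inter> inv_img P p W"
    have "openin (topol P) ?M" using N(1) mor_open[OF p O(1)] by blast
    moreover have "z \<in> ?M" using N(2) zP x pd_pt[OF xT] by (simp add: inv_img_def)
    moreover have "?M \<subseteq> ?D"
    proof
      fix z' assume "z' \<in> ?M"
      then have "z' = on_pts d (on_pts p z')" "on_pts p z' \<in> W" using N(3) by (auto simp: inv_img_def)
      then show "z' \<in> ?D" by (rule image_eqI)
    qed
    ultimately show "\<exists>M. openin (topol P) M \<and> z \<in> M \<and> M \<subseteq> ?D" by blast
  qed
  obtain \<sigma> where \<sigma>: "morphism (open_sub T W) T \<sigma>"
    "mor_comp (open_sub T W) T E h \<sigma> = mor_comp (open_sub T W) T E h (open_incl T W)"
    "\<forall>x\<in>W. on_pts \<sigma> x \<in> W'"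
    using chart_transition[OF W W' e] by metis
  let ?Z = "open_sub P ?D" and ?TW = "open_sub T W"
  note sZ = scheme_open_sub[OF sP D] note lZ = scheme_locally_ringed[OF sZ]
  note TW = locally_ringed_open_sub[OF lT O(1)] and iW = open_incl_morphism[OF lT O(1)] and iD = open_incl_morphism[OF lP D]
  let ?a = "mor_comp ?Z P T p (open_incl P ?D)"
  have a: "morphism ?Z T ?a" by (rule mor_comp_morphism[OF lZ lP lT iD p])
  have aW: "\<forall>z\<in>points ?Z. on_pts ?a z \<in> W"
  proof
    fix z assume "z \<in> points ?Z"
    then have z: "z \<in> ?D" using D by simp
    then obtain x where x: "x \<in> W" "z = on_pts d x" by blast
    have "on_pts ?a z = on_pts p z" using z D by simp
    then show "on_pts ?a z \<in> W" using x pd_pt(1)[of x] WP by auto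
  qed
  note ca = corestrict[OF lZ lT a O(1) aW]
  let ?a' = "mor_restrict ?Z T ?a (points ?Z) W"
  let ?b = "mor_comp ?Z ?TW T \<sigma> ?a'"
  have b: "morphism ?Z T ?b" by (rule mor_comp_morphism[OF lZ TW lT ca(1) \<sigma>(1)])
  have "mor_comp ?Z T E h ?a = mor_comp ?Z T E h (mor_comp ?Z ?TW T (open_incl T W) ?a')" unfolding ca(2) ..
  also have "\<dots> = mor_comp ?Z T E h ?b"
    using mor_comp_assoc[OF lZ TW lT lE ca(1) \<sigma>(1) h] mor_comp_assoc[OF lZ TW lT lE ca(1) iW h] \<sigma>(2) by simp
  finally obtain c' where c': "morphism ?Z P c'" "mor_comp ?Z P T p c' = ?a" "mor_comp ?Z P T q c' = ?b"
    using univ[OF sZ a b] by blast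
  let ?d = "mor_restrict T P d W ?D"
  have dWD: "\<And>x. x \<in> W \<Longrightarrow> on_pts d x \<in> ?D" by blast
  note md = mor_restrict_morphism[OF lT lP d O(1) D dWD] and id = incl_comp_restrict[OF lT lP d O(1) D dWD]
  have ad: "mor_comp ?TW ?Z T ?a ?d = open_incl T W"
    using mor_comp_assoc[OF TW lZ lP lT md iD p] mor_comp_assoc[OF TW lT lP lT iW d p] id pd mor_comp_id_left[OF TW lT iW] by simp
  have a'd: "mor_comp ?TW ?Z ?TW ?a' ?d = mor_id ?TW"
  proof (rule open_incl_mono[OF lT O(1) mor_comp_morphism[OF TW lZ TW md ca(1)] mor_id_morphism[OF TW]])
    show "mor_comp ?TW ?TW T (open_incl T W) (mor_comp ?TW ?Z ?TW ?a' ?d) = mor_comp ?TW ?TW T (open_incl T W) (mor_id ?TW)"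
      using mor_comp_assoc[OF TW lZ TW lT md ca(1) iW] ca(2) ad mor_comp_id_right[OF TW lT iW] by simp
  qed
  \<comment> \<open>The graph of the transition, now starting from \<open>W\<close>: its projections
    are the inclusion of \<open>W\<close> and \<open>\<sigma>\<close>.\<close>
  let ?c = "mor_comp ?TW ?Z P c' ?d"
  have c: "morphism ?TW P ?c" by (rule mor_comp_morphism[OF TW lZ lP md c'(1)])
  have pc: "mor_comp ?TW P T p ?c = open_incl T W"
    using mor_comp_assoc[OF TW lZ lP lT md c'(1) p] c'(2) ad by simp
  have qc: "mor_comp ?TW P T q ?c = \<sigma>"
    using mor_comp_assoc[OF TW lZ lP lT md c'(1) q] mor_comp_assoc[OF TW lZ TW lT md ca(1) \<sigma>(1)] c'(3) a'd mor_comp_id_right[OF TW lT \<sigma>(1)] by simp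
  let ?I = "W \<inter> W'"
  have I: "openin (topol ?TW) ?I" using openin_open_sub[OF O(1)] O(1) O'(1) by blast
  have eI: "open_sub ?TW ?I = open_sub T ?I" by (rule open_sub_open_sub) blast
  show ?thesis unfolding schematically_dominant_def
  proof (intro conjI allI impI inj_onI)
    show "morphism (open_sub T ?I) ?TW (open_incl ?TW ?I)" using open_incl_morphism[OF TW I] eI by simp
    fix N s s' assume N0: "openin (topol ?TW) N" and s0: "s \<in> carrier (sections ?TW N)" "s' \<in> carrier (sections ?TW N)"
      and eq: "on_sec (open_incl ?TW ?I) N s = on_sec (open_incl ?TW ?I) N s'"
    have N: "openin (topol T) N" "N \<subseteq> W" using N0 openin_open_sub[OF O(1)] by auto
    have s: "s \<in> carrier (sections T N)" "s' \<in> carrier (sections T N)" using s0 by auto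
    have NW': "?I \<inter> N = N \<inter> W'" using N(2) by blast
    have eq': "restrn T N (N \<inter> W') s = restrn T N (N \<inter> W') s'"
      using eq sec_incl[OF N0 s0(1), of ?I] sec_incl[OF N0 s0(2), of ?I] NW' by simp
    \<comment> \<open>The points of the fibre product with first projection in \<open>N\<close> and
      second projection in \<open>W'\<close>. Their inverse image is \<open>N\<close> cut with
      \<open>W'\<close> under the diagonal, but all of \<open>N\<close> under the graph.\<close>
    let ?Pn = "inv_img P p N" and ?M = "inv_img P p N \<inter> inv_img P q W'"
    have Pn: "openin (topol P) ?Pn" and M: "openin (topol P) ?M" using mor_open[OF p N(1)] mor_open[OF q O'(1)] by blast+
    have MP: "?M \<subseteq> ?Pn" by blast
    have NP: "N \<subseteq> points T" by (rule openin_points[OF N(1)])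
    have dPn: "inv_img T d ?Pn = N" using pd_pt NP mor_pts[OF d] by (auto simp: inv_img_def)
    have dM: "inv_img T d ?M = N \<inter> W'" using pd_pt NP mor_pts[OF d] openin_points[OF O'(1)] by (auto simp: inv_img_def)
    \<comment> \<open>The section is spread over the fibre product by the first projection. The
      diagonal pulls it back to the restriction of \<open>r\<close> to the overlap, the graph to
      \<open>r\<close> itself.\<close>
    define u where "u r = restrn P ?Pn ?M (on_sec p N r)" for r
    have uM: "u r \<in> carrier (sections P ?M)" if "r \<in> carrier (sections T N)" for r
      unfolding u_def by (rule P'.res_closed[OF Pn M MP mor_sec[OF p N(1) that]])
    have du: "on_sec d ?M (u r) = restrn T N (N \<inter> W') r" if r: "r \<in> carrier (sections T N)" for r
    proof -
      have "on_sec d ?Pn (on_sec p N r) = r" using arg_cong[OF pd, of "\<lambda>m. on_sec m N r"] N(1) r by simp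
      then show ?thesis unfolding u_def mor_nat[OF d Pn M MP mor_sec[OF p N(1) r]] dPn dM by simp
    qed
    \<comment> \<open>Agreement on the overlap becomes equality on the fibre product by dominance of
      the diagonal; pulling back along the graph then yields equality on \<open>N\<close>.\<close>
    have uu: "u s = u s'" by (rule dominant_inj[OF dom M uM[OF s(1)] uM[OF s(2)]]) (simp add: du s eq')
    have cPn: "inv_img ?TW ?c ?Pn = N"
      using inv_comp[OF c, of T p N] inv_incl[OF O(1), of N] N(2) unfolding pc by (simp add: inf_absorb2)
    have cq: "inv_img ?TW ?c (inv_img P q W') = W"
    proof -
      have "inv_img ?TW \<sigma> W' = W" using \<sigma>(3) O(1) by (auto simp: inv_img_def)
      then show ?thesis using inv_comp[OF c, of T q W'] unfolding qc by simp
    qed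
    have cM: "inv_img ?TW ?c ?M = N"
    proof -
      have "inv_img ?TW ?c ?M = inv_img ?TW ?c ?Pn \<inter> inv_img ?TW ?c (inv_img P q W')" by (auto simp: inv_img_def)
      then show ?thesis unfolding cPn cq using N(2) by blast
    qed
    have "on_sec ?c ?M (u r) = r" if r: "r \<in> carrier (sections T N)" for r
    proof -
      have "on_sec ?c ?Pn (on_sec p N r) = on_sec (open_incl T W) N r"
        using sec_comp[OF N(1) r, of ?TW P p ?c] unfolding pc by simp
      also have "\<dots> = r" using sec_incl[OF N(1) r, of W] N r by (simp add: inf_absorb2)
      finally show ?thesis
        unfolding u_def mor_nat[OF c Pn M MP mor_sec[OF p N(1) r]] cPn cM using N r by simp
    qed
    then show "s = s'" using uu s by metis
  qed
qed

end

section \<open>Sections and epimorphisms along a local isomorphism\<close>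

context local_iso
begin

text \<open>Each point of \<open>V\<close> is the image of a chart inside \<open>N\<close>, on which
  pullback of sections is bijective. So pullback to \<open>N\<close> loses no information about
  sections over \<open>V\<close>.\<close>

lemma h_sec_eqI:
  assumes N: "openin (topol T) N" and V: "openin (topol E) V" "V \<subseteq> on_pts h ` N"
    and s: "s \<in> carrier (sections E V)" and t: "t \<in> carrier (sections E V)"
    and e: "restrn T (inv_img T h V) (N \<inter> inv_img T h V) (on_sec h V s) = restrn T (inv_img T h V) (N \<inter> inv_img T h V) (on_sec h V t)"
  shows "s = t"
proof (rule sheaf_eqI[OF locally_ringed_sheaf[OF lE] V(1) s t])
  interpret T': presheaf T by (rule locally_ringed_presheaf[OF lT])
  interpret E': presheaf E by (rule locally_ringed_presheaf[OF lE])
  let ?hV = "inv_img T h V"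
  have hV: "openin (topol T) ?hV" by (rule mor_open[OF h V(1)])
  have NV: "openin (topol T) (N \<inter> ?hV)" using N hV by blast
  fix y assume y: "y \<in> V"
  then obtain x where x: "x \<in> N" "y = on_pts h x" using V(2) by blast
  have "x \<in> N \<inter> ?hV" using x y openin_points[OF N] by (auto simp: inv_img_def)
  then obtain W where W: "chart T E h W" "x \<in> W" "W \<subseteq> N \<inter> ?hV" using chart_near[OF NV] by metis
  note O = chart_open[OF W(1)]
  let ?hW = "on_pts h ` W"
  have WV: "?hW \<subseteq> V" using W(3) by (auto simp: inv_img_def)
  have iW: "W \<inter> inv_img T h ?hW = W" using openin_points[OF O(1)] by (auto simp: inv_img_def)
  have hW: "openin (topol T) (inv_img T h ?hW)" by (rule mor_open[OF h O(2)])
  have hWV: "inv_img T h ?hW \<subseteq> ?hV" using WV by (auto simp: inv_img_def)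
  have WhW: "W \<subseteq> inv_img T h ?hW" using iW by blast
  let ?k = "mor_restrict T E h W ?hW"
  have k: "isomorphism (open_sub T W) (open_sub E ?hW) ?k" using W(1) by (simp add: chart_def)
  have ok: "openin (topol (open_sub E ?hW)) ?hW" using openin_open_sub[OF O(2)] O(2) by simp
  have inj: "inj_on (on_sec ?k ?hW) (carrier (sections E ?hW))"
    using isomorphism_sec[OF k ok] by (simp add: bij_betw_def)
  have "on_sec ?k ?hW (restrn E V ?hW r) = restrn T (N \<inter> ?hV) W (restrn T ?hV (N \<inter> ?hV) (on_sec h V r))"
    if r: "r \<in> carrier (sections E V)" for r
  proof -
    note r' = mor_sec[OF h V(1) r]
    have "on_sec ?k ?hW (restrn E V ?hW r) = restrn T (inv_img T h ?hW) W (restrn T ?hV (inv_img T h ?hW) (on_sec h V r))"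
      using sec_restrict[OF O(2) O(2) subset_refl E'.res_closed[OF V(1) O(2) WV r], of T h W] iW mor_nat[OF h V(1) O(2) WV r] by simp
    also have "\<dots> = restrn T ?hV W (on_sec h V r)" by (rule T'.res_res[OF hV hW O(1) hWV WhW r'])
    also have "\<dots> = restrn T (N \<inter> ?hV) W (restrn T ?hV (N \<inter> ?hV) (on_sec h V r))"
      by (rule T'.res_res[OF hV NV O(1) _ W(3) r', symmetric]) blast
    finally show ?thesis .
  qed
  then have "on_sec ?k ?hW (restrn E V ?hW s) = on_sec ?k ?hW (restrn E V ?hW t)" using s t e by simp
  then have "restrn E V ?hW s = restrn E V ?hW t"
    using inj_onD[OF inj] E'.res_closed[OF V(1) O(2) WV s] E'.res_closed[OF V(1) O(2) WV t] by blast
  then show "\<exists>W. openin (topol E) W \<and> y \<in> W \<and> W \<subseteq> V \<and> restrn E V W s = restrn E V W t"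
    using O(2) WV W(2) x(2) by blast
qed

lemma chart_sec_lift:
  assumes W: "chart T E h W" and s: "s \<in> carrier (sections T W)"
  obtains t where "t \<in> carrier (sections E (on_pts h ` W))"
    "restrn T (inv_img T h (on_pts h ` W)) W (on_sec h (on_pts h ` W) t) = s"
proof -
  note O = chart_open[OF W]
  let ?hW = "on_pts h ` W"
  let ?k = "mor_restrict T E h W ?hW"
  have iW: "W \<inter> inv_img T h ?hW = W" using openin_points[OF O(1)] by (auto simp: inv_img_def)
  have k: "isomorphism (open_sub T W) (open_sub E ?hW) ?k" using W by (simp add: chart_def)
  have ok: "openin (topol (open_sub E ?hW)) ?hW" using openin_open_sub[OF O(2)] O(2) by simp
  have "inv_img (open_sub T W) ?k ?hW = W" using inv_restrict[OF O(1), of E h ?hW ?hW] iW by simp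
  then have b: "bij_betw (on_sec ?k ?hW) (carrier (sections E ?hW)) (carrier (sections T W))"
    using isomorphism_sec[OF k ok] by simp
  obtain t where t: "t \<in> carrier (sections E ?hW)" "on_sec ?k ?hW t = s" using bij_betw_preimageE[OF b s] .
  show ?thesis using that[OF t(1)] t(2) sec_restrict[OF O(2) O(2) subset_refl t(1), of T h W] iW by simp
qed

text \<open>An injective local isomorphism is an open immersion: \<open>h\<close> is open,
  \<open>h_sec_eqI\<close> gives injectivity on sections, and charts give local preimages of
  sections, which is what \<open>isomorphismI\<close> asks for.\<close>

lemma inj_chart:
  assumes U: "openin (topol T) U" and inj: "inj_on (on_pts h) U"
  shows "chart T E h U"
proof -
  interpret T': presheaf T by (rule locally_ringed_presheaf[OF lT])
  let ?hU = "on_pts h ` U" let ?k = "mor_restrict T E h U ?hU"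
  note hU = h_image_open[OF U]
  note TU = locally_ringed_open_sub[OF lT U] and EU = locally_ringed_open_sub[OF lE hU]
  have "isomorphism (open_sub T U) (open_sub E ?hU) ?k"
  proof (rule isomorphismI[OF TU EU h_open_sub(1)[OF U hU subset_refl]])
    have "inj_on (on_pts ?k) U" using inj U by (auto simp: inj_on_def)
    then show "bij_betw (on_pts ?k) (points (open_sub T U)) (points (open_sub E ?hU))"
      using U hU image_restrict[OF U subset_refl] by (simp add: bij_betw_def)
    fix M assume "openin (topol (open_sub T U)) M"
    then have M: "openin (topol T) M" "M \<subseteq> U" using openin_open_sub[OF U] by auto
    then show "openin (topol (open_sub E ?hU)) (on_pts ?k ` M)"
      using h_image_open[OF M(1)] image_restrict[OF U M(2), of E h ?hU] openin_open_sub[OF hU, of "on_pts h ` M"] by auto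
  next
    fix V assume V0: "openin (topol (open_sub E ?hU)) V"
    then have V: "openin (topol E) V" "V \<subseteq> ?hU" using openin_open_sub[OF hU] by auto
    show "inj_on (on_sec ?k V) (carrier (sections (open_sub E ?hU) V))"
    proof (rule inj_onI)
      fix s t assume st: "s \<in> carrier (sections (open_sub E ?hU) V)" "t \<in> carrier (sections (open_sub E ?hU) V)"
        and e: "on_sec ?k V s = on_sec ?k V t"
      then have st: "s \<in> carrier (sections E V)" "t \<in> carrier (sections E V)" by simp_all
      show "s = t"
        by (rule h_sec_eqI[OF U V st]) (use e sec_restrict[OF hU V st(1)] sec_restrict[OF hU V st(2)] in metis)
    qed
  next
    fix V s y assume V0: "openin (topol (open_sub E ?hU)) V"
      and s0: "s \<in> carrier (sections (open_sub T U) (inv_img (open_sub T U) ?k V))" and y: "y \<in> V"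
    have V: "openin (topol E) V" "V \<subseteq> ?hU" using V0 openin_open_sub[OF hU] by auto
    have iV: "inv_img (open_sub T U) ?k V = U \<inter> inv_img T h V" by (rule inv_restrict[OF U])
    then have s: "s \<in> carrier (sections T (U \<inter> inv_img T h V))" using s0 by simp
    have O: "openin (topol T) (U \<inter> inv_img T h V)" using U mor_open[OF h V(1)] by blast
    obtain x where x: "x \<in> U" "y = on_pts h x" using V(2) y by blast
    have "x \<in> U \<inter> inv_img T h V" using x y openin_points[OF U] by (auto simp: inv_img_def)
    then obtain W where W: "chart T E h W" "x \<in> W" "W \<subseteq> U \<inter> inv_img T h V" using chart_near[OF O] by metis
    note OW = chart_open[OF W(1)]
    let ?hW = "on_pts h ` W"
    obtain t where t: "t \<in> carrier (sections E ?hW)"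
      "restrn T (inv_img T h ?hW) W (on_sec h ?hW t) = restrn T (U \<inter> inv_img T h V) W s"
      using chart_sec_lift[OF W(1) T'.res_closed[OF O OW(1) W(3) s]] .
    have hWV: "?hW \<subseteq> V" using W(3) by (auto simp: inv_img_def)
    then have hWU: "?hW \<subseteq> ?hU" using V(2) by blast
    \<comment> \<open>Here injectivity on \<open>U\<close> is used: no point of \<open>U\<close>
      outside \<open>W\<close> lies over the image of \<open>W\<close>, so a lift of the section on
      \<open>W\<close> already lifts it on the whole part of \<open>U\<close> over that
      image.\<close>
    have "U \<inter> inv_img T h ?hW = W"
      using W(3) inj openin_points[OF U] by (auto simp: inv_img_def inj_on_def)
    then have "on_sec ?k ?hW t = restrn T (inv_img (open_sub T U) ?k V) (inv_img (open_sub T U) ?k ?hW) s"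
      using sec_restrict[OF hU OW(2) hWU t(1), of T h U] t(2) iV inv_restrict[OF U, of E h ?hU ?hW] by simp
    then show "\<exists>W t. openin (topol (open_sub E ?hU)) W \<and> y \<in> W \<and> W \<subseteq> V \<and> t \<in> carrier (sections (open_sub E ?hU) W) \<and>
        on_sec ?k W t = restrn (open_sub T U) (inv_img (open_sub T U) ?k V) (inv_img (open_sub T U) ?k W) s"
      using OW(2) hWV hWU t(1) x(2) W(2) openin_open_sub[OF hU] by (intro exI[of _ ?hW] exI[of _ t]) auto
  qed
  then show ?thesis using U hU by (simp add: chart_def)
qed

text \<open>A surjective local isomorphism is an epimorphism, on points by surjectivity and on
  sections by \<open>h_sec_eqI\<close>. This gives uniqueness in the universal property and the
  compatibility of the descended morphism with the structure morphisms.\<close>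

lemma h_epi:
  assumes surj: "on_pts h ` points T = points E"
    and v: "morphism E Z v" and w: "morphism E Z w" and e: "mor_comp T E Z v h = mor_comp T E Z w h"
  shows "v = w"
proof (rule mor_eqI[OF v w])
  fix y assume "y \<in> points E"
  then obtain x where "x \<in> points T" "y = on_pts h x" using surj by blast
  then show "on_pts v y = on_pts w y" using arg_cong[OF e, of "\<lambda>m. on_pts m x"] by simp
next
  fix V t assume V: "openin (topol Z) V" and t: "t \<in> carrier (sections Z V)"
  have "on_pts v y = on_pts w y" if "y \<in> points E" for y
  proof -
    obtain x where "x \<in> points T" "y = on_pts h x" using surj \<open>y \<in> points E\<close> by blast
    then show ?thesis using arg_cong[OF e, of "\<lambda>m. on_pts m x"] by simp
  qed
  then have i: "inv_img E w V = inv_img E v V" by (auto simp: inv_img_def)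
  note O = mor_open[OF v V]
  have sub: "inv_img E v V \<subseteq> on_pts h ` points T" using openin_points[OF O] surj by simp
  show "on_sec v V t = on_sec w V t"
  proof (rule h_sec_eqI[OF openin_points_self O sub mor_sec[OF v V t]])
    show "on_sec w V t \<in> carrier (sections E (inv_img E v V))" using mor_sec[OF w V t] i by simp
    have "on_sec h (inv_img E v V) (on_sec v V t) = on_sec h (inv_img E v V) (on_sec w V t)"
      using arg_cong[OF e, of "\<lambda>m. on_sec m V t"] V t i by simp
    then show "restrn T (inv_img T h (inv_img E v V)) (points T \<inter> inv_img T h (inv_img E v V)) (on_sec h (inv_img E v V) (on_sec v V t)) =
      restrn T (inv_img T h (inv_img E v V)) (points T \<inter> inv_img T h (inv_img E v V)) (on_sec h (inv_img E v V) (on_sec w V t))"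
      by (rule arg_cong)
  qed
qed

end

section \<open>Local isomorphisms with schematically dominant diagonal\<close>

locale dominant_diagonal = local_iso T E h
  for T :: "('a, 'b) ringed_data" and E :: "('e, 'f) ringed_data" and h +
  fixes P d
  assumes diag: "is_diagonal T E h P d" and dom: "schematically_dominant T P d"
begin

text \<open>The morphism \<open>k\<close> is defined on an open set containing \<open>W\<close> and
  its image under \<open>\<sigma>\<close>, so that one statement serves two purposes: with
  \<open>k\<close> the identity of a separated \<open>U\<close> it gives injectivity of
  \<open>h\<close>, with \<open>U\<close> all of \<open>T\<close> it gives descent.\<close>

lemma transition_eq:
  fixes Z :: "('i, 'j) ringed_data"
  assumes W: "chart T E h W" and W': "chart T E h W'" and im: "on_pts h ` W = on_pts h ` W'"
    and \<sigma>: "morphism (open_sub T W) T \<sigma>"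
    "mor_comp (open_sub T (W \<inter> W')) (open_sub T W) T \<sigma> (open_incl (open_sub T W) (W \<inter> W')) =
     mor_comp (open_sub T (W \<inter> W')) (open_sub T W) T (open_incl T W) (open_incl (open_sub T W) (W \<inter> W'))"
    and U: "openin (topol T) U" "W \<subseteq> U" "\<forall>x\<in>W. on_pts \<sigma> x \<in> U" and k: "morphism (open_sub T U) Z k"
    and Z: "scheme Z" and S: "locally_ringed S" and sep: "separated Z S g"
    and aff: "\<forall>s\<in>points S. \<exists>R (R0 :: 'k ring) r. openin (topol S) R \<and> s \<in> R \<and> cring R0 \<and> isomorphism (open_sub S R) (Spec R0) r"
    and g: "mor_comp (open_sub T W) (open_sub T U) S (mor_comp (open_sub T U) Z S g k) (mor_restrict (open_sub T W) T (open_incl T W) (points (open_sub T W)) U) =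
      mor_comp (open_sub T W) (open_sub T U) S (mor_comp (open_sub T U) Z S g k) (mor_restrict (open_sub T W) T \<sigma> (points (open_sub T W)) U)"
  shows "mor_comp (open_sub T W) (open_sub T U) Z k (mor_restrict (open_sub T W) T (open_incl T W) (points (open_sub T W)) U) =
      mor_comp (open_sub T W) (open_sub T U) Z k (mor_restrict (open_sub T W) T \<sigma> (points (open_sub T W)) U)"
proof -
  note O = chart_open(1)[OF W] chart_open(1)[OF W']
  let ?X = "open_sub T W" and ?I = "W \<inter> W'" and ?TU = "open_sub T U"
  let ?a = "mor_restrict ?X T (open_incl T W) (points ?X) U" and ?b = "mor_restrict ?X T \<sigma> (points ?X) U"
  note lX = locally_ringed_open_sub[OF lT O(1)] and lU = locally_ringed_open_sub[OF lT U(1)] and lZ = scheme_locally_ringed[OF Z]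
  have aU: "\<forall>x\<in>points ?X. on_pts (open_incl T W) x \<in> U" and bU: "\<forall>x\<in>points ?X. on_pts \<sigma> x \<in> U"
    using U(2,3) O(1) by auto
  note iW = open_incl_morphism[OF lT O(1)] and iU = open_incl_morphism[OF lT U(1)]
  note a = corestrict[OF lX lT iW U(1) aU] and b = corestrict[OF lX lT \<sigma>(1) U(1) bU]
  have OI: "openin (topol T) ?I" using O by blast
  have I: "openin (topol ?X) ?I" using OI openin_open_sub[OF O(1)] by blast
  have eI: "open_sub ?X ?I = open_sub T ?I" by (rule open_sub_open_sub) blast
  let ?t = "open_incl ?X ?I" and ?Y = "open_sub T ?I"
  note lY = locally_ringed_open_sub[OF lT OI]
  have t: "morphism ?Y ?X ?t" using open_incl_morphism[OF lX I] unfolding eI .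
  have gm: "morphism Z S g" using sep unfolding separated_def by blast
  have ab: "mor_comp ?Y ?X ?TU ?a ?t = mor_comp ?Y ?X ?TU ?b ?t"
  proof (rule open_incl_mono[OF lT U(1) mor_comp_morphism[OF lY lX lU t a(1)] mor_comp_morphism[OF lY lX lU t b(1)]])
    show "mor_comp ?Y ?TU T (open_incl T U) (mor_comp ?Y ?X ?TU ?a ?t) = mor_comp ?Y ?TU T (open_incl T U) (mor_comp ?Y ?X ?TU ?b ?t)"
      using mor_comp_assoc[OF lY lX lU lT t a(1) iU] mor_comp_assoc[OF lY lX lU lT t b(1) iU] a(2) b(2) \<sigma>(2) by metis
  qed
  show ?thesis
  proof (rule separated_dominant_eq[OF scheme_open_sub[OF T O(1)] Z S sep aff mor_comp_morphism[OF lX lU lZ a(1) k]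
      mor_comp_morphism[OF lX lU lZ b(1) k] _ lY chart_overlap_dominant[OF diag dom W W' im]])
    show "mor_comp ?X Z S g (mor_comp ?X ?TU Z k ?a) = mor_comp ?X Z S g (mor_comp ?X ?TU Z k ?b)"
      using mor_comp_assoc[OF lX lU lZ S a(1) k gm] mor_comp_assoc[OF lX lU lZ S b(1) k gm] g by metis
    show "mor_comp ?Y ?X Z (mor_comp ?X ?TU Z k ?a) ?t = mor_comp ?Y ?X Z (mor_comp ?X ?TU Z k ?b) ?t"
      using mor_comp_assoc[OF lY lX lU lZ t a(1) k] mor_comp_assoc[OF lY lX lU lZ t b(1) k] ab by metis
  qed
qed

text \<open>With \<open>k\<close> the identity of \<open>U\<close>, the transition from a chart
  around \<open>x\<close> to one around \<open>y\<close> is the inclusion; so \<open>x\<close> lies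
  in the chart of \<open>y\<close>, on which \<open>h\<close> is injective. The base is left open,
  and the last hypothesis isolates what is needed of it, so that separatedness over the given base
  and absolute separatedness are treated together.\<close>

lemma separated_inj:
  assumes U: "openin (topol T) U" and S: "locally_ringed S" and sep: "separated (open_sub T U) S f"
    and aff: "\<forall>s\<in>points S. \<exists>R (R0 :: 'k ring) r. openin (topol S) R \<and> s \<in> R \<and> cring R0 \<and> isomorphism (open_sub S R) (Spec R0) r"
    and f: "\<And>W \<alpha> \<beta>. openin (topol T) W \<Longrightarrow> morphism (open_sub T W) (open_sub T U) \<alpha> \<Longrightarrow> morphism (open_sub T W) (open_sub T U) \<beta> \<Longrightarrow>
      mor_comp (open_sub T W) T E h (mor_comp (open_sub T W) (open_sub T U) T (open_incl T U) \<alpha>) =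
      mor_comp (open_sub T W) T E h (mor_comp (open_sub T W) (open_sub T U) T (open_incl T U) \<beta>) \<Longrightarrow>
      mor_comp (open_sub T W) (open_sub T U) S f \<alpha> = mor_comp (open_sub T W) (open_sub T U) S f \<beta>"
  shows "inj_on (on_pts h) U"
proof (rule inj_onI)
  fix x y assume x: "x \<in> U" and y: "y \<in> U" and e: "on_pts h x = on_pts h y"
  obtain W W' where W: "chart T E h W" "x \<in> W" "W \<subseteq> U" and W': "chart T E h W'" "y \<in> W'" "W' \<subseteq> U"
    and im: "on_pts h ` W = on_pts h ` W'" using chart_pair[OF U x U y e] .
  obtain \<sigma> where \<sigma>: "morphism (open_sub T W) T \<sigma>"
    "mor_comp (open_sub T W) T E h \<sigma> = mor_comp (open_sub T W) T E h (open_incl T W)" "\<forall>x\<in>W. on_pts \<sigma> x \<in> W'"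
    "mor_comp (open_sub T (W \<inter> W')) (open_sub T W) T \<sigma> (open_incl (open_sub T W) (W \<inter> W')) =
     mor_comp (open_sub T (W \<inter> W')) (open_sub T W) T (open_incl T W) (open_incl (open_sub T W) (W \<inter> W'))"
    using chart_transition[OF W(1) W'(1) im] .
  let ?X = "open_sub T W" and ?TU = "open_sub T U"
  let ?a = "mor_restrict ?X T (open_incl T W) (points ?X) U" and ?b = "mor_restrict ?X T \<sigma> (points ?X) U"
  note O = chart_open(1)[OF W(1)]
  note lX = locally_ringed_open_sub[OF lT O] and lU = locally_ringed_open_sub[OF lT U]
  have \<sigma>U: "\<forall>x\<in>W. on_pts \<sigma> x \<in> U" using \<sigma>(3) W'(3) by blast
  have aU: "\<forall>x\<in>points ?X. on_pts (open_incl T W) x \<in> U" and bU: "\<forall>x\<in>points ?X. on_pts \<sigma> x \<in> U"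
    using W(3) \<sigma>U O by auto
  note a = corestrict[OF lX lT open_incl_morphism[OF lT O] U aU] and b = corestrict[OF lX lT \<sigma>(1) U bU]
  have fm: "morphism ?TU S f" using sep unfolding separated_def by blast
  have "mor_comp ?X ?TU S f ?a = mor_comp ?X ?TU S f ?b"
    by (rule f[OF O a(1) b(1)]) (use a(2) b(2) \<sigma>(2) in metis)
  then have g: "mor_comp ?X ?TU S (mor_comp ?TU ?TU S f (mor_id ?TU)) ?a = mor_comp ?X ?TU S (mor_comp ?TU ?TU S f (mor_id ?TU)) ?b"
    using mor_comp_id_right[OF lU S fm] by simp
  have "?a = ?b"
    using transition_eq[OF W(1) W'(1) im \<sigma>(1,4) U W(3) \<sigma>U mor_id_morphism[OF lU] scheme_open_sub[OF T U] S sep aff g]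
    unfolding mor_comp_id_left[OF lX lU a(1)] mor_comp_id_left[OF lX lU b(1)] .
  then have "open_incl T W = \<sigma>" using a(2) b(2) by metis
  then have "\<forall>z\<in>W. on_pts \<sigma> z = z" using pts_incl[OF O] by metis
  then have "x \<in> W'" using \<sigma>(3) W(2) by auto
  then show "x = y" using inj_onD[OF chart_inj[OF W'(1)] e] W'(2) by blast
qed

section \<open>Descent of a morphism along a surjective local isomorphism\<close>

context
  fixes E' :: "('i, 'j) ringed_data" and S :: "('k, 'l) ringed_data" and g g' h'
  assumes E': "scheme E'" and S: "scheme S" and sep: "separated E' S g'" and g: "morphism E S g"
    and h': "morphism T E' h'" and gh: "mor_comp T E' S g' h' = mor_comp T E S g h"
    and surj: "on_pts h ` points T = points E"
begin

text \<open>\<open>transition_eq\<close> with \<open>U\<close> all of \<open>T\<close> and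
  \<open>k\<close> the morphism to be descended. The composites with the structure morphism agree
  because they factor through \<open>h\<close>.\<close>

lemma descent_transition:
  assumes W: "chart T E h W" and W': "chart T E h W'" and im: "on_pts h ` W = on_pts h ` W'"
  obtains \<sigma> where "morphism (open_sub T W) T \<sigma>" "mor_comp (open_sub T W) T E h \<sigma> = mor_comp (open_sub T W) T E h (open_incl T W)"
    "\<forall>x\<in>W. on_pts \<sigma> x \<in> W'" "mor_comp (open_sub T W) T E' h' \<sigma> = mor_comp (open_sub T W) T E' h' (open_incl T W)"
proof -
  obtain \<sigma> where \<sigma>: "morphism (open_sub T W) T \<sigma>"
    "mor_comp (open_sub T W) T E h \<sigma> = mor_comp (open_sub T W) T E h (open_incl T W)" "\<forall>x\<in>W. on_pts \<sigma> x \<in> W'"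
    "mor_comp (open_sub T (W \<inter> W')) (open_sub T W) T \<sigma> (open_incl (open_sub T W) (W \<inter> W')) =
     mor_comp (open_sub T (W \<inter> W')) (open_sub T W) T (open_incl T W) (open_incl (open_sub T W) (W \<inter> W'))"
    using chart_transition[OF W W' im] .
  note O = chart_open(1)[OF W] and O' = chart_open(1)[OF W']
  note lX = locally_ringed_open_sub[OF lT O] and lS = scheme_locally_ringed[OF S]
  note iW = open_incl_morphism[OF lT O]
  have g': "morphism E' S g'" using sep unfolding separated_def by blast
  have WT: "W \<subseteq> points T" "\<forall>x\<in>W. on_pts \<sigma> x \<in> points T" using openin_points[OF O] openin_points[OF O'] \<sigma>(3) by blast+
  have r: "mor_restrict (open_sub T W) T (open_incl T W) (points (open_sub T W)) (points T) = open_incl T W"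
    "mor_restrict (open_sub T W) T \<sigma> (points (open_sub T W)) (points T) = \<sigma>"
    by (rule restrict_whole[OF lX lT iW], rule restrict_whole[OF lX lT \<sigma>(1)])
  have aff: "\<forall>s\<in>points S. \<exists>R (R0 :: 'l ring) r. openin (topol S) R \<and> s \<in> R \<and> cring R0 \<and> isomorphism (open_sub S R) (Spec R0) r"
    using S unfolding scheme_def affine_def by blast
  have "mor_comp (open_sub T W) T S (mor_comp T E' S g' h') (open_incl T W) = mor_comp (open_sub T W) T S (mor_comp T E' S g' h') \<sigma>"
    unfolding gh using mor_comp_assoc[OF lX lT lE lS iW h g] mor_comp_assoc[OF lX lT lE lS \<sigma>(1) h g] \<sigma>(2) by simp
  then have "mor_comp (open_sub T W) T E' h' (open_incl T W) = mor_comp (open_sub T W) T E' h' \<sigma>"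
    using transition_eq[OF W W' im \<sigma>(1,4) openin_points_self WT _ E' lS sep aff, of h'] h' unfolding open_sub_points r by blast
  then show ?thesis using that \<sigma> by metis
qed

text \<open>The transition between charts around the two points carries \<open>x\<close> to the only
  point of the second chart over the common image, which is \<open>y\<close>, and it does not change
  the value of \<open>h'\<close>.\<close>

lemma descent_pts:
  assumes x: "x \<in> points T" and y: "y \<in> points T" and e: "on_pts h x = on_pts h y"
  shows "on_pts h' x = on_pts h' y"
proof -
  obtain W W' where W: "chart T E h W" "x \<in> W" and W': "chart T E h W'" "y \<in> W'"
    and im: "on_pts h ` W = on_pts h ` W'" using chart_pair[OF openin_points_self x openin_points_self y e] .
  obtain \<sigma> where \<sigma>: "mor_comp (open_sub T W) T E h \<sigma> = mor_comp (open_sub T W) T E h (open_incl T W)"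
    "\<forall>x\<in>W. on_pts \<sigma> x \<in> W'" "mor_comp (open_sub T W) T E' h' \<sigma> = mor_comp (open_sub T W) T E' h' (open_incl T W)"
    using descent_transition[OF W(1) W'(1) im] by metis
  note O = chart_open(1)[OF W(1)]
  have "on_pts h (on_pts \<sigma> x) = on_pts h y" using arg_cong[OF \<sigma>(1), of "\<lambda>m. on_pts m x"] W(2) O e by simp
  then have "on_pts \<sigma> x = y" using inj_onD[OF chart_inj[OF W'(1)]] \<sigma>(2) W(2) W'(2) by blast
  then show ?thesis using arg_cong[OF \<sigma>(3), of "\<lambda>m. on_pts m x"] W(2) O by simp
qed

text \<open>Inverse images under \<open>h'\<close> are unions of fibres of \<open>h\<close>, as
  \<open>h'\<close> is constant on the fibres; and \<open>h\<close> is open.\<close>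

lemma descent_inv_img:
  assumes N: "openin (topol E') N"
  shows "openin (topol E) (on_pts h ` inv_img T h' N)" "inv_img T h (on_pts h ` inv_img T h' N) = inv_img T h' N"
proof -
  show "openin (topol E) (on_pts h ` inv_img T h' N)" by (rule h_image_open[OF mor_open[OF h' N]])
  have "x \<in> inv_img T h' N" if x: "x \<in> points T" "on_pts h x \<in> on_pts h ` inv_img T h' N" for x
  proof -
    obtain y where "y \<in> points T" "on_pts h' y \<in> N" "on_pts h x = on_pts h y" using x(2) by (auto simp: inv_img_def)
    then show ?thesis using descent_pts[OF x(1)] x(1) by (auto simp: inv_img_def)
  qed
  then show "inv_img T h (on_pts h ` inv_img T h' N) = inv_img T h' N" by (auto simp: inv_img_def)
qed

lemma h_sec_inj:
  assumes V: "openin (topol E) V" and s: "s \<in> carrier (sections E V)" and t: "t \<in> carrier (sections E V)"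
    and e: "on_sec h V s = on_sec h V t"
  shows "s = t"
  using h_sec_eqI[OF openin_points_self V _ s t] e openin_points[OF V] surj by simp

text \<open>The isomorphism of the chart provides \<open>r\<close> with the right pullback on
  \<open>W\<close>. The asserted equation concerns all points over the image of \<open>W\<close>;
  near those outside \<open>W\<close> it is carried over from \<open>W\<close> by transitions, which
  respect both sides.\<close>

lemma descent_sec_chart:
  assumes N: "openin (topol E') N" and t: "t \<in> carrier (sections E' N)"
    and W: "chart T E h W" "W \<subseteq> inv_img T h' N"
  obtains r where "r \<in> carrier (sections E (on_pts h ` W))"
    "on_sec h (on_pts h ` W) r = restrn T (inv_img T h' N) (inv_img T h (on_pts h ` W)) (on_sec h' N t)"
proof -
  interpret T': presheaf T by (rule locally_ringed_presheaf[OF lT])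
  note O = chart_open[OF W(1)] and M = mor_open[OF h' N] and s = mor_sec[OF h' N t]
  let ?M = "inv_img T h' N" and ?s = "on_sec h' N t" and ?V = "on_pts h ` W"
  let ?hV = "inv_img T h ?V"
  note hV = mor_open[OF h O(2)]
  have hVM: "?hV \<subseteq> ?M" using descent_inv_img(2)[OF N] W(2) by (auto simp: inv_img_def)
  have WhV: "W \<subseteq> ?hV" using openin_points[OF O(1)] by (auto simp: inv_img_def)
  obtain r where r: "r \<in> carrier (sections E ?V)" "restrn T ?hV W (on_sec h ?V r) = restrn T ?M W ?s"
    using chart_sec_lift[OF W(1) T'.res_closed[OF M O(1) W(2) s]] .
  note hr = mor_sec[OF h O(2) r(1)]
  have "on_sec h ?V r = restrn T ?M ?hV ?s"
  proof (rule sheaf_eqI[OF locally_ringed_sheaf[OF lT] hV hr T'.res_closed[OF M hV hVM s]])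
    fix y assume y: "y \<in> ?hV"
    then obtain x where x: "x \<in> W" "on_pts h y = on_pts h x" by (auto simp: inv_img_def)
    obtain W1 W2 where W1: "chart T E h W1" "y \<in> W1" "W1 \<subseteq> ?hV" and W2: "chart T E h W2" "W2 \<subseteq> W"
      and im: "on_pts h ` W1 = on_pts h ` W2" using chart_pair[OF hV y O(1) x] .
    obtain \<sigma> where \<sigma>: "morphism (open_sub T W1) T \<sigma>" "mor_comp (open_sub T W1) T E h \<sigma> = mor_comp (open_sub T W1) T E h (open_incl T W1)"
      "\<forall>x\<in>W1. on_pts \<sigma> x \<in> W2" "mor_comp (open_sub T W1) T E' h' \<sigma> = mor_comp (open_sub T W1) T E' h' (open_incl T W1)"
      using descent_transition[OF W1(1) W2(1) im] .
    note O1 = chart_open(1)[OF W1(1)]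
    let ?X = "open_sub T W1"
    have \<sigma>W: "inv_img ?X \<sigma> W = W1" using \<sigma>(3) W2(2) O1 by (auto simp: inv_img_def)
    have \<sigma>hV: "inv_img ?X \<sigma> ?hV = W1" using \<sigma>W WhV O1 by (auto simp: inv_img_def)
    have \<sigma>M: "inv_img ?X \<sigma> ?M = W1" using \<sigma>hV hVM O1 by (auto simp: inv_img_def)
    have i: "W1 \<inter> ?hV = W1" "W1 \<inter> ?M = W1" using W1(3) hVM by blast+
    have 1: "on_sec \<sigma> ?hV (on_sec h ?V r) = restrn T ?hV W1 (on_sec h ?V r)"
      using arg_cong[OF \<sigma>(2), of "\<lambda>m. on_sec m ?V r"] O(2) r(1) sec_incl[OF hV hr, of W1] i by simp
    have 2: "on_sec \<sigma> ?M ?s = restrn T ?M W1 ?s"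
      using arg_cong[OF \<sigma>(4), of "\<lambda>m. on_sec m N t"] N t sec_incl[OF M s, of W1] i by simp
    have W1W1: "restrn T W1 W1 z = z" if "z \<in> carrier (sections T W1)" for z using O1 that by simp
    have 3: "on_sec \<sigma> W (restrn T ?hV W (on_sec h ?V r)) = on_sec \<sigma> ?hV (on_sec h ?V r)"
      using mor_nat[OF \<sigma>(1) hV O(1) WhV hr] mor_sec[OF \<sigma>(1) hV hr] W1W1 unfolding \<sigma>W \<sigma>hV by simp
    have 4: "on_sec \<sigma> W (restrn T ?M W ?s) = on_sec \<sigma> ?M ?s"
      using mor_nat[OF \<sigma>(1) M O(1) W(2) s] mor_sec[OF \<sigma>(1) M s] W1W1 unfolding \<sigma>W \<sigma>M by simp
    \<comment> \<open>Pulling back the known equality on \<open>W\<close> along the transition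
      gives, by 1 to 4, the equality on the neighbourhood \<open>W1\<close> of
      \<open>y\<close>.\<close>
    have "restrn T ?hV W1 (on_sec h ?V r) = restrn T ?M W1 ?s" using 1 2 3 4 r(2) by simp
    also have "\<dots> = restrn T ?hV W1 (restrn T ?M ?hV ?s)" by (rule T'.res_res[OF M hV O1 hVM W1(3) s, symmetric])
    finally show "\<exists>W. openin (topol T) W \<and> y \<in> W \<and> W \<subseteq> ?hV \<and>
        restrn T ?hV W (on_sec h ?V r) = restrn T ?hV W (restrn T ?M ?hV ?s)" using O1 W1(2,3) by blast
  qed
  then show ?thesis using that r(1) by blast
qed

text \<open>Pullback along the surjective \<open>h\<close> is injective on sections, so the lifts
  over images of charts are unique and glue.\<close>

lemma descent_sec:
  assumes N: "openin (topol E') N" and t: "t \<in> carrier (sections E' N)"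
  shows "\<exists>!r. r \<in> carrier (sections E (on_pts h ` inv_img T h' N)) \<and> on_sec h (on_pts h ` inv_img T h' N) r = on_sec h' N t"
proof -
  interpret T': presheaf T by (rule locally_ringed_presheaf[OF lT])
  interpret E1: presheaf E by (rule locally_ringed_presheaf[OF lE])
  note M = mor_open[OF h' N] and s = mor_sec[OF h' N t] and V = descent_inv_img[OF N]
  let ?M = "inv_img T h' N" and ?s = "on_sec h' N t"
  let ?V = "on_pts h ` ?M"
  define R where "R V r \<longleftrightarrow> openin (topol E) V \<and> V \<subseteq> ?V \<and> r \<in> carrier (sections E V) \<and>
    on_sec h V r = restrn T ?M (inv_img T h V) ?s" for V r
  obtain r where r: "r \<in> carrier (sections E ?V)" "\<And>V r'. R V r' \<Longrightarrow> restrn E ?V V r = r'"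
  proof (rule sheaf_glue[OF locally_ringed_sheaf[OF lE] V(1), of R])
    show "openin (topol E) V \<and> V \<subseteq> ?V \<and> r \<in> carrier (sections E V)" if "R V r" for V r
      using that by (simp add: R_def)
    show "R V' (restrn E V V' r)" if R: "R V r" "openin (topol E) V'" "V' \<subseteq> V" for V r V'
    proof -
      have "openin (topol E) V" "V \<subseteq> ?V" "r \<in> carrier (sections E V)" and e: "on_sec h V r = restrn T ?M (inv_img T h V) ?s"
        using R(1) by (simp_all add: R_def)
      note V0 = this(1-3)
      have sub: "inv_img T h V \<subseteq> ?M" "inv_img T h V' \<subseteq> inv_img T h V" using V0(2) V(2) R(3) by (auto simp: inv_img_def)
      have "on_sec h V' (restrn E V V' r) = restrn T ?M (inv_img T h V') ?s"
        using mor_nat[OF h V0(1) R(2,3) V0(3)] T'.res_res[OF M mor_open[OF h V0(1)] mor_open[OF h R(2)] sub s] e by simp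
      then show ?thesis unfolding R_def using R(2,3) V0 by auto
    qed
    show "r = r'" if "R V r" "R V r'" for V r r'
      using that h_sec_inj[of V r r'] by (simp add: R_def)
    show "\<exists>V r. e \<in> V \<and> R V r" if e: "e \<in> ?V" for e
    proof -
      obtain x where x: "x \<in> ?M" "e = on_pts h x" using e by blast
      obtain W where W: "chart T E h W" "x \<in> W" "W \<subseteq> ?M" using chart_near[OF M x(1)] .
      obtain r where "r \<in> carrier (sections E (on_pts h ` W))"
        "on_sec h (on_pts h ` W) r = restrn T ?M (inv_img T h (on_pts h ` W)) ?s"
        using descent_sec_chart[OF N t W(1,3)] .
      then have "R (on_pts h ` W) r" unfolding R_def using chart_open(2)[OF W(1)] W(3) by blast
      then show ?thesis using x(2) W(2) by blast
    qed
  qed (rule that)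
  have "on_sec h ?V r = ?s"
  proof (rule sheaf_eqI[OF locally_ringed_sheaf[OF lT] M _ s])
    note hr = mor_sec[OF h V(1) r(1)]
    show "on_sec h ?V r \<in> carrier (sections T ?M)" using hr unfolding V(2) .
    fix x assume x: "x \<in> ?M"
    obtain W where W: "chart T E h W" "x \<in> W" "W \<subseteq> ?M" using chart_near[OF M x] .
    note O = chart_open[OF W(1)]
    obtain r' where r': "r' \<in> carrier (sections E (on_pts h ` W))"
        "on_sec h (on_pts h ` W) r' = restrn T ?M (inv_img T h (on_pts h ` W)) ?s"
        using descent_sec_chart[OF N t W(1,3)] .
    have WV: "on_pts h ` W \<subseteq> ?V" using W(3) by blast
    then have "R (on_pts h ` W) r'" unfolding R_def using O(2) r' by blast
    then have "restrn T ?M (inv_img T h (on_pts h ` W)) (on_sec h ?V r) = restrn T ?M (inv_img T h (on_pts h ` W)) ?s"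
      using mor_nat[OF h V(1) O(2) WV r(1)] r(2) r'(2) V(2) by simp
    moreover have "x \<in> inv_img T h (on_pts h ` W)" using x W(2) by (auto simp: inv_img_def)
    moreover have "inv_img T h (on_pts h ` W) \<subseteq> ?M" using WV V(2) by (auto simp: inv_img_def)
    ultimately show "\<exists>W. openin (topol T) W \<and> x \<in> W \<and> W \<subseteq> ?M \<and> restrn T ?M W (on_sec h ?V r) = restrn T ?M W ?s"
      using mor_open[OF h O(2)] by blast
  qed
  then show ?thesis using r(1) h_sec_inj[OF V(1)] by metis
qed

lemma descent:
  obtains u where "morphism E E' u" "mor_comp T E E' u h = h'"
proof -
  note lE' = scheme_locally_ringed[OF E']
  \<comment> \<open>An arbitrary point of each fibre; by \<open>descent_pts\<close> the choice does
    not affect the value of \<open>h'\<close>.\<close>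
  define pt where "pt = inv_into (points T) (on_pts h)"
  define D where "D N t r \<longleftrightarrow> r \<in> carrier (sections E (on_pts h ` inv_img T h' N)) \<and>
    on_sec h (on_pts h ` inv_img T h' N) r = on_sec h' N t" for N t r
  define u where "u = \<lparr>on_pts = (\<lambda>e\<in>points E. on_pts h' (pt e)),
    on_sec = (\<lambda>N\<in>{N. openin (topol E') N}. \<lambda>t\<in>carrier (sections E' N). THE r. D N t r)\<rparr>"
  have pt: "pt e \<in> points T" "on_pts h (pt e) = e" if "e \<in> points E" for e
    using that inv_into_into[of e "on_pts h" "points T"] f_inv_into_f[of e "on_pts h" "points T"] surj
    unfolding pt_def by simp_all
  have u_pt: "on_pts u (on_pts h x) = on_pts h' x" if x: "x \<in> points T" for x
    using descent_pts[OF pt(1) x pt(2)] mor_pts[OF h x] by (simp add: u_def)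
  have iu: "inv_img E u N = on_pts h ` inv_img T h' N" for N
  proof (intro equalityI subsetI)
    fix e assume e: "e \<in> inv_img E u N"
    then have eE: "e \<in> points E" by (simp add: inv_img_def)
    then have "pt e \<in> inv_img T h' N" using e pt[OF eE] by (simp add: inv_img_def u_def)
    then show "e \<in> on_pts h ` inv_img T h' N" using pt(2)[OF eE] by (metis imageI)
  next
    fix e assume "e \<in> on_pts h ` inv_img T h' N"
    then obtain x where "x \<in> points T" "on_pts h' x \<in> N" "e = on_pts h x" by (auto simp: inv_img_def)
    then show "e \<in> inv_img E u N" using u_pt mor_pts[OF h] by (simp add: inv_img_def)
  qed
  have V: "openin (topol E) (inv_img E u N)" "inv_img T h (inv_img E u N) = inv_img T h' N" if "openin (topol E') N" for N
    using descent_inv_img[OF that] unfolding iu by auto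
  have u_sec: "on_sec u N t \<in> carrier (sections E (inv_img E u N))" "on_sec h (inv_img E u N) (on_sec u N t) = on_sec h' N t"
    if N: "openin (topol E') N" and t: "t \<in> carrier (sections E' N)" for N t
  proof -
    have "on_sec u N t = (THE r. D N t r)" using N t by (simp add: u_def)
    moreover have "D N t (THE r. D N t r)" unfolding D_def by (rule theI'[OF descent_sec[OF N t]])
    ultimately show "on_sec u N t \<in> carrier (sections E (inv_img E u N))"
      "on_sec h (inv_img E u N) (on_sec u N t) = on_sec h' N t" unfolding iu D_def by auto
  qed
  have u_secI: "on_sec u N t = r" if N: "openin (topol E') N" "t \<in> carrier (sections E' N)"
    and r: "r \<in> carrier (sections E (inv_img E u N))" "on_sec h (inv_img E u N) r = on_sec h' N t" for N t r
    by (rule h_sec_inj[OF V(1)[OF N(1)] u_sec(1)[OF N] r(1)]) (simp add: u_sec(2)[OF N] r(2))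
  interpret E1: presheaf E by (rule locally_ringed_presheaf[OF lE])
  interpret E2: presheaf E' by (rule locally_ringed_presheaf[OF lE'])
  have mu: "morphism E E' u"
  proof (rule morphismI[OF lE lE'])
    show "on_pts u \<in> extensional (points E)" "on_sec u \<in> extensional {V. openin (topol E') V}"
      by (simp_all add: u_def)
    show "on_sec u N \<in> extensional (carrier (sections E' N))" if "openin (topol E') N" for N
      using that by (simp add: u_def)
    show "on_pts u e \<in> points E'" if "e \<in> points E" for e
      using mor_pts[OF h' pt(1)[OF that]] that by (simp add: u_def)
    fix N assume N: "openin (topol E') N"
    show "openin (topol E) (inv_img E u N)" by (rule V(1)[OF N])
    note u1 = u_sec[OF N] and hV = mor_hom[OF h V(1)[OF N]] and hN = mor_hom[OF h' N]
    interpret R: cring "sections E' N" by (rule E2.cring_sec[OF N])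
    interpret R': cring "sections E (inv_img E u N)" by (rule E1.cring_sec[OF V(1)[OF N]])
    show "on_sec u N \<in> ring_hom (sections E' N) (sections E (inv_img E u N))"
    proof (rule ring_hom_memI)
      show "on_sec u N t \<in> carrier (sections E (inv_img E u N))" if "t \<in> carrier (sections E' N)" for t by (rule u1(1)[OF that])
      fix s t assume st: "s \<in> carrier (sections E' N)" "t \<in> carrier (sections E' N)"
      show "on_sec u N (s \<otimes>\<^bsub>sections E' N\<^esub> t) = on_sec u N s \<otimes>\<^bsub>sections E (inv_img E u N)\<^esub> on_sec u N t"
        by (rule u_secI[OF N]) (use st u1 V(2)[OF N] ring_hom_mult[OF hV] ring_hom_mult[OF hN] in simp_all)
      show "on_sec u N (s \<oplus>\<^bsub>sections E' N\<^esub> t) = on_sec u N s \<oplus>\<^bsub>sections E (inv_img E u N)\<^esub> on_sec u N t"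
        by (rule u_secI[OF N]) (use st u1 V(2)[OF N] ring_hom_add[OF hV] ring_hom_add[OF hN] in simp_all)
    next
      show "on_sec u N \<one>\<^bsub>sections E' N\<^esub> = \<one>\<^bsub>sections E (inv_img E u N)\<^esub>"
        by (rule u_secI[OF N]) (use V(2)[OF N] ring_hom_one[OF hV] ring_hom_one[OF hN] in simp_all)
    qed
    show "on_sec u N' (restrn E' N N' t) = restrn E (inv_img E u N) (inv_img E u N') (on_sec u N t)"
      if N': "openin (topol E') N'" "N' \<subseteq> N" and t: "t \<in> carrier (sections E' N)" for N' t
    proof (rule u_secI[OF N'(1) E2.res_closed[OF N N' t]])
      have sub: "inv_img E u N' \<subseteq> inv_img E u N" using N'(2) by (auto simp: inv_img_def)
      show "restrn E (inv_img E u N) (inv_img E u N') (on_sec u N t) \<in> carrier (sections E (inv_img E u N'))"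
        by (rule E1.res_closed[OF V(1)[OF N] V(1)[OF N'(1)] sub u1(1)[OF t]])
      show "on_sec h (inv_img E u N') (restrn E (inv_img E u N) (inv_img E u N') (on_sec u N t)) = on_sec h' N' (restrn E' N N' t)"
        using mor_nat[OF h V(1)[OF N] V(1)[OF N'(1)] sub u1(1)[OF t]] mor_nat[OF h' N N' t] u1(2)[OF t] V(2)[OF N] V(2)[OF N'(1)] by simp
    qed
    show "unit_near E' (on_pts u e) N t"
      if e: "e \<in> points E" "on_pts u e \<in> N" and t: "t \<in> carrier (sections E' N)" and un: "unit_near E e (inv_img E u N) (on_sec u N t)" for e t
    proof -
      note x = pt[OF e(1)]
      have ue: "on_pts u e = on_pts h' (pt e)" using u_pt[OF x(1)] x(2) by simp
      have "on_pts h (pt e) \<in> inv_img E u N" using e x(2) by (simp add: inv_img_def)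
      \<comment> \<open>Locality of the descended morphism is inherited from \<open>h'\<close>:
        invertibility near a point of \<open>E\<close> is moved up to \<open>T\<close> along
        \<open>h\<close>, and down again along \<open>h'\<close>.\<close>
      then have "unit_near T (pt e) (inv_img T h' N) (on_sec h' N t)"
        using mor_unit_near[OF lT lE h x(1) V(1)[OF N] _ u1(1)[OF t]] un x(2) u1(2)[OF t] V(2)[OF N] by simp
      then show ?thesis using mor_unit_near[OF lT lE' h' x(1) N _ t] e(2) ue by simp
    qed
  qed
  moreover have "mor_comp T E E' u h = h'"
  proof (rule mor_eqI[OF mor_comp_morphism[OF lT lE lE' h mu] h'])
    show "on_pts (mor_comp T E E' u h) x = on_pts h' x" if "x \<in> points T" for x using u_pt that by simp
    show "on_sec (mor_comp T E E' u h) N t = on_sec h' N t" if "openin (topol E') N" "t \<in> carrier (sections E' N)" for N t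
      using u_sec(2) that by simp
  qed
  ultimately show ?thesis by (rule that)
qed

end

end

section \<open>Morphisms to the spectrum of the integers\<close>

lemma ring_hom_int_unique:
  assumes R: "ring R" and f: "f \<in> ring_hom \<Z> R" and g: "g \<in> ring_hom \<Z> R"
  shows "f k = g k"
proof -
  interpret R: ring R by (rule R)
  have c: "f k \<in> carrier R" "g k \<in> carrier R" for k using ring_hom_closed[OF f, of k] ring_hom_closed[OF g, of k] by auto
  have s: "f (k + 1) = f k \<oplus>\<^bsub>R\<^esub> \<one>\<^bsub>R\<^esub>" "g (k + 1) = g k \<oplus>\<^bsub>R\<^esub> \<one>\<^bsub>R\<^esub>" for k
    using ring_hom_add[OF f, of k 1] ring_hom_add[OF g, of k 1] ring_hom_one[OF f] ring_hom_one[OF g] by auto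
  have 0: "f 0 = g 0"
    using ring_hom_zero[OF f cring.axioms(1)[OF int_is_cring] R] ring_hom_zero[OF g cring.axioms(1)[OF int_is_cring] R] by simp
  show ?thesis
  proof (induction k rule: int_induct[where k = 0])
    case base show ?case by (rule 0)
  next
    case (step1 i) then show ?case using s by simp
  next
    case (step2 i)
    then have "f (i - 1) \<oplus>\<^bsub>R\<^esub> \<one>\<^bsub>R\<^esub> = g (i - 1) \<oplus>\<^bsub>R\<^esub> \<one>\<^bsub>R\<^esub>" using s[of "i - 1"] by simp
    then show ?case using c by simp
  qed
qed

text \<open>For an absolutely separated open set, compatibility of two morphisms with the structure
  morphism to the base is thereby automatic; no relation between the integers and \<open>S\<close>
  has to be established.\<close>

lemma Spec_int_mor_unique:
  assumes X: "locally_ringed X" and m: "morphism X (Spec \<Z>) m" and n: "morphism X (Spec \<Z>) n"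
  shows "m = n"
proof -
  interpret spectrum \<Z> by (rule spectrum.intro[OF int_is_cring])
  interpret X: presheaf X by (rule locally_ringed_presheaf[OF X])
  have "ring (sections X (points X))" using X.cring_sec[OF openin_points_self] by (rule cring.axioms(1))
  then show ?thesis
    using mor_spec_eqI[OF X m n] ring_hom_int_unique glob_hom[OF m] glob_hom[OF n] by metis
qed

section \<open>Separators\<close>

lemma diagonal_locally_ringed: "is_diagonal X S f P d \<Longrightarrow> locally_ringed P"
  unfolding is_diagonal_def is_fibre_product_def by (auto intro: scheme_locally_ringed)

text \<open>The fibre product of an open set \<open>U\<close> with itself is the part of
  \<open>P\<close> on which both projections land in \<open>U\<close>; as an open part it keeps the
  types of \<open>P\<close>. The base may be changed along a monomorphism \<open>i\<close>: for
  \<open>h\<close> it is the inclusion of the open image of \<open>U\<close>, for \<open>g\<close>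
  the identity of \<open>S\<close>.\<close>

lemma diagonal_open_sub:
  fixes X :: "('a, 'b) ringed_data" and P :: "('a, 'b, 'a, 'b) fp"
  assumes diag: "is_diagonal X S f P d" and X: "locally_ringed X" and S: "locally_ringed S" and S': "locally_ringed S'"
    and f: "morphism X S f" and U: "openin (topol X) U" and f': "morphism (open_sub X U) S' f'"
    and i: "morphism S' S i" "mor_comp (open_sub X U) S' S i f' = mor_comp (open_sub X U) X S f (open_incl X U)"
    and mono: "\<And>(Z :: ('a, 'b, 'a, 'b) fp) a b. locally_ringed Z \<Longrightarrow> morphism Z S' a \<Longrightarrow> morphism Z S' b \<Longrightarrow>
      mor_comp Z S' S i a = mor_comp Z S' S i b \<Longrightarrow> a = b"
  obtains N where "openin (topol P) N" "inv_img X d N = U"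
    "is_diagonal (open_sub X U) S' f' (open_sub P N) (mor_restrict X P d U N)"
proof -
  obtain p q where fp: "is_fibre_product X X S f f P p q" and d: "morphism X P d"
    and pd: "mor_comp X P X p d = mor_id X" and qd: "mor_comp X P X q d = mor_id X"
    using diag unfolding is_diagonal_def by blast
  have sP: "scheme P" and p: "morphism P X p" and q: "morphism P X q" and fpq: "mor_comp P X S f p = mor_comp P X S f q"
    using fp unfolding is_fibre_product_def by auto
  have univ: "\<exists>!u. morphism Z P u \<and> mor_comp Z P X p u = v \<and> mor_comp Z P X q u = w"
    if "scheme Z" "morphism Z X v" "morphism Z X w" "mor_comp Z X S f v = mor_comp Z X S f w"
    for Z :: "('a, 'b, 'a, 'b) fp" and v w
    using fp that unfolding is_fibre_product_def by blast
  note lP = scheme_locally_ringed[OF sP]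
  let ?N = "inv_img P p U \<inter> inv_img P q U"
  have N: "openin (topol P) ?N" using mor_open[OF p U] mor_open[OF q U] by blast
  have pd_pt: "on_pts p (on_pts d x) = x" "on_pts q (on_pts d x) = x" if "x \<in> points X" for x
    using arg_cong[OF pd, of "\<lambda>m. on_pts m x"] arg_cong[OF qd, of "\<lambda>m. on_pts m x"] that by auto
  have dN: "inv_img X d ?N = U" using pd_pt mor_pts[OF d] openin_points[OF U] by (auto simp: inv_img_def)
  let ?PN = "open_sub P ?N" and ?XU = "open_sub X U"
  let ?p = "mor_restrict P X p ?N U" and ?q = "mor_restrict P X q ?N U" and ?d = "mor_restrict X P d U ?N"
  note lN = locally_ringed_open_sub[OF lP N] and lU = locally_ringed_open_sub[OF X U]
  have pN: "\<And>z. z \<in> ?N \<Longrightarrow> on_pts p z \<in> U" and qN: "\<And>z. z \<in> ?N \<Longrightarrow> on_pts q z \<in> U" and dU: "\<And>x. x \<in> U \<Longrightarrow> on_pts d x \<in> ?N"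
    using dN by (auto simp: inv_img_def)
  have mp: "morphism ?PN ?XU ?p" and mq: "morphism ?PN ?XU ?q" and md: "morphism ?XU ?PN ?d"
    using mor_restrict_morphism[OF lP X p N U] mor_restrict_morphism[OF lP X q N U] mor_restrict_morphism[OF X lP d U N] pN qN dU by auto
  have ip: "mor_comp ?PN ?XU X (open_incl X U) ?p = mor_comp ?PN P X p (open_incl P ?N)"
    and iq: "mor_comp ?PN ?XU X (open_incl X U) ?q = mor_comp ?PN P X q (open_incl P ?N)"
    and idd: "mor_comp ?XU ?PN P (open_incl P ?N) ?d = mor_comp ?XU X P d (open_incl X U)"
    using incl_comp_restrict[OF lP X p N U] incl_comp_restrict[OF lP X q N U] incl_comp_restrict[OF X lP d U N] pN qN dU by auto
  note iN = open_incl_morphism[OF lP N] and iU = open_incl_morphism[OF X U]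
  \<comment> \<open>Over \<open>S'\<close> and over \<open>S\<close> the same pairs of morphisms to
    \<open>U\<close> are compatible; \<open>key\<close> translates between the two, and
    \<open>mono\<close> is used for the way back.\<close>
  have key: "mor_comp Z S' S i (mor_comp Z ?XU S' f' a) = mor_comp Z X S f (mor_comp Z ?XU X (open_incl X U) a)"
    if "locally_ringed Z" "morphism Z ?XU a" for Z :: "('a, 'b, 'a, 'b) fp" and a
    using mor_comp_assoc[OF that(1) lU S' S that(2) f' i(1)] mor_comp_assoc[OF that(1) lU X S that(2) iU f] i(2) by simp
  have "mor_comp ?PN S' S i (mor_comp ?PN ?XU S' f' ?p) = mor_comp ?PN S' S i (mor_comp ?PN ?XU S' f' ?q)"
    unfolding key[OF lN mp] key[OF lN mq] ip iq
    using mor_comp_assoc[OF lN lP X S iN p f] mor_comp_assoc[OF lN lP X S iN q f] fpq by simp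
  then have fpq': "mor_comp ?PN ?XU S' f' ?p = mor_comp ?PN ?XU S' f' ?q"
    by (rule mono[OF lN mor_comp_morphism[OF lN lU S' mp f'] mor_comp_morphism[OF lN lU S' mq f']])
  have "is_fibre_product ?XU ?XU S' f' f' ?PN ?p ?q"
    unfolding is_fibre_product_def
  proof (intro conjI allI impI scheme_open_sub[OF sP N] mp mq fpq')
    fix Z :: "('a, 'b, 'a, 'b) fp" and a b
    assume "scheme Z \<and> morphism Z ?XU a \<and> morphism Z ?XU b \<and> mor_comp Z ?XU S' f' a = mor_comp Z ?XU S' f' b"
    then have sZ: "scheme Z" and a: "morphism Z ?XU a" and b: "morphism Z ?XU b"
      and e: "mor_comp Z ?XU S' f' a = mor_comp Z ?XU S' f' b" by auto
    note lZ = scheme_locally_ringed[OF sZ]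
    let ?a = "mor_comp Z ?XU X (open_incl X U) a" and ?b = "mor_comp Z ?XU X (open_incl X U) b"
    have ab: "morphism Z X ?a" "morphism Z X ?b"
      by (rule mor_comp_morphism[OF lZ lU X a iU], rule mor_comp_morphism[OF lZ lU X b iU])
    have "mor_comp Z X S f ?a = mor_comp Z X S f ?b" using key[OF lZ a] key[OF lZ b] e by simp
    note ex1 = univ[OF sZ ab this]
    then obtain u where u: "morphism Z P u" "mor_comp Z P X p u = ?a" "mor_comp Z P X q u = ?b" by blast
    have comp: "mor_comp Z ?XU X (open_incl X U) (mor_comp Z ?PN ?XU ?p v) = mor_comp Z P X p (mor_comp Z ?PN P (open_incl P ?N) v)"
      "mor_comp Z ?XU X (open_incl X U) (mor_comp Z ?PN ?XU ?q v) = mor_comp Z P X q (mor_comp Z ?PN P (open_incl P ?N) v)"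
      if v: "morphism Z ?PN v" for v
      using mor_comp_assoc[OF lZ lN lU X v mp iU] mor_comp_assoc[OF lZ lN lP X v iN p] ip
        mor_comp_assoc[OF lZ lN lU X v mq iU] mor_comp_assoc[OF lZ lN lP X v iN q] iq by auto
    have "on_pts u z \<in> ?N" if z: "z \<in> points Z" for z
    proof -
      have "on_pts a z \<in> U" "on_pts b z \<in> U" using mor_pts[OF a z] mor_pts[OF b z] points_open_sub[OF U] by auto
      then show ?thesis
        using arg_cong[OF u(2), of "\<lambda>m. on_pts m z"] arg_cong[OF u(3), of "\<lambda>m. on_pts m z"] z mor_pts[OF u(1) z] pts_incl[OF U]
        by (simp add: inv_img_def)
    qed
    then have uN: "\<forall>z\<in>points Z. on_pts u z \<in> ?N" by blast
    note c = corestrict[OF lZ lP u(1) N uN]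
    let ?c = "mor_restrict Z P u (points Z) ?N"
    show "\<exists>!u. morphism Z ?PN u \<and> mor_comp Z ?PN ?XU ?p u = a \<and> mor_comp Z ?PN ?XU ?q u = b"
    proof (rule ex1I[of _ ?c], intro conjI c(1))
      show "mor_comp Z ?PN ?XU ?p ?c = a"
        by (rule open_incl_mono[OF X U mor_comp_morphism[OF lZ lN lU c(1) mp] a]) (simp only: comp(1)[OF c(1)] c(2) u(2))
      show "mor_comp Z ?PN ?XU ?q ?c = b"
        by (rule open_incl_mono[OF X U mor_comp_morphism[OF lZ lN lU c(1) mq] b]) (simp only: comp(2)[OF c(1)] c(2) u(3))
      fix v assume v: "morphism Z ?PN v \<and> mor_comp Z ?PN ?XU ?p v = a \<and> mor_comp Z ?PN ?XU ?q v = b"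
      then have mv: "morphism Z ?PN v" by blast
      have "mor_comp Z ?PN P (open_incl P ?N) v = u"
        using ex1 u mor_comp_morphism[OF lZ lN lP mv iN] comp[OF mv] v by metis
      then show "v = ?c" using open_incl_mono[OF lP N mv c(1)] c(2) by simp
    qed
  qed
  moreover have "mor_comp ?XU ?PN ?XU ?p ?d = mor_id ?XU"
  proof (rule open_incl_mono[OF X U mor_comp_morphism[OF lU lN lU md mp] mor_id_morphism[OF lU]])
    show "mor_comp ?XU ?XU X (open_incl X U) (mor_comp ?XU ?PN ?XU ?p ?d) = mor_comp ?XU ?XU X (open_incl X U) (mor_id ?XU)"
      using mor_comp_assoc[OF lU lN lU X md mp iU] mor_comp_assoc[OF lU lN lP X md iN p] mor_comp_assoc[OF lU X lP X iU d p]
        ip idd pd mor_comp_id_left[OF lU X iU] mor_comp_id_right[OF lU X iU] by simp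
  qed
  moreover have "mor_comp ?XU ?PN ?XU ?q ?d = mor_id ?XU"
  proof (rule open_incl_mono[OF X U mor_comp_morphism[OF lU lN lU md mq] mor_id_morphism[OF lU]])
    show "mor_comp ?XU ?XU X (open_incl X U) (mor_comp ?XU ?PN ?XU ?q ?d) = mor_comp ?XU ?XU X (open_incl X U) (mor_id ?XU)"
      using mor_comp_assoc[OF lU lN lU X md mq iU] mor_comp_assoc[OF lU lN lP X md iN q] mor_comp_assoc[OF lU X lP X iU d q]
        iq idd qd mor_comp_id_left[OF lU X iU] mor_comp_id_right[OF lU X iU] by simp
  qed
  ultimately have "is_diagonal ?XU S' f' ?PN ?d" unfolding is_diagonal_def using md by blast
  then show ?thesis by (rule that[OF N dN])
qed

text \<open>Because \<open>U\<close> is the whole inverse image of \<open>N\<close>, its image is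
  the image of \<open>d\<close> cut with \<open>N\<close>. So closedness, the topology and the local
  lifting of sections restrict to \<open>N\<close>.\<close>

lemma closed_immersion_restrict:
  assumes d: "closed_immersion X P d" and X: "locally_ringed X" and P: "locally_ringed P" and N: "openin (topol P) N"
    and U: "inv_img X d N = U"
  shows "closed_immersion (open_sub X U) (open_sub P N) (mor_restrict X P d U N)"
proof -
  have m: "morphism X P d" and cl: "closedin (topol P) (on_pts d ` points X)"
    and ho: "homeomorphic_map (topol X) (subtopology (topol P) (on_pts d ` points X)) (on_pts d)"
    and lift: "\<And>V s y. openin (topol P) V \<Longrightarrow> s \<in> carrier (sections X (inv_img X d V)) \<Longrightarrow> y \<in> V \<Longrightarrow>
           \<exists>W. openin (topol P) W \<and> y \<in> W \<and> W \<subseteq> V \<and>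
             (\<exists>t\<in>carrier (sections P W). on_sec d W t = restrn X (inv_img X d V) (inv_img X d W) s)"
    using d unfolding closed_immersion_def by blast+
  have oU: "openin (topol X) U" using mor_open[OF m N] U by simp
  have dU: "\<And>x. x \<in> U \<Longrightarrow> on_pts d x \<in> N" using U by (auto simp: inv_img_def)
  have im: "on_pts d ` U = on_pts d ` points X \<inter> N" using U by (auto simp: inv_img_def)
  let ?d = "mor_restrict X P d U N"
  have im': "on_pts ?d ` U = on_pts d ` U" by (rule image_restrict[OF oU subset_refl])
  have iV: "inv_img X d V \<subseteq> U" if "V \<subseteq> N" for V using that U by (auto simp: inv_img_def)
  show ?thesis unfolding closed_immersion_def points_open_sub[OF oU] im'
  proof (intro conjI allI impI ballI mor_restrict_morphism[OF X P m oU N] dU)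
    show "closedin (topol (open_sub P N)) (on_pts d ` U)"
      unfolding im using cl by (auto simp: open_sub_def closedin_subtopology)
    have "on_pts d ` (topspace (topol X) \<inter> U) = topspace (subtopology (topol P) (on_pts d ` points X)) \<inter> (on_pts d ` U)"
      using openin_points[OF oU] mor_pts[OF m] by (auto simp: points_def)
    then have "homeomorphic_map (subtopology (topol X) U) (subtopology (subtopology (topol P) (on_pts d ` points X)) (on_pts d ` U)) (on_pts d)"
      by (rule homeomorphic_map_subtopologies[OF ho])
    moreover have "subtopology (subtopology (topol P) (on_pts d ` points X)) (on_pts d ` U) = subtopology (subtopology (topol P) N) (on_pts d ` U)"
      unfolding subtopology_subtopology im by (rule arg_cong[of _ _ "subtopology (topol P)"]) blast
    ultimately have "homeomorphic_map (topol (open_sub X U)) (subtopology (topol (open_sub P N)) (on_pts d ` U)) (on_pts d)"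
      by (simp add: open_sub_def)
    then show "homeomorphic_map (topol (open_sub X U)) (subtopology (topol (open_sub P N)) (on_pts d ` U)) (on_pts ?d)"
      by (rule homeomorphic_map_eq) (use oU points_open_sub[OF oU] in \<open>simp add: points_def\<close>)
  next
    fix V s y assume "openin (topol (open_sub P N)) V" and s: "s \<in> carrier (sections (open_sub X U) (inv_img (open_sub X U) ?d V))" and y: "y \<in> V"
    then have V: "openin (topol P) V" "V \<subseteq> N" using openin_open_sub[OF N] by auto
    have i: "inv_img (open_sub X U) ?d W = inv_img X d W" if "W \<subseteq> N" for W
      unfolding inv_restrict[OF oU] using iV[OF that] by blast
    have s': "s \<in> carrier (sections X (inv_img X d V))" using s i[OF V(2)] by simp
    obtain W t where W: "openin (topol P) W" "y \<in> W" "W \<subseteq> V" and t: "t \<in> carrier (sections P W)"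
      "on_sec d W t = restrn X (inv_img X d V) (inv_img X d W) s" using lift[OF V(1) s' y] by blast
    have WN: "W \<subseteq> N" using W(3) V(2) by blast
    interpret presheaf X by (rule locally_ringed_presheaf[OF X])
    have "U \<inter> inv_img X d W = inv_img X d W" using iV[OF WN] by blast
    then have "on_sec ?d W t = on_sec d W t"
      using sec_restrict[OF N W(1) WN t(1), of X d U] mor_open[OF m W(1)] mor_sec[OF m W(1) t(1)] by simp
    then show "\<exists>W. openin (topol (open_sub P N)) W \<and> y \<in> W \<and> W \<subseteq> V \<and> (\<exists>t\<in>carrier (sections (open_sub P N) W).
        on_sec ?d W t = restrn (open_sub X U) (inv_img (open_sub X U) ?d V) (inv_img (open_sub X U) ?d W) s)"
      using W WN t i[OF V(2)] i[OF WN] openin_open_sub[OF N, of W] by (intro exI[of _ W] conjI bexI[of _ t]) simp_all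
  qed
qed

text \<open>The inverse image of a compact open set has to be cut with \<open>U\<close>. The
  alternatives in \<open>c\<close> are two reasons why it stays compact: for a diagonal nothing is
  cut away, since \<open>U\<close> is the whole inverse image of \<open>N\<close>; for
  \<open>h\<close> itself, where points outside \<open>U\<close> may lie over the image of
  \<open>U\<close>, retrocompactness is used.\<close>

lemma quasi_compact_restrict:
  assumes d: "quasi_compact X P d" and X: "locally_ringed X" and P: "locally_ringed P"
    and U: "openin (topol X) U" and N: "openin (topol P) N" and UN: "\<And>x. x \<in> U \<Longrightarrow> on_pts d x \<in> N"
    and c: "inv_img X d N = U \<or> retrocompact X U"
  shows "quasi_compact (open_sub X U) (open_sub P N) (mor_restrict X P d U N)"
  unfolding quasi_compact_def
proof (intro conjI allI impI)
  have m: "morphism X P d" using d unfolding quasi_compact_def by blast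
  show "morphism (open_sub X U) (open_sub P N) (mor_restrict X P d U N)" by (rule mor_restrict_morphism[OF X P m U N]) (rule UN)
  fix V assume V0: "openin (topol (open_sub P N)) V \<and> compactin (topol (open_sub P N)) V"
  then have V: "openin (topol P) V" "V \<subseteq> N" using openin_open_sub[OF N] by auto
  have "compactin (topol P) V" using V0 by (auto simp: open_sub_def compactin_subtopology)
  then have K: "compactin (topol X) (inv_img X d V)" using d V(1) unfolding quasi_compact_def by blast
  have "compactin (topol X) (U \<inter> inv_img X d V)"
  proof (cases "retrocompact X U")
    case True
    then have "compactin (topol (open_sub X U)) (inv_img (open_sub X U) (open_incl X U) (inv_img X d V))"
      using K mor_open[OF m V(1)] unfolding retrocompact_def quasi_compact_def by blast
    then show ?thesis unfolding inv_incl[OF U] by (auto simp: open_sub_def compactin_subtopology)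
  next
    case False
    then have "inv_img X d N = U" using c by blast
    then have "U \<inter> inv_img X d V = inv_img X d V" using V(2) by (auto simp: inv_img_def)
    then show ?thesis using K by simp
  qed
  then show "compactin (topol (open_sub X U)) (inv_img (open_sub X U) (mor_restrict X P d U N) V)"
    unfolding inv_restrict[OF U] by (auto simp: open_sub_def compactin_subtopology)
qed

lemma (in local_iso) local_isomorphism_open_sub:
  assumes U: "openin (topol T) U"
  shows "local_isomorphism (open_sub T U) (open_sub E (on_pts h ` U)) (mor_restrict T E h U (on_pts h ` U))"
  unfolding local_isomorphism_def points_open_sub[OF U]
proof (intro conjI ballI)
  let ?V = "on_pts h ` U" let ?k = "mor_restrict T E h U ?V"
  note V = h_image_open[OF U]
  show k: "morphism (open_sub T U) (open_sub E ?V) ?k" by (rule h_open_sub(1)[OF U V subset_refl])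
  fix x assume "x \<in> U"
  then obtain W where W: "chart T E h W" "x \<in> W" "W \<subseteq> U" using chart_near[OF U] by metis
  note O = chart_open[OF W(1)]
  let ?hW = "on_pts h ` W"
  have sub: "?hW \<subseteq> ?V" using W(3) by blast
  have WV: "\<And>x. x \<in> W \<Longrightarrow> on_pts h x \<in> ?V" "\<And>x. x \<in> W \<Longrightarrow> on_pts h x \<in> ?hW" "\<And>x. x \<in> U \<Longrightarrow> on_pts h x \<in> ?V" using W(3) by blast+
  have TW: "open_sub (open_sub T U) W = open_sub T W" "open_sub (open_sub E ?V) ?hW = open_sub E ?hW"
    by (rule open_sub_open_sub[OF W(3)], rule open_sub_open_sub[OF sub])
  have r: "mor_restrict (open_sub T U) (open_sub E ?V) ?k W ?V = mor_restrict T E h W ?V"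
    by (rule restrict_restrict[OF lT lE h U V WV(3) O(1) W(3) V subset_refl WV(1)])
  have r': "mor_restrict (open_sub T W) (open_sub E ?V) (mor_restrict T E h W ?V) W ?hW = mor_restrict T E h W ?hW"
    by (rule restrict_restrict[OF lT lE h O(1) V WV(1) O(1) subset_refl O(2) sub WV(2)])
  have im: "on_pts (mor_restrict T E h W ?V) ` W = ?hW" by (rule image_restrict[OF O(1) subset_refl])
  have "open_immersion (open_sub T W) (open_sub E ?V) (mor_restrict T E h W ?V)"
    unfolding open_immersion_def points_open_sub[OF O(1)] im r' TW
    using h_open_sub(1)[OF O(1) V sub] W(1) openin_open_sub[OF V] sub unfolding chart_def by blast
  then show "\<exists>W. openin (topol (open_sub T U)) W \<and> x \<in> W \<and> open_immersion (open_sub (open_sub T U) W) (open_sub E ?V)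
      (mor_restrict (open_sub T U) (open_sub E ?V) ?k W (points (open_sub E ?V)))"
    using O(1) W(2,3) openin_open_sub[OF U] r TW(1) points_open_sub[OF V] by metis
qed

lemma separator_local_iso: "is_separator T S f E h g \<Longrightarrow> local_iso T E h"
  unfolding is_separator_def by (intro local_iso.intro) simp_all

lemma separator_dominant_diagonal:
  assumes "is_separator T S f E h g" obtains P d where "dominant_diagonal T E h P d"
proof -
  obtain P d where "is_diagonal T E h P d" "schematically_dominant T P d"
    using assms unfolding is_separator_def by (elim conjE exE)
  then show ?thesis using that dominant_diagonal.intro[OF separator_local_iso[OF assms] dominant_diagonal_axioms.intro] by blast
qed

text \<open>Every diagonal in the claim is an open part of a given one. The two conditions on the
  diagonal of \<open>h\<close> are restricted over the image of \<open>U\<close>, and the one for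
  separatedness is restricted over the unchanged base \<open>S\<close>.\<close>

lemma separator_open_sub:
  assumes sep: "is_separator T S f E h g" and U: "retrocompact T U"
  shows "is_separator (open_sub T U) S (mor_comp (open_sub T U) T S f (open_incl T U))
    (open_sub E (on_pts h ` U)) (mor_restrict T E h U (on_pts h ` U))
    (mor_comp (open_sub E (on_pts h ` U)) E S g (open_incl E (on_pts h ` U)))"
proof -
  interpret local_iso T E h by (rule separator_local_iso[OF sep])
  let ?V = "on_pts h ` U"
  let ?TU = "open_sub T U" and ?EV = "open_sub E ?V" and ?k = "mor_restrict T E h U ?V" and ?g = "mor_comp (open_sub E ?V) E S g (open_incl E ?V)"
  have S: "scheme S" and f: "morphism T S f" and gsep: "separated E S g" and gh: "mor_comp T E S g h = f"
    and qc: "quasi_compact T E h"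
    using sep unfolding is_separator_def by blast+
  obtain P d where P: "is_diagonal T E h P d" "quasi_compact T P d"
    using sep unfolding is_separator_def quasi_separated_def by blast
  \<comment> \<open>Quasi-separatedness and schematic dominance each bring their own fibre product
    of \<open>T\<close> with itself over \<open>E\<close>. Instead of being compared, both are
    restricted.\<close>
  obtain P' d' where P': "is_diagonal T E h P' d'" "schematically_dominant T P' d'"
    using sep unfolding is_separator_def by blast
  obtain Q e where Q: "is_diagonal E S g Q e" "closed_immersion E Q e" and g: "morphism E S g"
    using gsep unfolding separated_def by blast
  note lS = scheme_locally_ringed[OF S]
  have oU: "openin (topol T) U" using U by (simp add: retrocompact_def)
  note oV = h_image_open[OF oU]
  note lU = locally_ringed_open_sub[OF lT oU] and lV = locally_ringed_open_sub[OF lE oV]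
  note k = h_open_sub[OF oU oV subset_refl] and iU = open_incl_morphism[OF lT oU] and iV = open_incl_morphism[OF lE oV]
  have mg: "morphism ?EV S ?g" by (rule mor_comp_morphism[OF lV lE lS iV g])
  have lP: "locally_ringed P" "locally_ringed P'" "locally_ringed Q"
    using diagonal_locally_ringed[OF P(1)] diagonal_locally_ringed[OF P'(1)] diagonal_locally_ringed[OF Q(1)] .
  have k_mono: "a = b" if "morphism Z ?EV a" "morphism Z ?EV b" "mor_comp Z ?EV E (open_incl E ?V) a = mor_comp Z ?EV E (open_incl E ?V) b"
    for Z :: "('a, 'b, 'a, 'b) fp" and a b by (rule open_incl_mono[OF lE oV that])
  have g_mono: "a = b" if "locally_ringed Z" "morphism Z S a" "morphism Z S b" "mor_comp Z S S (mor_id S) a = mor_comp Z S S (mor_id S) b"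
    for Z :: "('e, 'f, 'e, 'f) fp" and a b
    using that mor_comp_id_left[OF that(1) lS that(2)] mor_comp_id_left[OF that(1) lS that(3)] by metis
  \<comment> \<open>The point where \<open>U\<close> must be retrocompact, because the inverse image
    of the image of \<open>U\<close> can be larger than \<open>U\<close>.\<close>
  have qk: "quasi_compact ?TU ?EV ?k"
    by (rule quasi_compact_restrict[OF qc lT lE oU oV]) (use U in auto)
  obtain N where N: "openin (topol P) N" "inv_img T d N = U" "is_diagonal ?TU ?EV ?k (open_sub P N) (mor_restrict T P d U N)"
    by (rule diagonal_open_sub[OF P(1) lT lE lV h oU k(1) iV k(2) k_mono])
  have "quasi_compact ?TU (open_sub P N) (mor_restrict T P d U N)"
  proof (rule quasi_compact_restrict[OF P(2) lT lP(1) oU N(1)])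
    show "on_pts d x \<in> N" if "x \<in> U" for x using that unfolding N(2)[symmetric] inv_img_def by blast
    show "inv_img T d N = U \<or> retrocompact T U" using N(2) by blast
  qed
  then have qs: "quasi_separated ?TU ?EV ?k" using N(3) k(1) unfolding quasi_separated_def by blast
  obtain N' where N': "openin (topol P') N'" "inv_img T d' N' = U" "is_diagonal ?TU ?EV ?k (open_sub P' N') (mor_restrict T P' d' U N')"
    by (rule diagonal_open_sub[OF P'(1) lT lE lV h oU k(1) iV k(2) k_mono])
  have dom: "schematically_dominant ?TU (open_sub P' N') (mor_restrict T P' d' U N')"
    using dominant_restrict[OF lP(2) lT P'(2) N'(1)] unfolding N'(2) .
  obtain M where M: "openin (topol Q) M" "inv_img E e M = ?V" "is_diagonal ?EV S ?g (open_sub Q M) (mor_restrict E Q e ?V M)"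
    by (rule diagonal_open_sub[OF Q(1) lE lS lS g oV mg mor_id_morphism[OF lS] mor_comp_id_left[OF lV lS mg] g_mono])
  have "separated ?EV S ?g" unfolding separated_def
    using mg M(3) closed_immersion_restrict[OF Q(2) lE lP(3) M(1,2)] by blast
  moreover have "mor_comp ?TU ?EV S ?g ?k = mor_comp ?TU T S f (open_incl T U)"
    using mor_comp_assoc[OF lU lV lE lS k(1) iV g] mor_comp_assoc[OF lU lT lE lS iU h g] k(2) gh by simp
  moreover have "on_pts ?k ` points ?TU = points ?EV"
    using image_restrict[OF oU subset_refl] points_open_sub[OF oU] points_open_sub[OF oV] by metis
  ultimately show ?thesis unfolding is_separator_def
    using scheme_open_sub[OF T oU] S scheme_open_sub[OF E oV] mor_comp_morphism[OF lU lT lS iU f] k(1) qk qs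
      local_isomorphism_open_sub[OF oU] N'(3) dom by blast
qed

section \<open>Separated open subschemes and the universal property of a separator\<close>

context
  fixes T :: "('a, 'b) ringed_data" and S :: "('c, 'd) ringed_data" and E :: "('e, 'f) ringed_data" and f h g
  assumes sep: "is_separator T S f E h g"
begin

lemma separator_isomorphism_open:
  assumes U: "openin (topol T) U"
    and sU: "separated (open_sub T U) S (mor_comp (open_sub T U) T S f (open_incl T U)) \<or> separated_scheme (open_sub T U)"
  shows "openin (topol E) (on_pts h ` U) \<and>
    isomorphism (open_sub T U) (open_sub E (on_pts h ` U)) (mor_restrict T E h U (on_pts h ` U))"
proof -
  obtain P d where "dominant_diagonal T E h P d" using separator_dominant_diagonal[OF sep] .
  then interpret dominant_diagonal T E h P d .
  have S: "scheme S" and gsep: "separated E S g" and gh: "mor_comp T E S g h = f"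
    using sep unfolding is_separator_def by blast+
  have g: "morphism E S g" using gsep unfolding separated_def by blast
  note lS = scheme_locally_ringed[OF S] and lU = locally_ringed_open_sub[OF lT U] and iU = open_incl_morphism[OF lT U]
  have "inj_on (on_pts h) U" using sU
  proof
    assume s: "separated (open_sub T U) S (mor_comp (open_sub T U) T S f (open_incl T U))"
    have aff: "\<forall>s\<in>points S. \<exists>R (R0 :: 'd ring) r. openin (topol S) R \<and> s \<in> R \<and> cring R0 \<and> isomorphism (open_sub S R) (Spec R0) r"
      using S unfolding scheme_def affine_def by blast
    \<comment> \<open>The structure morphism of \<open>U\<close> factors through \<open>h\<close>,
      so morphisms to \<open>U\<close> that agree after \<open>h\<close> agree over
      \<open>S\<close>, as \<open>separated_inj\<close> requires.\<close>
    have f': "mor_comp (open_sub T U) T S f (open_incl T U) = mor_comp (open_sub T U) E S g (mor_comp (open_sub T U) T E h (open_incl T U))"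
      using mor_comp_assoc[OF lU lT lE lS iU h g] unfolding gh .
    note hU = mor_comp_morphism[OF lU lT lE iU h]
    show ?thesis
    proof (rule separated_inj[OF U lS s aff])
      fix W \<alpha> \<beta> assume W: "openin (topol T) W" and a: "morphism (open_sub T W) (open_sub T U) \<alpha>" and b: "morphism (open_sub T W) (open_sub T U) \<beta>"
        and e: "mor_comp (open_sub T W) T E h (mor_comp (open_sub T W) (open_sub T U) T (open_incl T U) \<alpha>) =
          mor_comp (open_sub T W) T E h (mor_comp (open_sub T W) (open_sub T U) T (open_incl T U) \<beta>)"
      note lW = locally_ringed_open_sub[OF lT W]
      show "mor_comp (open_sub T W) (open_sub T U) S (mor_comp (open_sub T U) T S f (open_incl T U)) \<alpha> =
        mor_comp (open_sub T W) (open_sub T U) S (mor_comp (open_sub T U) T S f (open_incl T U)) \<beta>"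
        unfolding f' mor_comp_assoc[OF lW lU lE lS a hU g] mor_comp_assoc[OF lW lU lE lS b hU g]
          mor_comp_assoc[OF lW lU lT lE a iU h] mor_comp_assoc[OF lW lU lT lE b iU h] e ..
    qed
  next
    assume "separated_scheme (open_sub T U)"
    then obtain m where m: "separated (open_sub T U) (Spec \<Z>) m" unfolding separated_scheme_def by blast
    then have mm: "morphism (open_sub T U) (Spec \<Z>) m" unfolding separated_def by blast
    note lZ = Spec_locally_ringed[OF int_is_cring]
    have id: "isomorphism (Spec \<Z>) (Spec \<Z>) (mor_id (Spec \<Z>))"
      unfolding isomorphism_def using mor_id_morphism[OF lZ] mor_comp_id_left[OF lZ lZ mor_id_morphism[OF lZ]] by blast
    \<comment> \<open>The whole base is one affine open set, but its ring has type
      \<open>int\<close>, which is not the type of sections of the spectrum. This is why the affine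
      cover of the base carries a ring type of its own.\<close>
    have aff: "\<forall>s\<in>points (Spec \<Z>). \<exists>R (R0 :: int ring) r. openin (topol (Spec \<Z>)) R \<and> s \<in> R \<and> cring R0 \<and> isomorphism (open_sub (Spec \<Z>) R) (Spec R0) r"
    proof
      fix s assume s: "s \<in> points (Spec \<Z>)"
      have "isomorphism (open_sub (Spec \<Z>) (points (Spec \<Z>))) (Spec \<Z>) (mor_id (Spec \<Z>))" unfolding open_sub_points by (rule id)
      then show "\<exists>R (R0 :: int ring) r. openin (topol (Spec \<Z>)) R \<and> s \<in> R \<and> cring R0 \<and> isomorphism (open_sub (Spec \<Z>) R) (Spec R0) r"
        using openin_points_self[of "Spec \<Z>"] s int_is_cring by metis
    qed
    show ?thesis
    proof (rule separated_inj[OF U lZ m aff])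
      fix W \<alpha> \<beta> assume W: "openin (topol T) W" and a: "morphism (open_sub T W) (open_sub T U) \<alpha>" and b: "morphism (open_sub T W) (open_sub T U) \<beta>"
      note lW = locally_ringed_open_sub[OF lT W]
      show "mor_comp (open_sub T W) (open_sub T U) (Spec \<Z>) m \<alpha> = mor_comp (open_sub T W) (open_sub T U) (Spec \<Z>) m \<beta>"
        by (rule Spec_int_mor_unique[OF lW mor_comp_morphism[OF lW lU lZ a mm] mor_comp_morphism[OF lW lU lZ b mm]])
    qed
  qed
  then show ?thesis using inj_chart[OF U] unfolding chart_def by blast
qed

lemma separator_isomorphism:
  assumes s: "separated T S f" shows "isomorphism T E h"
proof -
  have T: "scheme T" and E: "scheme E" and S: "scheme S" and f: "morphism T S f" and h: "morphism T E h" and surj: "on_pts h ` points T = points E"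
    using sep unfolding is_separator_def by blast+
  note lT = scheme_locally_ringed[OF T] and lE = scheme_locally_ringed[OF E] and lS = scheme_locally_ringed[OF S]
  have "mor_comp (open_sub T (points T)) T S f (open_incl T (points T)) = f"
    unfolding open_sub_points open_incl_points[OF lT] by (rule mor_comp_id_right[OF lT lS f])
  then show ?thesis
    using separator_isomorphism_open[OF openin_points_self] s unfolding surj open_sub_points restrict_whole[OF lT lE h] by metis
qed

lemma separator_universal:
  fixes E' :: "('i, 'j) ringed_data"
  assumes E': "scheme E'" and s: "separated E' S g'" and h': "morphism T E' h'" and gh': "mor_comp T E' S g' h' = f"
  shows "\<exists>!u. morphism E E' u \<and> mor_comp E E' S g' u = g \<and> mor_comp T E E' u h = h'"
proof -
  obtain P d where "dominant_diagonal T E h P d" using separator_dominant_diagonal[OF sep] .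
  then interpret dominant_diagonal T E h P d .
  have S: "scheme S" and gsep: "separated E S g" and gh: "mor_comp T E S g h = f" and surj: "on_pts h ` points T = points E"
    using sep unfolding is_separator_def by blast+
  have g: "morphism E S g" using gsep unfolding separated_def by blast
  have g': "morphism E' S g'" using s unfolding separated_def by blast
  note lS = scheme_locally_ringed[OF S] and lE' = scheme_locally_ringed[OF E']
  have e: "mor_comp T E' S g' h' = mor_comp T E S g h" using gh gh' by simp
  obtain u where u: "morphism E E' u" "mor_comp T E E' u h = h'"
    by (rule descent[OF E' S s g h' e surj])
  \<comment> \<open>It suffices to compare both sides after the epimorphism \<open>h\<close>, where
    each becomes \<open>f\<close>.\<close>
  have "mor_comp E E' S g' u = g"
    by (rule h_epi[OF surj mor_comp_morphism[OF lE lE' lS u(1) g'] g])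
      (use mor_comp_assoc[OF lT lE lE' lS h u(1) g'] u(2) e in simp)
  then show ?thesis
  proof (intro ex1I[of _ u] conjI u)
    fix v assume v: "morphism E E' v \<and> mor_comp E E' S g' v = g \<and> mor_comp T E E' v h = h'"
    show "v = u" by (rule h_epi[OF surj _ u(1)]) (use v u(2) in simp_all)
  qed
qed

end

theorem proposition3p1p1:
  fixes T :: "('a, 'b) ringed_data"
    and S :: "('c, 'd) ringed_data"
    and E :: "('e, 'f) ringed_data"
  assumes "scheme T" and "scheme S" and "morphism T S f"
    and "is_separator T S f E h g"
  shows
    "(\<forall>U. retrocompact T U \<longrightarrow>
        openin (topol E) (on_pts h ` U) \<and>
        is_separator (open_sub T U) S (mor_comp (open_sub T U) T S f (open_incl T U))
          (open_sub E (on_pts h ` U)) (mor_restrict T E h U (on_pts h ` U))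
          (mor_comp (open_sub E (on_pts h ` U)) E S g (open_incl E (on_pts h ` U)))) \<and>
     ((\<forall>U. openin (topol T) U \<and>
          (separated (open_sub T U) S (mor_comp (open_sub T U) T S f (open_incl T U)) \<or>
           separated_scheme (open_sub T U)) \<longrightarrow>
        openin (topol E) (on_pts h ` U) \<and>
        isomorphism (open_sub T U) (open_sub E (on_pts h ` U))
          (mor_restrict T E h U (on_pts h ` U))) \<and>
      (separated T S f \<longrightarrow> isomorphism T E h)) \<and>
     (\<forall>(E' :: ('i, 'j) ringed_data) g' h'.
        scheme E' \<and> separated E' S g' \<and> morphism T E' h' \<and> mor_comp T E' S g' h' = f \<longrightarrow>
        (\<exists>!u. morphism E E' u \<and> mor_comp E E' S g' u = g \<and> mor_comp T E E' u h = h'))"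
proof (intro conjI allI impI)
  interpret local_iso T E h by (rule separator_local_iso[OF assms(4)])
  fix U assume U: "retrocompact T U"
  show "openin (topol E) (on_pts h ` U)" using h_image_open U unfolding retrocompact_def by blast
  show "is_separator (open_sub T U) S (mor_comp (open_sub T U) T S f (open_incl T U))
      (open_sub E (on_pts h ` U)) (mor_restrict T E h U (on_pts h ` U))
      (mor_comp (open_sub E (on_pts h ` U)) E S g (open_incl E (on_pts h ` U)))"
    by (rule separator_open_sub[OF assms(4) U])
next
  fix U assume "openin (topol T) U \<and>
    (separated (open_sub T U) S (mor_comp (open_sub T U) T S f (open_incl T U)) \<or> separated_scheme (open_sub T U))"
  note * = separator_isomorphism_open[OF assms(4) this[THEN conjunct1] this[THEN conjunct2]]
  show "openin (topol E) (on_pts h ` U)" by (rule *[THEN conjunct1])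
  show "isomorphism (open_sub T U) (open_sub E (on_pts h ` U)) (mor_restrict T E h U (on_pts h ` U))"
    by (rule *[THEN conjunct2])
next
  show "isomorphism T E h" if "separated T S f" by (rule separator_isomorphism[OF assms(4) that])
next
  fix E' :: "('i, 'j) ringed_data" and g' h'
  assume "scheme E' \<and> separated E' S g' \<and> morphism T E' h' \<and> mor_comp T E' S g' h' = f"
  then show "\<exists>!u. morphism E E' u \<and> mor_comp E E' S g' u = g \<and> mor_comp T E E' u h = h'"
    by (elim conjE) (rule separator_universal[OF assms(4)])
qed

end
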